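(* Let $\mathcal X\subseteq\mathbb R^d$ be a manifold of intrinsic dimension $m<4$, and let $\mathcal X$, the design distribution $P$ with density $p$, and the kernel $K$ satisfy the conditions listed in the context. There exist constants $C_0,c_0,N,C,c>0$, depending only on $d,m,\mathcal X,p,K$, such that the following holds. Let $n\ge N$, $\alpha\in(0,1)$, $n^{-1/2}\le M\le M_{\max}(m)$, where $M_{\max}(1)=n^{1/8}$ and $M_{\max}(m)=n^{(4-m)/(4m)}$ for $m\ge2$, and let $$C_0\Bigl(\frac{\log n}{n}\Bigr)^{1/m}\le r\le\min\Bigl\{c_0,\;M^{(m-8)/(8+2m)}\,n^{(m-20)/(32+8m)}\Bigr\}.$$ Let $\hat\varphi$ be the Laplacian smoothing test, computed on the neighborhood graph $G_{n,r}$ from i.i.d. draws $(X_i,Y_i)$, $i=1,\dots,n$, with $\rho=(nr^{m+2})^{-1}n^{-4/(4+m)}M^{-8/(4+m)}$. Then for any $b\ge1$, if $$\epsilon^2\ge C\,M^{2m/(4+m)}\,n^{-4/(4+m)}\Bigl(b^2+b\sqrt{\tfrac1\alpha}\Bigr),$$ the worst-case risk satisfies $$R_n\bigl(\hat\varphi,H^1(\mathcal X,M),\epsilon\bigr)\le\frac Cb+Cn\exp(-cnr^m).$$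
   Context: Design: $P$ is supported on a compact, connected, smooth manifold $\mathcal X$ embedded in $\mathbb R^d$, of dimension $m\le d$, without boundary and with positive reach; $P$ has a density $p$ with respect to the volume form of $\mathcal X$ with $0<p_{\min}\le p(x)\le p_{\max}<\infty$ for all $x\in\mathcal X$, and $p$ is Lipschitz on $\mathcal X$ with constant $L_p$. Model: $X_i\sim P$ and $Y_i=f_0(X_i)+\varepsilon_i$, with $\varepsilon_i\sim N(0,1)$ independent of $X_i$, the pairs being i.i.d.; $\mathbb E_{f_0}$ is expectation under regression function $f_0$. Kernel: $K:[0,\infty)\to[0,\infty)$ is nonincreasing, supported on $[0,1]$, Lipschitz on $[0,1]$, $K(1)>0$, $\int_{\mathbb R^d}K(\|z\|_2)\,dz=1$, and $\sigma_K=\frac1d\int_{\mathbb R^d}\|x\|_2^2K(\|x\|_2)\,dx<\infty$. Neighborhood graph $G_{n,r}$: vertices $\{1,\dots,n\}$, weights $W_{ij}=K(\|X_i-X_j\|_2/r)$ (Euclidean distance in $\mathbb R^d$), degree matrix $D$ diagonal with $D_{ii}=\sum_jW_{ij}$, Laplacian $L=D-W$ with eigenvalues $0=\lambda_1\le\dots\le\lambda_n$. Laplacian smoothing estimator: $\hat f=\operatorname{argmin}_{f\in\mathbb R^n}\sum_i(Y_i-f_i)^2+\rho f^\top Lf$. Test: $\hat\varphi=\mathbf 1\{\hat T>\hat t_\alpha\}$, where $\hat T=\frac1n\|\hat f\|_2^2$ and $$\hat t_\alpha=\frac1n\sum_{k=1}^n\frac1{(\rho\lambda_k+1)^2}+\frac1n\sqrt{\frac2\alpha\sum_{k=1}^n\frac1{(\rho\lambda_k+1)^4}}.$$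 Worst-case risk: $R_n(\phi,\mathcal F,\epsilon)=\sup\{\mathbb E_{f_0}[1-\phi]:f_0\in\mathcal F,\ \|f_0\|_{L^2(\mathcal X)}>\epsilon\}$. Sobolev ball on the manifold (integrals with respect to the volume form, $\nabla$ the Riemannian weak gradient): $|f|_{H^1(\mathcal X)}^2=\int_{\mathcal X}\|\nabla f\|^2$, $\|f\|_{H^1(\mathcal X)}=\|f\|_{L^2(\mathcal X)}+|f|_{H^1(\mathcal X)}$, $H^1(\mathcal X,M)=\{f\in H^1(\mathcal X):\|f\|_{H^1(\mathcal X)}^2\le M^2\}$. Point evaluations $f_0(X_i)$ refer to a fixed representative of $f_0$; the choice does not matter almost surely. *)

theory Defs
  imports
    "HOL-Probability.Probability"
    "Jordan_Normal_Form.Char_Poly"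
begin

(* Jordan_Normal_Form and HOL-Analysis share some names and symbols: for the type 'a vec / 'a mat
   with index set {0..<n} we write scalar_prod and mult_mat_vec, for the Euclidean type real^'n
   we write inner; Gram determinants use Determinants.det. *)

(* f is of class C^k on the open set U: iterated directional derivatives up to order k exist as
   Frechet differentials and are continuous. *)
fun Ck_on :: "nat \<Rightarrow> 'a::real_normed_vector set \<Rightarrow> ('a \<Rightarrow> 'b::real_normed_vector) \<Rightarrow> bool" where
  "Ck_on 0 U f \<longleftrightarrow> continuous_on U f"
| "Ck_on (Suc k) U f \<longleftrightarrow>
     (\<forall>u\<in>U. f differentiable (at u)) \<and>
     (\<forall>v. Ck_on k U (\<lambda>u. frechet_derivative f (at u) v))"

definition smooth_on :: "'a::real_normed_vector set \<Rightarrow> ('a \<Rightarrow> 'b::real_normed_vector) \<Rightarrow> bool" where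
  "smooth_on U f \<longleftrightarrow> (\<forall>k. Ck_on k U f)"

definition coord_deriv :: "(real^'m::finite \<Rightarrow> 'b::real_normed_vector) \<Rightarrow> 'm \<Rightarrow> real^'m \<Rightarrow> 'b" where
  "coord_deriv f i u = frechet_derivative f (at u) (axis i 1)"

text \<open>A local parametrization (inverse chart) of \<^term>\<open>X\<close>: a smooth immersion of an open subset of
  \<open>\<real>\<^sup>m\<close> which is a homeomorphism onto a relatively open subset of \<^term>\<open>X\<close>.\<close>

definition local_param ::
    "(real^'d::finite) set \<Rightarrow> (real^'m::finite) set \<Rightarrow> (real^'m \<Rightarrow> real^'d) \<Rightarrow> bool" where
  "local_param X U \<phi> \<longleftrightarrow>
     open U \<and> smooth_on U \<phi> \<and> (\<forall>u\<in>U. inj (frechet_derivative \<phi> (at u))) \<and>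
     openin (top_of_set X) (\<phi> ` U) \<and> (\<exists>\<psi>. homeomorphism U (\<phi> ` U) \<phi> \<psi>)"

(* Smooth embedded submanifold of dimension CARD('m), without boundary: all charts are modelled on
   open subsets of real^'m. The argument TYPE('m) carries the intrinsic dimension. *)
definition embedded_manifold :: "'m::finite itself \<Rightarrow> (real^'d::finite) set \<Rightarrow> bool" where
  "embedded_manifold (m :: 'm itself) X \<longleftrightarrow>
     (\<forall>x\<in>X. \<exists>(U :: (real^'m) set) \<phi>. local_param X U \<phi> \<and> x \<in> \<phi> ` U)"

definition tangent_space :: "'m::finite itself \<Rightarrow> (real^'d::finite) set \<Rightarrow> real^'d \<Rightarrow> (real^'d) set" where
  "tangent_space (m :: 'm itself) X x =
     {v. \<exists>(U :: (real^'m) set) \<phi> u. local_param X U \<phi> \<and> u \<in> U \<and> \<phi> u = x \<and>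
           v \<in> range (frechet_derivative \<phi> (at u))}"

definition reach :: "'a::metric_space set \<Rightarrow> ereal" where
  "reach X = (SUP \<tau>\<in>{\<tau>::real. 0 \<le> \<tau> \<and>
     (\<forall>z. infdist z X < \<tau> \<longrightarrow> (\<exists>!x. x \<in> X \<and> dist z x = infdist z X))}. ereal \<tau>)"

definition volume_density :: "(real^'m::finite \<Rightarrow> real^'d::finite) \<Rightarrow> real^'m \<Rightarrow> real" where
  "volume_density \<phi> u =
     sqrt (Determinants.det (\<chi> i j. inner (coord_deriv \<phi> i u) (coord_deriv \<phi> j u)))"

(* The measure of the Riemannian volume form sqrt(det g) du of the metric induced by the embedding,
   on the Borel sets of X. It is determined by its values in local parametrizations, since
   countably many of them cover X. *)
definition riemannian_volume :: "'m::finite itself \<Rightarrow> (real^'d::finite) set \<Rightarrow> (real^'d) measure" where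
  "riemannian_volume (m :: 'm itself) X =
     (THE \<mu>. sets \<mu> = sets (restrict_space borel X) \<and>
       (\<forall>(U :: (real^'m) set) \<phi> A. local_param X U \<phi> \<longrightarrow> A \<in> sets borel \<longrightarrow> A \<subseteq> U \<longrightarrow>
          emeasure \<mu> (\<phi> ` A) = (\<integral>\<^sup>+u\<in>A. ennreal (volume_density \<phi> u) \<partial>lborel)))"

definition test_functions :: "(real^'m::finite) set \<Rightarrow> (real^'m \<Rightarrow> real) set" where
  "test_functions U = {\<eta>. smooth_on UNIV \<eta> \<and>
     compact (closure {u. \<eta> u \<noteq> 0}) \<and> closure {u. \<eta> u \<noteq> 0} \<subseteq> U}"

(* G is a square integrable tangent field representing the weak differential of f: in every local
   parametrization the weak partial derivative of f o phi in direction j is <G o phi, d_j phi>. *)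
definition is_weak_gradient ::
    "'m::finite itself \<Rightarrow> (real^'d::finite) set \<Rightarrow> (real^'d \<Rightarrow> real) \<Rightarrow> (real^'d \<Rightarrow> real^'d) \<Rightarrow> bool" where
  "is_weak_gradient (m :: 'm itself) X f G \<longleftrightarrow>
     G \<in> borel_measurable (riemannian_volume m X) \<and>
     integrable (riemannian_volume m X) (\<lambda>x. (norm (G x))\<^sup>2) \<and>
     (AE x in riemannian_volume m X. G x \<in> tangent_space m X x) \<and>
     (\<forall>(U :: (real^'m) set) \<phi> j. local_param X U \<phi> \<longrightarrow>
        (\<forall>\<eta>\<in>test_functions U.
           set_lebesgue_integral lborel U (\<lambda>u. f (\<phi> u) * coord_deriv \<eta> j u) =
           - set_lebesgue_integral lborel U (\<lambda>u. inner (G (\<phi> u)) (coord_deriv \<phi> j u) * \<eta> u)))"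

definition weak_gradient ::
    "'m::finite itself \<Rightarrow> (real^'d::finite) set \<Rightarrow> (real^'d \<Rightarrow> real) \<Rightarrow> real^'d \<Rightarrow> real^'d" where
  "weak_gradient m X f = (SOME G. is_weak_gradient m X f G)"

definition L2_norm :: "'m::finite itself \<Rightarrow> (real^'d::finite) set \<Rightarrow> (real^'d \<Rightarrow> real) \<Rightarrow> real" where
  "L2_norm m X f = sqrt (\<integral>x. (f x)\<^sup>2 \<partial>riemannian_volume m X)"

(* Elements are Borel representatives, so that point evaluations make sense; values outside X
   play no role. *)
definition H1 :: "'m::finite itself \<Rightarrow> (real^'d::finite) set \<Rightarrow> (real^'d \<Rightarrow> real) set" where
  "H1 m X = {f. f \<in> borel_measurable (riemannian_volume m X) \<and>
                integrable (riemannian_volume m X) (\<lambda>x. (f x)\<^sup>2) \<and>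
                (\<exists>G. is_weak_gradient m X f G)}"

definition H1_seminorm :: "'m::finite itself \<Rightarrow> (real^'d::finite) set \<Rightarrow> (real^'d \<Rightarrow> real) \<Rightarrow> real" where
  "H1_seminorm m X f = sqrt (\<integral>x. (norm (weak_gradient m X f x))\<^sup>2 \<partial>riemannian_volume m X)"

definition H1_norm :: "'m::finite itself \<Rightarrow> (real^'d::finite) set \<Rightarrow> (real^'d \<Rightarrow> real) \<Rightarrow> real" where
  "H1_norm m X f = L2_norm m X f + H1_seminorm m X f"

definition H1_ball :: "'m::finite itself \<Rightarrow> (real^'d::finite) set \<Rightarrow> real \<Rightarrow> (real^'d \<Rightarrow> real) set" where
  "H1_ball m X M = {f \<in> H1 m X. (H1_norm m X f)\<^sup>2 \<le> M\<^sup>2}"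

definition sigma_K :: "'d::finite itself \<Rightarrow> (real \<Rightarrow> real) \<Rightarrow> ennreal" where
  "sigma_K (d :: 'd itself) K =
     ennreal (1 / real CARD('d)) * (\<integral>\<^sup>+x. ennreal ((norm x)\<^sup>2 * K (norm x)) \<partial>(lborel :: (real^'d) measure))"

(* Only the values of K on {0..} matter. *)
definition admissible_kernel :: "'d::finite itself \<Rightarrow> (real \<Rightarrow> real) \<Rightarrow> bool" where
  "admissible_kernel (d :: 'd itself) K \<longleftrightarrow>
     (\<forall>t\<ge>0. 0 \<le> K t) \<and> antimono_on {0..} K \<and> (\<forall>t>1. K t = 0) \<and>
     (\<exists>B. lipschitz_on B {0..1} K) \<and> 0 < K 1 \<and>
     has_bochner_integral (lborel :: (real^'d) measure) (\<lambda>z. K (norm z)) 1 \<and>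
     sigma_K d K < \<infinity>"

(* Law of (X, f0(X) + e), with X ~ P and e ~ N(0,1) independent. *)
definition observation_law ::
    "(real^'d::finite) measure \<Rightarrow> (real^'d \<Rightarrow> real) \<Rightarrow> ((real^'d) \<times> real) measure" where
  "observation_law P f0 =
     distr (P \<Otimes>\<^sub>M density lborel std_normal_density) (P \<Otimes>\<^sub>M borel) (\<lambda>(x, e). (x, f0 x + e))"

(* n i.i.d. observations, indexed by {0..<n} as in Jordan_Normal_Form. *)
definition sample_law ::
    "(real^'d::finite) measure \<Rightarrow> nat \<Rightarrow> (real^'d \<Rightarrow> real) \<Rightarrow> (nat \<Rightarrow> (real^'d) \<times> real) measure" where
  "sample_law P n f0 = PiM {0..<n} (\<lambda>_. observation_law P f0)"

(* A supremum in ennreal, hence 0 if no function is admitted. *)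
definition worst_case_risk ::
    "'m::finite itself \<Rightarrow> (real^'d::finite) set \<Rightarrow> (real^'d) measure \<Rightarrow> nat \<Rightarrow>
     ((nat \<Rightarrow> (real^'d) \<times> real) \<Rightarrow> real) \<Rightarrow> (real^'d \<Rightarrow> real) set \<Rightarrow> real \<Rightarrow> ennreal" where
  "worst_case_risk m X P n test F \<epsilon> =
     (SUP f0\<in>{f0 \<in> F. \<epsilon> < L2_norm m X f0}. \<integral>\<^sup>+\<omega>. ennreal (1 - test \<omega>) \<partial>sample_law P n f0)"

definition weight_matrix :: "(real \<Rightarrow> real) \<Rightarrow> nat \<Rightarrow> real \<Rightarrow> (nat \<Rightarrow> real^'d::finite) \<Rightarrow> real mat" where
  "weight_matrix K n r x = Matrix.mat n n (\<lambda>(i, j). K (norm (x i - x j) / r))"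

definition degree_matrix :: "(real \<Rightarrow> real) \<Rightarrow> nat \<Rightarrow> real \<Rightarrow> (nat \<Rightarrow> real^'d::finite) \<Rightarrow> real mat" where
  "degree_matrix K n r x = mat_diag n (\<lambda>i. \<Sum>j<n. index_mat (weight_matrix K n r x) (i, j))"

definition laplacian :: "(real \<Rightarrow> real) \<Rightarrow> nat \<Rightarrow> real \<Rightarrow> (nat \<Rightarrow> real^'d::finite) \<Rightarrow> real mat" where
  "laplacian K n r x = degree_matrix K n r x - weight_matrix K n r x"

(* k-th smallest eigenvalue, k = 1, ..., n, counted with multiplicity; a real symmetric matrix of
   size n has n real eigenvalues. *)
definition sorted_eigenvalue :: "real mat \<Rightarrow> nat \<Rightarrow> real" where
  "sorted_eigenvalue A k = sorted_list_of_multiset (proots (char_poly A)) ! (k - 1)"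

definition laplacian_smoothing ::
    "(real \<Rightarrow> real) \<Rightarrow> nat \<Rightarrow> real \<Rightarrow> real \<Rightarrow> (nat \<Rightarrow> (real^'d::finite) \<times> real) \<Rightarrow> real Matrix.vec" where
  "laplacian_smoothing K n r \<rho> \<omega> =
     arg_min (\<lambda>f. (\<Sum>i<n. (snd (\<omega> i) - vec_index f i)\<^sup>2)
                  + \<rho> * scalar_prod f (mult_mat_vec (laplacian K n r (\<lambda>i. fst (\<omega> i))) f))
             (\<lambda>f. f \<in> carrier_vec n)"

definition test_statistic ::
    "(real \<Rightarrow> real) \<Rightarrow> nat \<Rightarrow> real \<Rightarrow> real \<Rightarrow> (nat \<Rightarrow> (real^'d::finite) \<times> real) \<Rightarrow> real" where
  "test_statistic K n r \<rho> \<omega> =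
     1 / real n * scalar_prod (laplacian_smoothing K n r \<rho> \<omega>) (laplacian_smoothing K n r \<rho> \<omega>)"

definition test_threshold ::
    "(real \<Rightarrow> real) \<Rightarrow> nat \<Rightarrow> real \<Rightarrow> real \<Rightarrow> real \<Rightarrow> (nat \<Rightarrow> (real^'d::finite) \<times> real) \<Rightarrow> real" where
  "test_threshold K n r \<rho> \<alpha> \<omega> =
     (let ev = sorted_eigenvalue (laplacian K n r (\<lambda>i. fst (\<omega> i))) in
        1 / real n * (\<Sum>k = 1..n. 1 / (\<rho> * ev k + 1)^2)
        + 1 / real n * sqrt (2 / \<alpha> * (\<Sum>k = 1..n. 1 / (\<rho> * ev k + 1)^4)))"

definition laplacian_smoothing_test ::
    "(real \<Rightarrow> real) \<Rightarrow> nat \<Rightarrow> real \<Rightarrow> real \<Rightarrow> real \<Rightarrow> (nat \<Rightarrow> (real^'d::finite) \<times> real) \<Rightarrow> real" where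
  "laplacian_smoothing_test K n r \<rho> \<alpha> \<omega> =
     of_bool (test_statistic K n r \<rho> \<omega> > test_threshold K n r \<rho> \<alpha> \<omega>)"

definition M_max :: "nat \<Rightarrow> nat \<Rightarrow> real" where
  "M_max m n = (if m = 1 then real n powr (1 / 8)
                else real n powr ((4 - real m) / (4 * real m)))"

end

theory Submission
  imports Defs "Jordan_Normal_Form.Spectral_Radius"
begin

text \<open>Given the design, \<open>n\<close> times the statistic is \<open>|S (f + e)|\<^sup>2\<close> with \<open>S = (I + \<rho> L)\<^sup>-\<^sup>1\<close>, and Chebyshev's
  inequality for this Gaussian quadratic form bounds the type II error by a multiple of \<open>1/A + V/A\<^sup>2\<close>
  as soon as the signal \<open>A = |S f|\<^sup>2\<close> exceeds \<open>2 sqrt (2 V / \<alpha>)\<close>, where \<open>V = tr S\<^sup>4\<close>.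

  The signal is at least \<open>|f|\<^sup>2 / 2 - \<rho> f\<^sup>T L f\<close>. In charts, the mean of the Dirichlet energy \<open>f\<^sup>T L f\<close> is bounded by
  the L2 norms of translation differences of \<open>f\<close>, hence by \<open>n\<^sup>2 r\<^sup>m\<^sup>+\<^sup>2 M\<^sup>2\<close>; the same quantity controls the
  loss when \<open>|f|\<^sup>2\<close> is compared with the L2 norm of \<open>f\<close> on cells of side of order \<open>r\<close>.

  If all these cells contain about \<open>n r\<^sup>m\<close> design points, which by a Chernoff bound fails with probability
  at most \<open>C n exp (- c n r\<^sup>m)\<close>, then a discrete Poincare inequality holds on every coarser cell of side \<open>1/t\<close>.
  Vectors with vanishing weighted means on the coarse cells therefore have energy at least of order
  \<open>n r\<^sup>m\<^sup>+\<^sup>2 t\<^sup>2\<close>, so at most \<open>C t\<^sup>m\<close> eigenvalues lie below this value, and summing over dyadic \<open>t\<close>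
  bounds \<open>V\<close>.\<close>

text \<open>Functions of the class have only weak derivatives, so differences along single edges of
  the graph are uncontrolled and only their means over the design are. Both energies are therefore
  allowed to exceed their mean bounds by a factor b; by Markov's inequality this costs 2/b, and no
  moment of f beyond the second enters. The parameter \<rho> equals 1/(n r^(m+2) T^2) with T =
  n^(2/(4+m)) M^(4/(4+m)), so damping sets in at eigenvalues of order n r^(m+2) T^2. With \<tau> =
  M^(2m/(4+m)) n^(-4/(4+m)) the identities (n \<tau>)^2 = T^m and \<tau> T^2 = M^2 express the
  balance: sqrt V is of order T^(m/2) = n \<tau>, and so is the smoothing bias n M^2 / T^2. The
  upper bound on r says n (T r)^8 <= T^m, which pays for the eigenvalues beyond the finest scale of
  the Poincare inequality: up to n terms, each of order (T r)^8. The bound on M gives T^m <= n and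
  hence T r <= 1. The volume measure is a definite description, so its existence and uniqueness must
  be proved before anything can be computed; this is the reason for the change of variables between
  charts.\<close>

abbreviation nn_integral_lborel :: "('a::euclidean_space \<Rightarrow> ennreal) \<Rightarrow> ennreal"  (binder "NI " 10)
  where "NI u. F u \<equiv> integral\<^sup>N lborel F"

section \<open>Smooth bump functions and mollification\<close>

lemma Ck_on_Suc_D: "Ck_on (Suc k) UNIV f ==> Ck_on k UNIV f"
proof (induction k arbitrary: f)
  case 0
  then show ?case
    by (auto simp: continuous_on_eq_continuous_within intro!: differentiable_imp_continuous_within)
next
  case (Suc k)
  then show ?case by auto
qed

lemma Ck_on_const: "Ck_on k UNIV (\<lambda>u. c)"
proof (induction k arbitrary: c)
  case (Suc k)
  have "frechet_derivative (\<lambda>u::'a. c) (at u) = (\<lambda>v. 0)" for u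
    by (rule frechet_derivative_at[symmetric]) (rule has_derivative_const)
  then show ?case using Suc by simp
qed simp

lemma Ck_on_bounded_linear:
  assumes "bounded_linear f" shows "Ck_on k UNIV (\<lambda>u. f u + c)"
proof (cases k)
  case 0
  then show ?thesis using assms by (simp add: continuous_on_add linear_continuous_on)
next
  case (Suc k')
  have D: "((\<lambda>u. f u + c) has_derivative f) (at u)" for u
    using has_derivative_add[OF bounded_linear_imp_has_derivative[OF assms] has_derivative_const] by simp
  have "frechet_derivative (\<lambda>u. f u + c) (at u) = f" for u
    by (rule frechet_derivative_at[OF D, symmetric])
  then show ?thesis using Suc D by (auto simp: Ck_on_const differentiable_def)
qed

lemma Ck_on_add:
  assumes "Ck_on k UNIV f" "Ck_on k UNIV g" shows "Ck_on k UNIV (\<lambda>u. f u + g u)"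
  using assms
proof (induction k arbitrary: f g)
  case 0
  then show ?case by (auto intro!: continuous_intros)
next
  case (Suc k)
  have D: "((\<lambda>u. f u + g u) has_derivative
      (\<lambda>v. frechet_derivative f (at u) v + frechet_derivative g (at u) v)) (at u)" for u
    using Suc.prems by (auto intro!: derivative_eq_intros simp: frechet_derivative_works)
  have "frechet_derivative (\<lambda>u. f u + g u) (at u) =
      (\<lambda>v. frechet_derivative f (at u) v + frechet_derivative g (at u) v)" for u
    by (rule frechet_derivative_at[OF D, symmetric])
  moreover have "(\<lambda>u. f u + g u) differentiable (at u)" for u
    using D differentiable_def by blast
  ultimately show ?case using Suc by simp
qed

lemma Ck_on_mult:
  fixes f g :: "'a::real_normed_vector => real"
  assumes "Ck_on k UNIV f" "Ck_on k UNIV g" shows "Ck_on k UNIV (\<lambda>u. f u * g u)"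
  using assms
proof (induction k arbitrary: f g)
  case 0
  then show ?case by (auto intro!: continuous_intros)
next
  case (Suc k)
  have D: "((\<lambda>u. f u * g u) has_derivative
      (\<lambda>v. f u * frechet_derivative g (at u) v + frechet_derivative f (at u) v * g u)) (at u)" for u
    using Suc.prems
    by (auto intro!: has_derivative_mult simp: frechet_derivative_works)
  have E: "frechet_derivative (\<lambda>u. f u * g u) (at u) =
      (\<lambda>v. f u * frechet_derivative g (at u) v + frechet_derivative f (at u) v * g u)" for u
    by (rule frechet_derivative_at[OF D, symmetric])
  have "(\<lambda>u. f u * g u) differentiable (at u)" for u
    using D differentiable_def by blast
  moreover have "Ck_on k UNIV (\<lambda>u. f u * frechet_derivative g (at u) v + frechet_derivative f (at u) v * g u)" for v
    using Suc.prems Ck_on_Suc_D[OF Suc.prems(1)] Ck_on_Suc_D[OF Suc.prems(2)]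
    by (intro Ck_on_add Suc.IH) auto
  ultimately show ?case by (simp add: E)
qed

text \<open>The functions \<open>t\<^sup>-\<^sup>k e\<^sup>-\<^sup>1\<^sup>/\<^sup>t\<close> form a family closed under differentiation.\<close>

definition exp_flat :: "nat => real => real" where
  "exp_flat k t = (if t > 0 then inverse t ^ k * exp (- inverse t) else 0)"

lemma exp_flat_nonneg: "0 \<le> exp_flat k t"
  by (simp add: exp_flat_def)

text \<open>A single term of the exponential series at \<open>inverse t\<close> gives the bound. The
  exponent k + 2 leaves a factor t^2 over, one power more than the difference quotient at 0
  consumes.\<close>

lemma exp_flat_le: "t > 0 ==> exp_flat k t \<le> fact (k + 2) * t^2"
proof -
  assume t: "t > 0"
  have "inverse t ^ (k+2) / fact (k+2) \<le> exp (inverse t)"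
  proof -
    have "(\<lambda>i. inverse t ^ i / fact i) sums exp (inverse t)"
      using exp_converges[of "inverse t"] by (simp add: field_simps)
    then have "(\<Sum>i\<in>{k+2}. inverse t ^ i / fact i) \<le> exp (inverse t)"
      using t sum_le_suminf[of "\<lambda>i. inverse t ^ i / fact i" "{k+2}"]
      by (auto simp: sums_iff)
    then show ?thesis by simp
  qed
  then have "inverse t ^ (k+2) * exp (- inverse t) \<le> fact (k+2)"
    by (simp add: exp_minus pos_divide_le_eq flip: divide_inverse del: power_inverse fact_Suc add_2_eq_Suc')
       (simp add: mult.commute)
  then have "t^2 * (inverse t ^ (k+2) * exp (- inverse t)) \<le> t^2 * fact (k+2)"
    by (intro mult_left_mono) auto
  moreover have "t^2 * (inverse t ^ (k+2) * exp (- inverse t)) = exp_flat k t"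
    using t by (simp add: exp_flat_def field_simps power_add power2_eq_square)
  ultimately show ?thesis by (simp add: mult.commute)
qed

lemma exp_flat_has_derivative:
  "(exp_flat k has_real_derivative exp_flat (k + 2) t - real k * exp_flat (k + 1) t) (at t)"
proof (cases "t > 0")
  case True
  have "((\<lambda>t. inverse t ^ k * exp (- inverse t)) has_real_derivative
     inverse t ^ (k+2) * exp (- inverse t) - real k * (inverse t ^ (k+1) * exp (- inverse t))) (at t)"
  proof -
    define q where "q = inverse t"
    have "((\<lambda>t. inverse t ^ k * exp (- inverse t)) has_real_derivative
       real k * (q ^ (k - 1) * - (q * q)) * exp (- q) + exp (- q) * (q * q) * q ^ k) (at t)"
      using True unfolding q_def
      by (auto intro!: derivative_eq_intros simp: power2_eq_square)
    moreover have "real k * (q ^ (k - 1) * - (q * q)) * exp (- q) + exp (- q) * (q * q) * q ^ k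
        = q ^ (k+2) * exp (- q) - real k * (q ^ (k+1) * exp (- q))"
      by (cases k) (auto simp: algebra_simps)
    ultimately show ?thesis by (simp only: q_def)
  qed
  then have "(exp_flat k has_real_derivative
     inverse t ^ (k+2) * exp (- inverse t) - real k * (inverse t ^ (k+1) * exp (- inverse t))) (at t)"
    by (rule has_field_derivative_transform_within_open[where S="{0<..}"])
       (use True in \<open>auto simp: exp_flat_def\<close>)
  then show ?thesis using True by (simp add: exp_flat_def)
next
  case False
  show ?thesis
  proof (cases "t < 0")
    case True
    have "((\<lambda>t. 0) has_real_derivative 0) (at t)" by simp
    then have "(exp_flat k has_real_derivative 0) (at t)"
      by (rule has_field_derivative_transform_within_open[where S="{..<0}"])
         (use True in \<open>auto simp: exp_flat_def\<close>)
    then show ?thesis using True by (simp add: exp_flat_def)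
  next
    case False
    with \<open>\<not> t > 0\<close> have t: "t = 0" by simp
    have "((\<lambda>y. exp_flat k y / y) \<longlongrightarrow> 0) (at 0)"
    proof (rule tendsto_0_le[where K = "fact (k+2)"])
      show "((\<lambda>y::real. y) \<longlongrightarrow> 0) (at 0)" by simp
      show "\<forall>\<^sub>F y in at 0. norm (exp_flat k y / y) \<le> norm y * fact (k + 2)"
      proof (rule always_eventually, rule allI)
        fix y :: real
        show "norm (exp_flat k y / y) \<le> norm y * fact (k + 2)"
          using exp_flat_le[of y k] exp_flat_nonneg[of k y]
        proof (cases "y > 0")
          case True
          then have "exp_flat k y / y \<le> fact (k + 2) * y"
            using exp_flat_le[OF True, of k] by (simp only: pos_divide_le_eq) (simp add: power2_eq_square mult_ac)
          then show ?thesis using True exp_flat_nonneg[of k y] by (simp add: mult.commute)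
        next
          case False
          then have "exp_flat k y = 0" by (simp add: exp_flat_def)
          then show ?thesis by (simp only: norm_zero div_0) simp
        qed
      qed
    qed
    then show ?thesis using t by (simp add: has_field_derivative_iff exp_flat_def)
  qed
qed

lemma exp_flat_bump_has_derivative:
  fixes c :: "'a::euclidean_space"
  shows "((\<lambda>u. exp_flat k (1 - a * (inner (u - c) (u - c)))) has_derivative
     (\<lambda>v. (exp_flat (k+2) (1 - a * (inner (u - c) (u - c))) - real k * exp_flat (k+1) (1 - a * (inner (u - c) (u - c))))
        * (- 2 * a * inner (u - c) v))) (at u)"
proof -
  have "((\<lambda>u. u - c) has_derivative (\<lambda>v. v)) (at u)"
    using has_derivative_diff[OF has_derivative_ident has_derivative_const] by simp
  from has_derivative_diff[OF has_derivative_const has_derivative_mult_right[OF has_derivative_inner[OF this this]], of 1 a]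
  have "((\<lambda>u. 1 - a * (inner (u - c) (u - c))) has_derivative (\<lambda>v. - 2 * a * inner (u - c) v)) (at u)"
    by (rule has_derivative_eq_rhs) (simp add: inner_commute[of _ "u - c"] mult.assoc mult.left_commute[of a])
  from has_derivative_compose[OF this exp_flat_has_derivative[unfolded has_field_derivative_def]]
  show ?thesis by (simp only: mult.commute)
qed

lemma continuous_on_exp_flat: "continuous_on S (exp_flat k)"
  using exp_flat_has_derivative by (meson DERIV_isCont continuous_at_imp_continuous_on)

text \<open>k stays general in the induction on n: one differentiation yields flat functions of
  orders k + 1 and k + 2 times an affine factor.\<close>

lemma Ck_on_flat_bump:
  fixes c :: "'a::euclidean_space"
  shows "Ck_on n UNIV (\<lambda>u. exp_flat k (1 - a * (inner (u - c) (u - c))))"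
proof (induction n arbitrary: k)
  case 0
  have "continuous_on UNIV (\<lambda>u. exp_flat k (1 - a * (inner (u - c) (u - c))))"
    by (rule continuous_on_compose2[OF continuous_on_exp_flat[of UNIV]]) (auto intro!: continuous_intros)
  then show ?case by simp
next
  case (Suc n)
  let ?q = "\<lambda>u. 1 - a * (inner (u - c) (u - c))"
  have D: "((\<lambda>u. exp_flat k (?q u)) has_derivative
     (\<lambda>v. (exp_flat (k+2) (?q u) - real k * exp_flat (k+1) (?q u)) * (- 2 * a * inner (u - c) v))) (at u)" for u
    by (rule exp_flat_bump_has_derivative)
  have E: "frechet_derivative (\<lambda>u. exp_flat k (?q u)) (at u) =
     (\<lambda>v. (exp_flat (k+2) (?q u) - real k * exp_flat (k+1) (?q u)) * (- 2 * a * inner (u - c) v))" for u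
    by (rule frechet_derivative_at[OF D, symmetric])
  have "Ck_on n UNIV (\<lambda>u. (exp_flat (k+2) (?q u) - real k * exp_flat (k+1) (?q u)) * (- 2 * a * inner (u - c) v))" for v
  proof (rule Ck_on_mult)
    have "Ck_on n UNIV (\<lambda>u. exp_flat (k+2) (?q u) + (- real k) * exp_flat (k+1) (?q u))"
      by (rule Ck_on_add[OF Suc.IH Ck_on_mult[OF Ck_on_const Suc.IH]])
    then show "Ck_on n UNIV (\<lambda>u. exp_flat (k+2) (?q u) - real k * exp_flat (k+1) (?q u))" by simp
    have "bounded_linear (\<lambda>u. - 2 * a * inner u v)"
      by (intro bounded_linear_intros)
    from Ck_on_bounded_linear[OF this, of n "2 * a * inner c v"]
    show "Ck_on n UNIV (\<lambda>u. - 2 * a * inner (u - c) v)"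
      by (simp add: inner_diff_left algebra_simps)
  qed
  moreover have "(\<lambda>u. exp_flat k (?q u)) differentiable (at u)" for u
    using D differentiable_def by blast
  ultimately show ?case by (simp add: E)
qed

section \<open>Approximation and translation in L2\<close>

lemma sum_square_le: "(a + b)^2 \<le> 2 * a^2 + 2 * (b^2 :: real)"
  using zero_le_power2[of "a - b"] unfolding power2_sum power2_diff by linarith

lemma sum3_square_le: "(a + b + c)^2 \<le> 3 * a^2 + 3 * b^2 + 3 * (c^2 :: real)"
  using zero_le_power2[of "a - b"] zero_le_power2[of "b - c"] zero_le_power2[of "a - c"]
  by (simp add: power2_eq_square algebra_simps)

definition clip :: "real => real => real" where
  "clip k x = max (- k) (min k x)"

lemma abs_clip_le: "0 \<le> k ==> \<bar>clip k x\<bar> \<le> k"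
  by (auto simp: clip_def)

lemma abs_diff_clip_le: "0 \<le> k ==> \<bar>x - clip k x\<bar> \<le> \<bar>x\<bar>"
  by (auto simp: clip_def max_def min_def)

lemma continuous_on_clip: "continuous_on S f ==> continuous_on S (\<lambda>x. clip k (f x))"
  unfolding clip_def by (intro continuous_intros)

lemma clip_measurable [measurable]: "f \<in> borel_measurable M ==> (\<lambda>x. clip k (f x)) \<in> borel_measurable M"
  unfolding clip_def by (intro borel_measurable_max borel_measurable_min borel_measurable_const)

lemma L2_approx_clip:
  fixes F :: "'a::euclidean_space => real"
  assumes [measurable]: "F \<in> borel_measurable borel"
    and fin: "(NI u. ennreal ((F u)^2)) < \<infinity>" and "0 < (\<delta>::real)"
  shows "\<exists>k::nat. (NI u. ennreal ((F u - clip (real k) (F u))^2)) \<le> ennreal \<delta>"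
proof -
  have "(\<lambda>k. (NI u. ennreal ((F u - clip (real k) (F u))^2))) \<longlonglongrightarrow> (\<integral>\<^sup>+u. 0 \<partial>(lborel::'a measure))"
  proof (rule nn_integral_dominated_convergence[where w = "\<lambda>u. ennreal ((F u)^2)"])
    show "AE u in lborel. ennreal ((F u - clip (real k) (F u))^2) \<le> ennreal ((F u)^2)" for k
      by (intro AE_I2 ennreal_leI) (metis abs_diff_clip_le abs_le_square_iff of_nat_0_le_iff)
    show "AE u in lborel. (\<lambda>k. ennreal ((F u - clip (real k) (F u))^2)) \<longlonglongrightarrow> 0"
    proof (rule AE_I2, rule tendsto_eventually)
      fix u
      obtain N::nat where N: "\<bar>F u\<bar> \<le> real N" using real_arch_simple by blast
      then have "clip (real k) (F u) = F u" if "k \<ge> N" for k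
        using that unfolding clip_def max_def min_def by auto
      then show "\<forall>\<^sub>F k in sequentially. ennreal ((F u - clip (real k) (F u))^2) = 0"
        by (intro eventually_sequentiallyI[of N]) simp
    qed
  qed (use fin in auto)
  then have "\<forall>\<^sub>F k in sequentially. (NI u. ennreal ((F u - clip (real k) (F u))^2)) < ennreal \<delta>"
    using \<open>0 < \<delta>\<close> by (intro order_tendstoD) auto
  then show ?thesis
    by (meson eventually_sequentially less_imp_le order_refl)
qed

text \<open>Measurability supplies continuous functions converging to F almost everywhere, but with
  no control of their size. Clipping F and the approximants at the same level k provides the
  dominating constant (2k)^2 on S, which has finite measure.\<close>

lemma L2_approx_continuous:
  fixes F :: "'a::euclidean_space => real"
  assumes F [measurable]: "F \<in> borel_measurable borel"
    and fin: "(NI u. ennreal ((F u)^2)) < \<infinity>" and \<delta>: "0 < (\<delta>::real)"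
    and S [measurable]: "S \<in> sets borel" and bS: "bounded S"
  shows "\<exists>c. continuous_on UNIV c \<and>
    (NI u. indicator S u * ennreal ((F u - c u)^2)) \<le> ennreal \<delta>"
proof -
  obtain k :: nat where k: "(NI u. ennreal ((F u - clip (real k) (F u))^2)) \<le> ennreal (\<delta> / 4)"
    using L2_approx_clip[OF F fin, of "\<delta> / 4"] \<delta> by auto
  have "F \<in> borel_measurable lebesgue" by (rule measurable_completion) simp
  then have "F measurable_on UNIV"
    by (intro lebesgue_measurable_imp_measurable_on) auto
  then obtain N g where N: "negligible N" and g: "\<And>n. continuous_on UNIV (g n)"
    and lim: "\<And>x. x \<notin> N ==> (\<lambda>n. g n x) \<longlonglongrightarrow> F x"
    unfolding measurable_on_def by auto
  have gm [measurable]: "g n \<in> borel_measurable borel" for n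
    using g by (rule borel_measurable_continuous_onI)
  have "AE u in lebesgue. u \<notin> N"
    using N by (simp add: negligible_iff_null_sets AE_not_in)
  then have aeN: "AE u in lborel. u \<notin> N" by (rule AE_completion_iff[THEN iffD1])
  have finS: "emeasure lborel S < \<infinity>" using bS emeasure_bounded_finite by blast
  have "(\<lambda>n. (NI u. indicator S u * ennreal ((clip k (F u) - clip k (g n u))^2)))
      \<longlonglongrightarrow> (\<integral>\<^sup>+u. 0 \<partial>(lborel::'a measure))"
  proof (rule nn_integral_dominated_convergence[where w = "\<lambda>u. ennreal ((2 * real k)^2) * indicator S u"])
    show "AE u in lborel. indicator S u * ennreal ((clip k (F u) - clip k (g n u))^2)
        \<le> ennreal ((2 * real k)^2) * indicator S u" for n
    proof (rule AE_I2)
      fix u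
      have "\<bar>clip k (F u) - clip k (g n u)\<bar> \<le> \<bar>2 * real k\<bar>"
        using abs_clip_le[of "real k" "F u"] abs_clip_le[of "real k" "g n u"] by linarith
      then have "(clip k (F u) - clip k (g n u))^2 \<le> (2 * real k)^2"
        by (simp only: abs_le_square_iff)
      then show "indicator S u * ennreal ((clip k (F u) - clip k (g n u))^2)
        \<le> ennreal ((2 * real k)^2) * indicator S u"
        by (auto simp: indicator_def ennreal_leI)
    qed
    have "(NI u. ennreal ((2 * real k)^2) * indicator S u) = ennreal ((2 * real k)^2) * emeasure lborel S"
      by (rule nn_integral_cmult_indicator) simp
    then show "(NI u. ennreal ((2 * real k)^2) * indicator S u) < \<infinity>"
      using finS by (simp add: ennreal_mult_less_top)
    show "AE u in lborel. (\<lambda>n. indicator S u * ennreal ((clip k (F u) - clip k (g n u))^2)) \<longlonglongrightarrow> 0"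
      using aeN
    proof eventually_elim
      case (elim u)
      have "(\<lambda>n. clip k (g n u)) \<longlonglongrightarrow> clip k (F u)"
        unfolding clip_def by (intro tendsto_intros lim elim)
      then have "(\<lambda>n. (clip k (F u) - clip k (g n u))^2) \<longlonglongrightarrow> (clip k (F u) - clip k (F u))\<^sup>2"
        by (intro tendsto_intros)
      then have "(\<lambda>n. ennreal ((clip k (F u) - clip k (g n u))^2)) \<longlonglongrightarrow> ennreal 0"
        by (intro tendsto_ennrealI) simp
      then show ?case by (cases "u \<in> S") auto
    qed
  qed auto
  then have "\<forall>\<^sub>F n in sequentially.
     (NI u. indicator S u * ennreal ((clip k (F u) - clip k (g n u))^2)) < ennreal (\<delta>/4)"
    using \<delta> by (intro order_tendstoD) auto
  then obtain n where n: "(NI u. indicator S u * ennreal ((clip k (F u) - clip k (g n u))^2)) \<le> ennreal (\<delta>/4)"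
    by (meson eventually_sequentially less_imp_le order_refl)
  let ?c = "\<lambda>u. clip k (g n u)"
  have "(NI u. indicator S u * ennreal ((F u - ?c u)^2)) \<le>
     (NI u. 2 * ennreal ((F u - clip k (F u))^2) +
        2 * (indicator S u * ennreal ((clip k (F u) - clip k (g n u))^2)))"
  proof (rule nn_integral_mono)
    fix u
    have "(F u - ?c u)^2 \<le> 2 * (F u - clip k (F u))^2 + 2 * (clip k (F u) - clip k (g n u))^2"
      using sum_square_le[of "F u - clip k (F u)" "clip k (F u) - clip k (g n u)"] by simp
    then have "ennreal ((F u - ?c u)^2) \<le> ennreal (2 * (F u - clip k (F u))^2 + 2 * (clip k (F u) - clip k (g n u))^2)"
      by (rule ennreal_leI)
    also have "\<dots> = 2 * ennreal ((F u - clip k (F u))^2) + 2 * ennreal ((clip k (F u) - clip k (g n u))^2)"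
      by (simp add: ennreal_mult')
    finally show "indicator S u * ennreal ((F u - ?c u)^2) \<le> 2 * ennreal ((F u - clip k (F u))^2) +
        2 * (indicator S u * ennreal ((clip k (F u) - clip k (g n u))^2))"
      by (auto simp: indicator_def)
  qed
  also have "\<dots> \<le> 2 * ennreal (\<delta> / 4) + 2 * ennreal (\<delta> / 4)"
    using k n by (simp add: nn_integral_add nn_integral_cmult add_mono mult_left_mono)
  also have "\<dots> = ennreal \<delta>"
    using \<delta> by (simp add: ennreal_mult'[symmetric] ennreal_plus[symmetric] flip: ennreal_numeral del: ennreal_plus)
  finally show ?thesis using g continuous_on_clip by blast
qed

lemma nn_integral_lborel_translate:
  fixes f :: "'a::euclidean_space => ennreal"
  assumes [measurable]: "f \<in> borel_measurable borel"
  shows "(NI u. f (a + u)) = (NI u. f u)"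
proof -
  have "(NI u. f u) = (\<integral>\<^sup>+u. f u \<partial>distr lborel borel ((+) a))"
    by (simp add: lborel_distr_plus)
  also have "\<dots> = (NI u. f (a + u))"
    by (subst nn_integral_distr) auto
  finally show ?thesis by simp
qed

lemma nn_integral_lborel_scale:
  fixes f :: "'a::euclidean_space => ennreal"
  assumes [measurable]: "f \<in> borel_measurable borel" and c: "c > 0"
  shows "(NI u. f u) = ennreal (c ^ DIM('a)) * (NI u. f (c *\<^sub>R u))"
proof -
  have "(NI u. f u) = (\<integral>\<^sup>+u. f u \<partial>density (distr lborel borel (\<lambda>x. 0 + c *\<^sub>R x)) (\<lambda>_. ennreal (\<bar>c\<bar> ^ DIM('a))))"
    using c by (subst lborel_affine[of c 0]) auto
  also have "\<dots> = ennreal (c ^ DIM('a)) * (NI u. f (c *\<^sub>R u))"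
    using c by (simp add: nn_integral_density nn_integral_distr nn_integral_cmult)
  finally show ?thesis .
qed

text \<open>On a bounded set F is close in L2 to a continuous function c, and c is uniformly
  continuous on a compact ball. The radii R + 1 and R + 2 leave room for shifts of length at most 1:
  outside \<open>S1\<close> both values of F vanish, and inside it both arguments lie in
  \<open>S2\<close>.\<close>

lemma L2_translation_continuous:
  fixes F :: "'a::euclidean_space => real"
  assumes F [measurable]: "F \<in> borel_measurable borel"
    and fin: "(NI u. ennreal ((F u)^2)) < \<infinity>" and \<delta>: "0 < (\<delta>::real)"
    and supp: "\<And>u. R < norm u ==> F u = 0"
  shows "\<exists>\<kappa>>0. \<forall>z. norm z \<le> \<kappa> --> (NI u. ennreal ((F (u - z) - F u)^2)) \<le> ennreal \<delta>"
proof -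
  define S1 where "S1 = cball (0::'a) (R + 1)"
  define S2 where "S2 = cball (0::'a) (R + 2)"
  have [measurable]: "S1 \<in> sets borel" "S2 \<in> sets borel" by (auto simp: S1_def S2_def)
  obtain c where c: "continuous_on UNIV c"
    and ca: "(NI u. indicator S2 u * ennreal ((F u - c u)^2)) \<le> ennreal (\<delta> / 9)"
    using L2_approx_continuous[OF F fin, of "\<delta>/9" S2] \<delta> by (auto simp: S2_def)
  have [measurable]: "c \<in> borel_measurable borel" using c by (rule borel_measurable_continuous_onI)
  have mS: "emeasure lborel S1 < \<infinity>" unfolding S1_def by (rule emeasure_lborel_cball_finite)
  define \<mu> where "\<mu> = measure lborel S1"
  have \<mu>: "emeasure lborel S1 = ennreal \<mu>" "0 \<le> \<mu>"
    using mS unfolding \<mu>_def by (auto simp: emeasure_eq_ennreal_measure)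
  \<comment> \<open>Three error terms, each with the factor 3 of \<open>sum3_square_le\<close>, must
    add up to \<delta>, hence the 9; the summand 1 keeps the denominator positive.\<close>
  define e where "e = sqrt (\<delta> / (9 * (\<mu> + 1)))"
  have e: "e > 0" "e^2 * \<mu> \<le> \<delta> / 9"
    using \<delta> \<mu>(2) by (auto simp: e_def field_simps)
  have "uniformly_continuous_on S2 c"
    using c unfolding S2_def by (intro compact_uniformly_continuous) (auto intro: continuous_on_subset)
  then obtain d where d: "d > 0" "\<And>x y. x \<in> S2 ==> y \<in> S2 ==> dist x y < d ==> dist (c x) (c y) < e"
    unfolding uniformly_continuous_on_def using e by meson
  show ?thesis
  proof (intro exI[of _ "min 1 (d/2)"] conjI allI impI)
    show "0 < min 1 (d/2)" using d by simp
    fix z :: 'a assume z: "norm z \<le> min 1 (d/2)"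
    have "(NI u. ennreal ((F (u - z) - F u)^2)) \<le>
      (NI u. 3 * (indicator S2 (-z + u) * ennreal ((F (-z + u) - c (-z + u))^2)) + 3 * (ennreal (e^2) * indicator S1 u)
         + 3 * (indicator S2 u * ennreal ((F u - c u)^2)))"
    proof (rule nn_integral_mono)
      fix u
      show "ennreal ((F (u - z) - F u)^2) \<le> 3 * (indicator S2 (-z + u) * ennreal ((F (-z + u) - c (-z + u))^2)) + 3 * (ennreal (e^2) * indicator S1 u)
         + 3 * (indicator S2 u * ennreal ((F u - c u)^2))"
      proof (cases "u \<in> S1")
        case False
        then have "norm u > R + 1" by (simp add: S1_def)
        moreover have "norm (u - z) \<ge> norm u - norm z" by (rule norm_triangle_ineq2)
        ultimately have "norm u > R" "norm (u - z) > R" using z by auto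
        then show ?thesis using supp by simp
      next
        case True
        then have u: "norm u \<le> R + 1" by (simp add: S1_def)
        have uz: "norm (u - z) \<le> norm u + norm z" by (rule norm_triangle_ineq4)
        have in2: "u \<in> S2" "u - z \<in> S2" using u uz z unfolding S2_def by auto
        have "dist (u - z) u < d" using z d by (auto simp: dist_norm)
        then have "\<bar>c (u - z) - c u\<bar> \<le> \<bar>e\<bar>" using d(2)[OF in2(2,1)] by (simp add: dist_real_def)
        then have ce: "(c (u - z) - c u)^2 \<le> e^2" by (simp only: abs_le_square_iff)
        have "(F (u - z) - F u)^2 \<le> 3 * (F (u - z) - c (u - z))^2 + 3 * e^2 + 3 * (F u - c u)^2"
          using sum3_square_le[of "F (u - z) - c (u - z)" "c (u - z) - c u" "c u - F u"] ce
          by (simp add: power2_commute[of "c u" "F u"])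
        then have "ennreal ((F (u - z) - F u)^2) \<le> ennreal (3 * (F (u - z) - c (u - z))^2 + 3 * e^2 + 3 * (F u - c u)^2)"
          by (rule ennreal_leI)
        also have "\<dots> = 3 * ennreal ((F (u - z) - c (u - z))^2) + 3 * ennreal (e^2) + 3 * ennreal ((F u - c u)^2)"
          by (simp add: ennreal_mult')
        finally show ?thesis using True in2 by simp
      qed
    qed
    also have "\<dots> = 3 * (NI u. (indicator S2 (-z + u) * ennreal ((F (-z + u) - c (-z + u))^2)))
         + 3 * (ennreal (e^2) * emeasure lborel S1)
         + 3 * (NI u. indicator S2 u * ennreal ((F u - c u)^2))"
      by (simp add: nn_integral_add nn_integral_cmult nn_integral_cmult_indicator)
    also have "(NI u. (indicator S2 (-z + u) * ennreal ((F (-z + u) - c (-z + u))^2)))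
      = (NI u. indicator S2 u * ennreal ((F u - c u)^2))"
      by (rule nn_integral_lborel_translate) simp
    also have "3 * (NI u. indicator S2 u * ennreal ((F u - c u)^2))
         + 3 * (ennreal (e^2) * emeasure lborel S1)
         + 3 * (NI u. indicator S2 u * ennreal ((F u - c u)^2)) \<le>
      3 * ennreal (\<delta>/9) + 3 * ennreal (\<delta>/9) + 3 * ennreal (\<delta>/9)"
      using ca e(2) \<mu> by (intro add_mono mult_left_mono) (auto simp: ennreal_mult'[symmetric] intro!: ennreal_leI)
    also have "\<dots> = ennreal \<delta>"
      using \<delta> by (simp add: ennreal_mult'[symmetric] ennreal_plus[symmetric] flip: ennreal_numeral del: ennreal_plus)
    finally show "(NI u. ennreal ((F (u - z) - F u)^2)) \<le> ennreal \<delta>" .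
  qed
qed

text \<open>Jensen's inequality for the square. No integrability has to be assumed: when it fails,
  either the expectation is 0 by convention or the right-hand side is infinite.\<close>

lemma (in prob_space) square_expectation_le:
  "ennreal ((expectation h)^2) \<le> (\<integral>\<^sup>+x. ennreal ((h x)^2) \<partial>M)"
proof (cases "integrable M h \<and> integrable M (\<lambda>x. (h x)^2)")
  case True
  have "0 \<le> variance h" by (rule variance_positive)
  then have "(expectation h)^2 \<le> expectation (\<lambda>x. (h x)^2)"
    using variance_eq[of h] True by simp
  then show ?thesis
    using True by (subst nn_integral_eq_integral) (auto intro: ennreal_leI)
next
  case False
  show ?thesis
  proof (cases "integrable M h")
    case False
    then have "expectation h = 0" by (rule not_integrable_integral_eq)
    then show ?thesis by simp
  next
    case True
    then have [measurable]: "h \<in> borel_measurable M" by simp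
    have "\<not> (\<integral>\<^sup>+x. ennreal ((h x)^2) \<partial>M) < \<infinity>"
      using True False by (auto simp: integrable_iff_bounded)
    then show ?thesis by (simp add: not_less top_unique)
  qed
qed

text \<open>On the ball that carries F, |F| is at most 1 + F^2.\<close>

lemma integrable_square_support:
  fixes F :: "'a::euclidean_space => real"
  assumes [measurable]: "F \<in> borel_measurable borel"
    and fin: "(NI u. ennreal ((F u)^2)) < \<infinity>"
    and supp: "\<And>u. R < norm u ==> F u = 0"
  shows "integrable lborel F"
proof (rule integrableI_bounded)
  have "(NI u. ennreal (norm (F u))) \<le> (NI u. indicator (cball 0 R) u + ennreal ((F u)^2))"
  proof (rule nn_integral_mono)
    fix u
    have "2 * \<bar>F u\<bar> \<le> 1 + (F u)^2"
      using zero_le_power2[of "\<bar>F u\<bar> - 1"] by (simp add: power2_diff)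
    then have "\<bar>F u\<bar> \<le> 1 + (F u)^2" by linarith
    then have "ennreal \<bar>F u\<bar> \<le> ennreal (1 + (F u)^2)" by (rule ennreal_leI)
    then show "ennreal (norm (F u)) \<le> indicator (cball 0 R) u + ennreal ((F u)^2)"
      using supp[of u] by (cases "norm u \<le> R") (auto simp: indicator_def)
  qed
  also have "\<dots> = emeasure lborel (cball (0::'a) R) + (NI u. ennreal ((F u)^2))"
    by (subst nn_integral_add) (auto intro!: borel_measurable_indicator)
  also have "\<dots> < \<infinity>" using fin emeasure_lborel_cball_finite[of "0::'a" R] by simp
  finally show "(NI u. ennreal (norm (F u))) < \<infinity>" .
qed simp

section \<open>Mollifiers and convolution\<close>

definition bump_mass :: "'a::euclidean_space itself => real => real" where
  "bump_mass _ \<epsilon> = (\<integral>w. exp_flat 0 (1 - (1 / \<epsilon>^2) * inner w w) \<partial>(lborel :: 'a measure))"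

definition moll :: "real => 'a::euclidean_space => real" where
  "moll \<epsilon> w = (1 / bump_mass TYPE('a) \<epsilon>) * exp_flat 0 (1 - (1 / \<epsilon>^2) * inner w w)"

lemma bump_zero:
  assumes "\<epsilon> > 0" "\<epsilon> \<le> norm w" shows "exp_flat k (1 - (1 / \<epsilon>^2) * inner w w) = 0"
proof -
  have "\<epsilon>^2 \<le> (norm w)^2" using assms by (intro power_mono) auto
  then have "1 \<le> (norm w)^2 / \<epsilon>^2" using assms by (simp add: pos_le_divide_eq)
  then show ?thesis by (simp add: exp_flat_def power2_norm_eq_inner)
qed

lemma exp_flat_0_le_1: "exp_flat 0 t \<le> 1"
  by (simp add: exp_flat_def)

lemma exp_flat_measurable [measurable]: "exp_flat k \<in> borel_measurable borel"
  using continuous_on_exp_flat by (rule borel_measurable_continuous_onI)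

lemma integrable_bump:
  assumes "\<epsilon> > 0"
  shows "integrable lborel (\<lambda>w::'a::euclidean_space. exp_flat 0 (1 - (1 / \<epsilon>^2) * inner w w))"
proof (rule integrable_square_support[where R = \<epsilon>])
  have "(\<integral>\<^sup>+w. ennreal ((exp_flat 0 (1 - (1 / \<epsilon>^2) * inner w w))^2) \<partial>(lborel::'a measure))
     \<le> (\<integral>\<^sup>+w. indicator (cball 0 \<epsilon>) w \<partial>(lborel::'a measure))"
  proof (rule nn_integral_mono)
    fix w :: 'a
    have "(exp_flat 0 (1 - (1 / \<epsilon>^2) * inner w w))^2 \<le> 1"
      using exp_flat_nonneg exp_flat_0_le_1 by (intro power_le_one) auto
    then show "ennreal ((exp_flat 0 (1 - (1 / \<epsilon>^2) * inner w w))^2) \<le> indicator (cball 0 \<epsilon>) w"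
      using bump_zero[of \<epsilon> w] assms by (cases "norm w \<le> \<epsilon>") (auto simp: indicator_def)
  qed
  also have "\<dots> < \<infinity>" using emeasure_lborel_cball_finite[of "0::'a" \<epsilon>] by simp
  finally show "(\<integral>\<^sup>+w. ennreal ((exp_flat 0 (1 - (1 / \<epsilon>^2) * inner w w))^2) \<partial>(lborel::'a measure)) < \<infinity>" .
qed (use assms in \<open>auto simp del: times_divide_eq_left intro!: bump_zero\<close>)

lemma bump_mass_pos:
  assumes "\<epsilon> > 0" shows "bump_mass TYPE('a::euclidean_space) \<epsilon> > 0"
proof (rule ccontr)
  let ?h = "\<lambda>w::'a. exp_flat 0 (1 - (1 / \<epsilon>^2) * inner w w)"
  assume "\<not> ?thesis"
  moreover have "0 \<le> integral\<^sup>L lborel ?h" by (rule integral_nonneg_AE) (simp add: exp_flat_nonneg)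
  ultimately have "integral\<^sup>L lborel ?h = 0" by (simp add: bump_mass_def)
  then have "AE w in lborel. ?h w = 0"
    using integral_nonneg_eq_0_iff_AE[OF integrable_bump[OF assms, where 'a='a]] by (simp add: exp_flat_nonneg)
  moreover have "?h w \<noteq> 0" if "w \<in> ball 0 \<epsilon>" for w
  proof -
    have "(norm w)^2 < \<epsilon>^2" using that by (intro power_strict_mono) auto
    then have "(norm w)^2 / \<epsilon>^2 < 1" using assms by simp
    then show ?thesis by (simp add: exp_flat_def power2_norm_eq_inner)
  qed
  ultimately have "AE w in lborel. w \<notin> ball (0::'a) \<epsilon>" by (auto elim: eventually_mono)
  then have "emeasure lborel (ball (0::'a) \<epsilon>) = 0"
    by (subst (asm) AE_iff_measurable[OF _ refl]) (auto simp: ball_def)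
  moreover have "emeasure lborel (ball (0::'a) \<epsilon>) \<noteq> 0"
    using open_not_negligible[of "ball (0::'a) \<epsilon>"] assms
    by (auto simp: negligible_iff_null_sets null_sets_def)
  ultimately show False by simp
qed

lemma moll_nonneg: "\<epsilon> > 0 ==> 0 \<le> moll \<epsilon> w"
  unfolding moll_def using bump_mass_pos[where 'a='a] exp_flat_nonneg by (simp add: less_imp_le)

lemma moll_zero: "\<epsilon> > 0 ==> \<epsilon> \<le> norm w ==> moll \<epsilon> w = 0"
  unfolding moll_def by (simp only: bump_zero mult_zero_right)

lemma moll_le: "\<epsilon> > 0 ==> moll \<epsilon> (w::'a::euclidean_space) \<le> 1 / bump_mass TYPE('a) \<epsilon>"
  unfolding moll_def using bump_mass_pos[where 'a='a] exp_flat_0_le_1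
  by (intro mult_left_le) (auto simp: less_imp_le)

lemma moll_measurable [measurable]: "moll \<epsilon> \<in> borel_measurable borel"
  unfolding moll_def[abs_def] by measurable

lemma moll_minus: "moll \<epsilon> (- w) = moll \<epsilon> w"
  by (simp add: moll_def)

text \<open>As a probability measure the mollifier turns convolution into an expectation over
  shifts, so that Jensen's inequality applies.\<close>

definition moll_measure :: "real => 'a::euclidean_space measure" where
  "moll_measure \<epsilon> = density lborel (\<lambda>w. ennreal (moll \<epsilon> w))"

lemma sets_moll_measure [simp, measurable_cong]: "sets (moll_measure \<epsilon>) = sets borel"
  by (simp add: moll_measure_def)

lemma prob_space_moll_measure:
  assumes "\<epsilon> > 0" shows "prob_space (moll_measure \<epsilon> :: 'a::euclidean_space measure)"
proof
  have "(\<integral>\<^sup>+w. ennreal (moll \<epsilon> w) \<partial>(lborel::'a measure)) = ennreal (\<integral>w. moll \<epsilon> w \<partial>(lborel::'a measure))"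
    using integrable_bump[OF assms, where 'a='a] moll_nonneg[OF assms, where 'a='a]
    by (intro nn_integral_eq_integral) (auto simp: moll_def)
  also have "(\<integral>w. moll \<epsilon> w \<partial>(lborel::'a measure)) = 1"
    using bump_mass_pos[OF assms, where 'a='a]
    by (simp add: moll_def bump_mass_def)
  finally show "emeasure (moll_measure \<epsilon> :: 'a measure) (space (moll_measure \<epsilon>)) = 1"
    by (simp add: moll_measure_def emeasure_density)
qed

lemma AE_moll_measure:
  assumes "\<epsilon> > 0" shows "AE z in moll_measure \<epsilon>. norm z \<le> \<epsilon>"
  unfolding moll_measure_def
proof (subst AE_density)
  show "AE z in lborel. 0 < ennreal (moll \<epsilon> z) --> norm z \<le> \<epsilon>"
    by (intro AE_I2 impI, rule ccontr) (simp add: moll_zero[OF assms])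
qed simp

definition mollify :: "real => ('a::euclidean_space => real) => 'a => real" where
  "mollify \<epsilon> F u = (\<integral>z. F (u - z) \<partial>moll_measure \<epsilon>)"

lemma mollify_measurable [measurable]:
  fixes F :: "'a::euclidean_space => real"
  assumes [measurable]: "F \<in> borel_measurable borel" and "\<epsilon> > 0"
  shows "mollify \<epsilon> F \<in> borel_measurable borel"
proof -
  interpret prob_space "moll_measure \<epsilon> :: 'a measure" using prob_space_moll_measure assms(2) .
  show ?thesis unfolding mollify_def[abs_def] by measurable
qed

lemma integral_lborel_translate_minus:
  fixes f :: "'a::euclidean_space => real"
  assumes [measurable]: "f \<in> borel_measurable borel"
  shows "(\<integral>z. f (u - z) \<partial>lborel) = (\<integral>z. f z \<partial>lborel)"
    and "integrable lborel (\<lambda>z. f (u - z)) \<longleftrightarrow> integrable lborel f"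
proof -
  have e: "(lborel::'a measure) = distr lborel borel (\<lambda>z. u - z)"
    using lborel_affine[of "-1" u] by (simp add: density_1)
  show "(\<integral>z. f (u - z) \<partial>lborel) = (\<integral>z. f z \<partial>lborel)"
    by (subst (2) e, subst integral_distr) auto
  show "integrable lborel (\<lambda>z. f (u - z)) \<longleftrightarrow> integrable lborel f"
    by (subst (2) e, subst integrable_distr_eq) auto
qed

text \<open>Moves the shift from F to the smooth kernel; in this form the mollification can be
  compared with a weak derivative, the kernel being the test function.\<close>

lemma mollify_eq:
  fixes F :: "'a::euclidean_space => real"
  assumes [measurable]: "F \<in> borel_measurable borel" and e: "\<epsilon> > 0"
  shows "mollify \<epsilon> F u = (\<integral>v. F v * moll \<epsilon> (u - v) \<partial>lborel)"
proof -
  have "mollify \<epsilon> F u = (\<integral>z. moll \<epsilon> z * F (u - z) \<partial>lborel)"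
    unfolding mollify_def moll_measure_def using moll_nonneg[OF e]
    by (subst integral_density) auto
  also have "\<dots> = (\<integral>z. (\<lambda>v. F v * moll \<epsilon> (u - v)) (u - z) \<partial>lborel)"
    by (simp add: mult.commute)
  also have "\<dots> = (\<integral>v. F v * moll \<epsilon> (u - v) \<partial>lborel)"
    by (rule integral_lborel_translate_minus) simp
  finally show ?thesis .
qed

lemma integrable_moll_measure:
  fixes F :: "'a::euclidean_space => real"
  assumes F: "integrable lborel F" and e: "\<epsilon> > 0"
  shows "integrable (moll_measure \<epsilon>) (\<lambda>z. F (u - z))"
proof -
  have [measurable]: "F \<in> borel_measurable borel" using F by auto
  have "integrable lborel (\<lambda>z. moll \<epsilon> z * F (u - z))"
  proof (rule Bochner_Integration.integrable_bound)
    show "integrable lborel (\<lambda>z. (1 / bump_mass TYPE('a) \<epsilon>) * F (u - z))"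
      using F integral_lborel_translate_minus(2)[of F u] by auto
    show "AE z in lborel. norm (moll \<epsilon> z * F (u - z)) \<le> norm ((1 / bump_mass TYPE('a) \<epsilon>) * F (u - z))"
      unfolding norm_mult using moll_le[OF e, where 'a='a] moll_nonneg[OF e, where 'a='a] bump_mass_pos[OF e, where 'a='a]
      by (intro AE_I2 mult_right_mono) auto
  qed simp
  then show ?thesis
    unfolding moll_measure_def using moll_nonneg[OF e, where 'a='a] by (subst integrable_density) auto
qed

text \<open>By Jensen's inequality and Tonelli's theorem the error is at most the average of the
  translation errors over shifts of length at most \<epsilon>.\<close>

lemma mollify_L2_error:
  fixes F :: "'a::euclidean_space => real"
  assumes F [measurable]: "F \<in> borel_measurable borel" and int: "integrable lborel F" and e: "\<epsilon> > 0"
    and tr: "\<And>z. norm z \<le> \<epsilon> ==> (NI u. ennreal ((F (u - z) - F u)^2)) \<le> \<delta>"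
  shows "(NI u. ennreal ((mollify \<epsilon> F u - F u)^2)) \<le> \<delta>"
proof -
  interpret M: prob_space "moll_measure \<epsilon> :: 'a measure" using prob_space_moll_measure e .
  interpret P: pair_sigma_finite "moll_measure \<epsilon> :: 'a measure" "lborel :: 'a measure" ..
  have "(NI u. ennreal ((mollify \<epsilon> F u - F u)^2))
      \<le> (NI u. (\<integral>\<^sup>+z. ennreal ((F (u - z) - F u)^2) \<partial>moll_measure \<epsilon>))"
  proof (rule nn_integral_mono)
    fix u
    have "mollify \<epsilon> F u - F u = (\<integral>z. F (u - z) - F u \<partial>moll_measure \<epsilon>)"
      unfolding mollify_def using integrable_moll_measure[OF int e]
      by (simp add: M.prob_space)
    then show "ennreal ((mollify \<epsilon> F u - F u)^2) \<le> (\<integral>\<^sup>+z. ennreal ((F (u - z) - F u)^2) \<partial>moll_measure \<epsilon>)"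
      using M.square_expectation_le by metis
  qed
  also have "\<dots> = (\<integral>\<^sup>+z. (NI u. ennreal ((F (u - z) - F u)^2)) \<partial>moll_measure \<epsilon>)"
    by (rule P.Fubini') measurable
  also have "\<dots> \<le> (\<integral>\<^sup>+z. \<delta> \<partial>(moll_measure \<epsilon> :: 'a measure))"
    using AE_moll_measure[OF e] by (intro nn_integral_mono_AE) (auto elim!: eventually_mono intro: tr)
  also have "\<dots> = \<delta>" by (simp add: M.emeasure_space_1)
  finally show ?thesis .
qed

section \<open>Weak gradients and translations\<close>

text \<open>The order 2 is that of \<open>exp_flat_has_derivative\<close> for k = 0, whose second
  term vanishes.\<close>

definition moll_deriv :: "real => 'a::euclidean_space => 'a => real" where
  "moll_deriv \<epsilon> x w = (1 / bump_mass TYPE('a) \<epsilon>) *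
     (exp_flat 2 (1 - (1 / \<epsilon>^2) * inner x x) * (- 2 * (1 / \<epsilon>^2) * inner x w))"

lemma moll_has_derivative: "(moll \<epsilon> has_derivative moll_deriv \<epsilon> x) (at x)"
  unfolding moll_def[abs_def] moll_deriv_def[abs_def]
  using has_derivative_mult_right[OF exp_flat_bump_has_derivative[of 0 "1/\<epsilon>^2" 0 x], of "1 / bump_mass TYPE('a) \<epsilon>"]
  by (simp only: diff_zero of_nat_0 mult_zero_left add_0)

lemma continuous_on_moll_deriv: "continuous_on S (\<lambda>x. moll_deriv \<epsilon> x w)"
proof -
  define a where "a = 1 / \<epsilon>^2"
  have "continuous_on S (\<lambda>x. exp_flat 2 (1 - a * inner x x))"
    by (rule continuous_on_compose2[OF continuous_on_exp_flat[of UNIV]]) (auto intro!: continuous_intros)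
  then show ?thesis
    unfolding moll_deriv_def a_def[symmetric]
    by (intro continuous_on_mult continuous_on_const continuous_on_inner continuous_on_id)
qed

lemma moll_deriv_bounded:
  assumes "\<epsilon> > 0" obtains B where "0 < B" "\<And>x. \<bar>moll_deriv \<epsilon> x w\<bar> \<le> B"
proof -
  have "compact ((\<lambda>x. moll_deriv \<epsilon> x w) ` cball 0 \<epsilon>)"
    by (intro compact_continuous_image continuous_on_moll_deriv) auto
  then have "bounded ((\<lambda>x. moll_deriv \<epsilon> x w) ` cball 0 \<epsilon>)" by (rule compact_imp_bounded)
  then obtain B where B: "0 < B" "\<And>x. norm x \<le> \<epsilon> ==> \<bar>moll_deriv \<epsilon> x w\<bar> \<le> B"
    unfolding bounded_pos by auto
  have "\<bar>moll_deriv \<epsilon> x w\<bar> \<le> B" for x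
  proof (cases "norm x \<le> \<epsilon>")
    case False
    then have "moll_deriv \<epsilon> x w = 0"
      unfolding moll_deriv_def using bump_zero[OF assms, of x 2] by (simp only: less_imp_le not_le mult_zero_left mult_zero_right)
    then show ?thesis using B by simp
  qed (use B in auto)
  then show ?thesis using that B by blast
qed

definition test_fun :: "'a::euclidean_space set => ('a => real) => bool" where
  "test_fun V \<eta> \<longleftrightarrow> smooth_on UNIV \<eta> \<and> compact (closure {u. \<eta> u \<noteq> 0}) \<and> closure {u. \<eta> u \<noteq> 0} \<subseteq> V"

text \<open>Directional derivatives along every w, instead of coordinates, keep the translation
  estimate free of bases; \<open>weak_grad_coord\<close> later derives this form from the coordinate
  identities.\<close>

definition weak_grad :: "'a::euclidean_space set => ('a => real) => ('a => 'a) => bool" where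
  "weak_grad V F g \<longleftrightarrow> (\<forall>\<eta> w. test_fun V \<eta> -->
     (\<integral>v. F v * frechet_derivative \<eta> (at v) w \<partial>lborel) = - (\<integral>v. inner (g v) w * \<eta> v \<partial>lborel))"

lemma test_fun_moll:
  fixes x :: "'a::euclidean_space"
  assumes e: "\<epsilon> > 0" and "cball x \<epsilon> \<subseteq> V"
  shows "test_fun V (\<lambda>v. moll \<epsilon> (x - v))"
  unfolding test_fun_def
proof (intro conjI)
  have "Ck_on k UNIV (\<lambda>v. (1 / bump_mass TYPE('a) \<epsilon>) * exp_flat 0 (1 - (1 / \<epsilon>^2) * inner (v - x) (v - x)))" for k
    by (rule Ck_on_mult[OF Ck_on_const Ck_on_flat_bump])
  moreover have "moll \<epsilon> (x - v) = (1 / bump_mass TYPE('a) \<epsilon>) * exp_flat 0 (1 - (1 / \<epsilon>^2) * inner (v - x) (v - x))" for v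
    using moll_minus[of \<epsilon> "x - v"] unfolding moll_def by (simp only: minus_diff_eq)
  ultimately show "smooth_on UNIV (\<lambda>v. moll \<epsilon> (x - v))" unfolding smooth_on_def by simp
  have "{v. moll \<epsilon> (x - v) \<noteq> 0} \<subseteq> cball x \<epsilon>"
    using moll_zero[OF e, of "x - v" for v] by (auto simp: dist_norm) (meson linear)
  then have *: "closure {v. moll \<epsilon> (x - v) \<noteq> 0} \<subseteq> cball x \<epsilon>" by (simp add: closure_minimal)
  then show "closure {v. moll \<epsilon> (x - v) \<noteq> 0} \<subseteq> V" using assms(2) by blast
  show "compact (closure {v. moll \<epsilon> (x - v) \<noteq> 0})"
    using compact_Int_closed[OF compact_cball[of x \<epsilon>] closed_closure] * by (metis Int_absorb1)
qed

text \<open>The kernel centred at x is itself a test function once its support fits into V. The sign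
  from differentiating x - v in v cancels the sign of the integration by parts.\<close>

lemma weak_grad_moll:
  fixes x :: "'a::euclidean_space"
  assumes W: "weak_grad V F g" and e: "\<epsilon> > 0" and "cball x \<epsilon> \<subseteq> V"
    and [measurable]: "g \<in> borel_measurable borel"
  shows "(\<integral>v. F v * moll_deriv \<epsilon> (x - v) w \<partial>lborel) = mollify \<epsilon> (\<lambda>v. inner (g v) w) x"
proof -
  have "((\<lambda>v. moll \<epsilon> (x - v)) has_derivative (\<lambda>w. moll_deriv \<epsilon> (x - v) (- w))) (at v)" for v
  proof -
    have "((\<lambda>v. x - v) has_derivative (\<lambda>w. - w)) (at v)"
      using has_derivative_diff[OF has_derivative_const has_derivative_ident] by simp
    from has_derivative_compose[OF this moll_has_derivative] show ?thesis .
  qed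
  then have "frechet_derivative (\<lambda>v. moll \<epsilon> (x - v)) (at v) = (\<lambda>w. moll_deriv \<epsilon> (x - v) (- w))" for v
    by (metis frechet_derivative_at)
  then have "frechet_derivative (\<lambda>v. moll \<epsilon> (x - v)) (at v) w = - moll_deriv \<epsilon> (x - v) w" for v
    by (simp add: moll_deriv_def)
  moreover have "(\<integral>v. F v * frechet_derivative (\<lambda>v. moll \<epsilon> (x - v)) (at v) w \<partial>lborel) = - (\<integral>v. inner (g v) w * moll \<epsilon> (x - v) \<partial>lborel)"
    using W[unfolded weak_grad_def, rule_format, OF test_fun_moll[OF assms(2,3)], of w] .
  ultimately have "(\<integral>v. F v * - moll_deriv \<epsilon> (x - v) w \<partial>lborel) = - (\<integral>v. inner (g v) w * moll \<epsilon> (x - v) \<partial>lborel)"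
    by (simp only:)
  then show ?thesis by (simp add: mollify_eq[OF _ e])
qed

text \<open>Written as a probability measure so that an integral along a segment is an
  expectation.\<close>

definition unif01 :: "real measure" where
  "unif01 = density lborel (indicator {0..1})"

lemma sets_unif01 [simp, measurable_cong]: "sets unif01 = sets borel"
  by (simp add: unif01_def)

lemma prob_space_unif01: "prob_space unif01"
proof
  have "emeasure (density lborel (indicator {0..1::real})) UNIV = 1"
    by (subst emeasure_density) auto
  then show "emeasure unif01 (space unif01) = 1" unfolding unif01_def by simp
qed

lemma AE_unif01: "AE t in unif01. t \<in> {0..1}"
  unfolding unif01_def by (subst AE_density) (auto simp: indicator_def)

text \<open>The fundamental theorem of calculus is applied to the kernel at each fixed v, where it
  is elementary; Fubini's theorem then moves the integral over t outside.\<close>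

lemma mollify_difference:
  fixes F :: "'a::euclidean_space => real"
  assumes W: "weak_grad V F g" and e: "\<epsilon> > 0"
    and seg: "\<And>t. t \<in> {0..1} ==> cball (u + t *\<^sub>R w) \<epsilon> \<subseteq> V"
    and F: "integrable lborel F" and g [measurable]: "g \<in> borel_measurable borel"
  shows "mollify \<epsilon> F (u + w) - mollify \<epsilon> F u = (\<integral>t. mollify \<epsilon> (\<lambda>v. inner (g v) w) (u + t *\<^sub>R w) \<partial>unif01)"
proof -
  have [measurable]: "F \<in> borel_measurable borel" using F by auto
  interpret T: prob_space unif01 by (rule prob_space_unif01)
  interpret P: pair_sigma_finite "lborel :: 'a measure" unif01 ..
  let ?D = "\<lambda>v t. moll_deriv \<epsilon> (u + t *\<^sub>R w - v) w"
  have [measurable]: "(\<lambda>x. moll_deriv \<epsilon> x w) \<in> borel_measurable borel"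
    by (rule borel_measurable_continuous_onI[OF continuous_on_moll_deriv])
  have ftc: "(\<integral>t. ?D v t \<partial>unif01) = moll \<epsilon> (u + w - v) - moll \<epsilon> (u - v)" for v
  proof -
    have "(\<integral>t. ?D v t \<partial>unif01) = (\<integral>t. indicator {0..1} t *\<^sub>R ?D v t \<partial>lborel)"
      unfolding unif01_def by (subst integral_density[symmetric]) (auto simp: ennreal_indicator)
    also have "\<dots> = moll \<epsilon> (u + 1 *\<^sub>R w - v) - moll \<epsilon> (u + 0 *\<^sub>R w - v)"
    proof (rule integral_FTC_Icc)
      show "((\<lambda>t. moll \<epsilon> (u + t *\<^sub>R w - v)) has_vector_derivative ?D v t) (at t within {0..1})" for t
      proof -
        have "((\<lambda>t. u + t *\<^sub>R w - v) has_derivative (\<lambda>h. h *\<^sub>R w)) (at t within {0..1})"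
          by (auto intro!: derivative_eq_intros)
        from has_derivative_compose[OF this moll_has_derivative]
        show ?thesis unfolding has_vector_derivative_def
          by (simp add: moll_deriv_def mult_ac)
      qed
      show "continuous_on {0..1} (?D v)"
        by (rule continuous_on_compose2[OF continuous_on_moll_deriv[of UNIV]]) (auto intro!: continuous_intros)
    qed simp
    finally show ?thesis by simp
  qed
  obtain B where B: "0 < B" "\<And>x. \<bar>moll_deriv \<epsilon> x w\<bar> \<le> B" using moll_deriv_bounded[OF e] by metis
  have "integrable (lborel \<Otimes>\<^sub>M unif01) (\<lambda>(v, t). F v * ?D v t)"
  proof (rule integrableI_bounded)
    have "(\<integral>\<^sup>+ x. ennreal (norm (case x of (v, t) => F v * ?D v t)) \<partial>(lborel \<Otimes>\<^sub>M unif01))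
      \<le> (\<integral>\<^sup>+ x. ennreal (\<bar>F (fst x)\<bar> * B) \<partial>(lborel \<Otimes>\<^sub>M unif01))"
      using B by (intro nn_integral_mono ennreal_leI) (auto simp: abs_mult intro!: mult_left_mono)
    also have "\<dots> = (NI v. \<integral>\<^sup>+t. ennreal (\<bar>F v\<bar> * B) \<partial>unif01)"
      by (subst T.nn_integral_fst[symmetric]) auto
    also have "\<dots> = (NI v. ennreal (\<bar>F v\<bar> * B))"
      by (simp add: T.emeasure_space_1)
    also have "\<dots> < \<infinity>"
    proof -
      have "(NI v. ennreal (\<bar>F v\<bar> * B)) = (NI v. ennreal (norm (F v))) * ennreal B"
        using B by (simp add: ennreal_mult nn_integral_multc)
      then show ?thesis using F by (simp add: integrable_iff_bounded ennreal_mult_less_top)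
    qed
    finally show "(\<integral>\<^sup>+ x. ennreal (norm (case x of (v, t) => F v * ?D v t)) \<partial>(lborel \<Otimes>\<^sub>M unif01)) < \<infinity>" .
  qed measurable
  then have fub: "(\<integral>t. (\<integral>v. F v * ?D v t \<partial>lborel) \<partial>unif01) = (\<integral>v. (\<integral>t. F v * ?D v t \<partial>unif01) \<partial>lborel)"
    by (rule P.Fubini_integral)
  have im: "integrable lborel (\<lambda>v. F v * moll \<epsilon> (x - v))" for x
  proof (rule Bochner_Integration.integrable_bound)
    show "integrable lborel (\<lambda>v. F v * (1 / bump_mass TYPE('a) \<epsilon>))" using F by auto
    show "AE v in lborel. norm (F v * moll \<epsilon> (x - v)) \<le> norm (F v * (1 / bump_mass TYPE('a) \<epsilon>))"
      unfolding norm_mult using moll_le[OF e, where 'a='a] moll_nonneg[OF e, where 'a='a] bump_mass_pos[OF e, where 'a='a]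
      by (intro AE_I2 mult_left_mono) auto
  qed simp
  have "mollify \<epsilon> F (u + w) - mollify \<epsilon> F u = (\<integral>v. F v * moll \<epsilon> (u + w - v) - F v * moll \<epsilon> (u - v) \<partial>lborel)"
    using im by (simp add: mollify_eq[OF _ e])
  also have "\<dots> = (\<integral>v. (\<integral>t. F v * ?D v t \<partial>unif01) \<partial>lborel)"
    by (simp add: ftc right_diff_distrib)
  also have "\<dots> = (\<integral>t. (\<integral>v. F v * ?D v t \<partial>lborel) \<partial>unif01)" by (rule fub[symmetric])
  also have "\<dots> = (\<integral>t. mollify \<epsilon> (\<lambda>v. inner (g v) w) (u + t *\<^sub>R w) \<partial>unif01)"
  proof (rule integral_cong_AE)
    show "AE t in unif01. (\<integral>v. F v * ?D v t \<partial>lborel) = mollify \<epsilon> (\<lambda>v. inner (g v) w) (u + t *\<^sub>R w)"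
      using AE_unif01 by eventually_elim (intro weak_grad_moll[OF W e seg g])
    show "(\<lambda>t. mollify \<epsilon> (\<lambda>v. inner (g v) w) (u + t *\<^sub>R w)) \<in> borel_measurable unif01"
      using mollify_measurable[of "\<lambda>v. inner (g v) w" \<epsilon>] e by measurable
  qed measurable
  finally show ?thesis .
qed

text \<open>For the mollified function the difference is an average of directional derivatives over
  the segment, and convexity of D keeps the segment in D. Removing the mollification costs an
  arbitrarily small error, so the inequality is proved up to e. The 6 is the factor 3 of splitting
  the difference into three parts times the factor 2 of comparing the mollified with the original
  gradient; the errors add up to 12 \<delta> = e.\<close>

lemma weak_grad_translation:
  fixes F :: "'a::euclidean_space => real"
  assumes W: "weak_grad V F g" and V: "open V" and B: "compact B" "B \<subseteq> V"
    and D: "D \<subseteq> B" "convex D" and Dm [measurable]: "D \<in> sets borel"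
    and F [measurable]: "F \<in> borel_measurable borel" and g [measurable]: "g \<in> borel_measurable borel"
    and finF: "(NI u. ennreal ((F u)^2)) < \<infinity>"
    and fing: "(NI u. ennreal ((norm (g u))^2)) < \<infinity>"
    and suppF: "\<And>u. R < norm u ==> F u = 0" and suppg: "\<And>u. R < norm u ==> g u = 0"
  shows "(NI u. indicator D u * indicator D (u + w) * ennreal ((F (u + w) - F u)^2))
     \<le> ennreal (6 * (norm w)^2) * (NI u. indicator D u * ennreal ((norm (g u))^2))"
proof (rule ennreal_le_epsilon)
  fix e :: real assume e0: "0 < e"
  define \<delta> where "\<delta> = e / 12"
  have \<delta>: "\<delta> > 0" using e0 by (simp add: \<delta>_def)
  let ?h = "\<lambda>u. inner (g u) w"
  have hle: "(?h u)^2 \<le> (norm w)^2 * (norm (g u))^2" for u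
    using Cauchy_Schwarz_ineq[of "g u" w] by (simp add: power2_norm_eq_inner mult.commute)
  have finh: "(NI u. ennreal ((?h u)^2)) < \<infinity>"
  proof -
    have "(NI u. ennreal ((?h u)^2)) \<le> (NI u. ennreal ((norm w)^2) * ennreal ((norm (g u))^2))"
      using hle by (intro nn_integral_mono) (auto simp: ennreal_mult'[symmetric] intro!: ennreal_leI)
    also have "\<dots> < \<infinity>" using fing by (simp add: nn_integral_cmult ennreal_mult_less_top)
    finally show ?thesis .
  qed
  have supph: "R < norm u ==> ?h u = 0" for u using suppg by simp
  have hm [measurable]: "?h \<in> borel_measurable borel" by measurable
  obtain \<kappa>1 where k1: "\<kappa>1 > 0" "\<And>z. norm z \<le> \<kappa>1 ==> (NI u. ennreal ((F (u - z) - F u)^2)) \<le> ennreal \<delta>"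
    using L2_translation_continuous[OF F finF \<delta> suppF] by blast
  obtain \<kappa>2 where k2: "\<kappa>2 > 0" "\<And>z. norm z \<le> \<kappa>2 ==> (NI u. ennreal ((?h (u - z) - ?h u)^2)) \<le> ennreal \<delta>"
    using L2_translation_continuous[OF hm finh \<delta> supph] by blast
  obtain \<epsilon>0 where e0': "\<epsilon>0 > 0" "(\<Union>x\<in>B. cball x \<epsilon>0) \<subseteq> V"
    using compact_subset_open_imp_cball_epsilon_subset[OF B(1) V B(2)] by metis
  define \<epsilon> where "\<epsilon> = min \<epsilon>0 (min \<kappa>1 \<kappa>2)"
  have eps: "\<epsilon> > 0" "\<epsilon> \<le> \<epsilon>0" "\<epsilon> \<le> \<kappa>1" "\<epsilon> \<le> \<kappa>2" using k1 k2 e0' by (auto simp: \<epsilon>_def)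
  have iF: "integrable lborel F" by (rule integrable_square_support[OF F finF suppF])
  have ih: "integrable lborel ?h" by (rule integrable_square_support[OF hm finh supph])
  let ?f = "mollify \<epsilon> F" and ?G = "mollify \<epsilon> ?h"
  let ?NG = "(NI u. indicator D u * ennreal ((?G u)^2))"
  let ?Nh = "(NI u. indicator D u * ennreal ((?h u)^2))"
  let ?Ng = "(NI u. indicator D u * ennreal ((norm (g u))^2))"
  let ?eF = "(NI u. ennreal ((?f u - F u)^2))"
  let ?D = "\<lambda>u. indicator D u * indicator D (u + w) :: ennreal"
  let ?d = "\<lambda>u. ?f (u + w) - ?f u"
  have [measurable]: "?f \<in> borel_measurable borel" "?G \<in> borel_measurable borel"
    by (auto intro!: mollify_measurable eps)
  have errF: "?eF \<le> ennreal \<delta>"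
    using eps k1(2) by (intro mollify_L2_error[OF F iF eps(1)]) auto
  have errh: "(NI u. ennreal ((?G u - ?h u)^2)) \<le> ennreal \<delta>"
    using eps k2(2) by (intro mollify_L2_error[OF hm ih eps(1)]) auto
  interpret T: prob_space unif01 by (rule prob_space_unif01)
  interpret P: pair_sigma_finite "lborel :: 'a measure" unif01 ..
  have diff: "(NI u. ?D u * ennreal ((?d u)^2))
     \<le> ?NG"
  proof -
    have "(NI u. ?D u * ennreal ((?d u)^2))
      \<le> (NI u. (\<integral>\<^sup>+t. ?D u * ennreal ((?G (u + t *\<^sub>R w))^2) \<partial>unif01))"
    proof (rule nn_integral_mono)
      fix u
      show "?D u * ennreal ((?d u)^2)
        \<le> (\<integral>\<^sup>+t. ?D u * ennreal ((?G (u + t *\<^sub>R w))^2) \<partial>unif01)"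
      proof (cases "u \<in> D \<and> u + w \<in> D")
        case True
        have seg: "cball (u + t *\<^sub>R w) \<epsilon> \<subseteq> V" if "t \<in> {0..1}" for t
        proof -
          have "(1 - t) *\<^sub>R u + t *\<^sub>R (u + w) \<in> D"
            using True that D(2) by (intro convexD_alt) auto
          then have "u + t *\<^sub>R w \<in> D" by (simp add: algebra_simps)
          then have "cball (u + t *\<^sub>R w) \<epsilon>0 \<subseteq> V" using e0'(2) D(1) by blast
          then show ?thesis using eps(2) by auto
        qed
        have "ennreal ((?d u)^2) \<le> (\<integral>\<^sup>+t. ennreal ((?G (u + t *\<^sub>R w))^2) \<partial>unif01)"
        proof -
          have eq: "?f (u + w) - ?f u = (\<integral>t. ?G (u + t *\<^sub>R w) \<partial>unif01)"
            by (rule mollify_difference[OF W eps(1) _ iF g]) (rule seg)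
          show ?thesis unfolding eq by (rule T.square_expectation_le)
        qed
        then show ?thesis using True by simp
      qed (auto simp: indicator_def)
    qed
    also have "\<dots> = (\<integral>\<^sup>+t. (NI u. ?D u * ennreal ((?G (u + t *\<^sub>R w))^2)) \<partial>unif01)"
      by (rule P.Fubini'[symmetric]) measurable
    \<comment> \<open>Both end points in D put u + t w in D, so for fixed t translation invariance
      bounds the integral by the one over D.\<close>
    also have "\<dots> \<le> (\<integral>\<^sup>+t. ?NG \<partial>unif01)"
    proof (rule nn_integral_mono_AE, use AE_unif01 in eventually_elim)
      fix t :: real assume t: "t \<in> {0..1}"
      have "(NI u. ?D u * ennreal ((?G (u + t *\<^sub>R w))^2))
        \<le> (NI u. indicator D (t *\<^sub>R w + u) * ennreal ((?G (t *\<^sub>R w + u))^2))"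
      proof (rule nn_integral_mono)
        fix u
        have "t *\<^sub>R w + u \<in> D" if "u \<in> D" "u + w \<in> D"
        proof -
          have "(1 - t) *\<^sub>R u + t *\<^sub>R (u + w) \<in> D"
            using that t D(2) by (intro convexD_alt) auto
          then show ?thesis by (simp add: algebra_simps)
        qed
        then show "?D u * ennreal ((?G (u + t *\<^sub>R w))^2) \<le>
           indicator D (t *\<^sub>R w + u) * ennreal ((?G (t *\<^sub>R w + u))^2)"
          by (auto simp: indicator_def add.commute)
      qed
      also have "\<dots> = ?NG"
        by (rule nn_integral_lborel_translate) simp
      finally show "(NI u. ?D u * ennreal ((?G (u + t *\<^sub>R w))^2))
         \<le> ?NG" .
    qed
    also have "\<dots> = ?NG"
      by (simp add: T.emeasure_space_1)
    finally show ?thesis .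
  qed
  have Gle: "?NG
     \<le> 2 * ?Nh + 2 * ennreal \<delta>"
  proof -
    have "?NG
       \<le> (NI u. 2 * (indicator D u * ennreal ((?h u)^2)) + 2 * ennreal ((?G u - ?h u)^2))"
    proof (rule nn_integral_mono)
      fix u
      have "ennreal ((?G u)^2) \<le> ennreal (2 * (?h u)^2 + 2 * (?G u - ?h u)^2)"
        using sum_square_le[of "?h u" "?G u - ?h u"] by (intro ennreal_leI) simp
      also have "\<dots> = 2 * ennreal ((?h u)^2) + 2 * ennreal ((?G u - ?h u)^2)"
        by (simp add: ennreal_mult')
      finally show "indicator D u * ennreal ((?G u)^2) \<le> 2 * (indicator D u * ennreal ((?h u)^2)) + 2 * ennreal ((?G u - ?h u)^2)"
        by (auto simp: indicator_def)
    qed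
    also have "\<dots> = 2 * ?Nh + 2 * (NI u. ennreal ((?G u - ?h u)^2))"
      by (simp add: nn_integral_add nn_integral_cmult)
    also have "\<dots> \<le> 2 * ?Nh + 2 * ennreal \<delta>"
      using errh by (intro add_mono mult_left_mono) auto
    finally show ?thesis .
  qed
  have hw: "?Nh
      \<le> ennreal ((norm w)^2) * ?Ng"
  proof -
    have "?Nh \<le> (NI u. ennreal ((norm w)^2) * (indicator D u * ennreal ((norm (g u))^2)))"
      using hle by (intro nn_integral_mono) (auto simp: indicator_def ennreal_mult'[symmetric] intro!: ennreal_leI)
    also have "\<dots> = ennreal ((norm w)^2) * ?Ng"
      by (rule nn_integral_cmult) measurable
    finally show ?thesis .
  qed
  have "(NI u. ?D u * ennreal ((F (u + w) - F u)^2))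
    \<le> (NI u. 3 * (?D u * ennreal ((?d u)^2))
          + 3 * ennreal ((?f (w + u) - F (w + u))^2) + 3 * ennreal ((?f u - F u)^2))"
  proof (rule nn_integral_mono)
    fix u
    have "ennreal ((F (u + w) - F u)^2) \<le> ennreal (3 * (?d u)^2 + 3 * (?f (w + u) - F (w + u))^2 + 3 * (?f u - F u)^2)"
      using sum3_square_le[of "?f (u + w) - ?f u" "F (w + u) - ?f (w + u)" "?f u - F u"]
      by (intro ennreal_leI) (simp add: power2_commute[of "F (w + u)"] add.commute[of u w])
    also have "\<dots> = 3 * ennreal ((?d u)^2) + 3 * ennreal ((?f (w + u) - F (w + u))^2) + 3 * ennreal ((?f u - F u)^2)"
      by (simp add: ennreal_mult')
    finally show "?D u * ennreal ((F (u + w) - F u)^2)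
     \<le> 3 * (?D u * ennreal ((?d u)^2))
          + 3 * ennreal ((?f (w + u) - F (w + u))^2) + 3 * ennreal ((?f u - F u)^2)"
      by (auto simp: indicator_def)
  qed
  also have "\<dots> = 3 * (NI u. ?D u * ennreal ((?d u)^2))
          + 3 * (NI u. ennreal ((?f (w + u) - F (w + u))^2)) + 3 * ?eF"
    by (simp add: nn_integral_add nn_integral_cmult)
  also have "(NI u. ennreal ((?f (w + u) - F (w + u))^2)) = ?eF"
    by (rule nn_integral_lborel_translate) simp
  also have "3 * (NI u. ?D u * ennreal ((?d u)^2))
          + 3 * ?eF + 3 * ?eF
     \<le> 3 * (2 * (ennreal ((norm w)^2) * ?Ng) + 2 * ennreal \<delta>)
          + 3 * ennreal \<delta> + 3 * ennreal \<delta>"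
    using errF hw by (intro add_mono mult_left_mono order_trans[OF diff] order_trans[OF Gle]) auto
  also have "\<dots> = ennreal (6 * (norm w)^2) * ?Ng + 12 * ennreal \<delta>"
  proof -
    have "ennreal (6 * (norm w)^2) = 6 * ennreal ((norm w)^2)" by (simp add: ennreal_mult')
    moreover have "3 * (2 * a + 2 * d) + 3 * d + 3 * d = 6 * a + 12 * d" for a d :: ennreal
      by (simp add: distrib_left add.assoc mult.assoc[symmetric]) (simp add: distrib_right[symmetric])
    ultimately show ?thesis by (simp add: mult.assoc)
  qed
  also have "12 * ennreal \<delta> = ennreal e" using e0 by (simp add: \<delta>_def ennreal_mult'[symmetric] flip: ennreal_numeral)
  finally show "(NI u. ?D u * ennreal ((F (u + w) - F u)^2))
     \<le> ennreal (6 * (norm w)^2) * ?Ng + ennreal e" .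
qed

text \<open>Integrates the translation estimate over all shifts w = v - u of length at most d, which
  gives the continuous counterpart of the energy of a neighbourhood graph.\<close>

lemma weak_grad_pairs:
  fixes F :: "'a::euclidean_space => real"
  assumes W: "weak_grad V F g" and V: "open V" and B: "compact B" "B \<subseteq> V"
    and D: "D \<subseteq> B" "convex D" and Dm [measurable]: "D \<in> sets borel"
    and F [measurable]: "F \<in> borel_measurable borel" and g [measurable]: "g \<in> borel_measurable borel"
    and finF: "(NI u. ennreal ((F u)^2)) < \<infinity>"
    and fing: "(NI u. ennreal ((norm (g u))^2)) < \<infinity>"
    and suppF: "\<And>u. R < norm u ==> F u = 0" and suppg: "\<And>u. R < norm u ==> g u = 0"
    and "0 \<le> d"
  shows "(NI u. (NI v. indicator D u * indicator D v * indicator (cball u d) v * ennreal ((F v - F u)^2)))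
     \<le> ennreal (6 * d^2) * emeasure lborel (cball (0::'a) d) * (NI u. indicator D u * ennreal ((norm (g u))^2))"
proof -
  let ?E = "(NI u. indicator D u * ennreal ((norm (g u))^2))"
  have "(NI u. (NI v. indicator D u * indicator D v * indicator (cball u d) v * ennreal ((F v - F u)^2)))
    = (NI u. (NI w. indicator D u * indicator D (u + w) * indicator (cball 0 d) w * ennreal ((F (u + w) - F u)^2)))"
  proof (rule nn_integral_cong)
    fix u :: 'a
    have [measurable]: "cball u d \<in> sets borel" by simp
    have "indicator (cball u d) (u + w) = (indicator (cball 0 d) w :: ennreal)" for w
      by (auto simp: indicator_def dist_norm)
    then show "(NI v. indicator D u * indicator D v * indicator (cball u d) v * ennreal ((F v - F u)^2))
      = (NI w. indicator D u * indicator D (u + w) * indicator (cball 0 d) w * ennreal ((F (u + w) - F u)^2))"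
      by (subst nn_integral_lborel_translate[symmetric, where a = u]) simp_all
  qed
  also have "\<dots> = (NI w. (NI u. indicator D u * indicator D (u + w) * indicator (cball 0 d) w * ennreal ((F (u + w) - F u)^2)))"
  proof (rule lborel_pair.Fubini'[symmetric])
    have [measurable]: "cball (0::'a) d \<in> sets borel" by simp
    have "(\<lambda>(u, w). indicator D u * indicator D (u + w) * indicator (cball 0 d) w * ennreal ((F (u + w) - F u)^2))
       \<in> borel_measurable (borel \<Otimes>\<^sub>M borel)" by measurable
    then show "(\<lambda>(u, w). indicator D u * indicator D (u + w) * indicator (cball 0 d) w * ennreal ((F (u + w) - F u)^2))
       \<in> borel_measurable (lborel \<Otimes>\<^sub>M lborel)"
      by (simp cong: measurable_cong_sets sets_pair_measure_cong)
  qed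
  also have "\<dots> \<le> (\<integral>\<^sup>+w. (ennreal (6 * d^2) * ?E) * indicator (cball 0 d) w \<partial>(lborel::'a measure))"
  proof (rule nn_integral_mono)
    fix w :: 'a
    show "(NI u. indicator D u * indicator D (u + w) * indicator (cball 0 d) w * ennreal ((F (u + w) - F u)^2))
      \<le> (ennreal (6 * d^2) * ?E) * indicator (cball 0 d) w"
    proof (cases "norm w \<le> d")
      case True
      have "(NI u. indicator D u * indicator D (u + w) * indicator (cball 0 d) w * ennreal ((F (u + w) - F u)^2))
        = (NI u. indicator D u * indicator D (u + w) * ennreal ((F (u + w) - F u)^2))"
        using True by simp
      also have "\<dots> \<le> ennreal (6 * (norm w)^2) * ?E"
        by (rule weak_grad_translation[OF W V B D Dm F g finF fing suppF suppg])
      also have "\<dots> \<le> ennreal (6 * d^2) * ?E"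
        using True by (intro mult_right_mono ennreal_leI mult_left_mono power_mono) auto
      finally show ?thesis using True by simp
    qed (simp add: indicator_def)
  qed
  also have "\<dots> = ennreal (6 * d^2) * ?E * emeasure lborel (cball (0::'a) d)"
    by (rule nn_integral_cmult_indicator) simp
  finally show ?thesis by (simp add: mult_ac)
qed

section \<open>The Riemannian volume\<close>

text \<open>Every matrix on the segment from the identity to the Gram matrix is positive definite,
  hence invertible. The determinant starts at 1 and is continuous without zeros, so it stays
  positive.\<close>

lemma det_gram_pos:
  fixes A :: "real^'m::finite^'d::finite"
  assumes inj: "inj ((*v) A)"
  shows "0 < Determinants.det (Finite_Cartesian_Product.transpose A ** A)"
proof -
  let ?G = "Finite_Cartesian_Product.transpose A ** A"
  let ?H = "\<lambda>t. (1 - t) *\<^sub>R (Finite_Cartesian_Product.mat 1 :: real^'m^'m) + t *\<^sub>R ?G"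
  have nz: "Determinants.det (?H t) \<noteq> 0" if t: "0 \<le> t" "t \<le> 1" for t
  proof
    assume "Determinants.det (?H t) = 0"
    then have "\<not> invertible (?H t)" by (simp add: invertible_det_nz)
    then obtain x where x: "x \<noteq> 0" "?H t *v x = 0"
      by (metis invertible_left_inverse matrix_left_invertible_ker)
    have "?H t *v x = (1 - t) *\<^sub>R x + t *\<^sub>R (?G *v x)"
      by (simp add: matrix_vector_mult_add_rdistrib scaleR_matrix_vector_assoc[symmetric])
    moreover have "inner x (?G *v x) = inner (A *v x) (A *v x)"
      by (metis dot_lmul_matrix matrix_vector_mul_assoc transpose_matrix_vector vector_transpose_matrix)
    ultimately have "inner x (?H t *v x) = (1 - t) * inner x x + t * inner (A *v x) (A *v x)"
      by (simp add: inner_add_right)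
    moreover have "0 < (1 - t) * inner x x + t * inner (A *v x) (A *v x)"
    proof (cases "t = 1")
      case True
      have "A *v x \<noteq> 0" using inj x(1) by (metis injD matrix_vector_mult_0_right)
      then show ?thesis using True by simp
    next
      case False
      then have "0 < (1 - t) * inner x x" using t x by (intro mult_pos_pos) auto
      moreover have "0 \<le> t * inner (A *v x) (A *v x)" using t by simp
      ultimately show ?thesis by linarith
    qed
    ultimately show False using x by simp
  qed
  have cont: "continuous_on {0..1} (\<lambda>t. Determinants.det (?H t))"
    unfolding Determinants.det_def by (intro continuous_intros)
  show ?thesis
  proof (rule ccontr)
    assume "\<not> ?thesis"
    then have le: "Determinants.det (?H 1) \<le> 0" by simp
    have "Determinants.det (?H 0) = 1" by simp
    then obtain t where "0 \<le> t" "t \<le> 1" "Determinants.det (?H t) = 0"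
      using IVT2'[of "\<lambda>t. Determinants.det (?H t)" 1 0 0] le cont by auto
    then show False using nz by blast
  qed
qed

lemma Ck_on_1D:
  assumes "smooth_on U f" "u \<in> U"
  shows "(f has_derivative frechet_derivative f (at u)) (at u)"
proof -
  have "Ck_on (Suc 0) U f" using assms(1) unfolding smooth_on_def by blast
  then have "f differentiable (at u)" using assms(2) by simp
  then show ?thesis by (simp add: frechet_derivative_works)
qed

lemma continuous_on_frechet:
  assumes "smooth_on U f"
  shows "continuous_on U (\<lambda>u. frechet_derivative f (at u) v)"
proof -
  have "Ck_on (Suc 0) U f" using assms(1) unfolding smooth_on_def by blast
  then show ?thesis by simp
qed

lemma gram_matrix:
  fixes f :: "real^'m::finite => real^'d::finite"
  assumes "(f has_derivative D) (at u)"
  shows "(\<chi> i j. inner (coord_deriv f i u) (coord_deriv f j u)) =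
     Finite_Cartesian_Product.transpose (matrix D) ** matrix D"
proof -
  have D: "frechet_derivative f (at u) = D" using assms by (metis frechet_derivative_at)
  show ?thesis
    unfolding coord_deriv_def D
    by (simp add: matrix_def matrix_matrix_mult_def Finite_Cartesian_Product.transpose_def vec_eq_iff inner_vec_def)
qed

lemma volume_density_eq:
  fixes f :: "real^'m::finite => real^'d::finite"
  assumes "(f has_derivative D) (at u)"
  shows "volume_density f u = sqrt (Determinants.det (Finite_Cartesian_Product.transpose (matrix D) ** matrix D))"
  using gram_matrix[OF assms] by (simp add: volume_density_def)

lemma local_paramD:
  assumes "local_param X U \<phi>"
  shows "open U" "smooth_on U \<phi>" "\<And>u. u \<in> U ==> inj (frechet_derivative \<phi> (at u))"
    "openin (top_of_set X) (\<phi> ` U)"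
    "\<And>u. u \<in> U ==> (\<phi> has_derivative frechet_derivative \<phi> (at u)) (at u)"
    "continuous_on U \<phi>" "inj_on \<phi> U" "\<phi> ` U \<subseteq> X"
    "continuous_on (\<phi> ` U) (the_inv_into U \<phi>)"
proof -
  show "open U" "smooth_on U \<phi>" "\<And>u. u \<in> U ==> inj (frechet_derivative \<phi> (at u))"
    and o: "openin (top_of_set X) (\<phi> ` U)"
    using assms unfolding local_param_def by auto
  then show "\<And>u. u \<in> U ==> (\<phi> has_derivative frechet_derivative \<phi> (at u)) (at u)"
    using Ck_on_1D by blast
  obtain \<psi> where h: "homeomorphism U (\<phi> ` U) \<phi> \<psi>" using assms unfolding local_param_def by auto
  then show "continuous_on U \<phi>" by (simp add: homeomorphism_def)
  show i: "inj_on \<phi> U" using h by (metis homeomorphism_apply1 inj_on_inverseI)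
  show "\<phi> ` U \<subseteq> X" using o openin_imp_subset by blast
  have "continuous_on (\<phi> ` U) \<psi>" using h by (simp add: homeomorphism_def)
  then show "continuous_on (\<phi> ` U) (the_inv_into U \<phi>)"
  proof (rule continuous_on_eq)
    fix x assume "x \<in> \<phi> ` U"
    then obtain u where u: "u \<in> U" "x = \<phi> u" by auto
    have "\<psi> x = u" using h u by (auto simp: homeomorphism_def)
    then show "\<psi> x = the_inv_into U \<phi> x" using the_inv_into_f_f[OF i u(1)] u(2) by simp
  qed
qed

lemma volume_density_pos:
  assumes "local_param X U \<phi>" "u \<in> U" shows "0 < volume_density \<phi> u"
proof -
  let ?D = "frechet_derivative \<phi> (at u)"
  have "linear ?D" using local_paramD(5)[OF assms] by (rule has_derivative_linear)
  then have "(*v) (matrix ?D) = ?D" using matrix_vector_mul by metis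
  then have "inj ((*v) (matrix ?D))" using local_paramD(3)[OF assms] by simp
  then show ?thesis
    unfolding volume_density_eq[OF local_paramD(5)[OF assms]] by (simp add: det_gram_pos)
qed

lemma continuous_on_volume_density:
  fixes \<phi> :: "real^'m::finite => real^'d::finite"
  assumes "local_param X U \<phi>" shows "continuous_on U (volume_density \<phi>)"
proof -
  have *: "continuous_on U (\<lambda>u. inner (coord_deriv \<phi> i u) (coord_deriv \<phi> j u))" for i j
    unfolding coord_deriv_def
    by (intro continuous_intros continuous_on_frechet local_paramD(2)[OF assms])
  then have "continuous_on U (\<lambda>u. sqrt (\<Sum>p\<in>{p. p permutes (UNIV::'m set)}.
      of_int (sign p) * (\<Prod>i\<in>UNIV. inner (coord_deriv \<phi> i u) (coord_deriv \<phi> (p i) u))))"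
    by (intro continuous_on_real_sqrt continuous_on_sum continuous_on_mult continuous_on_const continuous_on_prod *)
  then show ?thesis unfolding volume_density_def[abs_def] Determinants.det_def by simp
qed

text \<open>A chart may take values in a space of larger dimension, so the inverse function theorem
  does not apply to it directly. Here \<tau> is known only through f o \<tau> = h and its
  continuity; a left inverse L of the derivative of f recovers the increments of \<tau> from those
  of h.\<close>

lemma has_derivative_of_composite:
  fixes f :: "'b::real_normed_vector => 'c::real_normed_vector" and L :: "'c => 'b"
  assumes f: "(f has_derivative f') (at (\<tau> x))" and L: "bounded_linear L" "\<And>v. L (f' v) = v"
    and h: "(h has_derivative h') (at x within W)"
    and eq: "\<And>y. y \<in> W ==> f (\<tau> y) = h y" and x: "x \<in> W"
    and cont: "continuous (at x within W) \<tau>"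
  shows "(\<tau> has_derivative (\<lambda>v. L (h' v))) (at x within W)"
  unfolding has_derivative_within_alt
proof (intro conjI allI impI)
  interpret L: bounded_linear L by fact
  interpret h': bounded_linear h' using h by (rule has_derivative_bounded_linear)
  show "bounded_linear (\<lambda>v. L (h' v))"
    using bounded_linear_compose[OF L(1) h'.bounded_linear_axioms] .
  fix e :: real assume e: "0 < e"
  obtain KL where KL: "KL > 0" "\<And>v. norm (L v) \<le> norm v * KL" using L.pos_bounded by blast
  obtain Kh where Kh: "Kh > 0" "\<And>v. norm (h' v) \<le> norm v * Kh" using h'.pos_bounded by blast
  define C where "C = 2 * KL * (Kh + 1)"
  have C: "C > 0" using KL Kh by (simp add: C_def)
  \<comment> \<open>The bound 1/2 lets the term in |\<tau> y - \<tau> x| be absorbed on the left,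
    which yields the a priori Lipschitz bound with constant C; the other bound is for the final
    error.\<close>
  define e1 where "e1 = min (1 / (2 * KL)) (e / (2 * KL * C))"
  have e1: "e1 > 0" "KL * e1 \<le> 1/2" "KL * e1 * C \<le> e / 2"
  proof -
    show "e1 > 0" using KL C e by (simp add: e1_def)
    have "KL * e1 \<le> KL * (1 / (2 * KL))" unfolding e1_def using KL by (intro mult_left_mono) auto
    then show "KL * e1 \<le> 1/2" using KL by simp
    have "KL * e1 * C \<le> KL * (e / (2 * KL * C)) * C" unfolding e1_def using KL C
      by (intro mult_right_mono mult_left_mono) auto
    then show "KL * e1 * C \<le> e / 2" using KL C by simp
  qed
  obtain d1 where d1: "d1 > 0" "\<And>y. norm (y - \<tau> x) < d1 ==> norm (f y - f (\<tau> x) - f' (y - \<tau> x)) \<le> e1 * norm (y - \<tau> x)"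
    using f e1(1) unfolding has_derivative_at_alt by meson
  obtain d2 where d2: "d2 > 0" "\<And>y. y \<in> W ==> dist y x < d2 ==> dist (\<tau> y) (\<tau> x) < d1"
    using cont d1(1) unfolding continuous_within_eps_delta by meson
  define e3 where "e3 = min 1 (e / (2 * KL))"
  have e3: "e3 > 0" "e3 \<le> 1" "KL * e3 \<le> e / 2"
  proof -
    show "e3 > 0" "e3 \<le> 1" using KL e by (auto simp: e3_def)
    have "KL * e3 \<le> KL * (e / (2 * KL))" unfolding e3_def using KL by (intro mult_left_mono) auto
    then show "KL * e3 \<le> e / 2" using KL by simp
  qed
  obtain d3 where d3: "d3 > 0" "\<And>y. y \<in> W ==> norm (y - x) < d3 ==> norm (h y - h x - h' (y - x)) \<le> e3 * norm (y - x)"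
    using h e3(1) unfolding has_derivative_within_alt by meson
  show "\<exists>d>0. \<forall>y\<in>W. norm (y - x) < d --> norm (\<tau> y - \<tau> x - L (h' (y - x))) \<le> e * norm (y - x)"
  proof (intro exI[of _ "min d2 d3"] conjI ballI impI)
    show "0 < min d2 d3" using d2 d3 by simp
    fix y assume y: "y \<in> W" and n: "norm (y - x) < min d2 d3"
    let ?a = "\<tau> y - \<tau> x" and ?z = "y - x"
    have hb: "norm (h y - h x - h' ?z) \<le> e3 * norm ?z" using d3 y n by simp
    have "dist (\<tau> y) (\<tau> x) < d1" using d2 y n by (simp add: dist_norm)
    then have fb: "norm (h y - h x - f' ?a) \<le> e1 * norm ?a"
      using d1(2)[of "\<tau> y"] eq[OF y] eq[OF x] by (simp add: dist_norm)
    have La: "L (f' ?a) = ?a" by (rule L(2))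
    have b1: "norm (L (h y - h x) - ?a) \<le> KL * e1 * norm ?a"
    proof -
      have "norm (L (h y - h x) - ?a) = norm (L (h y - h x - f' ?a))"
        using La by (simp only: L.diff)
      also have "\<dots> \<le> norm (h y - h x - f' ?a) * KL" by (rule KL)
      also have "\<dots> \<le> (e1 * norm ?a) * KL" using fb KL by (intro mult_right_mono) auto
      finally show ?thesis by (simp add: mult_ac)
    qed
    have b2: "norm (h y - h x) \<le> (Kh + 1) * norm ?z"
    proof -
      have "norm (h y - h x) \<le> norm (h y - h x - h' ?z) + norm (h' ?z)"
        using norm_triangle_ineq[of "h y - h x - h' ?z" "h' ?z"] by simp
      also have "\<dots> \<le> e3 * norm ?z + norm ?z * Kh" using hb Kh by (intro add_mono) auto
      also have "\<dots> \<le> 1 * norm ?z + norm ?z * Kh" using e3 by (intro add_mono[OF mult_right_mono order_refl]) auto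
      finally show ?thesis by (simp add: algebra_simps)
    qed
    have "norm ?a \<le> norm (L (h y - h x)) + norm (L (h y - h x) - ?a)"
      using norm_triangle_sub[of ?a "L (h y - h x)"] by (simp add: norm_minus_commute)
    also have "\<dots> \<le> KL * ((Kh + 1) * norm ?z) + KL * e1 * norm ?a"
    proof (rule add_mono[OF _ b1])
      have "norm (L (h y - h x)) \<le> norm (h y - h x) * KL" by (rule KL)
      also have "\<dots> \<le> ((Kh + 1) * norm ?z) * KL" using b2 KL by (intro mult_right_mono) auto
      finally show "norm (L (h y - h x)) \<le> KL * ((Kh + 1) * norm ?z)" by (simp add: mult_ac)
    qed
    also have "KL * e1 * norm ?a \<le> 1/2 * norm ?a" using e1 by (intro mult_right_mono) auto
    finally have a: "norm ?a \<le> C * norm ?z" by (simp add: C_def algebra_simps)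
    have b3: "norm (L (h y - h x) - L (h' ?z)) \<le> e / 2 * norm ?z"
    proof -
      have "norm (L (h y - h x) - L (h' ?z)) = norm (L (h y - h x - h' ?z))" by (simp only: L.diff)
      also have "\<dots> \<le> norm (h y - h x - h' ?z) * KL" by (rule KL)
      also have "\<dots> \<le> (e3 * norm ?z) * KL" using hb KL by (intro mult_right_mono) auto
      also have "\<dots> = (KL * e3) * norm ?z" by simp
      also have "\<dots> \<le> e / 2 * norm ?z" using e3 by (intro mult_right_mono) auto
      finally show ?thesis .
    qed
    have "norm (?a - L (h' ?z)) \<le> norm (L (h y - h x) - ?a) + norm (L (h y - h x) - L (h' ?z))"
      using norm_triangle_ineq4[of "L (h y - h x) - L (h' ?z)" "L (h y - h x) - ?a"]
      by (simp only: diff_diff_eq2 add.commute diff_add_cancel add_diff_cancel_left' diff_add_eq) (simp add: algebra_simps)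
    also have "\<dots> \<le> KL * e1 * (C * norm ?z) + e / 2 * norm ?z"
      using b1 b3 a KL e1 by (intro add_mono order_trans[OF b1] mult_left_mono) auto
    also have "\<dots> \<le> e / 2 * norm ?z + e / 2 * norm ?z"
      using mult_right_mono[OF e1(3), of "norm ?z"] by (simp add: mult_ac)
    finally show "norm (?a - L (h' ?z)) \<le> e * norm ?z" by simp
  qed
qed

text \<open>The chain rule gives D = D' T for the derivatives, so the Gram matrix of \<phi> arises
  from that of \<phi>' by the congruence with T, and its determinant gains the square of det
  T.\<close>

lemma transition_map:
  fixes \<phi> :: "real^'m::finite => real^'d::finite"
  assumes P: "local_param X U \<phi>" and P': "local_param X U' \<phi>'"
    and u: "u \<in> U" "\<phi> u \<in> \<phi>' ` U'"
  defines "\<tau> \<equiv> \<lambda>u. the_inv_into U' \<phi>' (\<phi> u)"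
  shows "\<exists>T. (\<tau> has_derivative T) (at u) \<and>
     volume_density \<phi> u = \<bar>Determinants.det (matrix T)\<bar> * volume_density \<phi>' (\<tau> u)"
proof -
  let ?W = "{u\<in>U. \<phi> u \<in> \<phi>' ` U'}"
  note d = local_paramD[OF P] and d' = local_paramD[OF P']
  obtain O' where O': "open O'" "\<phi>' ` U' = X \<inter> O'" using d'(4) unfolding openin_open by blast
  have "?W = U \<inter> \<phi> -` O'" using O' d(8) by auto
  \<comment> \<open>Openness of the overlap lets a derivative within it count as a derivative at the
    point.\<close>
  then have oW: "open ?W" using continuous_open_preimage[OF d(6,1) O'(1)] by simp
  have tau: "\<tau> v \<in> U'" "\<phi>' (\<tau> v) = \<phi> v" if "v \<in> ?W" for v
    using that d'(7) unfolding \<tau>_def by (auto simp: f_the_inv_into_f the_inv_into_into)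
  have uW: "u \<in> ?W" using u by simp
  have ct: "continuous_on ?W \<tau>"
    unfolding \<tau>_def by (rule continuous_on_compose2[OF d'(9)]) (auto intro: continuous_on_subset[OF d(6)])
  let ?D = "frechet_derivative \<phi> (at u)" and ?D' = "frechet_derivative \<phi>' (at (\<tau> u))"
  have hD: "(\<phi> has_derivative ?D) (at u)" by (rule d(5)[OF u(1)])
  have hD': "(\<phi>' has_derivative ?D') (at (\<tau> u))" by (rule d'(5)[OF tau(1)[OF uW]])
  have lD': "linear ?D'" using hD' by (rule has_derivative_linear)
  then obtain L where L: "linear L" "L \<circ> ?D' = id"
    using linear_injective_left_inverse d'(3)[OF tau(1)[OF uW]] by blast
  have "(\<tau> has_derivative (\<lambda>v. L (?D v))) (at u within ?W)"
  proof (rule has_derivative_of_composite[where \<tau> = \<tau> and x = u, OF hD' _ _ has_derivative_at_withinI[OF hD] _ uW])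
    show "bounded_linear L" using L(1) by (rule linear_conv_bounded_linear[THEN iffD1])
    show "L (?D' v) = v" for v using L(2) by (metis comp_apply id_apply)
    show "continuous (at u within ?W) \<tau>" using ct uW continuous_on_eq_continuous_within by blast
  qed (use tau in auto)
  then have T: "(\<tau> has_derivative (\<lambda>v. L (?D v))) (at u)" (is "(_ has_derivative ?T) _")
    using at_within_open[OF uW oW] by simp
  have "((\<lambda>v. \<phi>' (\<tau> v)) has_derivative (\<lambda>v. ?D' (?T v))) (at u)"
    by (rule has_derivative_compose[OF T hD'])
  then have "(\<phi> has_derivative (\<lambda>v. ?D' (?T v))) (at u)"
    by (rule has_derivative_transform_within_open[OF _ oW uW]) (use tau in auto)
  then have DT: "?D = (\<lambda>v. ?D' (?T v))" using hD has_derivative_unique by blast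
  have lT: "linear ?T" using T by (rule has_derivative_linear)
  have "matrix ?D = matrix ?D' ** matrix ?T"
    using matrix_compose[OF lT lD'] DT by (simp add: o_def)
  then have "Determinants.det (Finite_Cartesian_Product.transpose (matrix ?D) ** matrix ?D) =
     (Determinants.det (matrix ?T))^2 * Determinants.det (Finite_Cartesian_Product.transpose (matrix ?D') ** matrix ?D')"
    by (simp add: matrix_transpose_mul det_mul power2_eq_square matrix_mul_assoc[symmetric])
       (simp add: matrix_mul_assoc det_mul)
  then have "volume_density \<phi> u = \<bar>Determinants.det (matrix ?T)\<bar> * volume_density \<phi>' (\<tau> u)"
    unfolding volume_density_eq[OF hD] volume_density_eq[OF hD'] by (simp add: real_sqrt_mult)
  then show ?thesis using T by blast
qed

text \<open>The change of variables theorem of the library needs a well-ordered index type; every finite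
  type has a well-ordered copy.\<close>

typedef (overloaded) 'a wo = "UNIV :: 'a::finite set" morphisms un_wo mk_wo ..

text \<open>Any injection into the naturals induces a well-order; which one is chosen is
  immaterial.\<close>

definition wo_code :: "'a::finite => nat" where
  "wo_code = (SOME f. inj f)"

lemma inj_wo_code: "inj (wo_code :: 'a::finite => nat)"
proof -
  have "\<exists>f :: 'a => nat. inj f" using finite_imp_inj_to_nat_seg[OF finite[of "UNIV :: 'a set"]] by blast
  then show ?thesis unfolding wo_code_def by (rule someI_ex)
qed

lemma mk_un_wo [simp]: "mk_wo (un_wo x) = x" "un_wo (mk_wo y) = y"
  by (simp_all add: un_wo_inverse mk_wo_inverse)

lemma bij_un_wo: "bij un_wo" and bij_mk_wo: "bij mk_wo"
  by (rule bij_betw_byWitness[where f' = mk_wo], auto) (rule bij_betw_byWitness[where f' = un_wo], auto)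

instance wo :: (finite) finite
proof
  have "(UNIV :: 'a wo set) = mk_wo ` UNIV" using bij_mk_wo bij_is_surj by blast
  then show "finite (UNIV :: 'a wo set)" by (metis finite finite_imageI)
qed

instantiation wo :: (finite) linorder
begin
definition "x \<le> y \<longleftrightarrow> wo_code (un_wo x) \<le> wo_code (un_wo y)"
definition "x < y \<longleftrightarrow> wo_code (un_wo x) < wo_code (un_wo y)"
instance
proof
  fix x y :: "'a wo"
  assume "x \<le> y" "y \<le> x"
  then have "wo_code (un_wo x) = wo_code (un_wo y)" by (simp add: less_eq_wo_def)
  then have "un_wo x = un_wo y" using inj_wo_code by (metis injD)
  then show "x = y" by (simp add: un_wo_inject)
qed (auto simp: less_eq_wo_def less_wo_def)
end

instance wo :: (finite) wellorder
proof (rule wf_wellorderI)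
  have "wf (inv_image less_than (wo_code \<circ> un_wo :: 'a wo => nat))" by (rule wf_inv_image) simp
  then show "wf {(x, y). x < (y::'a wo)}"
    by (rule wf_subset) (auto simp: less_wo_def)
qed standard

definition to_wo :: "real^'m::finite => real^'m wo" where "to_wo x = (\<chi> k. vec_nth x (un_wo k))"
definition of_wo :: "real^'m wo => real^'m::finite" where "of_wo x = (\<chi> i. vec_nth x (mk_wo i))"

lemma to_of_wo [simp]: "to_wo (of_wo x) = x" "of_wo (to_wo y) = y"
  by (simp_all add: to_wo_def of_wo_def Finite_Cartesian_Product.vec_eq_iff)

lemma linear_to_wo: "linear to_wo"
  by (rule linearI) (simp_all only: to_wo_def Finite_Cartesian_Product.vec_eq_iff vec_lambda_beta vector_add_component vector_scaleR_component, simp_all)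

lemma linear_of_wo: "linear of_wo"
  by (rule linearI) (simp_all only: of_wo_def Finite_Cartesian_Product.vec_eq_iff vec_lambda_beta vector_add_component vector_scaleR_component, simp_all)

lemma measurable_of_wo [measurable]: "of_wo \<in> borel_measurable borel"
  by (intro borel_measurable_continuous_onI linear_continuous_on linear_conv_bounded_linear[THEN iffD1] linear_of_wo)

text \<open>Renaming coordinates maps boxes to boxes with the same side lengths, and boxes determine
  Lebesgue measure.\<close>

lemma distr_of_wo: "distr lborel borel of_wo = (lborel :: (real^'m::finite) measure)"
proof (rule lborel_eqI[symmetric])
  fix l u :: "real^'m"
  assume le: "\<And>b. b \<in> Basis ==> inner l b \<le> inner u b"
  have le': "vec_nth l i \<le> vec_nth u i" for i
    using le[of "axis i 1"] by (simp add: inner_axis axis_in_Basis_iff)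
  have pre: "of_wo -` box l u = box (to_wo l) (to_wo u)"
  proof -
    have "of_wo x \<in> box l u \<longleftrightarrow> x \<in> box (to_wo l) (to_wo u)" for x
      unfolding mem_box_cart of_wo_def to_wo_def vec_lambda_beta by (metis mk_un_wo)
    then show ?thesis by auto
  qed
  have nonempty: "cbox (to_wo l) (to_wo u) \<noteq> {}" "cbox l u \<noteq> {}"
    using le' by (auto simp: interval_ne_empty_cart to_wo_def)
  have "emeasure (distr lborel borel of_wo) (box l u) = emeasure lborel (box (to_wo l) (to_wo u))"
    by (subst emeasure_distr) (auto simp: pre)
  also have "\<dots> = ennreal (\<Prod>k\<in>UNIV. vec_nth (to_wo u) k - vec_nth (to_wo l) k)"
  proof -
    have "measure lborel (box (to_wo l) (to_wo u)) = (\<Prod>k\<in>UNIV. vec_nth (to_wo u) k - vec_nth (to_wo l) k)"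
      using content_cbox_cart[OF nonempty(1)] by (simp only: measure_lborel_box_eq measure_lborel_cbox_eq)
    moreover have "emeasure lborel (box (to_wo l) (to_wo u)) = ennreal (measure lborel (box (to_wo l) (to_wo u)))"
      using emeasure_lborel_box_finite[of "to_wo l" "to_wo u"] by (intro emeasure_eq_ennreal_measure) auto
    ultimately show ?thesis by (simp only:)
  qed
  also have "(\<Prod>k\<in>UNIV. vec_nth (to_wo u) k - vec_nth (to_wo l) k) = (\<Prod>i\<in>UNIV. vec_nth u i - vec_nth l i)"
    using prod.reindex_bij_betw[OF bij_un_wo, of "\<lambda>i. vec_nth u i - vec_nth l i"] by (simp add: to_wo_def)
  also have "(\<Prod>i\<in>UNIV. vec_nth u i - vec_nth l i) = (\<Prod>b\<in>Basis. inner (u - l) b)"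
    using content_cbox_cart[OF nonempty(2)] le by (simp add: measure_lborel_cbox_eq)
  finally show "emeasure (distr lborel borel of_wo) (box l u) = ennreal (\<Prod>b\<in>Basis. inner (u - l) b)" .
qed simp

lemma nn_integral_of_wo:
  fixes h :: "real^'m::finite => ennreal"
  assumes [measurable]: "h \<in> borel_measurable borel"
  shows "(NI x. h x) = (NI x. h (of_wo x))"
  by (subst distr_of_wo[symmetric], subst nn_integral_distr) auto

text \<open>Transporting permutations along \<pi> is a bijection that preserves signs, and it merely
  permutes the factors of each term of the Leibniz formula.\<close>

lemma det_reindex:
  fixes A :: "real^'m::finite^'m" and \<pi> :: "'n::finite => 'm"
  assumes b: "bij \<pi>"
  shows "Determinants.det (\<chi> k l. vec_nth (vec_nth A (\<pi> k)) (\<pi> l)) = Determinants.det A"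
proof -
  have inj: "inj \<pi>" and surj: "surj \<pi>" using b by (auto simp: bij_def)
  have bij: "bij_betw (map_permutation UNIV \<pi>) {p. p permutes UNIV} {p. p permutes UNIV}"
  proof -
    have "bij_betw \<pi> UNIV UNIV" using b .
    show ?thesis
    proof (rule bij_betw_byWitness[where f' = "map_permutation UNIV (inv_into UNIV \<pi>)"])
      have surj': "surj (inv_into UNIV \<pi>)" and inv': "inv_into UNIV (inv_into UNIV \<pi>) = \<pi>"
        using bij_is_surj[OF bij_imp_bij_inv[OF b]] inv_inv_eq[OF b] by auto
      have i1: "map_permutation UNIV (inv_into UNIV \<pi>) (map_permutation UNIV \<pi> p) = p" for p
        by (intro ext) (simp add: map_permutation_def surj surj' inv' inj)
      have i2: "map_permutation UNIV \<pi> (map_permutation UNIV (inv_into UNIV \<pi>) p) = p" for p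
        by (intro ext) (simp add: map_permutation_def surj surj' inv' surj_f_inv_f)
      show "\<forall>p\<in>{p. p permutes UNIV}. map_permutation UNIV (inv_into UNIV \<pi>) (map_permutation UNIV \<pi> p) = p" using i1 by simp
      show "\<forall>p\<in>{p. p permutes UNIV}. map_permutation UNIV \<pi> (map_permutation UNIV (inv_into UNIV \<pi>) p) = p" using i2 by simp
      show "map_permutation UNIV \<pi> ` {p. p permutes UNIV} \<subseteq> {p. p permutes UNIV}"
        using map_permutation_permutes[OF b] by auto
      show "map_permutation UNIV (inv_into UNIV \<pi>) ` {p. p permutes UNIV} \<subseteq> {p. p permutes UNIV}"
        using map_permutation_permutes[OF bij_imp_bij_inv[OF b]] by auto
    qed
  qed
  have "Determinants.det A = (\<Sum>p\<in>{p. p permutes (UNIV::'n set)}. of_int (sign (map_permutation UNIV \<pi> p)) *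
      (\<Prod>i\<in>UNIV. vec_nth (vec_nth A i) (map_permutation UNIV \<pi> p i)))"
    unfolding Determinants.det_def by (rule sum.reindex_bij_betw[OF bij, symmetric])
  also have "\<dots> = (\<Sum>p\<in>{p. p permutes (UNIV::'n set)}. of_int (sign p) *
      (\<Prod>k\<in>UNIV. vec_nth (vec_nth A (\<pi> k)) (\<pi> (p k))))"
  proof (rule sum.cong[OF refl])
    fix p :: "'n => 'n" assume "p \<in> {p. p permutes UNIV}"
    then have p: "p permutes UNIV" by simp
    have "(\<Prod>i\<in>UNIV. vec_nth (vec_nth A i) (map_permutation UNIV \<pi> p i))
       = (\<Prod>k\<in>UNIV. vec_nth (vec_nth A (\<pi> k)) (map_permutation UNIV \<pi> p (\<pi> k)))"
      using b by (intro prod.reindex_bij_betw[symmetric])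
    also have "\<dots> = (\<Prod>k\<in>UNIV. vec_nth (vec_nth A (\<pi> k)) (\<pi> (p k)))"
      by (intro prod.cong refl) (simp add: map_permutation_apply[OF inj])
    finally show "of_int (sign (map_permutation UNIV \<pi> p)) *
      (\<Prod>i\<in>UNIV. vec_nth (vec_nth A i) (map_permutation UNIV \<pi> p i)) = real_of_int (sign p) *
      (\<Prod>k\<in>UNIV. vec_nth (vec_nth A (\<pi> k)) (\<pi> (p k)))"
      using sign_map_permutation[OF inj p finite] by simp
  qed
  finally show ?thesis unfolding Determinants.det_def by simp
qed

text \<open>The underlying theorem speaks of absolutely integrable vector-valued maps, so f is
  embedded into \<open>real^1\<close> and its integral has to be finite.\<close>

lemma nn_change_of_variables_wo:
  fixes g :: "real^'n::{finite,wellorder} => real^'n::_" and f :: "real^'n::_ => real"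
  assumes S: "S \<in> sets borel" and gS: "g ` S \<in> sets borel"
    and der: "\<And>x. x \<in> S ==> (g has_derivative g' x) (at x within S)"
    and inj: "inj_on g S"
    and nn: "\<And>y. y \<in> g ` S ==> 0 \<le> f y"
    and fm: "(\<lambda>y. indicator (g ` S) y * f y) \<in> borel_measurable borel"
    and hm: "(\<lambda>x. indicator S x * (\<bar>Determinants.det (matrix (g' x))\<bar> * f (g x))) \<in> borel_measurable borel"
    and fin: "(\<integral>\<^sup>+y\<in>g ` S. ennreal (f y) \<partial>lborel) < \<infinity>"
  shows "(\<integral>\<^sup>+x\<in>S. ennreal (\<bar>Determinants.det (matrix (g' x))\<bar> * f (g x)) \<partial>lborel) = (\<integral>\<^sup>+y\<in>g ` S. ennreal (f y) \<partial>lborel)"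
proof -
  let ?h = "\<lambda>x. \<bar>Determinants.det (matrix (g' x))\<bar> * f (g x)"
  let ?F = "\<lambda>y. Finite_Cartesian_Product.vec (f y) :: real^1"
  have "integrable lborel (\<lambda>y. indicator (g ` S) y * f y)"
  proof (rule integrableI_bounded[OF _ ])
    have "(NI y. ennreal (norm (indicator (g ` S) y * f y))) = (\<integral>\<^sup>+y\<in>g ` S. ennreal (f y) \<partial>lborel)"
      using nn by (intro nn_integral_cong) (auto simp: indicator_def)
    then show "(NI y. ennreal (norm (indicator (g ` S) y * f y))) < \<infinity>" using fin by simp
  qed (use fm in simp)
  then have "integrable lebesgue (\<lambda>y. indicator (g ` S) y *\<^sub>R f y)"
    by (simp add: integrable_completion fm)
  then have fa: "f absolutely_integrable_on (g ` S)" by (simp add: set_integrable_def)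
  then have Fa: "?F absolutely_integrable_on (g ` S)" by (simp add: absolutely_integrable_on_1_iff)
  have Sl: "S \<in> sets lebesgue" using S by simp
  have *: "(\<lambda>x. \<bar>Determinants.det (matrix (g' x))\<bar> *\<^sub>R ?F (g x)) absolutely_integrable_on S \<and>
           integral S (\<lambda>x. \<bar>Determinants.det (matrix (g' x))\<bar> *\<^sub>R ?F (g x)) = integral (g ` S) ?F"
    using has_absolute_integral_change_of_variables[OF Sl der inj, of ?F "integral (g ` S) ?F"] Fa by blast
  have ha: "?h absolutely_integrable_on S"
    using *[THEN conjunct1] by (simp add: absolutely_integrable_on_1_iff)
  have "Finite_Cartesian_Product.vec (integral S ?h) = (Finite_Cartesian_Product.vec (integral (g ` S) f) :: real^1)"
    using *[THEN conjunct2] by (simp add: integral_on_1_eq)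
  then have eq: "integral S ?h = integral (g ` S) f" by (simp add: Finite_Cartesian_Product.vec_eq_iff)
  have hI: "(?h has_integral integral S ?h) S"
    using ha set_lebesgue_integral_eq_integral(1) integrable_integral by blast
  have fI: "(f has_integral integral (g ` S) f) (g ` S)"
    using fa set_lebesgue_integral_eq_integral(1) integrable_integral by blast
  have "(\<integral>\<^sup>+x\<in>S. ennreal (?h x) \<partial>lborel) = ennreal (integral S ?h)"
    using nn by (intro nn_integral_has_integral_lebesgue'[OF _ hI]) auto
  also have "\<dots> = (\<integral>\<^sup>+y\<in>g ` S. ennreal (f y) \<partial>lborel)"
    unfolding eq using nn by (intro nn_integral_has_integral_lebesgue'[OF _ fI, symmetric]) auto
  finally show ?thesis .
qed

lemma nn_change_of_variables:
  fixes g :: "real^'m::finite => real^'m" and f :: "real^'m => real"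
  assumes S: "S \<in> sets borel" and gS: "g ` S \<in> sets borel"
    and der: "\<And>x. x \<in> S ==> (g has_derivative g' x) (at x)"
    and inj: "inj_on g S"
    and nn: "\<And>y. y \<in> g ` S ==> 0 \<le> f y"
    and fm [measurable]: "(\<lambda>y. indicator (g ` S) y * f y) \<in> borel_measurable borel"
    and hm [measurable]: "(\<lambda>x. indicator S x * (\<bar>Determinants.det (matrix (g' x))\<bar> * f (g x))) \<in> borel_measurable borel"
    and fin: "(\<integral>\<^sup>+y\<in>g ` S. ennreal (f y) \<partial>lborel) < \<infinity>"
  shows "(\<integral>\<^sup>+x\<in>S. ennreal (\<bar>Determinants.det (matrix (g' x))\<bar> * f (g x)) \<partial>lborel) = (\<integral>\<^sup>+y\<in>g ` S. ennreal (f y) \<partial>lborel)"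
proof -
  define S2 where "S2 = of_wo -` S"
  define g2 where "g2 = (\<lambda>x. to_wo (g (of_wo x)))"
  define g2' where "g2' = (\<lambda>x v. to_wo (g' (of_wo x) (of_wo v)))"
  have g2S: "g2 ` S2 = of_wo -` (g ` S)"
  proof (intro equalityI subsetI)
    fix y assume "y \<in> of_wo -` (g ` S)"
    then obtain s where "s \<in> S" "of_wo y = g s" by auto
    then have "y = g2 (to_wo s)" "to_wo s \<in> S2" unfolding g2_def S2_def by (auto, metis to_of_wo(1))
    then show "y \<in> g2 ` S2" by blast
  qed (auto simp: g2_def S2_def)
  have bl: "bounded_linear to_wo" "bounded_linear of_wo"
    using linear_to_wo linear_of_wo linear_conv_bounded_linear by auto
  have der2: "(g2 has_derivative g2' x) (at x within S2)" if "x \<in> S2" for x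
  proof -
    have 1: "(of_wo has_derivative of_wo) (at x within S2)" by (rule bounded_linear_imp_has_derivative[OF bl(2)])
    have 2: "(g has_derivative g' (of_wo x)) (at (of_wo x))" using that der by (simp add: S2_def)
    have 3: "((\<lambda>x. g (of_wo x)) has_derivative (\<lambda>v. g' (of_wo x) (of_wo v))) (at x within S2)"
      by (rule has_derivative_compose[OF 1 2])
    show ?thesis unfolding g2_def g2'_def
      by (rule bounded_linear.has_derivative[OF bl(1) 3])
  qed
  have det2: "Determinants.det (matrix (g2' x)) = Determinants.det (matrix (g' (of_wo x)))" for x
  proof -
    have ax: "of_wo (axis l 1) = axis (un_wo l) 1" for l
    proof -
      have "mk_wo i = l \<longleftrightarrow> i = un_wo l" for i by (metis mk_un_wo)
      then show ?thesis by (simp add: of_wo_def Finite_Cartesian_Product.vec_eq_iff axis_def)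
    qed
    have "matrix (g2' x) = (\<chi> k l. vec_nth (vec_nth (matrix (g' (of_wo x))) (un_wo k)) (un_wo l))"
      by (simp add: matrix_def g2'_def to_wo_def ax)
    then show ?thesis using det_reindex[OF bij_un_wo] by simp
  qed
  have ind: "indicator (of_wo -` T) x = (indicator T (of_wo x))" for T x by (simp add: indicator_def)
  have S2m: "S2 \<in> sets borel" "g2 ` S2 \<in> sets borel" unfolding g2S unfolding S2_def
    using measurable_sets[OF measurable_of_wo S] measurable_sets[OF measurable_of_wo gS] by auto
  have main: "(\<integral>\<^sup>+x\<in>S2. ennreal (\<bar>Determinants.det (matrix (g2' x))\<bar> * f (of_wo (g2 x))) \<partial>lborel)
      = (\<integral>\<^sup>+y\<in>g2 ` S2. ennreal (f (of_wo y)) \<partial>lborel)"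
  proof (rule nn_change_of_variables_wo[OF S2m der2])
    show "inj_on g2 S2"
    proof (rule inj_onI)
      fix x y assume "x \<in> S2" "y \<in> S2" "g2 x = g2 y"
      then have "g (of_wo x) = g (of_wo y)" unfolding g2_def by (metis to_of_wo(2))
      then have "of_wo x = of_wo y" using inj \<open>x \<in> S2\<close> \<open>y \<in> S2\<close> unfolding S2_def by (auto dest: inj_onD)
      then show "x = y" by (metis to_of_wo(1))
    qed
    show "\<And>y. y \<in> g2 ` S2 ==> 0 \<le> f (of_wo y)" using nn unfolding g2S by auto
    show "(\<lambda>y. indicator (g2 ` S2) y * f (of_wo y)) \<in> borel_measurable borel"
      using measurable_compose[OF measurable_of_wo fm] by (simp add: g2S ind)
    show "(\<lambda>x. indicator S2 x * (\<bar>Determinants.det (matrix (g2' x))\<bar> * f (of_wo (g2 x)))) \<in> borel_measurable borel"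
      using measurable_compose[OF measurable_of_wo hm] by (simp add: S2_def ind det2 g2_def)
    have "(NI y. ennreal (f y) * indicator (g ` S) y) = (NI y. ennreal (f (of_wo y)) * indicator (g ` S) (of_wo y))"
    proof (rule nn_integral_of_wo)
      have "(\<lambda>y. ennreal (indicator (g ` S) y * f y)) \<in> borel_measurable borel" by measurable
      moreover have "ennreal (indicator (g ` S) y * f y) = ennreal (f y) * indicator (g ` S) y" for y
        by (simp add: indicator_def)
      ultimately show "(\<lambda>y. ennreal (f y) * indicator (g ` S) y) \<in> borel_measurable borel" by simp
    qed
    then show "(\<integral>\<^sup>+y\<in>g2 ` S2. ennreal (f (of_wo y)) \<partial>lborel) < \<infinity>" using fin by (simp add: g2S ind)
  qed
  have m1: "(\<lambda>x. ennreal (\<bar>Determinants.det (matrix (g' x))\<bar> * f (g x)) * indicator S x) \<in> borel_measurable borel"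
  proof -
    have "(\<lambda>x. ennreal (indicator S x * (\<bar>Determinants.det (matrix (g' x))\<bar> * f (g x)))) \<in> borel_measurable borel"
      by measurable
    moreover have "ennreal (indicator S x * (\<bar>Determinants.det (matrix (g' x))\<bar> * f (g x))) =
      ennreal (\<bar>Determinants.det (matrix (g' x))\<bar> * f (g x)) * indicator S x" for x by (simp add: indicator_def)
    ultimately show ?thesis by simp
  qed
  have m2: "(\<lambda>y. ennreal (f y) * indicator (g ` S) y) \<in> borel_measurable borel"
  proof -
    have "(\<lambda>y. ennreal (indicator (g ` S) y * f y)) \<in> borel_measurable borel" by measurable
    moreover have "ennreal (indicator (g ` S) y * f y) = ennreal (f y) * indicator (g ` S) y" for y
      by (simp add: indicator_def)
    ultimately show ?thesis by simp
  qed
  show ?thesis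
    unfolding nn_integral_of_wo[OF m1] nn_integral_of_wo[OF m2]
    using main by (simp add: det2 g2S ind) (simp add: S2_def ind g2_def)
qed

section \<open>Construction and uniqueness of the volume measure\<close>

lemma continuous_on_preimage_borel:
  fixes f :: "'a::euclidean_space => 'b::euclidean_space"
  assumes "continuous_on U f" "U \<in> sets borel" "B \<in> sets borel"
  shows "{u\<in>U. f u \<in> B} \<in> sets borel"
proof -
  have "f \<in> borel_measurable (restrict_space borel U)"
    by (rule borel_measurable_continuous_on_restrict[OF assms(1)])
  then have "f -` B \<inter> space (restrict_space borel U) \<in> sets (restrict_space borel U)"
    using assms(3) by (rule measurable_sets)
  moreover have "f -` B \<inter> space (restrict_space borel U) = {u\<in>U. f u \<in> B}"
    by (auto simp: space_restrict_space)
  ultimately show ?thesis using assms(2) by (auto simp: sets_restrict_space_iff)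
qed

text \<open>The image of A is the preimage of A under the inverse chart, which is continuous on a
  relatively open subset of X.\<close>

lemma local_param_image_borel:
  assumes P: "local_param X U \<phi>" and X: "X \<in> sets borel" and A: "A \<in> sets borel" "A \<subseteq> U"
  shows "\<phi> ` A \<in> sets borel"
proof -
  note d = local_paramD[OF P]
  obtain T where T: "open T" "\<phi> ` U = X \<inter> T" using d(4) unfolding openin_open by blast
  then have "\<phi> ` U \<in> sets borel" using X by auto
  then have "{x\<in>\<phi> ` U. the_inv_into U \<phi> x \<in> A} \<in> sets borel"
    using d(9) A(1) by (intro continuous_on_preimage_borel)
  moreover have "{x\<in>\<phi> ` U. the_inv_into U \<phi> x \<in> A} = \<phi> ` A"
    using A(2) d(7) by (auto simp: the_inv_into_f_f f_the_inv_into_f image_iff subset_iff)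
  ultimately show ?thesis by simp
qed

text \<open>The indicator makes the density Borel on the whole space, since continuity of
  \<open>volume_density\<close> is known on U only.\<close>

definition chart_measure :: "(real^'m::finite) set => (real^'m => real^'d::finite) => (real^'m) measure" where
  "chart_measure U \<phi> = density lborel (\<lambda>u. ennreal (indicator U u * volume_density \<phi> u))"

lemma sets_chart_measure [simp]: "sets (chart_measure U \<phi>) = sets borel"
  by (simp add: chart_measure_def)

lemma volume_density_measurable:
  assumes "local_param X U \<phi>"
  shows "(\<lambda>u. indicator U u * volume_density \<phi> u) \<in> borel_measurable borel"
  using borel_measurable_continuous_on_indicator[OF _ continuous_on_volume_density[OF assms]] local_paramD(1)[OF assms]
  by simp

lemma emeasure_chart_measure:
  assumes P: "local_param X U \<phi>" and A: "A \<in> sets borel" "A \<subseteq> U"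
  shows "emeasure (chart_measure U \<phi>) A = (\<integral>\<^sup>+u\<in>A. ennreal (volume_density \<phi> u) \<partial>lborel)"
proof -
  have [measurable]: "(\<lambda>u. indicator U u * volume_density \<phi> u) \<in> borel_measurable borel"
    by (rule volume_density_measurable[OF P])
  show ?thesis
    unfolding chart_measure_def
  proof (subst emeasure_density)
    show "(\<lambda>u. ennreal (indicator U u * volume_density \<phi> u)) \<in> borel_measurable lborel" by simp
    show "(NI u. ennreal (indicator U u * volume_density \<phi> u) * indicator A u) =
      (\<integral>\<^sup>+u\<in>A. ennreal (volume_density \<phi> u) \<partial>lborel)"
      using A(2) by (intro nn_integral_cong) (auto simp: indicator_def)
  qed (use A in simp)
qed

text \<open>The consistency that makes the volume well defined: two charts assign the same mass to a
  piece of X covered by both, because the Jacobian of the transition map is the ratio of the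
  densities.\<close>

lemma chart_measure_transition:
  fixes \<phi> \<phi>' :: "real^'m::finite => real^'d::finite"
  assumes P: "local_param X U \<phi>" and P': "local_param X U' \<phi>'" and X: "X \<in> sets borel"
    and A: "A \<in> sets borel" "A \<subseteq> U" "\<phi> ` A \<subseteq> \<phi>' ` U'"
  shows "emeasure (chart_measure U' \<phi>') {v\<in>U'. \<phi>' v \<in> \<phi> ` A} = emeasure (chart_measure U \<phi>) A"
proof -
  note d = local_paramD[OF P] and d' = local_paramD[OF P']
  define \<tau> where "\<tau> = (\<lambda>u. the_inv_into U' \<phi>' (\<phi> u))"
  have tau: "\<tau> u \<in> U'" "\<phi>' (\<tau> u) = \<phi> u" if "u \<in> A" for u
    using that A(3) d'(7) unfolding \<tau>_def by (auto intro!: f_the_inv_into_f the_inv_into_into)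
  have inj: "inj_on \<tau> A"
    by (rule inj_onI) (metis tau(2) d(7) A(2) inj_onD subsetD)
  define A' where "A' = {v\<in>U'. \<phi>' v \<in> \<phi> ` A}"
  have A'eq: "A' = \<tau> ` A"
  proof (intro equalityI subsetI)
    fix v assume "v \<in> A'"
    then obtain u where u: "u \<in> A" "\<phi>' v = \<phi> u" "v \<in> U'" by (auto simp: A'_def)
    then have "v = \<tau> u" using the_inv_into_f_f[OF d'(7) u(3)] by (simp add: \<tau>_def)
    then show "v \<in> \<tau> ` A" using u by blast
  qed (use tau in \<open>auto simp: A'_def\<close>)
  have "\<phi> ` A \<in> sets borel" by (rule local_param_image_borel[OF P X A(1,2)])
  then have A'm: "A' \<in> sets borel"
    unfolding A'_def using d'(1,6) by (intro continuous_on_preimage_borel) auto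
  obtain T where T: "\<And>u. u \<in> A ==> (\<tau> has_derivative T u) (at u)"
    "\<And>u. u \<in> A ==> volume_density \<phi> u = \<bar>Determinants.det (matrix (T u))\<bar> * volume_density \<phi>' (\<tau> u)"
  proof -
    have "\<forall>u\<in>A. \<exists>T. (\<tau> has_derivative T) (at u) \<and> volume_density \<phi> u = \<bar>Determinants.det (matrix T)\<bar> * volume_density \<phi>' (\<tau> u)"
      using transition_map[OF P P'] A(2,3) unfolding \<tau>_def by blast
    then show thesis using that by metis
  qed
  \<comment> \<open>The change of variables formula asks for a finite integral. On
    \<open>V k\<close> both the size of the points and the density are at most k, and these sets
    increase to \<open>A'\<close>.\<close>
  define V where "V = (\<lambda>k::nat. A' \<inter> (cball 0 (real k) \<inter> {v. indicator U' v * volume_density \<phi>' v \<le> real k}))"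
  have [measurable]: "(\<lambda>u. indicator U u * volume_density \<phi> u) \<in> borel_measurable borel"
    "(\<lambda>u. indicator U' u * volume_density \<phi>' u) \<in> borel_measurable borel"
    by (rule volume_density_measurable[OF P] volume_density_measurable[OF P'])+
  have Vm: "V k \<in> sets borel" for k
    unfolding V_def using A'm by (intro sets.Int) auto
  have ctA: "continuous_on A \<tau>"
    using T(1) by (intro continuous_at_imp_continuous_on ballI has_derivative_continuous) auto
  define S where "S = (\<lambda>k. {u\<in>A. \<tau> u \<in> V k})"
  have Sm: "S k \<in> sets borel" for k
    unfolding S_def by (rule continuous_on_preimage_borel[OF ctA A(1) Vm])
  have SV: "\<tau> ` S k = V k" for k
    unfolding S_def V_def A'eq by auto
  have VU: "V k \<subseteq> U'" and SU: "S k \<subseteq> U" and SA: "S k \<subseteq> A" for k using A(2) by (auto simp: V_def S_def A'_def)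
  have eqk: "emeasure (chart_measure U \<phi>) (S k) = emeasure (chart_measure U' \<phi>') (V k)" for k
  proof -
    have e1: "\<bar>Determinants.det (matrix (T u))\<bar> * volume_density \<phi>' (\<tau> u) = volume_density \<phi> u" if "u \<in> S k" for u
      using T(2) that SA by (metis subsetD)
    have "(\<integral>\<^sup>+x\<in>S k. ennreal (\<bar>Determinants.det (matrix (T x))\<bar> * volume_density \<phi>' (\<tau> x)) \<partial>lborel)
        = (\<integral>\<^sup>+y\<in>\<tau> ` S k. ennreal (volume_density \<phi>' y) \<partial>lborel)"
    proof (rule nn_change_of_variables)
      show "S k \<in> sets borel" "\<tau> ` S k \<in> sets borel" using Sm Vm SV by auto
      show "(\<tau> has_derivative T x) (at x)" if "x \<in> S k" for x using T(1) that SA by blast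
      show "inj_on \<tau> (S k)" using inj SA by (rule inj_on_subset)
      show "0 \<le> volume_density \<phi>' y" if "y \<in> \<tau> ` S k" for y
        using volume_density_pos[OF P'] that VU SV by (simp add: less_imp_le subset_iff)
      have "(\<lambda>y. indicator (V k) y * (indicator U' y * volume_density \<phi>' y)) \<in> borel_measurable borel"
        by (rule borel_measurable_times[OF borel_measurable_indicator[OF Vm] volume_density_measurable[OF P']])
      moreover have "indicator (V k) y * (indicator U' y * volume_density \<phi>' y) = indicator (V k) y * volume_density \<phi>' y" for y
        using VU[of k] by (auto simp: indicator_def)
      ultimately show "(\<lambda>y. indicator (\<tau> ` S k) y * volume_density \<phi>' y) \<in> borel_measurable borel" by (simp add: SV)
      have "(\<lambda>y. indicator (S k) y * (indicator U y * volume_density \<phi> y)) \<in> borel_measurable borel"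
        by (rule borel_measurable_times[OF borel_measurable_indicator[OF Sm] volume_density_measurable[OF P]])
      moreover have "indicator (S k) y * (indicator U y * volume_density \<phi> y) =
         indicator (S k) y * (\<bar>Determinants.det (matrix (T y))\<bar> * volume_density \<phi>' (\<tau> y))" for y
        using SU[of k] e1[of y] by (auto simp: indicator_def)
      ultimately show "(\<lambda>x. indicator (S k) x * (\<bar>Determinants.det (matrix (T x))\<bar> * volume_density \<phi>' (\<tau> x))) \<in> borel_measurable borel"
        by simp
      have "(\<integral>\<^sup>+y\<in>\<tau> ` S k. ennreal (volume_density \<phi>' y) \<partial>lborel) \<le> (\<integral>\<^sup>+y. ennreal (real k) * indicator (cball 0 (real k)) y \<partial>(lborel::(real^'m) measure))"
        unfolding SV
      proof (rule nn_integral_mono)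
        fix y show "ennreal (volume_density \<phi>' y) * indicator (V k) y \<le> ennreal (real k) * indicator (cball 0 (real k)) y"
        proof (cases "y \<in> V k")
          case True
          then have "y \<in> U'" using VU by blast
          then have "volume_density \<phi>' y \<le> real k" "norm y \<le> real k"
            using True by (simp_all add: V_def)
          then show ?thesis using True by (simp add: ennreal_leI)
        qed simp
      qed
      also have "\<dots> = ennreal (real k) * emeasure lborel (cball (0::real^'m) (real k))"
        by (rule nn_integral_cmult_indicator) simp
      also have "\<dots> < \<infinity>" using emeasure_lborel_cball_finite[of "0::real^'m" "real k"] by (simp add: ennreal_mult_less_top)
      finally show "(\<integral>\<^sup>+y\<in>\<tau> ` S k. ennreal (volume_density \<phi>' y) \<partial>lborel) < \<infinity>" .
    qed
    moreover have "(\<integral>\<^sup>+x\<in>S k. ennreal (\<bar>Determinants.det (matrix (T x))\<bar> * volume_density \<phi>' (\<tau> x)) \<partial>lborel)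
       = (\<integral>\<^sup>+x\<in>S k. ennreal (volume_density \<phi> x) \<partial>lborel)"
      using e1 by (intro nn_integral_cong) (auto simp: indicator_def)
    ultimately show ?thesis
      using emeasure_chart_measure[OF P Sm SU] emeasure_chart_measure[OF P' Vm VU] SV by simp
  qed
  have Vinc: "incseq V"
    unfolding V_def incseq_def by (auto intro: order_trans)
  have Sinc: "incseq S"
    using Vinc unfolding S_def incseq_def by blast
  have Vun: "(\<Union>k. V k) = A'"
  proof (intro equalityI subsetI)
    fix v assume v: "v \<in> A'"
    obtain k where k: "max (norm v) (indicator U' v * volume_density \<phi>' v) \<le> real k" using real_arch_simple by blast
    then have "v \<in> V k" using v by (simp add: V_def)
    then show "v \<in> (\<Union>k. V k)" by blast
  qed (auto simp: V_def)
  have Sun: "(\<Union>k. S k) = A"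
    using Vun unfolding S_def A'eq by blast
  have "(\<lambda>k. emeasure (chart_measure U \<phi>) (S k)) \<longlonglongrightarrow> emeasure (chart_measure U \<phi>) A"
    using Lim_emeasure_incseq[OF _ Sinc, of "chart_measure U \<phi>"] Sm Sun by auto
  moreover have "(\<lambda>k. emeasure (chart_measure U' \<phi>') (V k)) \<longlonglongrightarrow> emeasure (chart_measure U' \<phi>') A'"
    using Lim_emeasure_incseq[OF _ Vinc, of "chart_measure U' \<phi>'"] Vm Vun by auto
  ultimately show ?thesis unfolding eqk A'_def by (rule LIMSEQ_unique[symmetric])
qed

text \<open>Compactness leaves finitely many charts; they are listed, with repetitions, as a
  sequence so that \<open>disjointed\<close> can cut X into pieces.\<close>

lemma countable_charts:
  fixes X :: "(real^'d::finite) set"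
  assumes "compact X" "X \<noteq> {}" "embedded_manifold TYPE('m::finite) X"
  obtains U :: "nat => (real^'m) set" and \<phi> where
    "\<And>i. local_param X (U i) (\<phi> i)" "X = (\<Union>i. \<phi> i ` U i)"
proof -
  have "\<forall>x\<in>X. \<exists>(V :: (real^'m) set) f. local_param X V f \<and> x \<in> f ` V"
    using assms(3) unfolding embedded_manifold_def .
  then obtain V :: "real^'d => (real^'m) set" and f where
    Vf: "\<And>x. x \<in> X ==> local_param X (V x) (f x)" "\<And>x. x \<in> X ==> x \<in> f x ` V x"
    by metis
  have "\<forall>x\<in>X. \<exists>T. open T \<and> f x ` V x = X \<inter> T"
    using local_paramD(4)[OF Vf(1)] unfolding openin_open by blast
  then obtain T where T: "\<And>x. x \<in> X ==> open (T x)" "\<And>x. x \<in> X ==> f x ` V x = X \<inter> T x" by metis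
  have "X \<subseteq> (\<Union>x\<in>X. T x)" using Vf(2) T(2) by blast
  then obtain C where C: "C \<subseteq> X" "finite C" "X \<subseteq> (\<Union>x\<in>C. T x)"
    using compactE_image[OF assms(1), of X T] T(1) by metis
  have "C \<noteq> {}" using C(3) assms(2) by auto
  then have rC: "range (from_nat_into C) = C" using C(2) by (simp add: range_from_nat_into countable_finite)
  show thesis
  proof (rule that[of "\<lambda>i. V (from_nat_into C i)" "\<lambda>i. f (from_nat_into C i)"])
    have inX: "from_nat_into C i \<in> X" for i using rC C(1) by blast
    show "local_param X (V (from_nat_into C i)) (f (from_nat_into C i))" for i using Vf(1)[OF inX] .
    show "X = (\<Union>i. f (from_nat_into C i) ` V (from_nat_into C i))"
    proof
      show "X \<subseteq> (\<Union>i. f (from_nat_into C i) ` V (from_nat_into C i))"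
      proof
        fix x assume x: "x \<in> X"
        then obtain y where y: "y \<in> C" "x \<in> T y" using C(3) by auto
        then obtain i where "y = from_nat_into C i" using rC by blast
        then show "x \<in> (\<Union>i. f (from_nat_into C i) ` V (from_nat_into C i))"
          using T(2)[of y] x y C(1) by blast
      qed
      show "(\<Union>i. f (from_nat_into C i) ` V (from_nat_into C i)) \<subseteq> X"
        using T(2)[OF inX] by blast
    qed
  qed
qed

text \<open>The predicate whose definite description is \<open>riemannian_volume\<close>.\<close>

definition is_volume :: "'m::finite itself => (real^'d::finite) set => (real^'d) measure => bool" where
  "is_volume (m :: 'm itself) X \<mu> \<longleftrightarrow> sets \<mu> = sets (restrict_space borel X) \<and>
       (\<forall>(U :: (real^'m) set) \<phi> A. local_param X U \<phi> --> A \<in> sets borel --> A \<subseteq> U -->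
          emeasure \<mu> (\<phi> ` A) = (\<integral>\<^sup>+u\<in>A. ennreal (volume_density \<phi> u) \<partial>lborel))"

text \<open>X is cut into disjoint Borel pieces, each inside one chart image, and the masses
  computed in the chosen charts are added. For an arbitrary chart the prescribed value follows piece
  by piece from \<open>chart_measure_transition\<close>.\<close>

lemma is_volume_exists:
  fixes X :: "(real^'d::finite) set"
  assumes X: "compact X" "X \<noteq> {}" "embedded_manifold TYPE('m::finite) X"
  shows "\<exists>\<mu>. is_volume TYPE('m) X \<mu>"
proof -
  obtain U :: "nat => (real^'m) set" and \<phi> where
    c: "\<And>i. local_param X (U i) (\<phi> i)" and un: "X = (\<Union>i. \<phi> i ` U i)"
    using countable_charts[OF X] by metis
  have Xb: "X \<in> sets borel" using X(1) by (simp add: compact_imp_closed)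
  note d = local_paramD[OF c]
  define E where "E = disjointed (\<lambda>i. \<phi> i ` U i)"
  have img: "\<phi> i ` U i \<in> sets borel" for i
    using local_param_image_borel[OF c Xb, of "U i"] d(1) by simp
  have Em: "E i \<in> sets borel" for i
    unfolding E_def using sets.range_disjointed_sets[of "\<lambda>i. \<phi> i ` U i" borel] img by blast
  have Ed: "disjoint_family E" unfolding E_def by (rule disjoint_family_disjointed)
  have Eun: "(\<Union>i. E i) = X" unfolding E_def UN_disjointed_eq un ..
  have Esub: "E i \<subseteq> \<phi> i ` U i" for i unfolding E_def by (rule disjointed_subset)
  \<comment> \<open>Writing the sum over charts as an integral over the counting measure lets
    countable additivity follow by exchanging it with a series.\<close>
  define f where "f = (\<lambda>S. \<integral>\<^sup>+i. emeasure (chart_measure (U i) (\<phi> i)) {u\<in>U i. \<phi> i u \<in> S \<inter> E i} \<partial>count_space UNIV)"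
  define \<mu> where "\<mu> = measure_of X (sets (restrict_space borel X)) f"
  have alg: "sigma_algebra X (sets (restrict_space borel X))"
    using sets.sigma_algebra_axioms[of "restrict_space borel X"] by (simp add: space_restrict_space)
  have rs: "S \<in> sets (restrict_space borel X) \<longleftrightarrow> S \<subseteq> X \<and> S \<in> sets borel" for S
    using Xb by (auto simp: sets_restrict_space_iff)
  have pre: "{u\<in>U i. \<phi> i u \<in> S} \<in> sets borel" if "S \<in> sets borel" for i S
    using d(1,6) that by (intro continuous_on_preimage_borel) auto
  have em: "emeasure \<mu> S = f S" if S: "S \<in> sets (restrict_space borel X)" for S
    unfolding \<mu>_def
  proof (rule emeasure_measure_of_sigma[OF alg])
    show "positive (sets (restrict_space borel X)) f" by (simp add: positive_def f_def)
    show "countably_additive (sets (restrict_space borel X)) f"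
    proof (rule countably_additiveI)
      fix A :: "nat => (real^'d) set"
      assume A: "range A \<subseteq> sets (restrict_space borel X)" "disjoint_family A"
      then have Ab: "A j \<in> sets borel" for j using rs by blast
      have "(\<Sum>j. f (A j)) = (\<integral>\<^sup>+i. (\<Sum>j. emeasure (chart_measure (U i) (\<phi> i)) {u\<in>U i. \<phi> i u \<in> A j \<inter> E i}) \<partial>count_space UNIV)"
        unfolding f_def by (rule nn_integral_suminf[symmetric]) simp
      also have "\<dots> = f (\<Union>j. A j)"
        unfolding f_def
      proof (rule nn_integral_cong)
        fix i
        have "(\<Sum>j. emeasure (chart_measure (U i) (\<phi> i)) {u\<in>U i. \<phi> i u \<in> A j \<inter> E i}) =
           emeasure (chart_measure (U i) (\<phi> i)) (\<Union>j. {u\<in>U i. \<phi> i u \<in> A j \<inter> E i})"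
        proof (rule suminf_emeasure)
          show "range (\<lambda>j. {u\<in>U i. \<phi> i u \<in> A j \<inter> E i}) \<subseteq> sets (chart_measure (U i) (\<phi> i))"
            using pre[of "A j \<inter> E i" i for j] Ab Em by auto
          show "disjoint_family (\<lambda>j. {u\<in>U i. \<phi> i u \<in> A j \<inter> E i})"
            using A(2) unfolding disjoint_family_on_def by blast
        qed
        also have "(\<Union>j. {u\<in>U i. \<phi> i u \<in> A j \<inter> E i}) = {u\<in>U i. \<phi> i u \<in> (\<Union>j. A j) \<inter> E i}" by blast
        finally show "(\<Sum>j. emeasure (chart_measure (U i) (\<phi> i)) {u\<in>U i. \<phi> i u \<in> A j \<inter> E i}) =
          emeasure (chart_measure (U i) (\<phi> i)) {u\<in>U i. \<phi> i u \<in> (\<Union>j. A j) \<inter> E i}" .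
      qed
      finally show "(\<Sum>j. f (A j)) = f (\<Union>j. A j)" .
    qed
  qed (use S in simp)
  have sets: "sets \<mu> = sets (restrict_space borel X)"
    unfolding \<mu>_def using alg by (simp add: sigma_algebra.sets_measure_of_eq)
  have "emeasure \<mu> (\<psi> ` A) = (\<integral>\<^sup>+u\<in>A. ennreal (volume_density \<psi> u) \<partial>lborel)"
    if P: "local_param X V \<psi>" and A: "A \<in> sets borel" "A \<subseteq> V" for V :: "(real^'m) set" and \<psi> A
  proof -
    note p = local_paramD[OF P]
    have "\<psi> ` A \<in> sets (restrict_space borel X)"
      using local_param_image_borel[OF P Xb A] p(8) A(2) rs by blast
    then have "emeasure \<mu> (\<psi> ` A) = f (\<psi> ` A)" by (rule em)
    also have "\<dots> = (\<integral>\<^sup>+i. emeasure (chart_measure V \<psi>) {u\<in>A. \<psi> u \<in> E i} \<partial>count_space UNIV)"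
      unfolding f_def
    proof (rule nn_integral_cong)
      fix i
      let ?A = "{u\<in>A. \<psi> u \<in> E i}"
      have Am: "?A \<in> sets borel"
        using continuous_on_preimage_borel[OF continuous_on_subset[OF p(6) A(2)] A(1) Em] .
      have "\<psi> ` ?A = \<psi> ` A \<inter> E i" by blast
      moreover have "emeasure (chart_measure (U i) (\<phi> i)) {v\<in>U i. \<phi> i v \<in> \<psi> ` ?A} = emeasure (chart_measure V \<psi>) ?A"
        using A Esub by (intro chart_measure_transition[OF P c Xb Am]) auto
      ultimately show "emeasure (chart_measure (U i) (\<phi> i)) {u\<in>U i. \<phi> i u \<in> \<psi> ` A \<inter> E i} =
        emeasure (chart_measure V \<psi>) ?A" by simp
    qed
    also have "\<dots> = (\<Sum>i. emeasure (chart_measure V \<psi>) {u\<in>A. \<psi> u \<in> E i})"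
      by (rule nn_integral_count_space_nat)
    also have "\<dots> = emeasure (chart_measure V \<psi>) (\<Union>i. {u\<in>A. \<psi> u \<in> E i})"
    proof (rule suminf_emeasure)
      show "range (\<lambda>i. {u\<in>A. \<psi> u \<in> E i}) \<subseteq> sets (chart_measure V \<psi>)"
        using continuous_on_preimage_borel[OF continuous_on_subset[OF p(6) A(2)] A(1) Em] by auto
      show "disjoint_family (\<lambda>i. {u\<in>A. \<psi> u \<in> E i})"
        using Ed unfolding disjoint_family_on_def by blast
    qed
    also have "(\<Union>i. {u\<in>A. \<psi> u \<in> E i}) = A" using Eun p(8) A(2) by blast
    also have "emeasure (chart_measure V \<psi>) A = (\<integral>\<^sup>+u\<in>A. ennreal (volume_density \<psi> u) \<partial>lborel)"
      by (rule emeasure_chart_measure[OF P A])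
    finally show ?thesis .
  qed
  then have "is_volume TYPE('m) X \<mu>" unfolding is_volume_def using sets by blast
  then show ?thesis by blast
qed

text \<open>Each Borel subset of X is a disjoint union of chart images, on which the value is
  prescribed.\<close>

lemma is_volume_unique:
  fixes X :: "(real^'d::finite) set"
  assumes X: "compact X" "X \<noteq> {}" "embedded_manifold TYPE('m::finite) X"
    and v: "is_volume TYPE('m) X \<mu>" "is_volume TYPE('m) X \<nu>"
  shows "\<mu> = \<nu>"
proof (rule measure_eqI)
  show s: "sets \<mu> = sets \<nu>" using v unfolding is_volume_def by simp
  obtain U :: "nat => (real^'m) set" and \<phi> where
    c: "\<And>i. local_param X (U i) (\<phi> i)" and un: "X = (\<Union>i. \<phi> i ` U i)"
    using countable_charts[OF X] by metis
  have Xb: "X \<in> sets borel" using X(1) by (simp add: compact_imp_closed)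
  note d = local_paramD[OF c]
  define E where "E = disjointed (\<lambda>i. \<phi> i ` U i)"
  have img: "\<phi> i ` U i \<in> sets borel" for i
    using local_param_image_borel[OF c Xb, of "U i"] d(1) by simp
  have Em: "E i \<in> sets borel" for i
    unfolding E_def using sets.range_disjointed_sets[of "\<lambda>i. \<phi> i ` U i" borel] img by blast
  have Ed: "disjoint_family E" unfolding E_def by (rule disjoint_family_disjointed)
  have Eun: "(\<Union>i. E i) = X" unfolding E_def UN_disjointed_eq un ..
  have Esub: "E i \<subseteq> \<phi> i ` U i" for i unfolding E_def by (rule disjointed_subset)
  fix S assume "S \<in> sets \<mu>"
  then have S: "S \<in> sets borel" "S \<subseteq> X"
    using v(1) Xb unfolding is_volume_def by (auto simp: sets_restrict_space_iff)
  define A where "A = (\<lambda>i. {u\<in>U i. \<phi> i u \<in> S \<inter> E i})"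
  have Am: "A i \<in> sets borel" for i
    unfolding A_def using d(1,6) S(1) Em by (intro continuous_on_preimage_borel) auto
  have AU: "A i \<subseteq> U i" for i by (auto simp: A_def)
  have img2: "\<phi> i ` A i = S \<inter> E i" for i unfolding A_def using Esub by blast
  have *: "emeasure \<kappa> S = (\<Sum>i. \<integral>\<^sup>+u\<in>A i. ennreal (volume_density (\<phi> i) u) \<partial>lborel)"
    if k: "is_volume TYPE('m) X \<kappa>" for \<kappa>
  proof -
    have "(\<Sum>i. emeasure \<kappa> (S \<inter> E i)) = emeasure \<kappa> (\<Union>i. S \<inter> E i)"
    proof (rule suminf_emeasure)
      show "range (\<lambda>i. S \<inter> E i) \<subseteq> sets \<kappa>"
        using k S Em Xb unfolding is_volume_def by (auto simp: sets_restrict_space_iff)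
      show "disjoint_family (\<lambda>i. S \<inter> E i)" using Ed unfolding disjoint_family_on_def by blast
    qed
    also have "(\<Union>i. S \<inter> E i) = S" using Eun S(2) by blast
    finally have "emeasure \<kappa> S = (\<Sum>i. emeasure \<kappa> (\<phi> i ` A i))" by (simp add: img2)
    also have "\<dots> = (\<Sum>i. \<integral>\<^sup>+u\<in>A i. ennreal (volume_density (\<phi> i) u) \<partial>lborel)"
      using k c Am AU unfolding is_volume_def by (intro suminf_cong) blast
    finally show ?thesis .
  qed
  show "emeasure \<mu> S = emeasure \<nu> S" using *[OF v(1)] *[OF v(2)] by simp
qed

lemma is_volume_riemannian_volume:
  fixes X :: "(real^'d::finite) set"
  assumes X: "compact X" "X \<noteq> {}" "embedded_manifold TYPE('m::finite) X"
  shows "is_volume TYPE('m) X (riemannian_volume TYPE('m) X)"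
proof -
  have "\<exists>!\<mu>. is_volume TYPE('m) X \<mu>" using is_volume_exists[OF X] is_volume_unique[OF X] by blast
  then have "is_volume TYPE('m) X (THE \<mu>. is_volume TYPE('m) X \<mu>)" by (rule theI')
  then show ?thesis unfolding is_volume_def[abs_def] riemannian_volume_def .
qed

section \<open>Uniform constants for charts over compact sets\<close>

lemma norm_linear_le_Basis:
  fixes L :: "'a::euclidean_space => 'b::real_normed_vector"
  assumes "linear L" shows "norm (L v) \<le> (\<Sum>b\<in>Basis. norm (L b)) * norm v"
proof -
  interpret linear L by fact
  have "L v = L (\<Sum>b\<in>Basis. inner v b *\<^sub>R b)" by (simp add: euclidean_representation)
  also have "\<dots> = (\<Sum>b\<in>Basis. inner v b *\<^sub>R L b)" by (simp add: sum scale)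
  also have "norm \<dots> \<le> (\<Sum>b\<in>Basis. norm (L b) * norm v)"
  proof (rule sum_norm_le)
    fix b :: 'a assume "b \<in> Basis"
    then show "norm (inner v b *\<^sub>R L b) \<le> norm (L b) * norm v"
      using mult_left_mono[OF Basis_le_norm[of b v] norm_ge_zero[of "L b"]] by (simp add: mult.commute)
  qed
  finally show ?thesis by (simp add: sum_distrib_right)
qed

text \<open>The mean value inequality on a ball for \<phi> minus its derivative at x, a map whose
  own derivative is at most e near x by continuity.\<close>

lemma smooth_on_strict_derivative:
  fixes \<phi> :: "'a::euclidean_space => 'b::euclidean_space"
  assumes s: "smooth_on U \<phi>" and U: "open U" "x \<in> U" and e: "0 < e"
  shows "\<exists>d>0. \<forall>a\<in>ball x d. \<forall>b\<in>ball x d.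
    norm (\<phi> a - \<phi> b - frechet_derivative \<phi> (at x) (a - b)) \<le> e * norm (a - b)"
proof -
  let ?D = "\<lambda>y. frechet_derivative \<phi> (at y)"
  let ?g = "\<lambda>y. \<Sum>b\<in>Basis. norm (?D y b - ?D x b)"
  have "continuous_on U ?g" by (intro continuous_intros continuous_on_frechet s)
  then obtain d1 where d1: "d1 > 0" "\<And>y. y \<in> U ==> dist y x < d1 ==> dist (?g y) (?g x) < e"
    using U(2) e unfolding continuous_on_iff by meson
  obtain d2 where d2: "d2 > 0" "ball x d2 \<subseteq> U" using U openE by blast
  let ?d = "min d1 d2"
  have lx: "linear (?D x)" using Ck_on_1D[OF s U(2)] by (rule has_derivative_linear)
  have "norm ((\<phi> a - ?D x a) - (\<phi> b - ?D x b)) \<le> e * norm (a - b)" if ab: "a \<in> ball x ?d" "b \<in> ball x ?d" for a b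
  proof (rule differentiable_bound[where S = "ball x ?d" and f' = "\<lambda>y v. ?D y v - ?D x v"])
    fix y assume y: "y \<in> ball x ?d"
    then have yU: "y \<in> U" using d2 by auto
    have hy: "(\<phi> has_derivative ?D y) (at y)" by (rule Ck_on_1D[OF s yU])
    have "bounded_linear (?D x)" using Ck_on_1D[OF s U(2)] by (rule has_derivative_bounded_linear)
    then have "((?D x) has_derivative (?D x)) (at y)" by (rule bounded_linear_imp_has_derivative)
    then show "((\<lambda>y. \<phi> y - ?D x y) has_derivative (\<lambda>v. ?D y v - ?D x v)) (at y within ball x ?d)"
      by (rule has_derivative_at_withinI[OF has_derivative_diff[OF hy]])
    have gy: "?g y \<le> e" using d1(2)[OF yU] y by (auto simp: dist_commute dist_real_def)
    have lin: "linear (\<lambda>v. ?D y v - ?D x v)" by (intro linear_compose_sub lx has_derivative_linear[OF hy])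
    show "onorm (\<lambda>v. ?D y v - ?D x v) \<le> e"
    proof (rule onorm_le)
      fix v
      have "norm (?D y v - ?D x v) \<le> ?g y * norm v" using norm_linear_le_Basis[OF lin] .
      also have "\<dots> \<le> e * norm v" using gy by (rule mult_right_mono) simp
      finally show "norm (?D y v - ?D x v) \<le> e * norm v" .
    qed
  qed (use ab in auto)
  moreover have "\<phi> a - \<phi> b - ?D x (a - b) = (\<phi> a - ?D x a) - (\<phi> b - ?D x b)" for a b
    by (simp add: linear_diff[OF lx])
  ultimately have "\<forall>a\<in>ball x ?d. \<forall>b\<in>ball x ?d. norm (\<phi> a - \<phi> b - ?D x (a - b)) \<le> e * norm (a - b)"
    by (simp only:) blast
  then show ?thesis using d1(1) d2(1) by (intro exI[of _ ?d]) simp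
qed

lemma compact_bounded_above:
  fixes f :: "'a::topological_space => real"
  assumes "compact K" "continuous_on K f" shows "\<forall>\<^sub>F L in at_top. \<forall>x\<in>K. f x \<le> L"
proof -
  have "bounded (f ` K)" using assms by (intro compact_imp_bounded compact_continuous_image)
  then obtain B where "\<forall>x\<in>K. \<bar>f x\<bar> \<le> B" unfolding bounded_iff by auto
  then show ?thesis by (intro eventually_mono[OF eventually_ge_at_top[of B]]) force
qed

lemma local_param_lipschitz:
  fixes \<phi> :: "real^'m::finite => real^'d::finite"
  assumes P: "local_param X U \<phi>" and K: "compact K" "convex K" "K \<subseteq> U"
  shows "\<forall>\<^sub>F L in at_top. \<forall>u\<in>K. \<forall>v\<in>K. norm (\<phi> u - \<phi> v) \<le> L * norm (u - v)"
proof -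
  let ?D = "\<lambda>y. frechet_derivative \<phi> (at y)"
  note d = local_paramD[OF P]
  have "continuous_on K (\<lambda>y. \<Sum>b\<in>Basis. norm (?D y b))"
    by (intro continuous_intros continuous_on_subset[OF continuous_on_frechet[OF d(2)] K(3)])
  from compact_bounded_above[OF K(1) this] show ?thesis
  proof eventually_elim
    case (elim L)
    show ?case
    proof (intro ballI)
      fix u v assume uv: "u \<in> K" "v \<in> K"
      show "norm (\<phi> u - \<phi> v) \<le> L * norm (u - v)"
      proof (rule differentiable_bound[OF K(2) _ _ uv, of _ ?D])
        fix y assume y: "y \<in> K"
        have hy: "(\<phi> has_derivative ?D y) (at y)" using d(5) K(3) y by blast
        then show "(\<phi> has_derivative ?D y) (at y within K)" by (rule has_derivative_at_withinI)
        show "onorm (?D y) \<le> L"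
          using order_trans[OF norm_linear_le_Basis[OF has_derivative_linear[OF hy]]] elim y
          by (intro onorm_le) (meson mult_right_mono norm_ge_zero order_trans norm_linear_le_Basis[OF has_derivative_linear[OF hy]])
      qed
    qed
  qed
qed

text \<open>If no constant worked, compactness would give pairs converging to points with the same
  image, hence to one point a by injectivity. Near a, strict differentiability with an injective
  derivative bounds the increments of \<phi> from below, a contradiction.\<close>

lemma local_param_inverse_lipschitz:
  fixes \<phi> :: "real^'m::finite => real^'d::finite"
  assumes P: "local_param X U \<phi>" and K: "compact K" "K \<subseteq> U"
  shows "\<forall>\<^sub>F L in at_top. \<forall>u\<in>K. \<forall>v\<in>K. norm (u - v) \<le> L * norm (\<phi> u - \<phi> v)"
proof -
  note d = local_paramD[OF P]
  have "\<exists>L. \<forall>u\<in>K. \<forall>v\<in>K. norm (u - v) \<le> L * norm (\<phi> u - \<phi> v)"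
  proof (rule ccontr)
    assume "\<not> ?thesis"
    then have "\<forall>n::nat. \<exists>u v. u \<in> K \<and> v \<in> K \<and> real n * norm (\<phi> u - \<phi> v) < norm (u - v)"
      by (meson not_le)
    then obtain u v where uv: "\<And>n::nat. u n \<in> K" "\<And>n. v n \<in> K"
      "\<And>n. real n * norm (\<phi> (u n) - \<phi> (v n)) < norm (u n - v n)" by metis
    have "\<forall>n. (u n, v n) \<in> K \<times> K" using uv by auto
    then obtain l s where l: "l \<in> K \<times> K" "strict_mono s" "((\<lambda>n. (u n, v n)) \<circ> s) \<longlonglongrightarrow> l"
      by (rule seq_compactE[OF compact_Times[OF K(1) K(1), unfolded compact_eq_seq_compact_metric]])
    obtain a b where ab: "l = (a, b)" by (cases l)
    have ua: "(\<lambda>n. u (s n)) \<longlonglongrightarrow> a" and vb: "(\<lambda>n. v (s n)) \<longlonglongrightarrow> b"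
      using tendsto_fst[OF l(3)] tendsto_snd[OF l(3)] by (simp_all add: ab o_def)
    have aK: "a \<in> K" "b \<in> K" using l(1) ab by auto
    have cK: "continuous_on K \<phi>" using d(6) K(2) by (rule continuous_on_subset)
    have phi: "(\<lambda>n. \<phi> (u (s n)) - \<phi> (v (s n))) \<longlonglongrightarrow> \<phi> a - \<phi> b"
      using uv by (intro tendsto_diff continuous_on_tendsto_compose[OF cK ua] continuous_on_tendsto_compose[OF cK vb] aK) auto
    obtain B where B: "\<forall>x\<in>K. norm x \<le> B" using compact_imp_bounded[OF K(1)] unfolding bounded_iff by auto
    have bnd: "norm (\<phi> (u (s n)) - \<phi> (v (s n))) \<le> 2 * B * inverse (real n)" if "n > 0" for n
    proof -
      have "real n * norm (\<phi> (u (s n)) - \<phi> (v (s n))) \<le> real (s n) * norm (\<phi> (u (s n)) - \<phi> (v (s n)))"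
        using seq_suble[OF l(2), of n] by (intro mult_right_mono) auto
      also have "\<dots> \<le> norm (u (s n) - v (s n))" using uv(3)[of "s n"] by simp
      also have "\<dots> \<le> norm (u (s n)) + norm (v (s n))" by (rule norm_triangle_ineq4)
      also have "\<dots> \<le> B + B" using B uv by (intro add_mono) auto
      also have "\<dots> = 2 * B" by simp
      finally show ?thesis using that by (simp add: field_simps)
    qed
    have "(\<lambda>n. 2 * B * inverse (real n)) \<longlonglongrightarrow> 2 * B * 0"
      by (intro tendsto_intros lim_inverse_n)
    then have "(\<lambda>n. 2 * B * inverse (real n)) \<longlonglongrightarrow> 0" by simp
    moreover have "\<forall>\<^sub>F n in sequentially. norm (\<phi> (u (s n)) - \<phi> (v (s n))) \<le> 2 * B * inverse (real n)"
      using eventually_gt_at_top[of 0] by eventually_elim (rule bnd)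
    ultimately have "(\<lambda>n. \<phi> (u (s n)) - \<phi> (v (s n))) \<longlonglongrightarrow> 0"
      by (rule Lim_null_comparison[rotated])
    then have "\<phi> a - \<phi> b = 0" using phi LIMSEQ_unique by blast
    then have eq: "a = b" using d(7) aK K(2) by (auto dest: inj_onD)
    have aU: "a \<in> U" using aK K(2) by auto
    let ?D = "frechet_derivative \<phi> (at a)"
    have bl: "bounded_linear ?D" "linear ?D" using d(5)[OF aU] has_derivative_bounded_linear has_derivative_linear by blast+
    obtain k where k: "k > 0" "\<And>w. k * norm w \<le> norm (?D w)"
      using linear_inj_bounded_below_pos[OF bl(2) d(3)[OF aU]] by metis
    obtain \<delta> where \<delta>: "\<delta> > 0" "\<And>x y. x \<in> ball a \<delta> ==> y \<in> ball a \<delta> ==> norm (\<phi> x - \<phi> y - ?D (x - y)) \<le> k / 2 * norm (x - y)"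
      using smooth_on_strict_derivative[OF d(2,1) aU, of "k/2"] k(1) by auto
    \<comment> \<open>From index \<open>n0\<close> on, the lower bound k / 2 on the increments near
      a contradicts the choice of the pairs.\<close>
    obtain n0 :: nat where n0: "2 / k \<le> real n0" using real_arch_simple by blast
    have "\<forall>\<^sub>F n in sequentially. u (s n) \<in> ball a \<delta>" "\<forall>\<^sub>F n in sequentially. v (s n) \<in> ball a \<delta>"
      using tendstoD[OF ua \<delta>(1)] tendstoD[OF vb \<delta>(1)] eq by (auto simp: dist_commute)
    then have "\<forall>\<^sub>F n in sequentially. u (s n) \<in> ball a \<delta> \<and> v (s n) \<in> ball a \<delta> \<and> n0 \<le> n"
      using eventually_ge_at_top[of n0] by eventually_elim auto
    then obtain n where n: "u (s n) \<in> ball a \<delta>" "v (s n) \<in> ball a \<delta>" "n0 \<le> n"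
      using eventually_happens'[OF sequentially_bot] by blast
    let ?x = "u (s n)" and ?y = "v (s n)"
    have "k * norm (?x - ?y) \<le> norm (?D (?x - ?y))" by (rule k)
    also have "\<dots> \<le> norm (\<phi> ?x - \<phi> ?y) + norm (\<phi> ?x - \<phi> ?y - ?D (?x - ?y))"
      using norm_triangle_sub[of "?D (?x - ?y)" "\<phi> ?x - \<phi> ?y"] by (simp add: norm_minus_commute)
    also have "\<dots> \<le> norm (\<phi> ?x - \<phi> ?y) + k / 2 * norm (?x - ?y)" using \<delta>(2)[OF n(1,2)] by simp
    finally have "norm (?x - ?y) \<le> 2 / k * norm (\<phi> ?x - \<phi> ?y)" using k(1) by (simp add: field_simps)
    also have "\<dots> \<le> real (s n) * norm (\<phi> ?x - \<phi> ?y)"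
      using n0 n(3) seq_suble[OF l(2), of n] by (intro mult_right_mono) auto
    finally show False using uv(3)[of "s n"] by simp
  qed
  then obtain L where L: "\<forall>u\<in>K. \<forall>v\<in>K. norm (u - v) \<le> L * norm (\<phi> u - \<phi> v)" by blast
  show ?thesis
    by (intro eventually_mono[OF eventually_ge_at_top[of L]])
       (meson L mult_right_mono norm_ge_zero order_trans)
qed

text \<open>The radii h, 2h and 3h are nested margins: images of the h-balls will cover X, points of
  X near the image of an h-ball lie in the image of the 2h-ball, and small grid cells meeting the
  2h-ball stay in the 3h-ball.\<close>

definition chart_ok :: "(real^'d::finite) set => (real^'m::finite => real^'d) => real^'m => real => real => bool" where
  "chart_ok X \<phi> c h L \<longleftrightarrow>
     (\<forall>u\<in>cball c (3*h). \<forall>v\<in>cball c (3*h). norm (\<phi> u - \<phi> v) \<le> L * norm (u - v)) \<and>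
     (\<forall>u\<in>cball c (3*h). \<forall>v\<in>cball c (3*h). norm (u - v) \<le> L * norm (\<phi> u - \<phi> v)) \<and>
     (\<forall>u\<in>cball c (3*h). volume_density \<phi> u \<le> L) \<and>
     (\<forall>u\<in>cball c (3*h). inverse L \<le> volume_density \<phi> u) \<and>
     (\<forall>u\<in>cball c (3*h). (\<Sum>j\<in>UNIV. (norm (coord_deriv \<phi> j u))^2) \<le> L) \<and>
     (\<forall>u\<in>cball c h. \<forall>y\<in>X. norm (\<phi> u - y) \<le> inverse L --> y \<in> \<phi> ` cball c (2*h))"

text \<open>Each bound persists when L grows, so the conclusion is phrased as eventual truth and
  finitely many charts can share one constant.\<close>

lemma eventually_chart_ok:
  fixes \<phi> :: "real^'m::finite => real^'d::finite"
  assumes P: "local_param X U \<phi>" and h: "0 < h" and sub: "cball c (3*h) \<subseteq> U"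
  shows "\<forall>\<^sub>F L in at_top. chart_ok X \<phi> c h L"
proof -
  note d = local_paramD[OF P]
  let ?K = "cball c (3*h)"
  have cJ: "continuous_on ?K (volume_density \<phi>)"
    using continuous_on_volume_density[OF P] sub by (rule continuous_on_subset)
  have Jpos: "volume_density \<phi> u > 0" if "u \<in> ?K" for u using volume_density_pos[OF P] sub that by blast
  have cJi: "continuous_on ?K (\<lambda>u. inverse (volume_density \<phi> u))"
    by (intro continuous_on_inverse cJ ballI) (use Jpos in fastforce)
  have cD: "continuous_on ?K (\<lambda>u. \<Sum>j\<in>UNIV. (norm (coord_deriv \<phi> j u))^2)"
    unfolding coord_deriv_def by (intro continuous_intros continuous_on_subset[OF continuous_on_frechet[OF d(2)] sub])
  have sub2: "ball c (2*h) \<subseteq> U" using sub h by (auto simp: subset_iff)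
  \<comment> \<open>The image of the open 2h-ball is open in X, so the compact image of the h-ball
    has a uniform neighbourhood in X inside it; this gives the last clause of
    \<open>chart_ok\<close>.\<close>
  obtain T where T: "open T" "\<phi> ` ball c (2*h) = X \<inter> T"
  proof -
    obtain T0 where T0: "open T0" "\<phi> ` U = X \<inter> T0" using d(4) unfolding openin_open by blast
    have "openin (top_of_set (\<phi> ` U)) (\<phi> ` U \<inter> the_inv_into U \<phi> -` ball c (2*h))"
      by (rule continuous_openin_preimage_gen[OF d(9) open_ball])
    moreover have "\<phi> ` U \<inter> the_inv_into U \<phi> -` ball c (2*h) = \<phi> ` ball c (2*h)"
    proof (intro equalityI subsetI)
      fix x assume "x \<in> \<phi> ` U \<inter> the_inv_into U \<phi> -` ball c (2*h)"
      then obtain u where "u \<in> U" "x = \<phi> u" "the_inv_into U \<phi> x \<in> ball c (2*h)" by blast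
      then show "x \<in> \<phi> ` ball c (2*h)" using the_inv_into_f_f[OF d(7)] by auto
    next
      fix x assume "x \<in> \<phi> ` ball c (2*h)"
      then obtain u where "u \<in> ball c (2*h)" "x = \<phi> u" by blast
      then show "x \<in> \<phi> ` U \<inter> the_inv_into U \<phi> -` ball c (2*h)"
        using the_inv_into_f_f[OF d(7), of u] sub2 by blast
    qed
    ultimately have "openin (top_of_set X) (\<phi> ` ball c (2*h))" using d(4) openin_trans by metis
    then show thesis using that unfolding openin_open by blast
  qed
  have sub1: "cball c h \<subseteq> U" using sub h by (auto simp: subset_iff)
  have "compact (\<phi> ` cball c h)" by (intro compact_continuous_image continuous_on_subset[OF d(6) sub1]) auto
  moreover have "\<phi> ` cball c h \<subseteq> T" using T(2) h by auto
  ultimately obtain e where e: "e > 0" "(\<Union>x\<in>\<phi> ` cball c h. cball x e) \<subseteq> T"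
    using compact_subset_open_imp_cball_epsilon_subset[OF _ T(1)] by metis
  have near: "y \<in> \<phi> ` cball c (2*h)" if "u \<in> cball c h" "y \<in> X" "norm (\<phi> u - y) \<le> e" for u y
  proof -
    have "y \<in> (\<Union>x\<in>\<phi> ` cball c h. cball x e)"
      using that by (intro UN_I[of "\<phi> u"]) (auto simp: dist_norm)
    then have "y \<in> T" using e(2) by blast
    then show ?thesis using T(2) that(2) ball_subset_cball by blast
  qed
  have "\<forall>\<^sub>F L in at_top. inverse e \<le> L" "\<forall>\<^sub>F L::real in at_top. 1 \<le> L" by (rule eventually_ge_at_top)+
  with local_param_lipschitz[OF P compact_cball convex_cball sub]
    local_param_inverse_lipschitz[OF P compact_cball sub] compact_bounded_above[OF compact_cball cJ]
    compact_bounded_above[OF compact_cball cJi] compact_bounded_above[OF compact_cball cD]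
  show ?thesis
  proof eventually_elim
    case (elim L)
    have "inverse L \<le> volume_density \<phi> u" if "u \<in> ?K" for u
      using elim(4) elim(7) that Jpos[OF that] by (metis inverse_inverse_eq inverse_positive_iff_positive le_imp_inverse_le)
    moreover have "inverse L \<le> e" using elim(6) e(1) by (metis inverse_inverse_eq inverse_positive_iff_positive le_imp_inverse_le)
    ultimately show ?case unfolding chart_ok_def using elim near by (meson order_trans)
  qed
qed

lemma finite_charts_ok:
  fixes X :: "(real^'d::finite) set"
  assumes "compact X" "embedded_manifold TYPE('m::finite) X"
  obtains A :: "(real^'d) set" and U :: "real^'d => (real^'m) set" and \<phi> c h L where
    "finite A" "\<And>a. a \<in> A ==> local_param X (U a) (\<phi> a)" "\<And>a. a \<in> A ==> 0 < h a"
    "\<And>a. a \<in> A ==> cball (c a) (3 * h a) \<subseteq> U a" "\<And>a. a \<in> A ==> chart_ok X (\<phi> a) (c a) (h a) L"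
    "X \<subseteq> (\<Union>a\<in>A. \<phi> a ` cball (c a) (h a))" "1 \<le> L"
proof -
  have "\<forall>x\<in>X. \<exists>(V :: (real^'m) set) f u r. local_param X V f \<and> f u = x \<and> 0 < r \<and> cball u (3*r) \<subseteq> V"
  proof
    fix x assume "x \<in> X"
    then have "\<exists>(V :: (real^'m) set) f. local_param X V f \<and> x \<in> f ` V"
      using assms(2) unfolding embedded_manifold_def by blast
    then obtain V :: "(real^'m) set" and f where V0: "local_param X V f" "x \<in> f ` V" by (elim exE conjE)
    then obtain u where V: "local_param X V f" "u \<in> V" "f u = x" by blast
    obtain r where "r > 0" "cball u r \<subseteq> V" using local_paramD(1)[OF V(1)] V(2) open_contains_cball by blast
    then show "\<exists>(V :: (real^'m) set) f u r. local_param X V f \<and> f u = x \<and> 0 < r \<and> cball u (3*r) \<subseteq> V"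
      using V by (intro exI[of _ V] exI[of _ f] exI[of _ u] exI[of _ "r/3"]) auto
  qed
  then obtain U :: "real^'d => (real^'m) set" and \<phi> c h where
    Uf: "\<And>x. x \<in> X ==> local_param X (U x) (\<phi> x)" "\<And>x. x \<in> X ==> \<phi> x (c x) = x" "\<And>x. x \<in> X ==> 0 < h x"
      "\<And>x. x \<in> X ==> cball (c x) (3 * h x) \<subseteq> U x" by metis
  have "\<forall>x\<in>X. \<exists>e>0. X \<inter> ball x e \<subseteq> \<phi> x ` cball (c x) (h x)"
  proof
    fix x assume x: "x \<in> X"
    \<comment> \<open>Used with half the radius, the last clause places a neighbourhood of x in X
      inside the image of the ball of radius \<open>h x\<close>.\<close>
    have "\<forall>\<^sub>F L in at_top. chart_ok X (\<phi> x) (c x) (h x / 2) L"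
      using Uf(3,4)[OF x] by (intro eventually_chart_ok[OF Uf(1)[OF x]]) (auto simp: subset_iff)
    then have "\<forall>\<^sub>F L in at_top. chart_ok X (\<phi> x) (c x) (h x / 2) L \<and> 0 < L"
      using eventually_gt_at_top[of 0] by eventually_elim simp
    then obtain L where L: "chart_ok X (\<phi> x) (c x) (h x / 2) L" "0 < L"
      using eventually_happens'[OF trivial_limit_at_top_linorder] by blast
    then have "y \<in> \<phi> x ` cball (c x) (h x)" if "y \<in> X" "norm (\<phi> x (c x) - y) \<le> inverse L" for y
      using that Uf(3)[OF x] unfolding chart_ok_def by (auto simp: less_imp_le)
    then show "\<exists>e>0. X \<inter> ball x e \<subseteq> \<phi> x ` cball (c x) (h x)"
      using L(2) Uf(2)[OF x] by (intro exI[of _ "inverse L"]) (auto simp: dist_norm)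
  qed
  then obtain e where e: "\<And>x. x \<in> X ==> 0 < e x" "\<And>x. x \<in> X ==> X \<inter> ball x (e x) \<subseteq> \<phi> x ` cball (c x) (h x)" by metis
  obtain A where A: "A \<subseteq> X" "finite A" "X \<subseteq> (\<Union>x\<in>A. ball x (e x))"
  proof (rule compactE_image[OF assms(1), of X "\<lambda>x. ball x (e x)"])
    show "X \<subseteq> (\<Union>x\<in>X. ball x (e x))" using e(1) by auto
  qed auto
  have "\<forall>\<^sub>F L in at_top. \<forall>x\<in>A. chart_ok X (\<phi> x) (c x) (h x) L"
  proof (intro eventually_ball_finite[OF A(2)] ballI)
    fix x assume "x \<in> A"
    then have x: "x \<in> X" using A(1) by blast
    show "\<forall>\<^sub>F L in at_top. chart_ok X (\<phi> x) (c x) (h x) L" by (rule eventually_chart_ok[OF Uf(1,3,4)[OF x]])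
  qed
  then have "\<forall>\<^sub>F L in at_top. (\<forall>x\<in>A. chart_ok X (\<phi> x) (c x) (h x) L) \<and> 1 \<le> L"
    using eventually_ge_at_top[of 1] by eventually_elim simp
  then obtain L where L: "\<forall>x\<in>A. chart_ok X (\<phi> x) (c x) (h x) L" "1 \<le> L"
    using eventually_happens'[OF trivial_limit_at_top_linorder] by blast
  have cov: "X \<subseteq> (\<Union>x\<in>A. \<phi> x ` cball (c x) (h x))" using A(1,3) e(2) by blast
  have inX: "a \<in> X" if "a \<in> A" for a using A(1) that by blast
  show thesis
    by (rule that[of A U \<phi> h c L, OF A(2) Uf(1)[OF inX] Uf(3)[OF inX] Uf(4)[OF inX] _ cov L(2)]) (use L(1) in blast)+
qed

lemma nn_integral_volume_chart:
  fixes X :: "(real^'d::finite) set" and \<phi> :: "real^'m::finite => real^'d" and g :: "real^'d => ennreal"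
  assumes V: "is_volume TYPE('m) X V" and X: "X \<in> sets borel" and P: "local_param X U \<phi>"
    and D: "D \<in> sets borel" "D \<subseteq> U" and g [measurable]: "g \<in> borel_measurable V"
  shows "(\<integral>\<^sup>+x. g x * indicator (\<phi> ` D) x \<partial>V) = (NI u. ennreal (volume_density \<phi> u) * g (\<phi> u) * indicator D u)"
proof (cases "D = {}")
  case False
  note d = local_paramD[OF P]
  have sV: "sets V = sets (restrict_space borel X)" using V unfolding is_volume_def by simp
  then have spV: "space V = X" by (metis sets_eq_imp_space_eq space_restrict_space2 space_restrict_space Int_UNIV_right space_borel Int_commute)
  have rs: "S \<in> sets V \<longleftrightarrow> S \<subseteq> X \<and> S \<in> sets borel" for S
    unfolding sV using X by (auto simp: sets_restrict_space_iff)
  obtain u0 where u0: "u0 \<in> D" using False by blast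
  \<comment> \<open>A total map into X is needed for the pushforward; outside D, where the density
    below is zero, it takes the constant value \<open>\<phi> u0\<close>.\<close>
  define \<psi> where "\<psi> = (\<lambda>u. if u \<in> D then \<phi> u else \<phi> u0)"
  have pre: "{u\<in>D. \<phi> u \<in> S} \<in> sets borel" if "S \<in> sets borel" for S
    using continuous_on_preimage_borel[OF continuous_on_subset[OF d(6) D(2)] D(1) that] .
  have [measurable]: "\<psi> \<in> lborel \<rightarrow>\<^sub>M V"
  proof (rule measurableI)
    show "\<psi> u \<in> space V" for u using d(8) D(2) u0 by (auto simp: spV \<psi>_def)
    fix S assume S: "S \<in> sets V"
    have "\<psi> -` S \<inter> space lborel = {u\<in>D. \<phi> u \<in> S} \<union> (if \<phi> u0 \<in> S then - D else {})"
      by (cases "\<phi> u0 \<in> S") (auto simp: \<psi>_def split: if_splits)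
    also have "\<dots> \<in> sets borel" using pre S rs D(1) by (intro sets.Un) (auto intro: borel_comp)
    finally show "\<psi> -` S \<inter> space lborel \<in> sets lborel" by simp
  qed
  let ?J = "\<lambda>u. ennreal (indicator U u * volume_density \<phi> u) * indicator D u"
  have Jm [measurable]: "?J \<in> borel_measurable lborel"
    using volume_density_measurable[OF P] D(1)
    by (intro borel_measurable_times_ennreal borel_measurable_indicator measurable_compose[OF _ measurable_ennreal]) auto
  have imD: "\<phi> ` D \<in> sets V" using local_param_image_borel[OF P X D] d(8) D(2) rs by blast
  have "density V (indicator (\<phi> ` D)) = distr (density lborel ?J) V \<psi>"
  proof (rule measure_eqI)
    fix S assume "S \<in> sets (density V (indicator (\<phi> ` D)))"
    then have S: "S \<in> sets V" by simp
    have "emeasure (distr (density lborel ?J) V \<psi>) S = (NI u. ?J u * indicator (\<psi> -` S) u)"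
    proof -
      have "\<psi> -` S \<in> sets lborel" using measurable_sets[OF \<open>\<psi> \<in> lborel \<rightarrow>\<^sub>M V\<close> S] by simp
      then show ?thesis using S by (simp add: emeasure_distr emeasure_density)
    qed
    also have "\<dots> = (\<integral>\<^sup>+u\<in>{u\<in>D. \<phi> u \<in> S}. ennreal (volume_density \<phi> u) \<partial>lborel)"
      using D(2) by (intro nn_integral_cong) (auto simp: indicator_def \<psi>_def)
    also have "\<dots> = emeasure V (\<phi> ` {u\<in>D. \<phi> u \<in> S})"
    proof -
      have "{u\<in>D. \<phi> u \<in> S} \<in> sets borel" "{u\<in>D. \<phi> u \<in> S} \<subseteq> U" using pre S rs D(2) by auto
      then show ?thesis using V[unfolded is_volume_def, THEN conjunct2, rule_format, OF P] by simp
    qed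
    also have "\<phi> ` {u\<in>D. \<phi> u \<in> S} = \<phi> ` D \<inter> S" by blast
    also have "emeasure V (\<phi> ` D \<inter> S) = emeasure (density V (indicator (\<phi> ` D))) S"
    proof -
      have "emeasure (density V (indicator (\<phi> ` D))) S = (\<integral>\<^sup>+x. indicator (\<phi> ` D) x * indicator S x \<partial>V)"
        using imD S by (intro emeasure_density borel_measurable_indicator)
      also have "\<dots> = (\<integral>\<^sup>+x. indicator (\<phi> ` D \<inter> S) x \<partial>V)"
        by (intro nn_integral_cong) (auto simp: indicator_def)
      also have "\<dots> = emeasure V (\<phi> ` D \<inter> S)" using imD S by (intro nn_integral_indicator) auto
      finally show ?thesis ..
    qed
    finally show "emeasure (density V (indicator (\<phi> ` D))) S = emeasure (distr (density lborel ?J) V \<psi>) S" ..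
  qed simp
  then have "(\<integral>\<^sup>+x. g x \<partial>density V (indicator (\<phi> ` D))) = (\<integral>\<^sup>+x. g x \<partial>distr (density lborel ?J) V \<psi>)" by simp
  also have "\<dots> = (NI u. ?J u * g (\<psi> u))"
    by (simp add: nn_integral_distr nn_integral_density)
  also have "\<dots> = (NI u. ennreal (volume_density \<phi> u) * g (\<phi> u) * indicator D u)"
    using D(2) by (intro nn_integral_cong) (auto simp: indicator_def \<psi>_def)
  also have "(\<integral>\<^sup>+x. g x \<partial>density V (indicator (\<phi> ` D))) = (\<integral>\<^sup>+x. g x * indicator (\<phi> ` D) x \<partial>V)"
    using imD by (simp add: nn_integral_density mult.commute)
  finally show ?thesis .
qed simp

section \<open>Grid cells and Poincare inequalities\<close>

text \<open>Half-open cubes named by any of their points: they partition the space, and no index set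
  is required.\<close>

definition cell :: "real => 'e::euclidean_space => 'e set" where
  "cell \<eta> u = {v. \<forall>b\<in>Basis. \<lfloor>inner v b / \<eta>\<rfloor> = \<lfloor>inner u b / \<eta>\<rfloor>}"

lemma cell_self [simp]: "u \<in> cell \<eta> u" by (simp add: cell_def)
lemma cell_commute: "u \<in> cell \<eta> v \<longleftrightarrow> v \<in> cell \<eta> u" by (auto simp: cell_def)
lemma cell_eq: "u \<in> cell \<eta> v ==> cell \<eta> u = cell \<eta> v" by (auto simp: cell_def)

lemma cell_mem_iff:
  assumes "\<eta> > 0"
  shows "v \<in> cell \<eta> u \<longleftrightarrow> (\<forall>b\<in>Basis. real_of_int \<lfloor>inner u b / \<eta>\<rfloor> * \<eta> \<le> inner v b \<and> inner v b < (real_of_int \<lfloor>inner u b / \<eta>\<rfloor> + 1) * \<eta>)"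
  unfolding cell_def using assms by (auto simp: floor_eq_iff pos_le_divide_eq pos_divide_less_eq)

lemma cell_borel [measurable]: "cell \<eta> u \<in> sets borel"
proof -
  have "cell \<eta> u = (\<Inter>b\<in>Basis. {v. \<lfloor>inner v b / \<eta>\<rfloor> = \<lfloor>inner u b / \<eta>\<rfloor>})" by (auto simp: cell_def)
  also have "\<dots> \<in> sets borel" by (intro sets.finite_INT) auto
  finally show ?thesis .
qed

lemma convex_cell:
  assumes "\<eta> > 0" shows "convex (cell \<eta> u)"
proof -
  have "cell \<eta> u = (\<Inter>b\<in>Basis. {v. real_of_int \<lfloor>inner u b / \<eta>\<rfloor> * \<eta> \<le> inner b v} \<inter> {v. inner b v < (real_of_int \<lfloor>inner u b / \<eta>\<rfloor> + 1) * \<eta>})"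
    using cell_mem_iff[OF assms, of _ u] by (auto simp: inner_commute)
  also have "convex \<dots>" by (intro convex_INT convex_Int convex_halfspace_lt convex_halfspace_ge)
  finally show ?thesis .
qed

lemma norm_diff_cell:
  fixes u :: "'e::euclidean_space"
  assumes "\<eta> > 0" "v \<in> cell \<eta> u" "w \<in> cell \<eta> u" shows "norm (v - w) \<le> real DIM('e) * \<eta>"
proof -
  have "norm (v - w) \<le> (\<Sum>b\<in>Basis. \<bar>inner (v - w) b\<bar>)" by (rule norm_le_l1)
  also have "\<dots> \<le> (\<Sum>b\<in>(Basis::'e set). \<eta>)"
    using assms(2,3)[unfolded cell_mem_iff[OF assms(1)]] by (intro sum_mono) (force simp: inner_diff_left algebra_simps abs_le_iff)
  finally show ?thesis by simp
qed

lemma emeasure_cell: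
  fixes u :: "'e::euclidean_space"
  assumes e: "\<eta> > 0" shows "emeasure lborel (cell \<eta> u) = ennreal (\<eta> ^ DIM('e))"
proof -
  let ?k = "\<lambda>b. real_of_int \<lfloor>inner u b / \<eta>\<rfloor>"
  define l where "l = (\<Sum>b\<in>Basis. (?k b * \<eta>) *\<^sub>R b)"
  define r where "r = (\<Sum>b\<in>Basis. ((?k b + 1) * \<eta>) *\<^sub>R b)"
  have lr: "inner l b = ?k b * \<eta>" "inner r b = (?k b + 1) * \<eta>" if "b \<in> Basis" for b
    using that by (simp_all add: l_def r_def)
  have le: "inner l b \<le> inner r b" if "b \<in> Basis" for b using lr[OF that] e by (simp add: algebra_simps)
  have "box l r \<subseteq> cell \<eta> u" "cell \<eta> u \<subseteq> cbox l r"
    using lr by (auto simp: cell_mem_iff[OF e] mem_box less_imp_le)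
  then have "emeasure lborel (box l r) \<le> emeasure lborel (cell \<eta> u)" "emeasure lborel (cell \<eta> u) \<le> emeasure lborel (cbox l r)"
    by (auto intro!: emeasure_mono)
  moreover have "(\<Prod>b\<in>Basis. inner (r - l) b) = \<eta> ^ DIM('e)"
    using lr by (simp add: inner_diff_left algebra_simps)
  ultimately show ?thesis using le by (simp add: antisym)
qed

text \<open>With an integer ratio K the coarse index of a coordinate is the integer quotient of its
  fine index by K, so fine cells never straddle coarse ones.\<close>

lemma cell_nested:
  assumes "\<eta> > 0" "0 < (K::nat)" "v \<in> cell (real K * \<eta>) u" shows "cell \<eta> v \<subseteq> cell (real K * \<eta>) u"
proof
  fix w assume w: "w \<in> cell \<eta> v"
  have fl: "\<lfloor>x / (real K * \<eta>)\<rfloor> = \<lfloor>x / \<eta>\<rfloor> div int K" for x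
    using floor_divide_real_eq_div[of "int K" "x / \<eta>"] assms by (simp add: field_simps)
  show "w \<in> cell (real K * \<eta>) u" using w assms(3) unfolding cell_def by (auto simp: fl)
qed

lemma nn_integral_indicator_swap:
  fixes f :: "'a::euclidean_space => 'a => ennreal"
  assumes "(\<lambda>(x, y). f x y) \<in> borel_measurable (borel \<Otimes>\<^sub>M borel)"
  shows "(NI x. (NI y. f x y)) = (NI y. (NI x. f x y))"
proof (rule lborel_pair.Fubini'[symmetric])
  show "(\<lambda>(x, y). f x y) \<in> borel_measurable (lborel \<Otimes>\<^sub>M lborel)"
    using assms by (simp cong: measurable_cong_sets sets_pair_measure_cong)
qed

lemma square_sum_le: "(\<Sum>t<l. x t)^2 \<le> real l * (\<Sum>t<l. (x t :: real)^2)"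
  using Cauchy_Schwarz_ineq_sum[of "\<lambda>_. 1" x "{..<l}"] by simp

text \<open>Cutting the segment from u to v into l equal steps compares all pairs of points with close pairs.\<close>

lemma nonlocal_poincare:
  fixes F :: "'e::euclidean_space => real"
  assumes F [measurable]: "F \<in> borel_measurable borel" and Q [measurable]: "Q \<in> sets borel" and cv: "convex Q"
    and l: "0 < (l::nat)" and diam: "\<And>u v. u \<in> Q ==> v \<in> Q ==> norm (u - v) \<le> real l * \<eta>"
  shows "(NI u. (NI v. indicator Q u * indicator Q v * ennreal ((F u - F v)^2)))
    \<le> ennreal (real l ^ (DIM('e) + 2)) *
      (NI u. (NI v. indicator Q u * indicator Q v * indicator {..\<eta>} (norm (u - v)) * ennreal ((F u - F v)^2)))"
    (is "_ \<le> _ * ?E")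
proof -
  define G where "G = (\<lambda>a z. indicator Q a * indicator Q (a + z) * indicator {..\<eta>} (norm z) * ennreal ((F a - F (a + z))^2))"
  have Gm [measurable]: "(\<lambda>(a, z). G a z) \<in> borel_measurable (borel \<Otimes>\<^sub>M borel)"
    unfolding G_def by measurable
  define p where "p = (\<lambda>t u w. u + (real t / real l) *\<^sub>R w :: 'e)"
  \<comment> \<open>Convexity keeps the division points in Q, and consecutive ones differ by w / l,
    a vector of length at most \<eta>.\<close>
  have tri: "indicator Q u * indicator Q (u + w) * ennreal ((F u - F (u + w))^2)
     \<le> ennreal (real l) * (\<Sum>t<l. G (p t u w) ((1 / real l) *\<^sub>R w))" for u w
  proof (cases "u \<in> Q \<and> u + w \<in> Q")
    case True
    have pQ: "p t u w \<in> Q" if "t \<le> l" for t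
    proof -
      have "(1 - real t / real l) *\<^sub>R u + (real t / real l) *\<^sub>R (u + w) \<in> Q"
        using True that l by (intro convexD_alt[OF cv]) auto
      then show ?thesis by (simp add: p_def algebra_simps)
    qed
    have ps: "p (Suc t) u w = p t u w + (1 / real l) *\<^sub>R w" for t
      by (simp add: p_def add_divide_distrib scaleR_add_left)
    have "norm w \<le> real l * \<eta>" using diam[of "u + w" u] True by simp
    then have nw: "norm ((1 / real l) *\<^sub>R w) \<le> \<eta>" using l by (simp add: pos_divide_le_eq mult.commute)
    have "F (p 0 u w) - F (p l u w) = (\<Sum>t<l. F (p t u w) - F (p (Suc t) u w))"
      by (rule sum_lessThan_telescope'[symmetric])
    moreover have "p 0 u w = u" "p l u w = u + w" using l by (simp_all add: p_def)
    ultimately have "(F u - F (u + w))^2 \<le> real l * (\<Sum>t<l. (F (p t u w) - F (p (Suc t) u w))^2)"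
      using square_sum_le[of "\<lambda>t. F (p t u w) - F (p (Suc t) u w)" l] by simp
    then have "ennreal ((F u - F (u + w))^2) \<le> ennreal (real l * (\<Sum>t<l. (F (p t u w) - F (p (Suc t) u w))^2))"
      by (rule ennreal_leI)
    also have "\<dots> = ennreal (real l) * (\<Sum>t<l. ennreal ((F (p t u w) - F (p (Suc t) u w))^2))"
      by (simp add: ennreal_mult' sum_ennreal)
    also have "(\<Sum>t<l. ennreal ((F (p t u w) - F (p (Suc t) u w))^2)) = (\<Sum>t<l. G (p t u w) ((1 / real l) *\<^sub>R w))"
    proof (rule sum.cong[OF refl])
      fix t assume "t \<in> {..<l}"
      then have "p t u w \<in> Q" "p t u w + (1 / real l) *\<^sub>R w \<in> Q" using pQ[of t] pQ[of "Suc t"] ps by auto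
      then show "ennreal ((F (p t u w) - F (p (Suc t) u w))^2) = G (p t u w) ((1 / real l) *\<^sub>R w)"
        using nw unfolding G_def ps by simp
    qed
    finally show ?thesis using True by simp
  qed (auto simp: indicator_def)
  have "(NI u. (NI v. indicator Q u * indicator Q v * ennreal ((F u - F v)^2)))
     = (NI u. (NI w. indicator Q u * indicator Q (u + w) * ennreal ((F u - F (u + w))^2)))"
    by (intro nn_integral_cong nn_integral_lborel_translate[symmetric]) measurable
  also have "\<dots> \<le> (NI u. (NI w. ennreal (real l) * (\<Sum>t<l. G (p t u w) ((1 / real l) *\<^sub>R w))))"
    by (intro nn_integral_mono tri)
  also have "\<dots> = ennreal (real l) * (\<Sum>t<l. (NI u. (NI w. G (p t u w) ((1 / real l) *\<^sub>R w))))"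
    unfolding p_def by (simp add: nn_integral_cmult nn_integral_sum)
  \<comment> \<open>All l summands are equal: translating u by (t / l) w removes t, and the
    substitution w = l z contributes l ^ DIM. Together with the l of Cauchy-Schwarz and the number
    of summands this is l ^ (DIM + 2).\<close>
  also have "(\<Sum>t<l. (NI u. (NI w. G (p t u w) ((1 / real l) *\<^sub>R w)))) = (\<Sum>t<l. ennreal (real l ^ DIM('e)) * ?E)"
  proof (rule sum.cong[OF refl])
    fix t assume "t \<in> {..<l}"
    have "(NI u. (NI w. G (p t u w) ((1 / real l) *\<^sub>R w)))
      = (NI w. (NI u. G (p t u w) ((1 / real l) *\<^sub>R w)))"
      unfolding p_def by (rule nn_integral_indicator_swap) measurable
    also have "\<dots> = (NI w. (NI a. G a ((1 / real l) *\<^sub>R w)))"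
    proof (rule nn_integral_cong)
      fix w :: 'e
      have "p t u w = (real t / real l) *\<^sub>R w + u" for u by (simp add: p_def)
      then show "(NI u. G (p t u w) ((1 / real l) *\<^sub>R w)) = (NI a. G a ((1 / real l) *\<^sub>R w))"
        using nn_integral_lborel_translate[of "\<lambda>a. G a ((1 / real l) *\<^sub>R w)" "(real t / real l) *\<^sub>R w"] by simp
    qed
    also have "\<dots> = ennreal (real l ^ DIM('e)) * (NI z. (NI a. G a z))"
      using l by (subst nn_integral_lborel_scale[of _ "real l"]) auto
    also have "(NI z. (NI a. G a z)) = (NI a. (NI z. G a z))"
      by (rule nn_integral_indicator_swap[symmetric]) measurable
    also have "\<dots> = ?E"
    proof (rule nn_integral_cong)
      fix a :: 'e
      have "(NI v. indicator Q a * indicator Q v * indicator {..\<eta>} (norm (a - v)) * ennreal ((F a - F v)^2))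
         = (NI z. indicator Q a * indicator Q (a + z) * indicator {..\<eta>} (norm (a - (a + z))) * ennreal ((F a - F (a + z))^2))"
        by (rule nn_integral_lborel_translate[symmetric]) measurable
      then show "(NI z. G a z) = (NI v. indicator Q a * indicator Q v * indicator {..\<eta>} (norm (a - v)) * ennreal ((F a - F v)^2))"
        by (simp add: G_def)
    qed
    finally show "(NI u. (NI w. G (p t u w) ((1 / real l) *\<^sub>R w))) = ennreal (real l ^ DIM('e)) * ?E" .
  qed
  also have "(\<Sum>t<l. ennreal (real l ^ DIM('e)) * ?E) = ennreal (real l) * (ennreal (real l ^ DIM('e)) * ?E)"
    by (simp only: sum_constant card_lessThan ennreal_of_nat_eq_real_of_nat)
  also have "ennreal (real l) * \<dots> = ennreal (real l * (real l * real l ^ DIM('e))) * ?E"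
    by (simp only: mult.assoc[symmetric] ennreal_mult' of_nat_0_le_iff zero_le_power mult_nonneg_nonneg)
  also have "real l * (real l * real l ^ DIM('e)) = real l ^ (DIM('e) + 2)" by (simp only: add_2_eq_Suc' power_Suc)
  finally show ?thesis .
qed

section \<open>From functions on a cube to vectors on a point set\<close>

lemma square_convex_sum:
  fixes y :: "'i => real"
  assumes "\<And>i. i \<in> I ==> 0 \<le> \<alpha> i" "(\<Sum>i\<in>I. \<alpha> i) = 1"
  shows "(\<Sum>i\<in>I. \<alpha> i * y i)^2 \<le> (\<Sum>i\<in>I. \<alpha> i * (y i)^2)"
proof -
  let ?m = "\<Sum>i\<in>I. \<alpha> i * y i"
  have "0 \<le> (\<Sum>i\<in>I. \<alpha> i * (y i - ?m)^2)" using assms(1) by (intro sum_nonneg) auto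
  also have "\<dots> = (\<Sum>i\<in>I. \<alpha> i * (y i)^2 - 2 * ?m * (\<alpha> i * y i) + ?m^2 * \<alpha> i)"
    by (intro sum.cong refl) (simp add: power2_diff algebra_simps)
  also have "\<dots> = (\<Sum>i\<in>I. \<alpha> i * (y i)^2) - 2 * ?m * ?m + ?m^2 * (\<Sum>i\<in>I. \<alpha> i)"
    by (simp only: sum.distrib sum_subtractf sum_distrib_left)
  finally show ?thesis using assms(2) by (simp add: power2_eq_square)
qed

text \<open>F has mean 0 on Q, so y is the mean of y - F, and Jensen's inequality applies to the
  uniform law on Q.\<close>

lemma square_mean_le:
  fixes F :: "'e::euclidean_space => real"
  assumes F [measurable]: "F \<in> borel_measurable borel" and Q [measurable]: "Q \<in> sets borel"
    and fin: "emeasure lborel Q = ennreal q" "0 < q"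
    and int: "integrable lborel (\<lambda>v. indicator Q v * F v)" "(\<integral>v. indicator Q v * F v \<partial>lborel) = 0"
  shows "ennreal (q * y^2) \<le> (NI v. indicator Q v * ennreal ((y - F v)^2))"
proof -
  define M where "M = density lborel (\<lambda>v. ennreal (inverse q * indicator Q v))"
  have [measurable_cong]: "sets M = sets borel" by (simp add: M_def)
  have e1: "emeasure M (space M) = 1"
  proof -
    have "emeasure M (space M) = (NI v. ennreal (inverse q) * indicator Q v)"
      unfolding M_def by (subst emeasure_density) (auto intro!: nn_integral_cong simp: indicator_def)
    also have "\<dots> = ennreal (inverse q) * ennreal q" by (subst nn_integral_cmult_indicator) (auto simp: fin(1))
    finally show ?thesis using fin(2) by (simp add: ennreal_mult'[symmetric])
  qed
  interpret M: prob_space M by standard (rule e1)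
  have iF: "integrable M F" "(\<integral>v. F v \<partial>M) = 0"
  proof -
    have e: "inverse q * indicator Q v * F v = inverse q * (indicator Q v * F v)" for v by simp
    show "integrable M F" unfolding M_def using fin(2) int(1)
      by (subst integrable_density) (auto simp: e)
    show "(\<integral>v. F v \<partial>M) = 0" unfolding M_def using fin(2) int(2)
      by (subst integral_density) (auto simp: e)
  qed
  have "y = (\<integral>v. y - F v \<partial>M)" using iF by (simp add: M.prob_space)
  then have "ennreal (y^2) \<le> (\<integral>\<^sup>+v. ennreal ((y - F v)^2) \<partial>M)" using M.square_expectation_le by metis
  also have "\<dots> = (NI v. ennreal (inverse q) * (indicator Q v * ennreal ((y - F v)^2)))"
    unfolding M_def by (subst nn_integral_density) (auto intro!: nn_integral_cong simp: indicator_def)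
  also have "\<dots> = ennreal (inverse q) * (NI v. indicator Q v * ennreal ((y - F v)^2))"
    by (rule nn_integral_cmult) measurable
  finally have "ennreal q * ennreal (y^2) \<le> ennreal q * (ennreal (inverse q) * (NI v. indicator Q v * ennreal ((y - F v)^2)))"
    by (rule mult_left_mono) simp
  then show ?thesis using fin(2) by (simp add: mult.assoc[symmetric] ennreal_mult'[symmetric])
qed

definition cell_count :: "real => ('i => 'e::euclidean_space) => 'i set => 'e => real" where
  "cell_count \<eta> u I v = (\<Sum>i\<in>I. indicator (cell \<eta> (u i)) v)"

text \<open>The step function that carries a vector on the points over to the continuous Poincare
  inequality; on a cell without points it is 0.\<close>

definition cell_mean :: "real => ('i => 'e::euclidean_space) => 'i set => ('i => real) => 'e => real" where
  "cell_mean \<eta> u I f v = (\<Sum>i\<in>I. (indicator (cell \<eta> (u i)) v / cell_count \<eta> u I v) * f i)"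

lemma cell_mean_const: "w \<in> cell \<eta> v ==> cell_mean \<eta> u I f w = cell_mean \<eta> u I f v"
  and cell_count_const: "w \<in> cell \<eta> v ==> cell_count \<eta> u I w = cell_count \<eta> u I v"
proof -
  have *: "indicator (cell \<eta> (u i)) w = (indicator (cell \<eta> (u i)) v :: real)" if "w \<in> cell \<eta> v" for i
    using that by (auto simp: indicator_def cell_def)
  show c: "w \<in> cell \<eta> v ==> cell_count \<eta> u I w = cell_count \<eta> u I v"
    by (simp add: cell_count_def *)
  show "w \<in> cell \<eta> v ==> cell_mean \<eta> u I f w = cell_mean \<eta> u I f v"
    by (simp add: cell_mean_def * c)
qed

lemma cell_mean_measurable [measurable]: "cell_mean \<eta> u I f \<in> borel_measurable borel"
  unfolding cell_mean_def[abs_def] cell_count_def by measurable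

lemma diff_cell_mean_square:
  assumes c: "0 < cell_count \<eta> u I v"
  shows "(y - cell_mean \<eta> u I f v)^2 \<le> (\<Sum>i\<in>I. (indicator (cell \<eta> (u i)) v / cell_count \<eta> u I v) * (y - f i)^2)"
proof -
  let ?\<alpha> = "\<lambda>i. indicator (cell \<eta> (u i)) v / cell_count \<eta> u I v :: real"
  have a1: "(\<Sum>i\<in>I. ?\<alpha> i) = 1" using c by (simp add: sum_divide_distrib[symmetric] cell_count_def[symmetric])
  have "(\<Sum>i\<in>I. ?\<alpha> i * (y - f i)) = (\<Sum>i\<in>I. ?\<alpha> i) * y - cell_mean \<eta> u I f v"
    by (simp add: cell_mean_def right_diff_distrib sum_subtractf sum_distrib_right)
  then have "y - cell_mean \<eta> u I f v = (\<Sum>i\<in>I. ?\<alpha> i * (y - f i))" using a1 by simp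
  also have "\<dots>^2 \<le> (\<Sum>i\<in>I. ?\<alpha> i * (y - f i)^2)"
    using c a1 by (intro square_convex_sum) auto
  finally show ?thesis .
qed

text \<open>f is split into its deviation from the cell means and the step function of the cell
  means. The first part involves only pairs within a cell. The weights of \<open>mean0\<close> make
  the integral of the step function over the coarse cell vanish, so the continuous inequality
  applies to it, and Jensen's inequality in each cell brings its differences back to pairs of
  points. Such pairs are at most two cell diameters and \<eta> apart, hence the 3 DIM
  \<eta>.\<close>

lemma discrete_poincare:
  fixes u :: "'i => 'e::euclidean_space"
  assumes fin: "finite I" and e: "0 < \<eta>" and K: "0 < (K::nat)" and uQ: "\<And>i. i \<in> I ==> u i \<in> cell (real K * \<eta>) z"
    and lo: "0 < lo" and cnt: "\<And>v. v \<in> cell (real K * \<eta>) z ==> lo \<le> cell_count \<eta> u I v"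
      "\<And>v. v \<in> cell (real K * \<eta>) z ==> cell_count \<eta> u I v \<le> hi"
    and mean0: "(\<Sum>i\<in>I. f i / cell_count \<eta> u I (u i)) = 0"
  shows "(\<Sum>i\<in>I. (f i)^2) \<le> 4 * real DIM('e) ^ (DIM('e) + 2) * (hi / lo^2) * (real K)^2 *
     (\<Sum>i\<in>I. \<Sum>j\<in>I. of_bool (norm (u i - u j) \<le> 3 * real DIM('e) * \<eta>) * (f i - f j)^2)"
    (is "_ \<le> _ * ?S")
proof -
  define m where "m = DIM('e)"
  let ?c = "\<lambda>i. cell \<eta> (u i)" and ?B = "\<lambda>i j. of_bool (norm (u i - u j) \<le> 3 * real m * \<eta>) * (f i - f j)^2"
  let ?k = "1 / lo^2" and ?q = "\<eta> ^ m * \<eta> ^ m" and ?C = "real m ^ (m + 2) * (hi / lo^2) * (real K)^2"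
  have m1: "1 \<le> m" unfolding m_def by (simp add: Suc_leI)
  define Q where "Q = cell (real K * \<eta>) z"
  have Qm [measurable]: "Q \<in> sets borel" by (simp add: Q_def)
  let ?n = "cell_count \<eta> u I" and ?F = "cell_mean \<eta> u I f"
  define q where "q = (real K * \<eta>) ^ m"
  have Ke: "0 < real K * \<eta>" using K e by simp
  have q: "emeasure lborel Q = ennreal q" "0 < q"
    using emeasure_cell[OF Ke] Ke by (auto simp: Q_def q_def m_def)
  have subQ: "cell \<eta> v \<subseteq> Q" if "v \<in> Q" for v using cell_nested[OF e K] that unfolding Q_def by blast
  have zQ: "z \<in> Q" by (simp add: Q_def)
  have hi: "0 < hi" using lo cnt[of z] by simp
  have S0: "0 \<le> ?S" by (intro sum_nonneg) auto
  have close: "norm (u i - u j) \<le> 3 * real m * \<eta>" if "v \<in> ?c i" "w \<in> ?c j" "norm (v - w) \<le> \<eta>" for i j v w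
  proof -
    have "norm (u i - v) \<le> real m * \<eta>" "norm (w - u j) \<le> real m * \<eta>"
      unfolding m_def using that by (auto intro!: norm_diff_cell[OF e])
    moreover have "norm (u i - u j) \<le> norm (u i - v) + norm (v - w) + norm (w - u j)"
      using norm_triangle_ineq[of "u i - v" "v - u j"] norm_triangle_ineq[of "v - w" "w - u j"] by simp
    moreover have "\<eta> \<le> real m * \<eta>" using m1 e by simp
    ultimately show ?thesis using that(3) by linarith
  qed
  \<comment> \<open>Each point is compared with the average over its own cell, in which every weight
    is at most 1 / \<open>lo\<close>.\<close>
  have part1: "(\<Sum>i\<in>I. (f i - ?F (u i))^2) \<le> (1 / lo) * ?S"
  proof -
    have "(f i - ?F (u i))^2 \<le> (1 / lo) * (\<Sum>j\<in>I. ?B i j)" if i: "i \<in> I" for i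
    proof -
      have n: "lo \<le> ?n (u i)" using cnt(1) uQ[OF i] by simp
      have "(f i - ?F (u i))^2 \<le> (\<Sum>j\<in>I. (indicator (?c j) (u i) / ?n (u i)) * (f i - f j)^2)"
        using n lo by (intro diff_cell_mean_square) simp
      also have "\<dots> \<le> (\<Sum>j\<in>I. (1 / lo) * (?B i j))"
      proof (rule sum_mono)
        fix j assume "j \<in> I"
        have "indicator (?c j) (u i) / ?n (u i) \<le> (1 / lo) * of_bool (norm (u i - u j) \<le> 3 * real m * \<eta>)"
          using close[of "u i" i "u i" j] e n lo by (auto simp: indicator_def frac_le)
        then show "(indicator (?c j) (u i) / ?n (u i)) * (f i - f j)^2 \<le> (1 / lo) * (?B i j)"
          by (metis mult.assoc mult_right_mono zero_le_power2)
      qed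
      finally show ?thesis by (simp add: sum_distrib_left)
    qed
    then have "(\<Sum>i\<in>I. (f i - ?F (u i))^2) \<le> (\<Sum>i\<in>I. (1 / lo) * (\<Sum>j\<in>I. ?B i j))"
      by (rule sum_mono)
    then show ?thesis by (simp add: sum_distrib_left m_def)
  qed
  let ?N = "(NI v. indicator Q v * ennreal ((?F v)^2))"
  \<comment> \<open>Passing from points to the integral: a place in the coarse cell is covered by
    the cells of at most \<open>hi\<close> sample points, each of volume \<eta> ^ m.\<close>
  have part2: "ennreal (\<eta> ^ m * (\<Sum>i\<in>I. (?F (u i))^2)) \<le> ennreal hi * ?N"
  proof -
    have "ennreal (\<eta> ^ m * (\<Sum>i\<in>I. (?F (u i))^2)) = (\<Sum>i\<in>I. ennreal ((?F (u i))^2) * emeasure lborel (?c i))"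
      using e by (simp add: emeasure_cell sum_distrib_left ennreal_mult' sum_ennreal[symmetric] m_def mult.commute)
    also have "\<dots> = (\<Sum>i\<in>I. (NI v. ennreal ((?F v)^2) * indicator (?c i) v))"
    proof (rule sum.cong[OF refl])
      fix i
      have "ennreal ((?F (u i))^2) * emeasure lborel (?c i) = (NI v. ennreal ((?F (u i))^2) * indicator (?c i) v)"
        by (rule nn_integral_cmult_indicator[symmetric]) simp
      also have "\<dots> = (NI v. ennreal ((?F v)^2) * indicator (?c i) v)"
        by (intro nn_integral_cong) (auto simp: indicator_def cell_mean_const)
      finally show "ennreal ((?F (u i))^2) * emeasure lborel (?c i) = (NI v. ennreal ((?F v)^2) * indicator (?c i) v)" .
    qed
    also have "\<dots> = (NI v. (\<Sum>i\<in>I. ennreal ((?F v)^2) * indicator (?c i) v))"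
      by (rule nn_integral_sum[symmetric]) measurable
    also have "\<dots> \<le> (NI v. ennreal hi * (indicator Q v * ennreal ((?F v)^2)))"
    proof (rule nn_integral_mono)
      fix v
      show "(\<Sum>i\<in>I. ennreal ((?F v)^2) * indicator (?c i) v) \<le> ennreal hi * (indicator Q v * ennreal ((?F v)^2))"
      proof (cases "v \<in> Q")
        case True
        have "(\<Sum>i\<in>I. indicator (?c i) v :: ennreal) = ennreal (?n v)"
          unfolding cell_count_def by (simp add: sum_ennreal[symmetric] ennreal_indicator)
        also have "\<dots> \<le> ennreal hi" using cnt(2) True by (auto simp: Q_def intro: ennreal_leI)
        finally have "ennreal ((?F v)^2) * (\<Sum>i\<in>I. indicator (?c i) v) \<le> ennreal ((?F v)^2) * ennreal hi"
          by (rule mult_left_mono) simp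
        then show ?thesis using True unfolding sum_distrib_left by (simp add: mult.commute)
      next
        case False
        have "v \<notin> ?c i" if "i \<in> I" for i using subQ[of "u i"] uQ[OF that] False by (auto simp: Q_def)
        then show ?thesis by (auto intro!: order_eq_refl sum.neutral)
      qed
    qed
    also have "\<dots> = ennreal hi * ?N"
      by (rule nn_integral_cmult) measurable
    finally show ?thesis .
  qed
  \<comment> \<open>Rewrites the step function as a combination of cell indicators, each of integral
    \<eta> ^ m; its integral is therefore the sum in \<open>mean0\<close> times that volume.\<close>
  have eqn: "indicator Q v * ?F v = (\<Sum>i\<in>I. (f i / ?n (u i)) * indicator (?c i) v)" for v
  proof (cases "v \<in> Q")
    case True
    then show ?thesis unfolding cell_mean_def
      by (auto intro!: sum.cong simp: indicator_def cell_count_const)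
  next
    case False
    have "v \<notin> ?c i" if "i \<in> I" for i using subQ[of "u i"] uQ[OF that] False by (auto simp: Q_def)
    then show ?thesis using False by simp
  qed
  have ci: "integrable lborel (\<lambda>v. indicator (?c i) v :: real)" for i
    using emeasure_cell[OF e, of "u i"] by (intro integrable_real_indicator) auto
  have int1: "integrable lborel (\<lambda>v. indicator Q v * ?F v)" unfolding eqn using ci by auto
  have int0: "(\<integral>v. indicator Q v * ?F v \<partial>lborel) = 0"
  proof -
    have "measure lborel (?c i) = \<eta> ^ m" for i
      using e by (simp add: measure_def emeasure_cell m_def)
    then have "(\<integral>v. indicator Q v * ?F v \<partial>lborel) = (\<Sum>i\<in>I. (f i / ?n (u i)) * \<eta> ^ m)"
      unfolding eqn using ci by (subst Bochner_Integration.integral_sum) auto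
    also have "\<dots> = (\<Sum>i\<in>I. f i / ?n (u i)) * \<eta> ^ m" by (simp only: sum_distrib_right)
    finally show ?thesis using mean0 by simp
  qed
  let ?E = "(NI v. (NI w. indicator Q v * indicator Q w * indicator {..\<eta>} (norm (v - w)) * ennreal ((?F v - ?F w)^2)))"
  \<comment> \<open>The coarse cell has diameter at most m K \<eta>, so m K steps of length \<eta>
    suffice.\<close>
  have part3: "ennreal q * ?N \<le> ennreal (real (m * K) ^ (m + 2)) * ?E"
  proof -
    have "ennreal q * ?N = (NI v. indicator Q v * ennreal (q * (?F v)^2))"
      using q(2) by (subst nn_integral_cmult[symmetric]) (auto intro!: nn_integral_cong simp: ennreal_mult' mult_ac)
    also have "\<dots> \<le> (NI v. (NI w. indicator Q v * indicator Q w * ennreal ((?F v - ?F w)^2)))"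
    proof (rule nn_integral_mono)
      fix v
      have "ennreal (q * (?F v)^2) \<le> (NI w. indicator Q w * ennreal ((?F v - ?F w)^2))"
        by (rule square_mean_le[OF cell_mean_measurable Qm q int1 int0])
      then show "indicator Q v * ennreal (q * (?F v)^2) \<le> (NI w. indicator Q v * indicator Q w * ennreal ((?F v - ?F w)^2))"
        by (auto simp: indicator_def)
    qed
    also have "\<dots> \<le> ennreal (real (m * K) ^ (m + 2)) * ?E"
      unfolding m_def
    proof (rule nonlocal_poincare[OF cell_mean_measurable Qm])
      show "convex Q" unfolding Q_def by (rule convex_cell[OF Ke])
      show "norm (v - w) \<le> real (DIM('e) * K) * \<eta>" if "v \<in> Q" "w \<in> Q" for v w
        using norm_diff_cell[OF Ke, of v z w] that by (simp add: Q_def mult.assoc)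
    qed (use K in simp)
    finally show ?thesis .
  qed
  \<comment> \<open>Two cell means differ by a double average over pairs of points; each of the two
    averages divides by at least \<open>lo\<close>.\<close>
  have part4: "?E \<le> ennreal (?k * ?q * ?S)"
  proof -
    have "?E \<le> (NI v. (NI w. (\<Sum>i\<in>I. \<Sum>j\<in>I. ennreal (?k * ?B i j) * (indicator (?c i) v * indicator (?c j) w))))"
    proof (intro nn_integral_mono)
      fix v w
      show "indicator Q v * indicator Q w * indicator {..\<eta>} (norm (v - w)) * ennreal ((?F v - ?F w)^2)
        \<le> (\<Sum>i\<in>I. \<Sum>j\<in>I. ennreal (?k * ?B i j) * (indicator (?c i) v * indicator (?c j) w))"
      proof (cases "v \<in> Q \<and> w \<in> Q \<and> norm (v - w) \<le> \<eta>")
        case True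
        have nv: "lo \<le> ?n v" "lo \<le> ?n w" using True cnt(1) by (auto simp: Q_def)
        let ?a = "\<lambda>i. indicator (?c i) v / ?n v :: real" and ?b = "\<lambda>j. indicator (?c j) w / ?n w :: real"
        have "(?F v - ?F w)^2 = (?F w - ?F v)^2" by (rule power2_commute)
        also have "\<dots> \<le> (\<Sum>i\<in>I. ?a i * (?F w - f i)^2)" using nv lo by (intro diff_cell_mean_square) simp
        also have "\<dots> \<le> (\<Sum>i\<in>I. ?a i * (\<Sum>j\<in>I. ?b j * (f i - f j)^2))"
        proof (intro sum_mono mult_left_mono)
          fix i show "(?F w - f i)^2 \<le> (\<Sum>j\<in>I. ?b j * (f i - f j)^2)"
            using diff_cell_mean_square[of \<eta> u I w "f i" f] nv lo by (simp add: power2_commute)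
          show "0 \<le> ?a i" using nv lo by simp
        qed
        also have "\<dots> = (\<Sum>i\<in>I. \<Sum>j\<in>I. ?a i * ?b j * (f i - f j)^2)" by (simp add: sum_distrib_left mult.assoc)
        also have "\<dots> \<le> (\<Sum>i\<in>I. \<Sum>j\<in>I. (?k * ?B i j) * (indicator (?c i) v * indicator (?c j) w))"
        proof (intro sum_mono)
          fix i j assume "i \<in> I" "j \<in> I"
          show "?a i * ?b j * (f i - f j)^2 \<le> (?k * ?B i j) * (indicator (?c i) v * indicator (?c j) w)"
          proof (cases "v \<in> ?c i \<and> w \<in> ?c j")
            case in_cells: True
            have "lo^2 \<le> ?n v * ?n w" unfolding power2_eq_square using nv lo by (intro mult_mono) auto
            then have "1 / (?n v * ?n w) \<le> 1 / lo^2" using lo by (intro frac_le) auto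
            then have "1 / (?n v * ?n w) * (f i - f j)^2 \<le> 1 / lo^2 * (f i - f j)^2" by (rule mult_right_mono) simp
            then show ?thesis using in_cells close[of v i w j] True by simp
          qed auto
        qed
        finally have "ennreal ((?F v - ?F w)^2) \<le> ennreal (\<Sum>i\<in>I. \<Sum>j\<in>I. (?k * ?B i j) * (indicator (?c i) v * indicator (?c j) w))"
          by (rule ennreal_leI)
        also have "\<dots> = (\<Sum>i\<in>I. \<Sum>j\<in>I. ennreal (?k * ?B i j) * (indicator (?c i) v * indicator (?c j) w))"
        proof -
          have "ennreal (\<Sum>i\<in>I. \<Sum>j\<in>I. (?k * ?B i j) * (indicator (?c i) v * indicator (?c j) w))
            = (\<Sum>i\<in>I. \<Sum>j\<in>I. ennreal ((?k * ?B i j) * (indicator (?c i) v * indicator (?c j) w)))"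
            by (subst sum_ennreal, auto intro!: sum_nonneg sum_ennreal[symmetric])+
          also have "\<dots> = (\<Sum>i\<in>I. \<Sum>j\<in>I. ennreal (?k * ?B i j) * (indicator (?c i) v * indicator (?c j) w))"
            by (intro sum.cong refl) (simp only: indicator_def of_bool_def split: if_split, simp)
          finally show ?thesis .
        qed
        finally show ?thesis using True by simp
      qed (auto simp: indicator_def)
    qed
    also have "\<dots> = (\<Sum>i\<in>I. \<Sum>j\<in>I. ennreal (?k * ?B i j) * (emeasure lborel (?c i) * emeasure lborel (?c j)))"
      by (simp add: nn_integral_sum nn_integral_cmult nn_integral_multc mult.assoc[symmetric])
    also have "\<dots> = (\<Sum>i\<in>I. \<Sum>j\<in>I. ennreal ((?k * ?B i j) * ?q))"
      unfolding emeasure_cell[OF e] m_def[symmetric] using e by (intro sum.cong refl) (simp only: ennreal_mult'' zero_le_power less_imp_le mult_nonneg_nonneg)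
    also have "\<dots> = ennreal (?k * ?q * ?S)"
    proof -
      have "0 \<le> (?k * ?B i j) * ?q" for i j using e by simp
      then have "(\<Sum>i\<in>I. \<Sum>j\<in>I. ennreal ((?k * ?B i j) * ?q)) =
        ennreal (\<Sum>i\<in>I. \<Sum>j\<in>I. (?k * ?B i j) * ?q)"
        by (simp only: sum_ennreal sum_nonneg)
      also have "(\<Sum>i\<in>I. \<Sum>j\<in>I. (?k * ?B i j) * ?q) = ?k * ?q * ?S"
        unfolding m_def sum_distrib_left by (intro sum.cong refl) (simp only: mult_ac)
      finally show ?thesis .
    qed
    finally show ?thesis .
  qed
  have "ennreal (q * (\<eta> ^ m * (\<Sum>i\<in>I. (?F (u i))^2))) \<le> ennreal q * (ennreal hi * ?N)"
    using part2 q(2) by (subst ennreal_mult') (auto intro: mult_left_mono)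
  also have "\<dots> = ennreal hi * (ennreal q * ?N)"
    by (simp only: mult_ac)
  also have "\<dots> \<le> ennreal hi * (ennreal (real (m * K) ^ (m + 2)) * ennreal (?k * ?q * ?S))"
    by (intro mult_left_mono order_trans[OF part3] part4) auto
  also have "\<dots> = ennreal (hi * (real (m * K) ^ (m + 2) * (?k * ?q * ?S)))"
    using hi by (simp only: ennreal_mult' less_imp_le zero_le_power of_nat_0_le_iff)
  finally have "q * (\<eta> ^ m * (\<Sum>i\<in>I. (?F (u i))^2)) \<le> hi * (real (m * K) ^ (m + 2) * (?k * ?q * ?S))"
    using hi S0 e by (subst (asm) ennreal_le_iff) (auto intro!: mult_nonneg_nonneg)
  \<comment> \<open>Since q = (K \<eta>) ^ m, the power K ^ (m + 2) loses K ^ m to the volume of the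
    coarse cell and only K^2 remains.\<close>
  also have "\<dots> = (q * \<eta> ^ m) * (?C * ?S)"
    by (simp add: q_def power_mult_distrib power_add power2_eq_square field_simps)
  finally have "(q * \<eta> ^ m) * (\<Sum>i\<in>I. (?F (u i))^2) \<le> (q * \<eta> ^ m) * (?C * ?S)"
    by (simp only: mult.assoc)
  then have F2: "(\<Sum>i\<in>I. (?F (u i))^2) \<le> ?C * ?S"
    using q(2) e by (subst (asm) mult_le_cancel_left_pos) auto
  have "(\<Sum>i\<in>I. (f i)^2) \<le> (\<Sum>i\<in>I. 2 * (f i - ?F (u i))^2 + 2 * (?F (u i))^2)"
    using sum_square_le[of "f i - ?F (u i)" "?F (u i)" for i] by (intro sum_mono) simp
  also have "\<dots> = 2 * (\<Sum>i\<in>I. (f i - ?F (u i))^2) + 2 * (\<Sum>i\<in>I. (?F (u i))^2)"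
    by (simp add: sum.distrib sum_distrib_left)
  also have "\<dots> \<le> 2 * ((1 / lo) * ?S) + 2 * (?C * ?S)"
    using part1 F2 by simp
  \<comment> \<open>\<open>lo\<close> is at most \<open>hi\<close>, so the deviation within cells is
    absorbed by the same constant; the factors 2 from splitting the square make 4 in total.\<close>
  also have "(1 / lo) * ?S \<le> (?C) * ?S"
  proof (rule mult_right_mono[OF _ S0])
    have "lo \<le> hi" using cnt[of z] by simp
    then have "1 / lo \<le> hi / lo^2" using lo by (simp add: field_simps power2_eq_square)
    also have "\<dots> \<le> real m ^ (m + 2) * (hi / lo^2)" using mult_right_mono[OF one_le_power[of "real m" "m + 2"], of "hi / lo^2"] m1 hi lo by simp
    also have "\<dots> \<le> ?C"
    proof -
      have "1 \<le> (real K)^2" using K by simp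
      then show ?thesis using mult_left_mono[of 1 "(real K)^2" "real m ^ (m + 2) * (hi / lo^2)"] hi lo by simp
    qed
    finally show "1 / lo \<le> ?C" .
  qed
  also have "2 * ((?C) * ?S) + 2 * (?C * ?S)
     = 4 * ?C * ?S"
  proof -
    have "2 * (a * S) + 2 * (a * S) = 4 * a * S" for a S :: real by simp
    then show ?thesis by (simp only: mult.assoc)
  qed
  finally show ?thesis by (simp only: m_def mult.assoc)
qed

section \<open>Spectral decomposition of the graph Laplacian\<close>

lemma symmetric_scalar_prod:
  fixes A :: "real mat"
  assumes A: "A \<in> carrier_mat n n" "transpose_mat A = A" and v: "v \<in> carrier_vec n" "w \<in> carrier_vec n"
  shows "scalar_prod v (mult_mat_vec A w) = scalar_prod w (mult_mat_vec A v)"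
proof -
  have "scalar_prod v (mult_mat_vec A w) = scalar_prod (mult_mat_vec A w) v"
    using A v by (intro comm_scalar_prod) auto
  also have "\<dots> = scalar_prod w (mult_mat_vec (transpose_mat A) v)"
    using transpose_vec_mult_scalar[OF A(1) v(2,1)] A v by (simp add: comm_scalar_prod[of _ n])
  finally show ?thesis using A by simp
qed

text \<open>Write a complex eigenvector as a + i b. Symmetry equates b . A a and a . A b, which
  forces Im k (|a|^2 + |b|^2) = 0; so k is real and a or b, whichever is nonzero, is a real
  eigenvector.\<close>

lemma symmetric_real_eigenvector:
  fixes A :: "real mat"
  assumes A: "A \<in> carrier_mat n n" "transpose_mat A = A" and n: "0 < n"
  shows "\<exists>v \<alpha>. v \<in> carrier_vec n \<and> scalar_prod v v = 1 \<and> mult_mat_vec A v = \<alpha> \<cdot>\<^sub>v v"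
proof -
  let ?C = "map_mat complex_of_real A"
  have C: "?C \<in> carrier_mat n n" using A by auto
  obtain k where "eigenvalue ?C k" using spectrum_non_empty[OF C n] unfolding spectrum_def by auto
  then obtain z where z: "z \<in> carrier_vec n" "z \<noteq> 0\<^sub>v n" "mult_mat_vec ?C z = k \<cdot>\<^sub>v z"
    using C unfolding eigenvalue_def eigenvector_def by auto
  define a where "a = Matrix.vec n (\<lambda>i. Re (vec_index z i))"
  define b where "b = Matrix.vec n (\<lambda>i. Im (vec_index z i))"
  have ab: "a \<in> carrier_vec n" "b \<in> carrier_vec n" by (auto simp: a_def b_def)
  have row: "(\<Sum>j<n. complex_of_real (A $$ (i, j)) * vec_index z j) = k * vec_index z i" if i: "i < n" for i
  proof -
    have "vec_index (mult_mat_vec ?C z) i = (\<Sum>j<n. complex_of_real (A $$ (i, j)) * vec_index z j)"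
      using i A z(1) by (simp add: scalar_prod_def lessThan_atLeast0)
    then show ?thesis using z i by simp
  qed
  have Aa: "mult_mat_vec A a = Re k \<cdot>\<^sub>v a - Im k \<cdot>\<^sub>v b"
  proof (rule eq_vecI)
    fix i assume "i < dim_vec (Re k \<cdot>\<^sub>v a - Im k \<cdot>\<^sub>v b)"
    then have i: "i < n" by (simp add: b_def)
    have "vec_index (mult_mat_vec A a) i = Re (\<Sum>j<n. complex_of_real (A $$ (i, j)) * vec_index z j)"
      using i A by (simp add: scalar_prod_def lessThan_atLeast0 a_def)
    then show "vec_index (mult_mat_vec A a) i = vec_index (Re k \<cdot>\<^sub>v a - Im k \<cdot>\<^sub>v b) i"
      using i by (simp add: row a_def b_def)
  qed (use A in \<open>auto simp: b_def\<close>)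
  have Ab: "mult_mat_vec A b = Re k \<cdot>\<^sub>v b + Im k \<cdot>\<^sub>v a"
  proof (rule eq_vecI)
    fix i assume "i < dim_vec (Re k \<cdot>\<^sub>v b + Im k \<cdot>\<^sub>v a)"
    then have i: "i < n" by (simp add: a_def)
    have "vec_index (mult_mat_vec A b) i = Im (\<Sum>j<n. complex_of_real (A $$ (i, j)) * vec_index z j)"
      using i A by (simp add: scalar_prod_def lessThan_atLeast0 b_def)
    then show "vec_index (mult_mat_vec A b) i = vec_index (Re k \<cdot>\<^sub>v b + Im k \<cdot>\<^sub>v a) i"
      using i by (simp add: row a_def b_def)
  qed (use A in \<open>auto simp: a_def\<close>)
  have sq: "scalar_prod v v = (\<Sum>i<n. (vec_index v i)^2)" if "v \<in> carrier_vec n" for v :: "real Matrix.vec"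
    using that by (simp add: scalar_prod_def lessThan_atLeast0 power2_eq_square)
  have ne: "0 < scalar_prod a a + scalar_prod b b"
  proof -
    have "\<exists>i<n. vec_index z i \<noteq> 0"
    proof (rule ccontr)
      assume "\<not> ?thesis"
      then have "z = 0\<^sub>v n" using z(1) by (intro eq_vecI) auto
      then show False using z(2) by simp
    qed
    then obtain i where i: "i < n" "vec_index z i \<noteq> 0" by blast
    have "0 < (Re (vec_index z i))^2 + (Im (vec_index z i))^2"
      using i(2) by (metis complex_eq_iff sum_power2_gt_zero_iff zero_complex.simps)
    also have "\<dots> \<le> (\<Sum>i<n. (Re (vec_index z i))^2 + (Im (vec_index z i))^2)"
      using i(1) by (intro member_le_sum[of i "{..<n}" "\<lambda>i. (Re (vec_index z i))^2 + (Im (vec_index z i))^2"]) auto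
    also have "\<dots> = scalar_prod a a + scalar_prod b b"
      using ab by (simp add: sq sum.distrib) (simp add: a_def b_def)
    finally show ?thesis .
  qed
  have "scalar_prod b (mult_mat_vec A a) = scalar_prod a (mult_mat_vec A b)"
    by (rule symmetric_scalar_prod[OF A ab(2,1)])
  then have "Im k * (scalar_prod a a + scalar_prod b b) = 0"
    unfolding Aa Ab using ab
    by (simp add: scalar_prod_minus_distrib[of _ n] scalar_prod_add_distrib[of _ n] comm_scalar_prod[of b n a] algebra_simps)
  then have "Im k = 0" using ne by simp
  have ev: "mult_mat_vec A a = Re k \<cdot>\<^sub>v a" "mult_mat_vec A b = Re k \<cdot>\<^sub>v b"
    unfolding Aa Ab \<open>Im k = 0\<close> using ab by (auto intro!: eq_vecI)
  have "\<exists>w. w \<in> carrier_vec n \<and> 0 < scalar_prod w w \<and> mult_mat_vec A w = Re k \<cdot>\<^sub>v w"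
  proof (cases "0 < scalar_prod a a")
    case False
    then have "0 < scalar_prod b b" using ne by linarith
    then show ?thesis using ab ev by blast
  qed (use ab ev in blast)
  then obtain w where w: "w \<in> carrier_vec n" "0 < scalar_prod w w" "mult_mat_vec A w = Re k \<cdot>\<^sub>v w" by blast
  define v where "v = inverse (sqrt (scalar_prod w w)) \<cdot>\<^sub>v w"
  have "v \<in> carrier_vec n" using w by (simp add: v_def)
  moreover have "scalar_prod v v = 1"
    using w unfolding v_def by (simp add: smult_scalar_prod_distrib[of _ n] scalar_prod_smult_distrib[of _ n] field_simps)
  moreover have "mult_mat_vec A v = Re k \<cdot>\<^sub>v v"
    using w A unfolding v_def by (simp add: mult_mat_vec[of _ n n] smult_smult_assoc mult.commute)
  ultimately show ?thesis by blast
qed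

text \<open>The reflection that exchanges v and the first unit vector e_0, that is, the one along w
  = v - e_0; its normalisation is s = |w|^2 = 2 - 2 v_0, nonzero unless v = e_0.\<close>

lemma householder:
  fixes v :: "real Matrix.vec"
  assumes v: "v \<in> carrier_vec n" "scalar_prod v v = 1" and n: "0 < n"
  shows "\<exists>H. H \<in> carrier_mat n n \<and> transpose_mat H = H \<and> H * H = 1\<^sub>m n \<and> mult_mat_vec H (unit_vec n 0) = v"
proof (cases "v = unit_vec n 0")
  case True
  then show ?thesis using n by (intro exI[of _ "1\<^sub>m n"]) auto
next
  case False
  define w where "w = (\<lambda>i. vec_index v i - of_bool (i = 0))"
  define s where "s = (\<Sum>k<n. (w k)^2)"
  have vv: "(\<Sum>k<n. (vec_index v k)^2) = 1"
    using v by (simp add: scalar_prod_def lessThan_atLeast0 power2_eq_square)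
  have "s = (\<Sum>k<n. (vec_index v k)^2) - 2 * (\<Sum>k<n. vec_index v k * of_bool (k = 0)) + (\<Sum>k<n. of_bool (k = 0))"
  proof -
    have "(w k)^2 = (vec_index v k)^2 - 2 * (vec_index v k * of_bool (k = 0)) + of_bool (k = 0)" for k
      by (cases "k = 0") (auto simp: w_def power2_diff)
    then show ?thesis unfolding s_def by (simp only: sum.distrib sum_subtractf sum_distrib_left)
  qed
  also have "(\<Sum>k<n. vec_index v k * of_bool (k = 0)) = vec_index v 0" using n by (simp add: of_bool_def if_distrib sum.delta cong: if_cong)
  also have "(\<Sum>k<n. of_bool (k = 0)) = (1::real)" using n by (simp add: of_bool_def sum.delta)
  finally have s: "s = 2 - 2 * vec_index v 0" using vv by simp
  have "s \<noteq> 0"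
  proof
    assume "s = 0"
    then have "\<forall>k\<in>{..<n}. (w k)^2 = 0" unfolding s_def by (subst (asm) sum_nonneg_eq_0_iff) auto
    then have "v = unit_vec n 0" using v(1) n by (intro eq_vecI) (auto simp: w_def)
    then show False using False by simp
  qed
  define H where "H = Matrix.mat n n (\<lambda>(i, j). of_bool (i = j) - (2 / s) * (w i * w j))"
  have Hc: "H \<in> carrier_mat n n" by (simp add: H_def)
  have "transpose_mat H = H" unfolding H_def by (rule eq_matI) (auto simp: mult.commute)
  moreover have "H * H = 1\<^sub>m n"
  proof (rule eq_matI)
    fix i j assume "i < dim_row (1\<^sub>m n)" "j < dim_col (1\<^sub>m n :: real mat)"
    then have ij: "i < n" "j < n" by auto
    have "(H * H) $$ (i, j) = (\<Sum>k<n. (of_bool (i = k) - (2 / s) * (w i * w k)) * (of_bool (k = j) - (2 / s) * (w k * w j)))"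
      using ij by (simp add: H_def scalar_prod_def lessThan_atLeast0)
    also have "\<dots> = (\<Sum>k<n. of_bool (i = k) * of_bool (k = j)) - (2 / s) * w j * (\<Sum>k<n. of_bool (i = k) * w k)
        - (2 / s) * w i * (\<Sum>k<n. w k * of_bool (k = j)) + (2 / s)^2 * (w i * w j) * s"
    proof -
      have "(of_bool (i = k) - c * (w i * w k)) * (of_bool (k = j) - c * (w k * w j)) = of_bool (i = k) * of_bool (k = j)
          - c * w j * (of_bool (i = k) * w k) - c * w i * (w k * of_bool (k = j)) + c^2 * (w i * w j) * (w k)^2" for c k
        by (simp only: left_diff_distrib right_diff_distrib power2_eq_square mult_ac)
      then show ?thesis
        unfolding s_def by (simp only: sum.distrib sum_subtractf sum_distrib_left)
    qed
    also have "(\<Sum>k<n. of_bool (i = k) * of_bool (k = j)) = (of_bool (i = j) :: real)"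
      using ij by (simp add: of_bool_def if_distrib sum.delta cong: if_cong)
    also have "(\<Sum>k<n. of_bool (i = k) * w k) = w i" using ij by (simp add: of_bool_def if_distribR if_distrib sum.delta' cong: if_cong)
    also have "(\<Sum>k<n. w k * of_bool (k = j)) = w j" using ij by (simp add: of_bool_def if_distrib sum.delta cong: if_cong)
    finally show "(H * H) $$ (i, j) = 1\<^sub>m n $$ (i, j)" using ij \<open>s \<noteq> 0\<close> by (simp add: power2_eq_square)
  qed (auto simp: H_def)
  moreover have "mult_mat_vec H (unit_vec n 0) = v"
  proof (rule eq_vecI)
    fix i assume "i < dim_vec v"
    then have i: "i < n" using v by simp
    have "vec_index (mult_mat_vec H (unit_vec n 0)) i = H $$ (i, 0)" using i n Hc by simp
    also have "\<dots> = of_bool (i = 0) - (2 / s) * w i * w 0" using i n by (simp add: H_def)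
    also have "w 0 = - s / 2" unfolding s by (simp add: w_def)
    finally show "vec_index (mult_mat_vec H (unit_vec n 0)) i = vec_index v i"
      using \<open>s \<noteq> 0\<close> by (simp add: w_def) (simp add: field_simps)
  qed (use v in \<open>auto simp: H_def\<close>)
  ultimately show ?thesis using Hc by blast
qed

text \<open>Conjugation by the reflection that carries the first unit vector to an eigenvector
  clears the first column off the diagonal, symmetry clears the first row, and the remaining block
  is handled by induction.\<close>

lemma symmetric_spectral:
  fixes A :: "real mat"
  assumes "A \<in> carrier_mat n n" "transpose_mat A = A"
  shows "\<exists>Q d. Q \<in> carrier_mat n n \<and> transpose_mat Q * Q = 1\<^sub>m n \<and> A = Q * mat_diag n d * transpose_mat Q"
  using assms
proof (induction n arbitrary: A)
  case 0
  then show ?case by (intro exI[of _ "1\<^sub>m 0"] exI[of _ "\<lambda>_. 0"]) (auto intro!: eq_matI)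
next
  case (Suc k)
  let ?n = "Suc k"
  obtain v \<alpha> where v: "v \<in> carrier_vec ?n" "scalar_prod v v = 1" "mult_mat_vec A v = \<alpha> \<cdot>\<^sub>v v"
    using symmetric_real_eigenvector[OF Suc.prems] by blast
  obtain H where H: "H \<in> carrier_mat ?n ?n" "transpose_mat H = H" "H * H = 1\<^sub>m ?n" "mult_mat_vec H (unit_vec ?n 0) = v"
    using householder[OF v(1,2)] by blast
  define B where "B = H * A * H"
  have B: "B \<in> carrier_mat ?n ?n" using H Suc.prems by (auto simp: B_def)
  have Bt: "transpose_mat B = B"
    using H Suc.prems unfolding B_def
    by (simp add: transpose_mult[of _ ?n ?n _ ?n] assoc_mult_mat[of _ ?n ?n _ ?n _ ?n])
  have HBH: "A = H * B * H"
  proof -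
    have "H * B * H = (H * H) * A * (H * H)"
      unfolding B_def using H(1) Suc.prems(1) by (simp add: assoc_mult_mat[of _ ?n ?n _ ?n _ ?n])
    then show ?thesis using H Suc.prems by simp
  qed
  have "mult_mat_vec B (unit_vec ?n 0) = mult_mat_vec H (mult_mat_vec A (mult_mat_vec H (unit_vec ?n 0)))"
    unfolding B_def using H(1) Suc.prems(1) by (simp add: assoc_mult_mat_vec[of _ ?n ?n _ ?n])
  also have "\<dots> = \<alpha> \<cdot>\<^sub>v mult_mat_vec H v" using v H by (simp add: mult_mat_vec[of _ ?n ?n])
  also have "mult_mat_vec H v = mult_mat_vec (H * H) (unit_vec ?n 0)"
    unfolding H(4)[symmetric] by (rule assoc_mult_mat_vec[OF H(1,1) unit_vec_carrier, symmetric])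
  also have "\<dots> = unit_vec ?n 0" using H by simp
  finally have Be: "mult_mat_vec B (unit_vec ?n 0) = \<alpha> \<cdot>\<^sub>v unit_vec ?n 0" .
  have col0: "B $$ (i, 0) = \<alpha> * of_bool (i = 0)" if "i < ?n" for i
    using arg_cong[OF Be, of "\<lambda>x. vec_index x i"] that B by simp
  have row0: "B $$ (0, j) = \<alpha> * of_bool (j = 0)" if "j < ?n" for j
    using arg_cong[OF Bt, of "\<lambda>M. M $$ (j, 0)"] that B col0[OF that] by simp
  define B' where "B' = Matrix.mat k k (\<lambda>(i, j). B $$ (Suc i, Suc j))"
  have B': "B' \<in> carrier_mat k k" by (simp add: B'_def)
  have "transpose_mat B' = B'"
  proof (rule eq_matI)
    fix i j assume "i < dim_row B'" "j < dim_col B'"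
    then show "transpose_mat B' $$ (i, j) = B' $$ (i, j)"
      using arg_cong[OF Bt, of "\<lambda>M. M $$ (Suc i, Suc j)"] B by (simp add: B'_def)
  qed (auto simp: B'_def)
  then obtain Q' d' where Q': "Q' \<in> carrier_mat k k" "transpose_mat Q' * Q' = 1\<^sub>m k" "B' = Q' * mat_diag k d' * transpose_mat Q'"
    using Suc.IH[OF B'] by blast
  let ?a = "Matrix.mat 1 1 (\<lambda>_. \<alpha>)"
  define Q2 where "Q2 = four_block_mat (1\<^sub>m 1) (0\<^sub>m 1 k) (0\<^sub>m k 1) Q'"
  define d where "d = case_nat \<alpha> d'"
  have Q2: "Q2 \<in> carrier_mat ?n ?n" using Q' four_block_carrier_mat[of "1\<^sub>m 1 :: real mat" 1 1 Q' k k] by (simp add: Q2_def)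
  have Q2t: "transpose_mat Q2 = four_block_mat (1\<^sub>m 1) (0\<^sub>m 1 k) (0\<^sub>m k 1) (transpose_mat Q')"
    unfolding Q2_def using Q' by (subst transpose_four_block_mat[of _ 1 1 _ k _ k]) auto
  have D: "mat_diag ?n d = four_block_mat ?a (0\<^sub>m 1 k) (0\<^sub>m k 1) (mat_diag k d')"
    by (rule eq_matI) (auto simp: mat_diag_def d_def split: nat.split)
  have Bb: "B = four_block_mat ?a (0\<^sub>m 1 k) (0\<^sub>m k 1) B'"
    using B col0 row0 by (intro eq_matI) (auto simp: B'_def)
  have Q2Q2: "transpose_mat Q2 * Q2 = 1\<^sub>m ?n"
    unfolding Q2t unfolding Q2_def using Q'
    by (subst mult_four_block_mat[of _ 1 1 _ k _ k _ _ 1 _ k]) (auto intro!: eq_matI)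
  have mdc: "mat_diag k d' \<in> carrier_mat k k" by (simp add: mat_diag_def)
  have "Q2 * mat_diag ?n d * transpose_mat Q2 = four_block_mat ?a (0\<^sub>m 1 k) (0\<^sub>m k 1) (Q' * mat_diag k d' * transpose_mat Q')"
  proof -
    have "Q2 * mat_diag ?n d = four_block_mat ?a (0\<^sub>m 1 k) (0\<^sub>m k 1) (Q' * mat_diag k d')"
      unfolding Q2_def D using Q' mdc
      by (subst mult_four_block_mat[of _ 1 1 _ k _ k _ _ 1 _ k]) (auto simp: left_mult_zero_mat[OF mdc])
    then show ?thesis
      unfolding Q2t using Q' mdc mult_carrier_mat[OF Q'(1) mdc] mult_carrier_mat[OF mult_carrier_mat[OF Q'(1) mdc], of "transpose_mat Q'" k]
      by (simp, subst mult_four_block_mat[of _ 1 1 _ k _ k _ _ 1 _ k])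
        (auto simp: right_mult_zero_mat[OF mult_carrier_mat[OF Q'(1) mdc]] left_add_zero_mat[of _ k k])
  qed
  then have BQ: "B = Q2 * mat_diag ?n d * transpose_mat Q2" using Bb Q'(3) by simp
  define Q where "Q = H * Q2"
  have Qt: "transpose_mat Q = transpose_mat Q2 * H"
    unfolding Q_def using H Q2 by (simp add: transpose_mult[of _ ?n ?n _ ?n])
  have md: "mat_diag ?n d \<in> carrier_mat ?n ?n" by (simp add: mat_diag_def)
  have Q2c: "transpose_mat Q2 \<in> carrier_mat ?n ?n" using Q2 by simp
  have "transpose_mat Q * Q = transpose_mat Q2 * (H * H) * Q2"
    unfolding Qt unfolding Q_def using H(1) Q2 Q2c by (simp add: assoc_mult_mat[of _ ?n ?n _ ?n _ ?n])
  also have "\<dots> = 1\<^sub>m ?n" unfolding H(3) using Q2c Q2Q2 by simp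
  finally have 1: "transpose_mat Q * Q = 1\<^sub>m ?n" .
  have 2: "A = Q * mat_diag ?n d * transpose_mat Q"
    unfolding HBH BQ Qt unfolding Q_def
    using H(1) Q2 Q2c md mult_carrier_mat[OF md Q2c] mult_carrier_mat[OF Q2 mult_carrier_mat[OF md Q2c]] by (simp add: assoc_mult_mat[of _ ?n ?n _ ?n _ ?n])
  have 3: "Q \<in> carrier_mat ?n ?n" using H Q2 by (simp add: Q_def)
  show ?case using 1 2 3 by blast
qed

text \<open>The threshold depends on the spectrum only through sums, so the order of the eigenvalues
  is immaterial: similarity gives the characteristic polynomial as the product of the factors X - d
  i, whose multiset of roots is that of d.\<close>

lemma sum_sorted_eigenvalue:
  fixes A :: "real mat" and h :: "real => real"
  assumes Q: "Q \<in> carrier_mat n n" "transpose_mat Q * Q = 1\<^sub>m n" and A: "A = Q * mat_diag n d * transpose_mat Q"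
  shows "(\<Sum>k = 1..n. h (sorted_eigenvalue A k)) = (\<Sum>i<n. h (d i))"
proof -
  have md: "mat_diag n d \<in> carrier_mat n n" by (simp add: mat_diag_def)
  have "Q * transpose_mat Q = 1\<^sub>m n" using mat_mult_left_right_inverse[of "transpose_mat Q" n Q] Q by simp
  then have "similar_mat A (mat_diag n d)"
    using Q A md by (intro similar_matI[of _ _ Q "transpose_mat Q" n, OF _ _ _ A]) auto
  then have "char_poly A = char_poly (mat_diag n d)" by (rule char_poly_similar)
  also have "\<dots> = (\<Prod>a\<leftarrow>diag_mat (mat_diag n d). [:- a, 1:])"
    by (rule char_poly_upper_triangular[OF md]) (auto simp: upper_triangular_def mat_diag_def)
  also have "diag_mat (mat_diag n d) = map d [0..<n]" by (auto simp: diag_mat_def mat_diag_def intro!: map_cong)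
  finally have cp: "char_poly A = (\<Prod>a\<leftarrow>map d [0..<n]. [:- a, 1:])" .
  have pr: "proots (\<Prod>a\<leftarrow>xs. [:- a, 1:]) = mset xs" for xs :: "real list"
  proof (induction xs)
    case (Cons a xs)
    have "(\<Prod>a\<leftarrow>xs. [:- a, 1:]) \<noteq> 0" by (auto simp: prod_list_zero_iff)
    then have "proots ([:- a, 1:] * (\<Prod>a\<leftarrow>xs. [:- a, 1:])) = proots [:- a, 1:] + proots (\<Prod>a\<leftarrow>xs. [:- a, 1:])"
      by (intro proots_mult) auto
    then show ?case using Cons by (simp del: mult_pCons_left)
  qed simp
  define ys where "ys = sorted_list_of_multiset (mset (map d [0..<n]))"
  have ys: "mset ys = mset (map d [0..<n])" "length ys = n"
    by (simp_all add: ys_def flip: size_mset)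
  have "(\<Sum>k = 1..n. h (sorted_eigenvalue A k)) = (\<Sum>k = 1..n. h (ys ! (k - 1)))"
    unfolding sorted_eigenvalue_def cp pr ys_def ..
  also have "\<dots> = (\<Sum>k<n. h (ys ! k))"
    by (rule sum.reindex_bij_witness[of _ Suc "\<lambda>k. k - 1"]) auto
  also have "\<dots> = sum_list (map h ys)" using ys(2) by (simp add: sum_list_sum_nth lessThan_atLeast0)
  also have "\<dots> = sum_mset (image_mset h (mset ys))" by (simp add: sum_mset_sum_list[symmetric])
  also have "\<dots> = sum_list (map h (map d [0..<n]))" unfolding ys(1) by (simp only: sum_mset_sum_list[symmetric] mset_map)
  also have "\<dots> = (\<Sum>i<n. h (d i))" by (simp add: sum_list_sum_nth lessThan_atLeast0)
  finally show ?thesis .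
qed

text \<open>Elimination: an unknown \<open>i0\<close> with a nonzero coefficient in equation j is
  expressed by the others, which leaves one equation and one unknown fewer.\<close>

lemma homogeneous_system_nontrivial:
  fixes a :: "'j => 'i => real"
  assumes "finite J" "finite S" "card J < card S"
  shows "\<exists>c. (\<exists>i\<in>S. c i \<noteq> 0) \<and> (\<forall>j\<in>J. (\<Sum>i\<in>S. c i * a j i) = 0)"
  using assms
proof (induction J arbitrary: S a rule: finite_induct)
  case empty
  then have "S \<noteq> {}" by auto
  then obtain i where "i \<in> S" by blast
  then show ?case by (intro exI[of _ "\<lambda>_. 1"]) auto
next
  case (insert j J)
  show ?case
  proof (cases "\<forall>i\<in>S. a j i = 0")
    case True
    have "card J < card S" using insert by simp
    then obtain c where "\<exists>i\<in>S. c i \<noteq> 0" "\<forall>j\<in>J. (\<Sum>i\<in>S. c i * a j i) = 0"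
      using insert.IH[of S a] insert.prems by blast
    then show ?thesis using True by (intro exI[of _ c]) auto
  next
    case False
    then obtain i0 where i0: "i0 \<in> S" "a j i0 \<noteq> 0" by blast
    let ?S = "S - {i0}"
    have "card J < card ?S" using insert i0 by simp
    then obtain c where c: "\<exists>i\<in>?S. c i \<noteq> 0" "\<forall>j'\<in>J. (\<Sum>i\<in>?S. c i * (a j' i - a j' i0 * a j i / a j i0)) = 0"
      using insert.IH[of ?S "\<lambda>j' i. a j' i - a j' i0 * a j i / a j i0"] insert.prems by auto
    define t where "t = - (\<Sum>i\<in>?S. c i * a j i) / a j i0"
    define c' where "c' = c(i0 := t)"
    have split: "(\<Sum>i\<in>S. c' i * b i) = t * b i0 + (\<Sum>i\<in>?S. c i * b i)" for b
    proof -
      have "(\<Sum>i\<in>?S. c' i * b i) = (\<Sum>i\<in>?S. c i * b i)" by (intro sum.cong) (auto simp: c'_def)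
      then show ?thesis using sum.remove[OF insert.prems(1) i0(1), of "\<lambda>i. c' i * b i"] by (simp add: c'_def)
    qed
    have "(\<Sum>i\<in>S. c' i * a j i) = 0" unfolding split using i0 by (simp add: t_def)
    moreover have "(\<Sum>i\<in>S. c' i * a j' i) = 0" if "j' \<in> J" for j'
    proof -
      have "(\<Sum>i\<in>?S. c i * (a j' i - a j' i0 * a j i / a j i0)) =
         (\<Sum>i\<in>?S. c i * a j' i) - (a j' i0 / a j i0) * (\<Sum>i\<in>?S. c i * a j i)"
        by (simp add: sum_subtractf[symmetric] sum_distrib_left algebra_simps)
      then show ?thesis unfolding split using c(2) that i0 by (simp add: t_def field_simps)
    qed
    moreover have "\<exists>i\<in>S. c' i \<noteq> 0" using c(1) by (auto simp: c'_def)
    ultimately show ?thesis by (intro exI[of _ c']) auto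
  qed
qed

section \<open>Coordinates in an eigenbasis and the smoother\<close>

locale spectral_data =
  fixes n :: nat and L Q :: "real mat" and d :: "nat => real"
  assumes Q: "Q \<in> carrier_mat n n" "transpose_mat Q * Q = 1\<^sub>m n"
    and L: "L = Q * mat_diag n d * transpose_mat Q"
begin

definition q :: "nat => nat => real" where "q i k = Q $$ (i, k)"
definition co :: "(nat => real) => nat => real" where "co f k = (\<Sum>i<n. q i k * f i)"

lemma Lc: "L \<in> carrier_mat n n" using Q L by (auto simp: mat_diag_def)

lemma q_cols: "k < n ==> l < n ==> (\<Sum>i<n. q i k * q i l) = of_bool (k = l)"
  using arg_cong[OF Q(2), of "\<lambda>M. M $$ (k, l)"] Q(1) by (simp add: scalar_prod_def lessThan_atLeast0 q_def)

lemma q_rows: "i < n ==> j < n ==> (\<Sum>k<n. q i k * q j k) = of_bool (i = j)"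
proof -
  have "Q * transpose_mat Q = 1\<^sub>m n" using mat_mult_left_right_inverse[of "transpose_mat Q" n Q] Q by simp
  from arg_cong[OF this, of "\<lambda>M. M $$ (i, j)"] show "i < n ==> j < n ==> (\<Sum>k<n. q i k * q j k) = of_bool (i = j)"
    using Q(1) by (simp add: scalar_prod_def lessThan_atLeast0 q_def)
qed

lemma L_entry: "i < n ==> j < n ==> L $$ (i, j) = (\<Sum>k<n. d k * q i k * q j k)"
proof -
  assume ij: "i < n" "j < n"
  have "(Q * mat_diag n d) $$ (i, k) = q i k * d k" if "k < n" for k
    using ij that Q(1) by (simp add: mat_diag_mult_right[of _ n] q_def)
  then show ?thesis
    unfolding L using ij Q(1) by (simp add: mat_diag_def scalar_prod_def lessThan_atLeast0 q_def mult_ac)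
qed

text \<open>One rearrangement for every function h of the spectrum: h = d gives the quadratic form,
  h = 1 Parseval's identity, and h = s^2 the smoothed norm.\<close>

lemma sum_swap_q: "(\<Sum>i<n. \<Sum>j<n. (\<Sum>k<n. h k * q i k * q j k) * f i * g j) = (\<Sum>k<n. h k * co f k * co g k)"
proof -
  have "(\<Sum>i<n. \<Sum>j<n. (\<Sum>k<n. h k * q i k * q j k) * f i * g j) = (\<Sum>i<n. \<Sum>j<n. \<Sum>k<n. h k * (q i k * f i) * (q j k * g j))"
    by (simp add: sum_distrib_right sum_distrib_left mult_ac)
  also have "\<dots> = (\<Sum>i<n. \<Sum>k<n. \<Sum>j<n. h k * (q i k * f i) * (q j k * g j))"
    by (intro sum.cong refl sum.swap)
  also have "\<dots> = (\<Sum>k<n. \<Sum>i<n. \<Sum>j<n. h k * (q i k * f i) * (q j k * g j))"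
    by (rule sum.swap)
  also have "\<dots> = (\<Sum>k<n. h k * co f k * co g k)"
  proof (rule sum.cong[OF refl])
    fix k
    have "co f k * co g k = (\<Sum>i<n. \<Sum>j<n. (q i k * f i) * (q j k * g j))" unfolding co_def sum_product ..
    then show "(\<Sum>i<n. \<Sum>j<n. h k * (q i k * f i) * (q j k * g j)) = h k * co f k * co g k"
      by (simp only: mult.assoc sum_distrib_left)
  qed
  finally show ?thesis .
qed

lemma quad_form: "(\<Sum>i<n. \<Sum>j<n. L $$ (i, j) * f i * f j) = (\<Sum>k<n. d k * (co f k)^2)"
proof -
  have "(\<Sum>i<n. \<Sum>j<n. L $$ (i, j) * f i * f j) = (\<Sum>i<n. \<Sum>j<n. (\<Sum>k<n. d k * q i k * q j k) * f i * f j)"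
    by (intro sum.cong refl) (simp add: L_entry)
  then show ?thesis using sum_swap_q[of d f f] by (simp add: power2_eq_square mult.assoc)
qed

lemma co_co: "k < n ==> co (\<lambda>i. \<Sum>l<n. q i l * c l) k = c k"
proof -
  assume k: "k < n"
  have "co (\<lambda>i. \<Sum>l<n. q i l * c l) k = (\<Sum>l<n. (\<Sum>i<n. q i k * q i l) * c l)"
    unfolding co_def by (simp add: sum_distrib_left sum_distrib_right mult.assoc) (rule sum.swap)
  also have "\<dots> = (\<Sum>l<n. of_bool (k = l) * c l)" using k by (simp add: q_cols)
  also have "\<dots> = c k" using k by (simp add: of_bool_def if_distribR if_distrib sum.delta' cong: if_cong)
  finally show ?thesis .
qed

lemma parseval: "(\<Sum>k<n. co f k * co g k) = (\<Sum>i<n. f i * g i)"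
proof -
  have "(\<Sum>k<n. co f k * co g k) = (\<Sum>i<n. \<Sum>j<n. (\<Sum>k<n. q i k * q j k) * f i * g j)"
    using sum_swap_q[of "\<lambda>_. 1" f g] by simp
  also have "\<dots> = (\<Sum>i<n. \<Sum>j<n. of_bool (i = j) * f i * g j)" by (simp add: q_rows)
  also have "\<dots> = (\<Sum>i<n. f i * g i)" by (simp add: of_bool_def if_distribR if_distrib sum.delta' cong: if_cong)
  finally show ?thesis .
qed

lemma parseval2: "(\<Sum>k<n. (co f k)^2) = (\<Sum>i<n. (f i)^2)"
  using parseval[of f f] by (simp add: power2_eq_square)

text \<open>The min-max principle. Were there more eigenvalues below g than constraints, some
  nonzero combination of their eigenvectors would satisfy all the constraints, while its quadratic
  form is less than g |f|^2.\<close>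

lemma card_eigenvalues_less:
  fixes w :: "'j => nat => real"
  assumes J: "finite J"
    and gap: "\<And>f. (\<And>j. j \<in> J ==> (\<Sum>i<n. w j i * f i) = 0) ==> g * (\<Sum>i<n. (f i)^2) \<le> (\<Sum>i<n. \<Sum>j<n. L $$ (i, j) * f i * f j)"
  shows "card {i. i < n \<and> d i < g} \<le> card J"
proof (rule ccontr)
  let ?S = "{i. i < n \<and> d i < g}"
  assume "\<not> ?thesis"
  then have "card J < card ?S" by simp
  then obtain c where c: "\<exists>i\<in>?S. c i \<noteq> 0" "\<forall>j\<in>J. (\<Sum>i\<in>?S. c i * (\<Sum>k<n. w j k * q k i)) = 0"
    using homogeneous_system_nontrivial[OF J, of ?S "\<lambda>j i. \<Sum>k<n. w j k * q k i"] by auto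
  define c' where "c' = (\<lambda>i. if i \<in> ?S then c i else 0)"
  define f where "f = (\<lambda>k. \<Sum>i<n. q k i * c' i)"
  have Sn: "?S = {..<n} \<inter> {i. d i < g}" by auto
  have "(\<Sum>i<n. w j i * f i) = 0" if j: "j \<in> J" for j
  proof -
    have "(\<Sum>i<n. w j i * f i) = (\<Sum>i<n. c' i * (\<Sum>k<n. w j k * q k i))"
      unfolding f_def by (simp add: sum_distrib_left mult_ac) (rule sum.swap)
    also have "\<dots> = (\<Sum>i\<in>?S. c i * (\<Sum>k<n. w j k * q k i))"
      unfolding Sn c'_def by (auto simp: sum.inter_restrict if_distrib if_distribR intro!: sum.cong)
    finally show ?thesis using c(2) j by simp
  qed
  then have le: "g * (\<Sum>i<n. (f i)^2) \<le> (\<Sum>k<n. d k * (co f k)^2)"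
    using gap[of f] quad_form[of f] by simp
  have cf: "co f k = c' k" if "k < n" for k using co_co[OF that] by (simp add: f_def)
  have "(\<Sum>k<n. d k * (c' k)^2) < (\<Sum>k<n. g * (c' k)^2)"
  proof (rule sum_strict_mono_ex1)
    show "\<forall>k\<in>{..<n}. d k * (c' k)^2 \<le> g * (c' k)^2" by (auto simp: c'_def mult_right_mono)
    obtain i where "i \<in> ?S" "c i \<noteq> 0" using c(1) by blast
    then show "\<exists>k\<in>{..<n}. d k * (c' k)^2 < g * (c' k)^2" by (intro bexI[of _ i]) (auto simp: c'_def)
  qed simp
  moreover have "(\<Sum>k<n. (c' k)^2) = (\<Sum>i<n. (f i)^2)" using parseval2[of f] cf by simp
  moreover have "(\<Sum>k<n. d k * (co f k)^2) = (\<Sum>k<n. d k * (c' k)^2)" using cf by simp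
  ultimately show False using le by (simp only: sum_distrib_left[symmetric])
qed

end

locale smoothing = spectral_data +
  fixes \<rho> :: real
  assumes rho: "0 < \<rho>" and d_nonneg: "\<And>k. k < n ==> 0 \<le> d k"
begin

definition s :: "nat => real" where "s k = 1 / (\<rho> * d k + 1)"
text \<open>The matrix S^2 for the smoother S = (I + \<rho> L)^-1, whose eigenvalues are the
  \<open>s k\<close>.\<close>

definition B :: "nat => nat => real" where "B i j = (\<Sum>k<n. (s k)^2 * q i k * q j k)"

text \<open>The third bound, 1/2 - x <= (1 + x)^-2 for x >= 0, is linear in \<open>d k\<close>; it
  lets the Dirichlet energy measure what smoothing removes from the signal.\<close>

lemma s_bounds: "k < n ==> 0 < s k" "k < n ==> s k \<le> 1" "k < n ==> 1 / 2 - \<rho> * d k \<le> (s k)^2"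
proof -
  assume k: "k < n"
  define x where "x = \<rho> * d k"
  have x: "0 \<le> x" using rho d_nonneg[OF k] by (simp add: x_def)
  show "0 < s k" "s k \<le> 1" using x by (simp_all add: s_def x_def)
  have "(1 / 2 - x) * (x + 1)^2 = 1 / 2 - (3 / 2 * x^2 + x ^ 3)" by (simp add: power2_eq_square power3_eq_cube algebra_simps)
  also have "\<dots> \<le> 1"
  proof -
    have "0 \<le> x^2" "0 \<le> x ^ 3" using x by auto
    then show ?thesis by linarith
  qed
  finally have "1 / 2 - x \<le> 1 / (x + 1)^2" using x by (simp add: pos_le_divide_eq)
  then show "1 / 2 - \<rho> * d k \<le> (s k)^2" by (simp add: s_def x_def power_divide)
qed

lemma B_sym: "B i j = B j i" by (simp add: B_def mult_ac)

lemma B_trace: "(\<Sum>i<n. B i i) = (\<Sum>k<n. (s k)^2)"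
proof -
  have "(\<Sum>i<n. B i i) = (\<Sum>k<n. (s k)^2 * (\<Sum>i<n. q i k * q i k))"
    unfolding B_def by (subst sum.swap) (simp add: sum_distrib_left mult.assoc)
  then show ?thesis by (simp add: q_cols)
qed

lemma B_apply: "k < n ==> co (\<lambda>i. \<Sum>j<n. B i j * f j) k = (s k)^2 * co f k"
proof -
  assume k: "k < n"
  have "(\<Sum>j<n. B i j * f j) = (\<Sum>l<n. q i l * ((s l)^2 * co f l))" for i
    unfolding B_def co_def by (simp add: sum_distrib_right sum_distrib_left mult_ac) (rule sum.swap)
  then show ?thesis using co_co[OF k, of "\<lambda>l. (s l)^2 * co f l"] by simp
qed

lemma B_frobenius: "(\<Sum>i<n. \<Sum>j<n. (B i j)^2) = (\<Sum>k<n. (s k) ^ 4)"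
proof -
  have "(\<Sum>j<n. (B i j)^2) = (\<Sum>k<n. (s k) ^ 4 * (q i k)^2)" if i: "i < n" for i
  proof -
    have "B i j = (\<Sum>l<n. q j l * ((s l)^2 * q i l))" for j unfolding B_def by (simp add: mult_ac)
    then have "co (\<lambda>j. B i j) k = (s k)^2 * q i k" if "k < n" for k using co_co[OF that] by simp
    then have "(\<Sum>k<n. (co (\<lambda>j. B i j) k)^2) = (\<Sum>k<n. (s k) ^ 4 * (q i k)^2)"
      by (intro sum.cong) (auto simp: power_mult_distrib)
    then show ?thesis by (simp add: parseval2)
  qed
  then have "(\<Sum>i<n. \<Sum>j<n. (B i j)^2) = (\<Sum>i<n. \<Sum>k<n. (s k) ^ 4 * (q i k)^2)" by simp
  also have "\<dots> = (\<Sum>k<n. (s k) ^ 4 * (\<Sum>i<n. q i k * q i k))"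
    by (subst sum.swap) (simp add: sum_distrib_left power2_eq_square)
  finally show ?thesis by (simp add: q_cols)
qed

definition signal :: "(nat => real) => real" where "signal f = (\<Sum>k<n. (s k)^2 * (co f k)^2)"

lemma signal_add:
  "signal (\<lambda>i. f i + e i) = signal f + 2 * (\<Sum>i<n. (\<Sum>j<n. B i j * f j) * e i) + (\<Sum>i<n. \<Sum>j<n. B i j * e i * e j)"
proof -
  have c: "co (\<lambda>i. f i + e i) k = co f k + co e k" for k by (simp add: co_def distrib_left sum.distrib)
  have 1: "(\<Sum>i<n. (\<Sum>j<n. B i j * f j) * e i) = (\<Sum>k<n. (s k)^2 * co e k * co f k)"
    using sum_swap_q[of "\<lambda>k. (s k)^2" e f] unfolding B_def[symmetric] by (simp add: sum_distrib_right sum_distrib_left mult_ac)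
  have 2: "(\<Sum>i<n. \<Sum>j<n. B i j * e i * e j) = (\<Sum>k<n. (s k)^2 * co e k * co e k)"
    using sum_swap_q[of "\<lambda>k. (s k)^2" e e] unfolding B_def[symmetric] .
  have "signal (\<lambda>i. f i + e i) = (\<Sum>k<n. (s k)^2 * (co f k)^2 + 2 * ((s k)^2 * co e k * co f k) + (s k)^2 * co e k * co e k)"
    unfolding signal_def c by (intro sum.cong refl) (simp add: power2_eq_square algebra_simps)
  then show ?thesis unfolding 1 2 signal_def by (simp only: sum.distrib sum_distrib_left)
qed

text \<open>The linear noise term has variance proportional to |B f|^2, and s <= 1 bounds this by
  the signal; its contribution to Chebyshev's bound is then the reciprocal of the signal.\<close>

lemma signal_linear_coeff: "(\<Sum>i<n. (\<Sum>j<n. B i j * f j)^2) \<le> signal f"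
proof -
  have "(\<Sum>i<n. (\<Sum>j<n. B i j * f j)^2) = (\<Sum>k<n. ((s k)^2 * co f k)^2)"
    unfolding parseval2[of "\<lambda>i. \<Sum>j<n. B i j * f j", symmetric] by (intro sum.cong refl) (simp add: B_apply)
  also have "\<dots> \<le> signal f" unfolding signal_def
  proof (rule sum_mono)
    fix k assume "k \<in> {..<n}"
    then have "(s k)^2 * (s k)^2 \<le> (s k)^2 * 1" using s_bounds(1,2)[of k] by (intro mult_left_mono power_le_one) auto
    then show "((s k)^2 * co f k)^2 \<le> (s k)^2 * (co f k)^2"
      unfolding power_mult_distrib by (intro mult_right_mono) (auto simp: power2_eq_square)
  qed
  finally show ?thesis .
qed

lemma signal_lower: "(\<Sum>i<n. (f i)^2) / 2 - \<rho> * (\<Sum>i<n. \<Sum>j<n. L $$ (i, j) * f i * f j) \<le> signal f"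
proof -
  have "(\<Sum>i<n. (f i)^2) / 2 - \<rho> * (\<Sum>i<n. \<Sum>j<n. L $$ (i, j) * f i * f j) = (\<Sum>k<n. (1/2 - \<rho> * d k) * (co f k)^2)"
    unfolding quad_form parseval2[of f, symmetric] by (simp add: left_diff_distrib sum_subtractf sum_distrib_left sum_divide_distrib mult.assoc)
  also have "\<dots> \<le> signal f" unfolding signal_def
    by (intro sum_mono mult_right_mono s_bounds(3)) auto
  finally show ?thesis .
qed

text \<open>In eigencoordinates the objective is a weighted sum of squares \<open>E\<close> plus a
  constant, by completing the square. As \<open>arg_min\<close> is a choice operator, a minimiser is
  exhibited first; every minimiser then has \<open>E\<close> equal to 0, which fixes its coordinates
  and its norm.\<close>

lemma argmin_norm:
  assumes f: "f = arg_min (\<lambda>f. (\<Sum>i<n. (Y i - vec_index f i)^2) + \<rho> * scalar_prod f (mult_mat_vec L f)) (\<lambda>f. f \<in> carrier_vec n)"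
  shows "scalar_prod f f = signal Y"
proof -
  let ?O = "\<lambda>f. (\<Sum>i<n. (Y i - vec_index f i)^2) + \<rho> * scalar_prod f (mult_mat_vec L f)"
  let ?c = "\<lambda>f k. co (\<lambda>i. vec_index f i) k"
  define E where "E = (\<lambda>f. \<Sum>k<n. (\<rho> * d k + 1) * (?c f k - s k * co Y k)^2)"
  have pos: "0 < \<rho> * d k + 1" if "k < n" for k using rho d_nonneg[OF that] by (simp add: add_nonneg_pos)
  have O: "?O f = E f + (\<Sum>k<n. (1 - s k) * (co Y k)^2)" if fc: "f \<in> carrier_vec n" for f
  proof -
    have 1: "scalar_prod f (mult_mat_vec L f) = (\<Sum>i<n. \<Sum>j<n. L $$ (i, j) * vec_index f i * vec_index f j)"
      using fc Lc by (simp add: scalar_prod_def lessThan_atLeast0 sum_distrib_left mult_ac)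
    have cd: "co (\<lambda>i. Y i - vec_index f i) k = co Y k - ?c f k" for k
      by (simp add: co_def right_diff_distrib sum_subtractf)
    have "?O f = (\<Sum>k<n. (co Y k - ?c f k)^2) + \<rho> * (\<Sum>k<n. d k * (?c f k)^2)"
      unfolding 1 quad_form parseval2[of "\<lambda>i. Y i - vec_index f i", symmetric] cd ..
    also have "\<dots> = (\<Sum>k<n. (co Y k - ?c f k)^2 + \<rho> * d k * (?c f k)^2)"
      by (simp add: sum.distrib sum_distrib_left mult.assoc)
    also have "\<dots> = (\<Sum>k<n. (\<rho> * d k + 1) * (?c f k - s k * co Y k)^2 + (1 - s k) * (co Y k)^2)"
    proof (rule sum.cong[OF refl])
      fix k assume "k \<in> {..<n}"
      then have sk: "(\<rho> * d k + 1) * s k = 1" using pos[of k] by (simp add: s_def)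
      have "(y - x)^2 + (t - 1) * x^2 = t * (x - u * y)^2 + (1 - u) * y^2" if "t * u = 1" for x y t u :: real
      proof -
        have "t * (x - u * y)^2 = t * x^2 - 2 * (t * u) * (x * y) + (t * u) * (u * y^2)"
          by (simp add: power2_eq_square algebra_simps)
        then show ?thesis using that by (simp add: power2_eq_square algebra_simps)
      qed
      from this[OF sk] show "(co Y k - ?c f k)^2 + \<rho> * d k * (?c f k)^2 = (\<rho> * d k + 1) * (?c f k - s k * co Y k)^2 + (1 - s k) * (co Y k)^2"
        by simp
    qed
    finally show ?thesis by (simp add: E_def sum.distrib)
  qed
  have E0: "0 \<le> E f" for f unfolding E_def using pos by (intro sum_nonneg) (auto simp: less_imp_le)
  define f0 where "f0 = Matrix.vec n (\<lambda>i. \<Sum>l<n. q i l * (s l * co Y l))"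
  have f0: "f0 \<in> carrier_vec n" by (simp add: f0_def)
  have c0: "?c f0 k = s k * co Y k" if "k < n" for k
  proof -
    have "?c f0 k = co (\<lambda>i. \<Sum>l<n. q i l * (s l * co Y l)) k" unfolding co_def by (intro sum.cong) (auto simp: f0_def co_def)
    then show ?thesis using co_co[OF that, of "\<lambda>l. s l * co Y l"] by simp
  qed
  have "E f0 = 0" unfolding E_def by (simp add: c0)
  then have "is_arg_min ?O (\<lambda>f. f \<in> carrier_vec n) f0"
    unfolding is_arg_min_linorder using f0 O E0 by simp
  then have "is_arg_min ?O (\<lambda>f. f \<in> carrier_vec n) f" unfolding f arg_min_def by (rule someI)
  then have fm: "f \<in> carrier_vec n" "?O f \<le> ?O f0" using f0 unfolding is_arg_min_linorder by auto
  then have "E f \<le> 0" using O[OF fm(1)] O[OF f0] \<open>E f0 = 0\<close> by simp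
  then have "E f = 0" using E0[of f] by simp
  then have "\<forall>k\<in>{..<n}. (\<rho> * d k + 1) * (?c f k - s k * co Y k)^2 = 0"
    unfolding E_def using pos by (subst (asm) sum_nonneg_eq_0_iff) (auto simp: less_imp_le)
  then have cf: "?c f k = s k * co Y k" if "k < n" for k
  proof -
    have "\<rho> * d k + 1 \<noteq> 0" using pos[OF that] by simp
    then show ?thesis using that \<open>\<forall>k\<in>{..<n}. _\<close> by auto
  qed
  have "scalar_prod f f = (\<Sum>i<n. (vec_index f i)^2)"
    using fm(1) by (simp add: scalar_prod_def lessThan_atLeast0 power2_eq_square)
  also have "\<dots> = (\<Sum>k<n. (?c f k)^2)" by (rule parseval2[symmetric])
  also have "\<dots> = signal Y" unfolding signal_def by (intro sum.cong refl) (simp add: cf power_mult_distrib)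
  finally show ?thesis .
qed

end

section \<open>The graph Laplacian and its quadratic form\<close>

lemma laplacian_carrier: "laplacian K n r x \<in> carrier_mat n n"
  by (simp add: laplacian_def weight_matrix_def degree_matrix_def mat_diag_def minus_carrier_mat)

lemma laplacian_entry:
  assumes "i < n" "j < n"
  shows "laplacian K n r x $$ (i, j) = of_bool (i = j) * (\<Sum>k<n. K (norm (x i - x k) / r)) - K (norm (x i - x j) / r)"
  using assms by (simp add: laplacian_def weight_matrix_def degree_matrix_def mat_diag_def)

lemma laplacian_symmetric: "transpose_mat (laplacian K n r x) = laplacian K n r x"
proof (rule eq_matI)
  fix i j assume "i < dim_row (laplacian K n r x)" "j < dim_col (laplacian K n r x)"
  then have "i < n" "j < n" using laplacian_carrier[of K n r x] by auto
  then show "transpose_mat (laplacian K n r x) $$ (i, j) = laplacian K n r x $$ (i, j)"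
    using laplacian_carrier[of K n r x] by (auto simp: laplacian_entry norm_minus_commute)
qed (use laplacian_carrier[of K n r x] in auto)

lemma laplacian_quad_form:
  "(\<Sum>i<n. \<Sum>j<n. laplacian K n r x $$ (i, j) * f i * f j) = (\<Sum>i<n. \<Sum>j<n. K (norm (x i - x j) / r) * (f i - f j)^2) / 2"
proof -
  let ?W = "\<lambda>i j. K (norm (x i - x j) / r)"
  have W: "?W i j = ?W j i" for i j by (simp add: norm_minus_commute)
  have "(\<Sum>i<n. \<Sum>j<n. laplacian K n r x $$ (i, j) * f i * f j) =
     (\<Sum>i<n. \<Sum>j<n. of_bool (i = j) * ((\<Sum>k<n. ?W i k) * f i * f j)) - (\<Sum>i<n. \<Sum>j<n. ?W i j * f i * f j)"
    by (simp add: laplacian_entry left_diff_distrib sum_subtractf mult.assoc)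
  also have "(\<Sum>i<n. \<Sum>j<n. of_bool (i = j) * ((\<Sum>k<n. ?W i k) * f i * f j)) = (\<Sum>i<n. \<Sum>j<n. ?W i j * (f i)^2)"
    by (simp add: of_bool_def if_distribR if_distrib sum.delta' sum_distrib_right power2_eq_square mult.assoc cong: if_cong)
  finally have 1: "(\<Sum>i<n. \<Sum>j<n. laplacian K n r x $$ (i, j) * f i * f j) = (\<Sum>i<n. \<Sum>j<n. ?W i j * (f i)^2) - (\<Sum>i<n. \<Sum>j<n. ?W i j * f i * f j)" .
  have 2: "(\<Sum>i<n. \<Sum>j<n. ?W i j * (f j)^2) = (\<Sum>i<n. \<Sum>j<n. ?W i j * (f i)^2)"
    by (subst sum.swap) (simp add: norm_minus_commute)
  have "(\<Sum>i<n. \<Sum>j<n. ?W i j * (f i - f j)^2) = (\<Sum>i<n. \<Sum>j<n. ?W i j * (f i)^2 + ?W i j * (f j)^2 - 2 * (?W i j * f i * f j))"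
    by (intro sum.cong refl) (simp add: power2_eq_square algebra_simps)
  also have "\<dots> = 2 * (\<Sum>i<n. \<Sum>j<n. ?W i j * (f i)^2) - 2 * (\<Sum>i<n. \<Sum>j<n. ?W i j * f i * f j)"
    by (simp only: sum.distrib sum_subtractf 2 sum_distrib_left[symmetric])
  finally show ?thesis unfolding 1 by simp
qed

section \<open>Gaussian noise and the power at a fixed design\<close>

text \<open>For a function that need not be measurable, \<open>nn_integral\<close> is a lower integral; transport and
  Tonelli survive as inequalities, so the test need not be shown measurable.\<close>

lemma nn_integral_distr_le:
  assumes [measurable]: "T \<in> M \<rightarrow>\<^sub>M N"
  shows "(\<integral>\<^sup>+x. f x \<partial>distr M N T) \<le> (\<integral>\<^sup>+x. f (T x) \<partial>M)"
  unfolding nn_integral_def[of "distr M N T"]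
proof (rule SUP_least)
  fix g assume "g \<in> {g. simple_function (distr M N T) g \<and> g \<le> f}"
  then have g: "simple_function (distr M N T) g" "g \<le> f" by auto
  have [measurable]: "g \<in> borel_measurable N" using borel_measurable_simple_function[OF g(1)] by simp
  have "integral\<^sup>S (distr M N T) g = (\<integral>\<^sup>+x. g x \<partial>distr M N T)" using nn_integral_eq_simple_integral[OF g(1)] by simp
  also have "\<dots> = (\<integral>\<^sup>+x. g (T x) \<partial>M)" by (rule nn_integral_distr) auto
  also have "\<dots> \<le> (\<integral>\<^sup>+x. f (T x) \<partial>M)" using g(2) by (intro nn_integral_mono) (auto simp: le_fun_def)
  finally show "integral\<^sup>S (distr M N T) g \<le> (\<integral>\<^sup>+x. f (T x) \<partial>M)" .
qed

lemma nn_integral_pair_le: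
  assumes "sigma_finite_measure N"
  shows "(\<integral>\<^sup>+z. f z \<partial>(M \<Otimes>\<^sub>M N)) \<le> (\<integral>\<^sup>+x. \<integral>\<^sup>+y. f (x, y) \<partial>N \<partial>M)"
  unfolding nn_integral_def[of "M \<Otimes>\<^sub>M N"]
proof (rule SUP_least)
  interpret sigma_finite_measure N by fact
  fix g assume "g \<in> {g. simple_function (M \<Otimes>\<^sub>M N) g \<and> g \<le> f}"
  then have g: "simple_function (M \<Otimes>\<^sub>M N) g" "g \<le> f" by auto
  have "integral\<^sup>S (M \<Otimes>\<^sub>M N) g = (\<integral>\<^sup>+x. g x \<partial>(M \<Otimes>\<^sub>M N))" using nn_integral_eq_simple_integral[OF g(1)] by simp
  also have "\<dots> = (\<integral>\<^sup>+x. \<integral>\<^sup>+y. g (x, y) \<partial>N \<partial>M)"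
    by (rule nn_integral_fst[symmetric]) (rule borel_measurable_simple_function[OF g(1)])
  also have "\<dots> \<le> (\<integral>\<^sup>+x. \<integral>\<^sup>+y. f (x, y) \<partial>N \<partial>M)" using g(2) by (intro nn_integral_mono) (auto simp: le_fun_def)
  finally show "integral\<^sup>S (M \<Otimes>\<^sub>M N) g \<le> (\<integral>\<^sup>+x. \<integral>\<^sup>+y. f (x, y) \<partial>N \<partial>M)" .
qed

section \<open>Independent designs and Gaussian noise\<close>

definition gauss :: "real measure" where "gauss = density lborel std_normal_density"

lemma sets_gauss [simp, measurable_cong]: "sets gauss = sets borel" by (simp add: gauss_def)

lemma prob_space_gauss: "prob_space gauss"
  unfolding gauss_def by (rule prob_space_normal_density) simp

text \<open>The integrand is a product over I in which all factors but one are 1.\<close>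

lemma nn_integral_product_component:
  assumes M: "prob_space M" and I: "finite I" "j \<in> I" and h: "h \<in> borel_measurable M"
  shows "(\<integral>\<^sup>+x. h (x j) \<partial>PiM I (\<lambda>_. M)) = (\<integral>\<^sup>+x. h x \<partial>M)"
proof -
  interpret prob_space M by fact
  interpret product_sigma_finite "\<lambda>_. M" ..
  have "h (x j) = (\<Prod>i\<in>I. if i = j then h (x i) else 1)" for x using I by (simp add: prod.delta)
  then have "(\<integral>\<^sup>+x. h (x j) \<partial>PiM I (\<lambda>_. M)) = (\<integral>\<^sup>+x. (\<Prod>i\<in>I. (\<lambda>i y. if i = j then h y else 1) i (x i)) \<partial>PiM I (\<lambda>_. M))" by simp
  also have "\<dots> = (\<Prod>i\<in>I. \<integral>\<^sup>+y. (if i = j then h y else 1) \<partial>M)"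
    using h by (intro product_nn_integral_prod I(1)) auto
  also have "\<dots> = (\<Prod>i\<in>I. if i = j then (\<integral>\<^sup>+y. h y \<partial>M) else 1)" by (intro prod.cong) (auto simp: emeasure_space_1)
  finally show ?thesis using I by (simp add: prod.delta)
qed

lemma nn_integral_product_pair:
  assumes M: "prob_space M" and I: "finite I" "i \<in> I" "j \<in> I" "i \<noteq> j"
    and h [measurable]: "(\<lambda>(x, y). h x y) \<in> borel_measurable (M \<Otimes>\<^sub>M M)"
  shows "(\<integral>\<^sup>+x. h (x i) (x j) \<partial>PiM I (\<lambda>_. M)) = (\<integral>\<^sup>+x. \<integral>\<^sup>+y. h y x \<partial>M \<partial>M)"
proof -
  interpret prob_space M by fact
  interpret product_sigma_finite "\<lambda>_. M" ..
  have ins: "insert i (I - {i}) = I" using I by auto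
  have m: "(\<lambda>x. h (x i) (x j)) \<in> borel_measurable (PiM I (\<lambda>_. M))"
    using I by (intro measurable_compose[OF measurable_Pair h, simplified]) auto
  have "(\<integral>\<^sup>+x. h (x i) (x j) \<partial>PiM I (\<lambda>_. M)) = (\<integral>\<^sup>+x. h (x i) (x j) \<partial>PiM (insert i (I - {i})) (\<lambda>_. M))" by (simp only: ins)
  also have "\<dots> = (\<integral>\<^sup>+x. \<integral>\<^sup>+y. h ((x(i := y)) i) ((x(i := y)) j) \<partial>M \<partial>PiM (I - {i}) (\<lambda>_. M))"
    using I m by (intro product_nn_integral_insert) (auto simp: ins)
  also have "\<dots> = (\<integral>\<^sup>+x. (\<integral>\<^sup>+y. h y (x j) \<partial>M) \<partial>PiM (I - {i}) (\<lambda>_. M))" using I by simp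
  also have "\<dots> = (\<integral>\<^sup>+x. \<integral>\<^sup>+y. h y x \<partial>M \<partial>M)"
    using I by (intro nn_integral_product_component[OF M]) auto
  finally show ?thesis .
qed

text \<open>The sample law is the image of independent designs and noises; this identity of product
  measures is checked on rectangles. For the integrals only an inequality results, because F may
  fail to be measurable.\<close>

lemma sample_law_le:
  fixes P :: "(real^'d::finite) measure"
  assumes P: "prob_space P" and f0 [measurable]: "f0 \<in> borel_measurable P"
  shows "(\<integral>\<^sup>+\<omega>. F \<omega> \<partial>sample_law P n f0) \<le>
    (\<integral>\<^sup>+x. \<integral>\<^sup>+e. F (\<lambda>i\<in>{0..<n}. (x i, f0 (x i) + e i)) \<partial>PiM {0..<n} (\<lambda>_. gauss) \<partial>PiM {0..<n} (\<lambda>_. P))"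
proof -
  interpret P: prob_space P by fact
  interpret G: prob_space gauss by (rule prob_space_gauss)
  interpret PP: product_sigma_finite "\<lambda>_. P" ..
  interpret GG: product_sigma_finite "\<lambda>_. gauss" ..
  let ?I = "{0..<n}"
  let ?O = "observation_law P f0"
  have Odef: "?O = distr (P \<Otimes>\<^sub>M gauss) (P \<Otimes>\<^sub>M borel) (\<lambda>(x, e). (x, f0 x + e))"
    by (simp add: observation_law_def gauss_def)
  have Tm [measurable]: "(\<lambda>(x, e). (x, f0 x + e)) \<in> P \<Otimes>\<^sub>M gauss \<rightarrow>\<^sub>M P \<Otimes>\<^sub>M borel" by measurable
  interpret PG: pair_prob_space P gauss ..
  interpret O: prob_space ?O unfolding Odef by (rule PG.prob_space_distr) measurable
  interpret OO: product_sigma_finite "\<lambda>_. ?O" ..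
  have sO [measurable_cong]: "sets ?O = sets (P \<Otimes>\<^sub>M borel)" by (simp add: Odef)
  interpret GI: prob_space "PiM ?I (\<lambda>_. gauss)" by (rule prob_space_PiM) (rule prob_space_gauss)
  let ?T = "\<lambda>(x, e). \<lambda>i\<in>?I. (x i, f0 (x i) + e i)"
  let ?N = "PiM ?I (\<lambda>_. P) \<Otimes>\<^sub>M PiM ?I (\<lambda>_. gauss)"
  have T [measurable]: "?T \<in> ?N \<rightarrow>\<^sub>M PiM ?I (\<lambda>_. ?O)"
    unfolding measurable_cong_sets[OF refl sets_PiM_cong[OF refl sO]] split_beta'
    by (intro measurable_restrict measurable_Pair) measurable
  have "distr ?N (PiM ?I (\<lambda>_. ?O)) ?T = PiM ?I (\<lambda>_. ?O)"
  proof (rule OO.PiM_eqI)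
    fix A assume A: "\<And>i. i \<in> ?I ==> A i \<in> sets ?O"
    have Am [measurable]: "i \<in> ?I ==> A i \<in> sets (P \<Otimes>\<^sub>M borel)" for i using A sO by blast
    have PA: "Pi\<^sub>E ?I A \<in> sets (PiM ?I (\<lambda>_. ?O))" using A by (intro sets_PiM_I_finite) auto
    let ?g = "\<lambda>i x e. indicator (A i) (x, f0 x + e) :: ennreal"
    have gm: "i \<in> ?I ==> (\<lambda>(x, e). ?g i x e) \<in> borel_measurable (P \<Otimes>\<^sub>M gauss)" for i
      using measurable_compose[OF Tm borel_measurable_indicator[OF Am]] by (simp add: split_beta')
    have pm: "(\<lambda>z. \<Prod>i\<in>?I. ?g i (fst z i) (snd z i)) \<in> borel_measurable ?N"
    proof (intro borel_measurable_prod_ennreal)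
      fix i assume i: "i \<in> ?I"
      have "(\<lambda>z. (fst z i, snd z i)) \<in> ?N \<rightarrow>\<^sub>M P \<Otimes>\<^sub>M gauss" using i by (intro measurable_Pair) measurable
      from measurable_compose[OF this gm[OF i]] show "(\<lambda>z. ?g i (fst z i) (snd z i)) \<in> borel_measurable ?N" by simp
    qed
    have "emeasure (distr ?N (PiM ?I (\<lambda>_. ?O)) ?T) (Pi\<^sub>E ?I A) = (\<integral>\<^sup>+z. indicator (Pi\<^sub>E ?I A) z \<partial>distr ?N (PiM ?I (\<lambda>_. ?O)) ?T)"
      by (rule nn_integral_indicator[symmetric]) (subst sets_distr, rule PA)
    also have "\<dots> = (\<integral>\<^sup>+z. indicator (Pi\<^sub>E ?I A) (?T z) \<partial>?N)"
      by (rule nn_integral_distr[OF T]) (rule borel_measurable_indicator, subst sets_distr, rule PA)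
    also have "\<dots> = (\<integral>\<^sup>+z. (\<Prod>i\<in>?I. ?g i (fst z i) (snd z i)) \<partial>?N)"
    proof (rule nn_integral_cong)
      fix z
      have "?T z \<in> Pi\<^sub>E ?I A \<longleftrightarrow> (\<forall>i\<in>?I. (fst z i, f0 (fst z i) + snd z i) \<in> A i)" by (auto simp: split_beta' PiE_iff)
      then show "indicator (Pi\<^sub>E ?I A) (?T z) = (\<Prod>i\<in>?I. ?g i (fst z i) (snd z i))"
        by (auto simp: indicator_def)
    qed
    also have "\<dots> = (\<integral>\<^sup>+x. \<integral>\<^sup>+e. (\<Prod>i\<in>?I. ?g i (x i) (e i)) \<partial>PiM ?I (\<lambda>_. gauss) \<partial>PiM ?I (\<lambda>_. P))"
      by (subst GI.nn_integral_fst[symmetric, OF pm]) simp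
    also have "\<dots> = (\<integral>\<^sup>+x. (\<Prod>i\<in>?I. \<integral>\<^sup>+e. ?g i (x i) e \<partial>gauss) \<partial>PiM ?I (\<lambda>_. P))"
    proof (rule nn_integral_cong)
      fix x assume x: "x \<in> space (PiM ?I (\<lambda>_. P))"
      show "(\<integral>\<^sup>+e. (\<Prod>i\<in>?I. ?g i (x i) (e i)) \<partial>PiM ?I (\<lambda>_. gauss)) = (\<Prod>i\<in>?I. \<integral>\<^sup>+e. ?g i (x i) e \<partial>gauss)"
      proof (rule GG.product_nn_integral_prod)
        fix i assume i: "i \<in> ?I"
        then have "x i \<in> space P" using x by (auto simp: space_PiM)
        then show "(\<lambda>e. ?g i (x i) e) \<in> borel_measurable gauss"
          using measurable_compose_Pair1[OF _ gm[OF i]] by simp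
      qed simp
    qed
    also have "\<dots> = (\<Prod>i\<in>?I. \<integral>\<^sup>+x. \<integral>\<^sup>+e. ?g i x e \<partial>gauss \<partial>P)"
      using G.borel_measurable_nn_integral[OF gm] by (intro PP.product_nn_integral_prod) auto
    also have "\<dots> = (\<Prod>i\<in>?I. emeasure ?O (A i))"
    proof (rule prod.cong[OF refl])
      fix i assume i: "i \<in> ?I"
      have "emeasure ?O (A i) = (\<integral>\<^sup>+z. indicator (A i) z \<partial>?O)" using A[OF i] by simp
      also have "\<dots> = (\<integral>\<^sup>+z. (case z of (x, e) => ?g i x e) \<partial>(P \<Otimes>\<^sub>M gauss))"
        unfolding Odef using Am[OF i] by (subst nn_integral_distr[OF Tm]) (auto simp: split_beta' intro: borel_measurable_indicator)
      also have "\<dots> = (\<integral>\<^sup>+x. \<integral>\<^sup>+e. ?g i x e \<partial>gauss \<partial>P)" by (subst G.nn_integral_fst[symmetric, OF gm[OF i]]) simp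
      finally show "(\<integral>\<^sup>+x. \<integral>\<^sup>+e. ?g i x e \<partial>gauss \<partial>P) = emeasure ?O (A i)" by simp
    qed
    finally show "emeasure (distr ?N (PiM ?I (\<lambda>_. ?O)) ?T) (Pi\<^sub>E ?I A) = (\<Prod>i\<in>?I. emeasure ?O (A i))" .
  qed auto
  then have "(\<integral>\<^sup>+\<omega>. F \<omega> \<partial>sample_law P n f0) = (\<integral>\<^sup>+\<omega>. F \<omega> \<partial>distr ?N (PiM ?I (\<lambda>_. ?O)) ?T)"
    by (simp add: sample_law_def)
  also have "\<dots> \<le> (\<integral>\<^sup>+z. F (?T z) \<partial>?N)" by (rule nn_integral_distr_le[OF T])
  also have "\<dots> \<le> (\<integral>\<^sup>+x. \<integral>\<^sup>+e. F (?T (x, e)) \<partial>PiM ?I (\<lambda>_. gauss) \<partial>PiM ?I (\<lambda>_. P))"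
    by (rule nn_integral_pair_le) (rule GI.sigma_finite_measure_axioms)
  finally show ?thesis by simp
qed

text \<open>1, t and t^2 - 1 are the first Hermite polynomials: orthogonal under the normal law,
  with squared norms 1, 1 and 2.\<close>

lemma gauss_quadratic:
  "(\<integral>\<^sup>+t. ennreal ((z + t * u + (t^2 - 1) * v)^2) \<partial>gauss) = ennreal (z^2 + u^2 + 2 * v^2)"
proof -
  let ?N = "std_normal_density"
  have m0: "has_bochner_integral lborel (\<lambda>t. ?N t * t ^ 0) 1"
    and m2: "has_bochner_integral lborel (\<lambda>t. ?N t * t ^ 2) 1"
    and m4: "has_bochner_integral lborel (\<lambda>t. ?N t * t ^ 4) 3"
    using std_normal_moment_even[of 0] std_normal_moment_even[of 1] std_normal_moment_even[of 2]
    by (simp_all add: fact_numeral)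
  have m1: "has_bochner_integral lborel (\<lambda>t. ?N t * t ^ 1) 0"
    and m3: "has_bochner_integral lborel (\<lambda>t. ?N t * t ^ 3) 0"
    using std_normal_moment_odd[of 0] std_normal_moment_odd[of 1] by (simp_all add: numeral_3_eq_3)
  have "has_bochner_integral lborel (\<lambda>t. (z^2 - 2 * z * v + v^2) * (?N t * t ^ 0) + (2 * z * u - 2 * u * v) * (?N t * t ^ 1)
      + (u^2 + 2 * z * v - 2 * v^2) * (?N t * t ^ 2) + 2 * u * v * (?N t * t ^ 3) + v^2 * (?N t * t ^ 4))
     ((z^2 - 2 * z * v + v^2) * 1 + (2 * z * u - 2 * u * v) * 0 + (u^2 + 2 * z * v - 2 * v^2) * 1 + 2 * u * v * 0 + v^2 * 3)"
    by (intro has_bochner_integral_add has_bochner_integral_mult_right m0 m1 m2 m3 m4)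
  moreover have "(z^2 - 2 * z * v + v^2) * (?N t * t ^ 0) + (2 * z * u - 2 * u * v) * (?N t * t ^ 1)
      + (u^2 + 2 * z * v - 2 * v^2) * (?N t * t ^ 2) + 2 * u * v * (?N t * t ^ 3) + v^2 * (?N t * t ^ 4)
     = ?N t * (z + t * u + (t^2 - 1) * v)^2" for t
    by (simp add: power2_eq_square power3_eq_cube power4_eq_xxxx algebra_simps)
  ultimately have "has_bochner_integral lborel (\<lambda>t. ?N t * (z + t * u + (t^2 - 1) * v)^2) (z^2 + u^2 + 2 * v^2)"
    by (simp add: algebra_simps)
  then have "(NI t. ennreal (?N t * (z + t * u + (t^2 - 1) * v)^2)) = ennreal (z^2 + u^2 + 2 * v^2)"
    by (subst nn_integral_eq_integral) (auto simp: has_bochner_integral_iff)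
  then show ?thesis
    unfolding gauss_def by (subst nn_integral_density) (auto simp: ennreal_mult')
qed

lemma gauss_linear:
  fixes n :: nat
  shows "(\<integral>\<^sup>+e. ennreal ((z + (\<Sum>i<n. b i * e i))^2) \<partial>PiM {..<n} (\<lambda>_. gauss)) = ennreal (z^2 + (\<Sum>i<n. (b i)^2))"
proof (induction n)
  case 0
  show ?case by (simp add: PiM_empty nn_integral_count_space_finite)
next
  case (Suc n)
  interpret G: prob_space gauss by (rule prob_space_gauss)
  interpret product_sigma_finite "\<lambda>_. gauss" ..
  interpret GI: prob_space "PiM {..<n} (\<lambda>_. gauss)" by (rule prob_space_PiM) (rule prob_space_gauss)
  have "(\<integral>\<^sup>+e. ennreal ((z + (\<Sum>i<Suc n. b i * e i))^2) \<partial>PiM {..<Suc n} (\<lambda>_. gauss)) =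
    (\<integral>\<^sup>+e. \<integral>\<^sup>+t. ennreal ((z + (\<Sum>i<Suc n. b i * (e(n := t)) i))^2) \<partial>gauss \<partial>PiM {..<n} (\<lambda>_. gauss))"
    unfolding lessThan_Suc by (rule product_nn_integral_insert) (auto simp: lessThan_Suc[symmetric])
  also have "\<dots> = (\<integral>\<^sup>+e. \<integral>\<^sup>+t. ennreal ((z + (\<Sum>i<n. b i * e i) + t * b n + (t^2 - 1) * 0)^2) \<partial>gauss \<partial>PiM {..<n} (\<lambda>_. gauss))"
    by (intro nn_integral_cong) (simp add: mult.commute add.assoc)
  also have "\<dots> = (\<integral>\<^sup>+e. ennreal ((z + (\<Sum>i<n. b i * e i))^2) + ennreal ((b n)^2) \<partial>PiM {..<n} (\<lambda>_. gauss))"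
    unfolding gauss_quadratic by simp
  also have "\<dots> = ennreal (z^2 + (\<Sum>i<n. (b i)^2)) + ennreal ((b n)^2)"
    by (subst nn_integral_add) (auto simp: Suc GI.emeasure_space_1)
  finally show ?case by (simp add: ennreal_plus[symmetric] sum_nonneg add.assoc del: ennreal_plus)
qed

lemma sum_symmetric_split:
  fixes c :: "nat => nat => real"
  assumes "\<And>i j. c i j = c j i"
  shows "(\<Sum>i<n. \<Sum>j<n. c i j) = (\<Sum>i<n. c i i + 2 * (\<Sum>j<i. c i j))"
proof (induction n)
  case (Suc n)
  have "(\<Sum>i<n. c i n) = (\<Sum>j<n. c n j)" using assms by simp
  then show ?case using Suc by (simp add: sum.distrib)
qed simp

text \<open>The diagonal, linear and off-diagonal parts are revealed one coordinate at a time and form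
  martingale increments.\<close>

lemma gauss_quadratic_form:
  fixes B :: "nat => nat => real" and n :: nat
  assumes sym: "\<And>i j. B i j = B j i"
  shows "(\<integral>\<^sup>+e. ennreal ((2 * (\<Sum>i<n. a i * e i) + (\<Sum>i<n. \<Sum>j<n. B i j * e i * e j) - (\<Sum>i<n. B i i))^2) \<partial>PiM {..<n} (\<lambda>_. gauss))
     = ennreal (4 * (\<Sum>i<n. (a i)^2) + 2 * (\<Sum>i<n. \<Sum>j<n. (B i j)^2))"
proof -
  \<comment> \<open>Grouped by the largest index: increment i is a combination of Hermite
    polynomials of \<open>e i\<close> whose coefficients depend on the earlier coordinates
    only.\<close>
  define Z where "Z = (\<lambda>n e. \<Sum>i<n. e i * (2 * a i + 2 * (\<Sum>j<i. B i j * e j)) + ((e i)^2 - 1) * B i i)"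
  have Zeq: "2 * (\<Sum>i<n. a i * e i) + (\<Sum>i<n. \<Sum>j<n. B i j * e i * e j) - (\<Sum>i<n. B i i) = Z n e" for e
  proof -
    have "(\<Sum>i<n. \<Sum>j<n. B i j * e i * e j) = (\<Sum>i<n. B i i * e i * e i + 2 * (\<Sum>j<i. B i j * e i * e j))"
      by (rule sum_symmetric_split) (use sym in \<open>simp add: mult_ac\<close>)
    then show ?thesis
      by (simp add: Z_def sum.distrib sum_subtractf sum_distrib_left algebra_simps power2_eq_square)
  qed
  have Zm: "(\<lambda>e. Z k e) \<in> borel_measurable (PiM {..<k} (\<lambda>_. gauss))" for k
  proof -
    have "i < k ==> (\<lambda>e. e i) \<in> borel_measurable (PiM {..<k} (\<lambda>_. gauss))" for i
      using measurable_component_singleton[of i "{..<k}" "\<lambda>_. gauss"] by simp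
    then show ?thesis unfolding Z_def
      by (intro borel_measurable_sum borel_measurable_add borel_measurable_times borel_measurable_diff borel_measurable_power borel_measurable_const) auto
  qed
  have main: "(\<integral>\<^sup>+e. ennreal ((Z n e)^2) \<partial>PiM {..<n} (\<lambda>_. gauss))
     = ennreal (\<Sum>i<n. 4 * (a i)^2 + 4 * (\<Sum>j<i. (B i j)^2) + 2 * (B i i)^2)" for n
  proof (induction n)
    case 0
    show ?case by (simp add: PiM_empty nn_integral_count_space_finite Z_def)
  next
    case (Suc n)
    interpret G: prob_space gauss by (rule prob_space_gauss)
    interpret product_sigma_finite "\<lambda>_. gauss" ..
    interpret GI: prob_space "PiM {..<n} (\<lambda>_. gauss)" by (rule prob_space_PiM) (rule prob_space_gauss)
    let ?l = "\<lambda>e. 2 * a n + (\<Sum>j<n. (2 * B n j) * e j)"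
    have lm: "?l \<in> borel_measurable (PiM {..<n} (\<lambda>_. gauss))"
    proof -
      have "i < n ==> (\<lambda>e. e i) \<in> borel_measurable (PiM {..<n} (\<lambda>_. gauss))" for i
        using measurable_component_singleton[of i "{..<n}" "\<lambda>_. gauss"] by simp
      then show ?thesis by (intro borel_measurable_add borel_measurable_const borel_measurable_sum borel_measurable_times) auto
    qed
    have Zup: "Z (Suc n) (e(n := t)) = Z n e + t * ?l e + (t^2 - 1) * B n n" for e t
    proof -
      have "Z n (e(n := t)) = Z n e" unfolding Z_def by (intro sum.cong) auto
      then show ?thesis by (simp add: Z_def sum_distrib_left mult.assoc)
    qed
    have "(\<integral>\<^sup>+e. ennreal ((Z (Suc n) e)^2) \<partial>PiM {..<Suc n} (\<lambda>_. gauss)) =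
      (\<integral>\<^sup>+e. \<integral>\<^sup>+t. ennreal ((Z (Suc n) (e(n := t)))^2) \<partial>gauss \<partial>PiM {..<n} (\<lambda>_. gauss))"
      unfolding lessThan_Suc using Zm[of "Suc n"]
      by (intro product_nn_integral_insert) (auto simp: lessThan_Suc[symmetric])
    also have "\<dots> = (\<integral>\<^sup>+e. ennreal ((Z n e)^2) + ennreal ((?l e)^2) + ennreal (2 * (B n n)^2) \<partial>PiM {..<n} (\<lambda>_. gauss))"
      unfolding Zup gauss_quadratic by simp
    also have "\<dots> = (\<integral>\<^sup>+e. ennreal ((Z n e)^2) \<partial>PiM {..<n} (\<lambda>_. gauss)) + (\<integral>\<^sup>+e. ennreal ((?l e)^2) \<partial>PiM {..<n} (\<lambda>_. gauss)) + ennreal (2 * (B n n)^2)"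
      using Zm[of n] lm by (subst nn_integral_add, simp, simp, subst nn_integral_add) (auto simp: GI.emeasure_space_1)
    also have "\<dots> = ennreal ((\<Sum>i<n. 4 * (a i)^2 + 4 * (\<Sum>j<i. (B i j)^2) + 2 * (B i i)^2)) + ennreal ((2 * a n)^2 + (\<Sum>j<n. (2 * B n j)^2)) + ennreal (2 * (B n n)^2)"
      unfolding Suc gauss_linear ..
    also have "\<dots> = ennreal ((\<Sum>i<n. 4 * (a i)^2 + 4 * (\<Sum>j<i. (B i j)^2) + 2 * (B i i)^2) + ((2 * a n)^2 + (\<Sum>j<n. (2 * B n j)^2)) + 2 * (B n n)^2)"
      by (simp add: ennreal_plus[symmetric] sum_nonneg add_nonneg_nonneg del: ennreal_plus)
    finally show ?case by (simp add: power_mult_distrib sum_distrib_left add.assoc)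
  qed
  have "(\<Sum>i<n. \<Sum>j<n. (B i j)^2) = (\<Sum>i<n. (B i i)^2 + 2 * (\<Sum>j<i. (B i j)^2))"
    by (rule sum_symmetric_split) (use sym in simp)
  then have "4 * (\<Sum>i<n. (a i)^2) + 2 * (\<Sum>i<n. \<Sum>j<n. (B i j)^2) = (\<Sum>i<n. 4 * (a i)^2 + 4 * (\<Sum>j<i. (B i j)^2) + 2 * (B i i)^2)"
    by (simp add: sum.distrib sum_distrib_left)
  then show ?thesis unfolding Zeq main by simp
qed

text \<open>The exponential Markov inequality, kept general in c so that c = 1 serves the upper and
  c = -1 the lower tail; 1 + x <= exp x replaces the binomial by a Poisson exponent.\<close>

lemma (in prob_space) chernoff_count:
  fixes c :: real and n :: nat
  assumes S: "S \<in> sets M" and c: "c * y \<ge> 0"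
  shows "emeasure (PiM {..<n} (\<lambda>_. M)) {x \<in> space (PiM {..<n} (\<lambda>_. M)). y \<le> c * (\<Sum>i<n. indicator S (x i))}
     \<le> ennreal (exp (real n * prob S * (exp c - 1) - y))"
proof -
  interpret product_sigma_finite "\<lambda>_. M" ..
  let ?P = "PiM {..<n} (\<lambda>_. M)"
  have cm: "i < n ==> (\<lambda>x. x i) \<in> ?P \<rightarrow>\<^sub>M M" for i by (rule measurable_component_singleton) simp
  have im: "i < n ==> (\<lambda>x. indicator S (x i) :: real) \<in> borel_measurable ?P" for i
    by (rule measurable_compose[OF cm borel_measurable_indicator[OF S]])
  let ?N = "\<lambda>x. \<Sum>i<n. indicator S (x i) :: real"
  have Nm: "?N \<in> borel_measurable ?P" using im by (intro borel_measurable_sum) auto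
  have "emeasure ?P {x \<in> space ?P. y \<le> c * ?N x} = (\<integral>\<^sup>+x. indicator {x \<in> space ?P. y \<le> c * ?N x} x \<partial>?P)"
    by (rule nn_integral_indicator[symmetric])
      (rule borel_measurable_le[OF borel_measurable_const borel_measurable_times[OF borel_measurable_const Nm]])
  also have "\<dots> \<le> (\<integral>\<^sup>+x. ennreal (exp (- y)) * (\<Prod>i<n. ennreal (exp (c * indicator S (x i)))) \<partial>?P)"
  proof (rule nn_integral_mono)
    fix x
    have "(\<Prod>i<n. ennreal (exp (c * indicator S (x i)))) = ennreal (exp (c * ?N x))"
      by (simp add: prod_ennreal exp_sum[symmetric] sum_distrib_left)
    then have "ennreal (exp (- y)) * (\<Prod>i<n. ennreal (exp (c * indicator S (x i)))) = ennreal (exp (c * ?N x - y))"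
      by (simp add: ennreal_mult'[symmetric] exp_add[symmetric] del: ennreal_mult'')
    moreover have "indicator {x \<in> space ?P. y \<le> c * ?N x} x \<le> ennreal (exp (c * ?N x - y))"
      by (auto simp: indicator_def)
    ultimately show "indicator {x \<in> space ?P. y \<le> c * ?N x} x \<le> ennreal (exp (- y)) * (\<Prod>i<n. ennreal (exp (c * indicator S (x i))))"
      by simp
  qed
  also have "\<dots> = ennreal (exp (- y)) * (\<integral>\<^sup>+x. (\<Prod>i<n. ennreal (exp (c * indicator S (x i)))) \<partial>?P)"
  proof (rule nn_integral_cmult)
    show "(\<lambda>x. \<Prod>i<n. ennreal (exp (c * indicator S (x i)))) \<in> borel_measurable ?P"
    proof (intro borel_measurable_prod_ennreal)
      fix i assume "i \<in> {..<n}"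
      then have [measurable]: "(\<lambda>x. indicator S (x i) :: real) \<in> borel_measurable ?P" using im by simp
      show "(\<lambda>x. ennreal (exp (c * indicator S (x i)))) \<in> borel_measurable ?P" by measurable
    qed
  qed
  also have "(\<integral>\<^sup>+x. (\<Prod>i<n. ennreal (exp (c * indicator S (x i)))) \<partial>?P) = (\<Prod>i<n. \<integral>\<^sup>+x. ennreal (exp (c * indicator S x)) \<partial>M)"
    using S by (intro product_nn_integral_prod) auto
  also have "(\<integral>\<^sup>+x. ennreal (exp (c * indicator S x)) \<partial>M) = ennreal (1 + prob S * (exp c - 1))"
  proof -
    have "exp (c * indicator S x) = 1 + (exp c - 1) * indicator S x" for x by (simp add: indicator_def)
    moreover have "integrable M (\<lambda>x. 1 + (exp c - 1) * indicator S x)" using S by (auto simp: emeasure_eq_measure)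
    moreover have "expectation (\<lambda>x. 1 + (exp c - 1) * indicator S x) = 1 + (exp c - 1) * prob S"
      using S by (subst Bochner_Integration.integral_add) (auto simp: prob_space emeasure_eq_measure)
    moreover have "0 \<le> 1 + (exp c - 1) * indicator S x" for x by (simp add: indicator_def)
    ultimately show ?thesis by (simp add: nn_integral_eq_integral mult.commute)
  qed
  also have "ennreal (exp (- y)) * (\<Prod>i<n. ennreal (1 + prob S * (exp c - 1))) \<le> ennreal (exp (- y)) * ennreal (exp (real n * prob S * (exp c - 1)))"
  proof (rule mult_left_mono)
    have "prob S * (1 - exp c) \<le> prob S * 1" by (rule mult_left_mono) auto
    then have nn: "0 \<le> 1 + prob S * (exp c - 1)"
      using prob_le_1[of S] mult_nonneg_nonneg[OF measure_nonneg[of M S] exp_ge_zero[of c]]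
      by (simp only: right_diff_distrib mult_1_right)
    have "(1 + prob S * (exp c - 1)) ^ n \<le> exp (prob S * (exp c - 1)) ^ n"
      using nn exp_ge_add_one_self by (intro power_mono) auto
    also have "\<dots> = exp (real n * prob S * (exp c - 1))" by (simp add: exp_of_nat_mult[symmetric] mult.assoc)
    finally show "(\<Prod>i<n. ennreal (1 + prob S * (exp c - 1))) \<le> ennreal (exp (real n * prob S * (exp c - 1)))"
      using nn by (simp add: ennreal_power ennreal_leI)
  qed simp
  also have "\<dots> = ennreal (exp (real n * prob S * (exp c - 1) - y))"
    by (simp add: ennreal_mult'[symmetric] exp_add[symmetric] del: ennreal_mult'')
  finally show ?thesis .
qed

text \<open>Each \<open>d k\<close> is the value of the nonnegative graph form at the k-th column of
  Q.\<close>

lemma laplacian_spectrum: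
  assumes K: "\<And>t. 0 \<le> t ==> 0 \<le> K t" and r: "0 < r"
  shows "\<exists>Q d. spectral_data n (laplacian K n r x) Q d \<and> (\<forall>k<n. 0 \<le> d k)"
proof -
  obtain Q d where Q: "Q \<in> carrier_mat n n" "transpose_mat Q * Q = 1\<^sub>m n"
      and L: "laplacian K n r x = Q * mat_diag n d * transpose_mat Q"
    using symmetric_spectral[OF laplacian_carrier laplacian_symmetric] by blast
  interpret spectral_data n "laplacian K n r x" Q d by standard (use Q L in auto)
  have "0 \<le> d k" if k: "k < n" for k
  proof -
    have "co (\<lambda>i. q i k) l = of_bool (l = k)" if "l < n" for l
      using q_cols[OF that k] by (simp add: co_def)
    then have "(\<Sum>l<n. d l * (co (\<lambda>i. q i k) l)^2) = (\<Sum>l<n. if l = k then d l else 0)"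
      by (intro sum.cong) auto
    also have "\<dots> = d k" using k by simp
    finally have "d k = (\<Sum>i<n. \<Sum>j<n. K (norm (x i - x j) / r) * (q i k - q j k)^2) / 2"
      using quad_form[of "\<lambda>i. q i k"] by (simp add: laplacian_quad_form)
    also have "0 \<le> \<dots>" using r K by (simp add: sum_nonneg)
    finally show ?thesis .
  qed
  then show ?thesis using spectral_data_axioms by blast
qed

text \<open>Chebyshev's inequality for the noise part of the statistic, whose mean is the first part of the threshold.\<close>

lemma type_II_error:
  fixes x :: "nat => real^'d::finite" and \<theta> :: "nat => real"
  assumes K: "\<And>t. 0 \<le> t ==> 0 \<le> K t" and r: "0 < r" and \<rho>: "0 < \<rho>" and n: "0 < n"
    and V: "(\<Sum>k = 1..n. 1 / (\<rho> * sorted_eigenvalue (laplacian K n r x) k + 1) ^ 4) \<le> V"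
    and A: "A \<le> (\<Sum>i<n. (\<theta> i)^2) / 2 - \<rho> * ((\<Sum>i<n. \<Sum>j<n. K (norm (x i - x j) / r) * (\<theta> i - \<theta> j)^2) / 2)"
    and pos: "0 < A" and large: "2 * sqrt (2 / \<alpha> * V) \<le> A" and \<alpha>: "0 < \<alpha>"
  shows "(\<integral>\<^sup>+e. ennreal (1 - laplacian_smoothing_test K n r \<rho> \<alpha> (\<lambda>i\<in>{0..<n}. (x i, \<theta> i + e i))) \<partial>PiM {0..<n} (\<lambda>_. gauss))
    \<le> ennreal (16 / A + 8 * V / A^2)"
proof -
  obtain Q d where "spectral_data n (laplacian K n r x) Q d" and d: "\<forall>k<n. 0 \<le> d k"
    using laplacian_spectrum[of K r n x] K r by blast
  then interpret spectral_data n "laplacian K n r x" Q d by simp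
  interpret smoothing n "laplacian K n r x" Q d \<rho> by standard (use \<rho> d in auto)
  note ev = sum_sorted_eigenvalue[OF Q L]
  define V' where "V' = (\<Sum>k<n. (s k) ^ 4)"
  have V': "V' \<le> V" "0 \<le> V'"
    using V unfolding ev[of "\<lambda>t. 1 / (\<rho> * t + 1) ^ 4"] V'_def s_def
    by (simp_all add: power_divide sum_nonneg)
  define S where "S = signal \<theta>"
  have S: "A \<le> S" using A signal_lower[of \<theta>] by (simp add: S_def laplacian_quad_form)
  define a where "a = (\<lambda>i. \<Sum>j<n. B i j * \<theta> j)"
  define Z where "Z = (\<lambda>e. 2 * (\<Sum>i<n. a i * e i) + (\<Sum>i<n. \<Sum>j<n. B i j * e i * e j) - (\<Sum>i<n. B i i))"
  have "ennreal (1 - laplacian_smoothing_test K n r \<rho> \<alpha> (\<lambda>i\<in>{0..<n}. (x i, \<theta> i + e i))) \<le> ennreal (4 / S^2) * ennreal ((Z e)^2)" for e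
  proof -
    define \<omega> where "\<omega> = (\<lambda>i\<in>{0..<n}. (x i, \<theta> i + e i))"
    \<comment> \<open>The restricted sample is undefined outside the index range, but the Laplacian
      reads only indices below n.\<close>
    have lap: "laplacian K n r (\<lambda>i. fst (\<omega> i)) = laplacian K n r x"
      by (rule eq_matI) (auto simp: laplacian_entry \<omega>_def carrier_matD[OF laplacian_carrier] intro!: sum.cong)
    have "laplacian_smoothing K n r \<rho> \<omega> = arg_min (\<lambda>f. (\<Sum>i<n. ((\<theta> i + e i) - vec_index f i)^2)
        + \<rho> * scalar_prod f (mult_mat_vec (laplacian K n r x) f)) (\<lambda>f. f \<in> carrier_vec n)"
      by (simp add: laplacian_smoothing_def lap) (simp add: \<omega>_def)
    then have "real n * test_statistic K n r \<rho> \<omega> = signal (\<lambda>i. \<theta> i + e i)"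
      using n by (simp add: test_statistic_def argmin_norm)
    then have T: "real n * test_statistic K n r \<rho> \<omega> = S + Z e + (\<Sum>k<n. (s k)^2)"
      unfolding signal_add by (simp add: S_def Z_def a_def B_trace)
    have "real n * test_threshold K n r \<rho> \<alpha> \<omega> = (\<Sum>k = 1..n. 1 / (\<rho> * sorted_eigenvalue (laplacian K n r x) k + 1) ^ 2)
       + sqrt (2 / \<alpha> * (\<Sum>k = 1..n. 1 / (\<rho> * sorted_eigenvalue (laplacian K n r x) k + 1) ^ 4))"
      using n by (simp add: test_threshold_def Let_def lap add_divide_distrib[symmetric])
    then have t: "real n * test_threshold K n r \<rho> \<alpha> \<omega> = (\<Sum>k<n. (s k)^2) + sqrt (2 / \<alpha> * V')"
      unfolding ev[of "\<lambda>t. 1 / (\<rho> * t + 1) ^ 4"] ev[of "\<lambda>t. 1 / (\<rho> * t + 1) ^ 2"] by (simp add: V'_def s_def power_divide)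
    show ?thesis
    proof (cases "test_statistic K n r \<rho> \<omega> > test_threshold K n r \<rho> \<alpha> \<omega>")
      case True
      then show ?thesis by (simp add: laplacian_smoothing_test_def \<omega>_def[symmetric])
    next
      case False
      then have "real n * test_statistic K n r \<rho> \<omega> \<le> real n * test_threshold K n r \<rho> \<alpha> \<omega>" by (intro mult_left_mono) auto
      then have "S + Z e \<le> sqrt (2 / \<alpha> * V')" unfolding T t by simp
      also have "\<dots> \<le> sqrt (2 / \<alpha> * V)" using V' \<alpha> by (intro real_sqrt_le_mono mult_left_mono) auto
      \<comment> \<open>Not rejecting means that the noise cancels at least half of the signal: the
        part of the threshold beyond the noise mean is at most A / 2, and A is at most S.\<close>
      finally have "S / 2 \<le> - Z e" using large S by linarith
      then have "(S / 2)^2 \<le> (- Z e)^2" using S pos by (intro power_mono) auto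
      then have "1 \<le> 4 / S^2 * (Z e)^2" using S pos by (simp add: field_simps power_divide)
      then show ?thesis using False
        by (simp add: laplacian_smoothing_test_def \<omega>_def[symmetric] ennreal_mult'[symmetric] del: ennreal_mult'')
    qed
  qed
  then have "(\<integral>\<^sup>+e. ennreal (1 - laplacian_smoothing_test K n r \<rho> \<alpha> (\<lambda>i\<in>{0..<n}. (x i, \<theta> i + e i))) \<partial>PiM {0..<n} (\<lambda>_. gauss))
     \<le> (\<integral>\<^sup>+e. ennreal (4 / S^2) * ennreal ((Z e)^2) \<partial>PiM {..<n} (\<lambda>_. gauss))"
    unfolding lessThan_atLeast0 by (rule nn_integral_mono)
  also have "\<dots> = ennreal (4 / S^2) * (\<integral>\<^sup>+e. ennreal ((Z e)^2) \<partial>PiM {..<n} (\<lambda>_. gauss))"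
  proof (rule nn_integral_cmult)
    have "i < n ==> (\<lambda>e. e i) \<in> borel_measurable (PiM {..<n} (\<lambda>_. gauss))" for i
      using measurable_component_singleton[of i "{..<n}" "\<lambda>_. gauss"] by simp
    then have "Z \<in> borel_measurable (PiM {..<n} (\<lambda>_. gauss))" unfolding Z_def
      by (intro borel_measurable_sum borel_measurable_add borel_measurable_times borel_measurable_diff borel_measurable_const) auto
    then show "(\<lambda>e. ennreal ((Z e)^2)) \<in> borel_measurable (PiM {..<n} (\<lambda>_. gauss))" by simp
  qed
  also have "(\<integral>\<^sup>+e. ennreal ((Z e)^2) \<partial>PiM {..<n} (\<lambda>_. gauss)) = ennreal (4 * (\<Sum>i<n. (a i)^2) + 2 * (\<Sum>i<n. \<Sum>j<n. (B i j)^2))"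
    unfolding Z_def by (rule gauss_quadratic_form) (rule B_sym)
  \<comment> \<open>The linear part of the variance is bounded by the signal; the quadratic part is
    the Frobenius norm of B, the sum of the fourth powers of \<open>s\<close>.\<close>
  also have "\<dots> \<le> ennreal (4 * S + 2 * V)"
    using signal_linear_coeff[of \<theta>] V' by (intro ennreal_leI) (simp add: a_def S_def V'_def B_frobenius)
  also have "ennreal (4 / S^2) * ennreal (4 * S + 2 * V) = ennreal (16 / S + 8 * V / S^2)"
    using S pos by (simp add: ennreal_mult'[symmetric] power2_eq_square field_simps del: ennreal_mult'')
  also have "\<dots> \<le> ennreal (16 / A + 8 * V / A^2)"
    using S pos V' by (intro ennreal_leI add_mono divide_left_mono power_mono mult_pos_pos) auto
  finally show ?thesis by (simp only: mult_left_mono zero_le)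
qed

text \<open>Induction on the number of layers: an eigenvalue between \<open>g l\<close> and
  \<open>g (Suc l)\<close> contributes at most \<open>h (g l)\<close>, those below
  \<open>g 0\<close> at most 1, and those beyond the last level are all charged
  \<open>h (g N)\<close>.\<close>

lemma sum_layers:
  fixes d :: "nat => real" and h :: "real => real"
  assumes h: "\<And>s t. 0 \<le> s ==> s \<le> t ==> h t \<le> h s" "\<And>t. 0 \<le> h t" "h 0 \<le> 1"
    and d: "\<And>k. k < n ==> 0 \<le> d k" and g: "\<And>l. 0 \<le> g l"
  shows "(\<Sum>k<n. h (d k)) \<le> real (card {k. k < n \<and> d k < g 0})
     + (\<Sum>l<N. real (card {k. k < n \<and> d k < g (Suc l)}) * h (g l)) + real n * h (g N)"
proof -
  have cnt: "(\<Sum>k<n. of_bool (d k < t)) = real (card {k. k < n \<and> d k < t})" for t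
    by (simp add: sum.If_cases of_bool_def Int_def)
  have "h (d k) \<le> of_bool (d k < g 0) + (\<Sum>l<N. of_bool (d k < g (Suc l)) * h (g l)) + h (g N)" if k: "k < n" for k
  proof (induction N)
    case 0
    show ?case
    proof (cases "d k < g 0")
      case True
      then show ?thesis using h(1)[of 0 "d k"] h(2)[of "g 0"] h(3) d[OF k] by auto
    next
      case False
      then show ?thesis using h(1)[of "g 0" "d k"] g by auto
    qed
  next
    case (Suc N)
    have nn: "0 \<le> (\<Sum>l<N. of_bool (d k < g (Suc l)) * h (g l))" using h(2) by (intro sum_nonneg) auto
    show ?case
    proof (cases "d k < g (Suc N)")
      case True
      then show ?thesis using Suc h(2)[of "g (Suc N)"] by simp
    next
      case False
      then have "h (d k) \<le> h (g (Suc N))" using h(1)[of "g (Suc N)" "d k"] g by auto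
      then show ?thesis using nn False by simp
    qed
  qed
  then have "(\<Sum>k<n. h (d k)) \<le> (\<Sum>k<n. of_bool (d k < g 0) + (\<Sum>l<N. of_bool (d k < g (Suc l)) * h (g l)) + h (g N))"
    by (intro sum_mono) auto
  also have "\<dots> = (\<Sum>k<n. of_bool (d k < g 0)) + (\<Sum>l<N. (\<Sum>k<n. of_bool (d k < g (Suc l))) * h (g l)) + real n * h (g N)"
    unfolding sum.distrib sum_distrib_right by (subst sum.swap) simp
  also have "\<dots> = real (card {k. k < n \<and> d k < g 0}) + (\<Sum>l<N. real (card {k. k < n \<and> d k < g (Suc l)}) * h (g l)) + real n * h (g N)"
    unfolding cnt ..
  finally show ?thesis .
qed

text \<open>Level g / 4 ^ j belongs to the coarse side 2 ^ j \<eta>. The lowest level in use has the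
  last J with 2 ^ J T \<eta> <= 1, that is, side about 1 / T, where the smoother begins to damp.
  From there on counts grow at most like 8 ^ l while the summands decay like 256 ^ -l, so the sum is
  of the order of the first count, T ^ m.\<close>

lemma power_sum_bound:
  fixes d :: "nat => real"
  assumes d: "\<And>k. k < n ==> 0 \<le> d k" and m: "m < 4" and T: "1 \<le> T" and \<eta>: "0 < \<eta>"
    and \<rho>: "0 < \<rho>" and g: "0 < g" and q: "0 < q" "q / (T * \<eta>)^2 \<le> \<rho> * g"
    and c1: "0 \<le> c1" "\<And>j. 2 ^ j * \<eta> \<le> 1 ==> real (card {k. k < n \<and> d k < g / 4 ^ j}) \<le> c1 / (2 ^ j * \<eta>) ^ m"
    and c2: "real n * (T * \<eta>) ^ 8 \<le> c2 * T ^ m" and small: "T * \<eta> \<le> 1"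
  shows "(\<Sum>k<n. 1 / (\<rho> * d k + 1) ^ 4) \<le> (8 * c1 + 128 * c1 / q ^ 4 + c2 / q ^ 4) * T ^ m"
proof -
  define h :: "real => real" where "h = (\<lambda>t. 1 / (\<rho> * max 0 t + 1) ^ 4)"
  have Te: "0 < T * \<eta>" using T \<eta> by simp
  obtain J0 where J0: "1 / (T * \<eta>) < 2 ^ J0" using real_arch_pow[of 2 "1 / (T * \<eta>)"] by auto
  define J where "J = (GREATEST j. 2 ^ j * (T * \<eta>) \<le> 1)"
  have bd: "\<forall>j. 2 ^ j * (T * \<eta>) \<le> 1 --> j \<le> J0"
  proof (intro allI impI leI notI)
    fix j assume a: "2 ^ j * (T * \<eta>) \<le> 1" and "J0 < j"
    then have "(2::real) ^ J0 * (T * \<eta>) \<le> 2 ^ j * (T * \<eta>)" using Te by (intro mult_right_mono power_increasing) auto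
    then show False using a J0 Te by (simp add: field_simps)
  qed
  have J: "2 ^ J * (T * \<eta>) \<le> 1" unfolding J_def by (rule GreatestI_nat[of _ 0 J0]) (use small bd in auto)
  have J': "1 < 2 ^ Suc J * (T * \<eta>)"
    using Greatest_le_nat[of "\<lambda>j. 2 ^ j * (T * \<eta>) \<le> 1" "Suc J" J0] bd unfolding J_def by fastforce
  define G where "G = (\<lambda>l. g / 4 ^ (J - l))"
  have card: "real (card {k. k < n \<and> d k < G l}) \<le> 8 * c1 * T ^ m * 8 ^ l" if l: "l \<le> J" for l
  proof -
    have pw: "(2::real) ^ J = 2 ^ (J - l) * 2 ^ l" using l by (simp add: power_add[symmetric])
    have "2 ^ (J - l) * \<eta> \<le> 2 ^ J * (T * \<eta>)"
      using \<eta> T mult_mono[of \<eta> "T * \<eta>" "2 ^ (J - l)" "2 ^ J"] power_increasing[of "J - l" J "2::real"] by (simp add: mult.commute)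
    then have "real (card {k. k < n \<and> d k < G l}) \<le> c1 / (2 ^ (J - l) * \<eta>) ^ m"
      unfolding G_def using c1(2)[of "J - l"] J by linarith
    also have "\<dots> = c1 * (1 / (2 ^ (J - l) * \<eta>)) ^ m" by (simp add: power_divide)
    also have "\<dots> \<le> c1 * (T * (2 * 2 ^ l)) ^ m"
    proof (intro mult_left_mono power_mono c1(1))
      show "1 / (2 ^ (J - l) * \<eta>) \<le> T * (2 * 2 ^ l)" using J' \<eta> pw by (simp add: field_simps)
    qed (use \<eta> in auto)
    \<comment> \<open>m <= 3 allows one geometric rate 8 ^ l for all dimensions.\<close>
    also have "\<dots> \<le> c1 * (T ^ m * (2 * 2 ^ l) ^ 3)"
      unfolding power_mult_distrib[of T]
      using m T c1(1) order_trans[OF one_le_power[of "2::real" l], of "2 * 2 ^ l"] by (intro mult_left_mono power_increasing) auto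
    also have "((2::real) * 2 ^ l) ^ 3 = 8 * 8 ^ l" by (simp add: power_mult_distrib power_mult[symmetric] mult.commute[of l]) (simp add: power_mult)
    finally show ?thesis by (simp add: mult_ac)
  qed
  have hG: "h (G l) \<le> 1 / q ^ 4 / 256 ^ l" if l: "l \<le> J" for l
  proof -
    have "q * 4 ^ l \<le> \<rho> * G l"
    proof -
      have pw: "(4::real) ^ J = 4 ^ (J - l) * 4 ^ l" using l by (simp add: power_add[symmetric])
      have "(2 ^ J * (T * \<eta>))^2 \<le> 1" using J Te by (intro power_le_one) auto
      then have "4 ^ J * (T * \<eta>)^2 \<le> 1" by (simp add: power_mult_distrib power_mult[symmetric] mult.commute[of J]) (simp add: power_mult)
      then have "q * 4 ^ l * (4 ^ (J - l) * (T * \<eta>)^2) \<le> q * 1" using q(1) pw by (simp add: mult_ac)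
      then have "q * 4 ^ l * 4 ^ (J - l) \<le> q / (T * \<eta>)^2" 
        using pos_le_divide_eq[of "(T * \<eta>)^2"] zero_less_power[OF Te, of 2] by (metis mult.assoc mult_1_right)
      then show ?thesis using q(2) by (simp add: G_def pos_le_divide_eq)
    qed
    then have "(q * 4 ^ l) ^ 4 \<le> (\<rho> * max 0 (G l) + 1) ^ 4" using q(1) g by (intro power_mono) (auto simp: G_def)
    moreover have "((4::real) ^ l) ^ 4 = 256 ^ l" by (simp add: power_mult[symmetric] mult.commute[of l]) (simp add: power_mult)
    moreover have "0 < q ^ 4 * 256 ^ l" using q(1) by simp
    ultimately show ?thesis unfolding h_def by (simp add: power_mult_distrib frac_le)
  qed
  have "(\<Sum>k<n. h (d k)) \<le> real (card {k. k < n \<and> d k < G 0})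
     + (\<Sum>l<J. real (card {k. k < n \<and> d k < G (Suc l)}) * h (G l)) + real n * h (G J)"
  proof (rule sum_layers)
    fix s t :: real assume "0 \<le> s" "s \<le> t"
    then show "h t \<le> h s" unfolding h_def using \<rho> by (intro divide_left_mono power_mono mult_pos_pos zero_less_power) (auto simp: add_nonneg_pos)
  qed (use d g \<rho> in \<open>auto simp: h_def G_def\<close>)
  also have "\<dots> \<le> 8 * c1 * T ^ m + (\<Sum>l<J. 64 * c1 / q ^ 4 * T ^ m * (1 / 2) ^ l) + c2 / q ^ 4 * T ^ m"
  proof (intro add_mono sum_mono)
    show "real (card {k. k < n \<and> d k < G 0}) \<le> 8 * c1 * T ^ m" using card[of 0] by simp
  next
    fix l assume "l \<in> {..<J}"
    then have l: "Suc l \<le> J" "l \<le> J" by auto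
    have "real (card {k. k < n \<and> d k < G (Suc l)}) * h (G l) \<le> (8 * c1 * T ^ m * 8 ^ Suc l) * (1 / q ^ 4 / 256 ^ l)"
      using c1 T \<rho> by (intro mult_mono card[OF l(1)] hG[OF l(2)]) (auto simp: h_def)
    also have "\<dots> = 64 * c1 / q ^ 4 * T ^ m * (8 ^ l / 256 ^ l)" by simp
    \<comment> \<open>8 / 256 is well below 1 / 2; the coarser ratio sums to at most 2, and 2 * 64
      gives the 128 of the claim.\<close>
    also have "\<dots> \<le> 64 * c1 / q ^ 4 * T ^ m * (1 / 2) ^ l"
      unfolding power_divide[symmetric] using c1 T by (intro mult_left_mono power_mono) auto
    finally show "real (card {k. k < n \<and> d k < G (Suc l)}) * h (G l) \<le> 64 * c1 / q ^ 4 * T ^ m * (1 / 2) ^ l" .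
  next
    \<comment> \<open>No count is available above g, the level of the finest cells; all n
      eigenvalues are charged (T \<eta>) ^ 8 / q ^ 4, and \<open>c2\<close> pays for them.\<close>
    have "G J = g" by (simp add: G_def)
    have "q / (T * \<eta>)^2 \<le> \<rho> * max 0 g + 1" using q g by simp
    then have "(q / (T * \<eta>)^2) ^ 4 \<le> (\<rho> * max 0 g + 1) ^ 4" using q by (intro power_mono) auto
    then have "h g \<le> 1 / (q / (T * \<eta>)^2) ^ 4" unfolding h_def
      using q T \<eta> g \<rho> by (intro divide_left_mono mult_pos_pos zero_less_power divide_pos_pos add_nonneg_pos) auto
    also have "\<dots> = (T * \<eta>) ^ 8 / q ^ 4" by (simp add: power_divide power_mult[symmetric])
    finally have "real n * h g \<le> real n * ((T * \<eta>) ^ 8 / q ^ 4)" by (rule mult_left_mono) simp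
    also have "\<dots> \<le> c2 * T ^ m / q ^ 4" using c2 q by (simp add: divide_right_mono)
    finally show "real n * h (G J) \<le> c2 / q ^ 4 * T ^ m" using \<open>G J = g\<close> by simp
  qed
  also have "(\<Sum>l<J. 64 * c1 / q ^ 4 * T ^ m * (1 / 2) ^ l) \<le> 64 * c1 / q ^ 4 * T ^ m * 2"
    unfolding sum_distrib_left[symmetric] using c1 T q(1)
    by (intro mult_left_mono) (auto simp: sum_gp_strict)
  finally have "(\<Sum>k<n. h (d k)) \<le> (8 * c1 + 128 * c1 / q ^ 4 + c2 / q ^ 4) * T ^ m" by (simp add: algebra_simps)
  moreover have "(\<Sum>k<n. h (d k)) = (\<Sum>k<n. 1 / (\<rho> * d k + 1) ^ 4)" using d by (intro sum.cong) (auto simp: h_def)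
  ultimately show ?thesis by simp
qed

section \<open>Random designs in a finite atlas\<close>

text \<open>Volume comparison: the cells are disjoint, of equal volume, and contained in a slightly
  larger ball. The bound for finite subfamilies already shows that the family is finite.\<close>

lemma card_cells:
  fixes z :: "'e::euclidean_space"
  assumes e: "0 < \<eta>" "real DIM('e) * \<eta> \<le> \<delta>"
  shows "finite (cell \<eta> ` cball z R)" and "real (card (cell \<eta> ` cball z R)) * \<eta> ^ DIM('e) \<le> measure lborel (cball z (R + \<delta>))"
proof -
  let ?v = "measure lborel (cball z (R + \<delta>))"
  have *: "real (card G) * \<eta> ^ DIM('e) \<le> ?v" if G: "finite G" "G \<subseteq> cell \<eta> ` cball z R" for G
  proof -
    have "(\<Sum>Q\<in>G. measure lborel Q) = measure lborel (\<Union>G)"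
    proof (rule measure_Union'[symmetric])
      show "finite G" by fact
      fix Q assume "Q \<in> G"
      then show "Q \<in> fmeasurable lborel" using G(2) e
        by (auto simp: fmeasurable_def emeasure_cell)
    next
      show "pairwise disjnt G"
        unfolding pairwise_def disjnt_def
      proof (intro ballI impI)
        fix Q Q' assume Q: "Q \<in> G" "Q' \<in> G" "Q \<noteq> Q'"
        then obtain u u' where "Q = cell \<eta> u" "Q' = cell \<eta> u'" using G(2) by blast
        then show "Q \<inter> Q' = {}" using Q(3) cell_eq by blast
      qed
    qed
    also have "\<dots> \<le> ?v"
    proof (rule measure_mono_fmeasurable)
      show "\<Union>G \<subseteq> cball z (R + \<delta>)"
      proof
        fix w assume "w \<in> \<Union>G"
        then obtain u where u: "u \<in> cball z R" "w \<in> cell \<eta> u" using G(2) by blast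
        then have "norm (u - w) \<le> \<delta>" using norm_diff_cell[OF e(1) cell_self u(2)] e(2) by linarith
        then show "w \<in> cball z (R + \<delta>)" using u(1) dist_triangle[of z w u] by (auto simp: dist_norm)
      qed
      show "\<Union>G \<in> sets lborel" using G by (intro sets.finite_Union) auto
    qed (use emeasure_lborel_cball_finite in \<open>auto simp: fmeasurable_def\<close>)
    finally have "(\<Sum>Q\<in>G. measure lborel Q) \<le> ?v" .
    moreover have "measure lborel Q = \<eta> ^ DIM('e)" if "Q \<in> G" for Q
      using G(2) that e by (auto simp: measure_def emeasure_cell)
    ultimately show ?thesis by simp
  qed
  obtain N :: nat where N: "?v / \<eta> ^ DIM('e) \<le> real N" using real_arch_simple by blast
  show f: "finite (cell \<eta> ` cball z R)"
  proof (rule ccontr)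
    assume "infinite (cell \<eta> ` cball z R)"
    then obtain G where G: "finite G" "card G = Suc N" "G \<subseteq> cell \<eta> ` cball z R"
      using infinite_arbitrarily_large by blast
    have "real (Suc N) \<le> ?v / \<eta> ^ DIM('e)" using *[OF G(1,3)] G(2) e by (simp add: pos_le_divide_eq)
    then show False using N by simp
  qed
  show "real (card (cell \<eta> ` cball z R)) * \<eta> ^ DIM('e) \<le> ?v" using *[OF f] by simp
qed

text \<open>What the probabilistic part uses of the manifold: finitely many bi-Lipschitz charts in
  which P and Lebesgue measure agree up to the factor k. Derivatives of the charts no longer
  occur.\<close>

locale atlas = prob_space P for P :: "(real^'d::finite) measure" +
  fixes A :: "'a set" and \<phi> :: "'a => real^'m::finite => real^'d" and c :: "'a => real^'m" and h :: "'a => real"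
    and L k :: real
  assumes A: "finite A" and h: "\<And>a. a \<in> A ==> 0 < h a" and L1: "1 \<le> L" and k: "1 \<le> k"
    and lip: "\<And>a u v. a \<in> A ==> u \<in> cball (c a) (3 * h a) ==> v \<in> cball (c a) (3 * h a) ==> norm (\<phi> a u - \<phi> a v) \<le> L * norm (u - v)"
    and inverse_lip: "\<And>a u v. a \<in> A ==> u \<in> cball (c a) (3 * h a) ==> v \<in> cball (c a) (3 * h a) ==> norm (u - v) \<le> L * norm (\<phi> a u - \<phi> a v)"
    and near: "\<And>a u y. a \<in> A ==> u \<in> cball (c a) (h a) ==> y \<in> space P ==> norm (\<phi> a u - y) \<le> inverse L ==> y \<in> \<phi> a ` cball (c a) (2 * h a)"
    and borel_P [measurable]: "(\<lambda>x. x) \<in> P \<rightarrow>\<^sub>M borel"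
    and cover: "\<And>x. x \<in> space P ==> \<exists>a\<in>A. x \<in> \<phi> a ` cball (c a) (h a)"
    and image_sets: "\<And>a D. a \<in> A ==> D \<in> sets borel ==> D \<subseteq> cball (c a) (3 * h a) ==> \<phi> a ` D \<in> sets P"
    and upper: "\<And>a D g. a \<in> A ==> D \<in> sets borel ==> D \<subseteq> cball (c a) (3 * h a) ==> g \<in> borel_measurable P ==>
       (\<integral>\<^sup>+x. g x * indicator (\<phi> a ` D) x \<partial>P) \<le> ennreal k * (NI u. g (\<phi> a u) * indicator D u)"
    and lower: "\<And>a D. a \<in> A ==> D \<in> sets borel ==> D \<subseteq> cball (c a) (3 * h a) ==> emeasure lborel D \<le> ennreal k * emeasure P (\<phi> a ` D)"
begin

text \<open>t = 1 gives cells whose images cover X; t = 2 also includes the fine cells inside a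
  coarse cell that reaches out of the h-ball.\<close>

definition cells :: "real => real => ('a \<times> (real^'m) set) set" where
  "cells t s = (SIGMA a:A. cell s ` cball (c a) (t * h a))"

definition total_volume :: real where "total_volume = (\<Sum>a\<in>A. measure lborel (cball (c a) (3 * h a)))"

text \<open>Apart from lying in X, this is all that the spectral argument asks of the design
  points.\<close>

definition good :: "nat => real => real => real => (nat => real^'d) => bool" where
  "good n \<eta> lo hi x \<longleftrightarrow> (\<forall>(a, Q)\<in>cells 2 \<eta>. lo \<le> (\<Sum>i<n. indicator (\<phi> a ` Q) (x i)) \<and> (\<Sum>i<n. indicator (\<phi> a ` Q) (x i)) \<le> hi)"

lemma inj_\<phi>: "a \<in> A ==> inj_on (\<phi> a) (cball (c a) (3 * h a))"
  using inverse_lip by (force intro!: inj_onI)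

lemma cell_subset:
  assumes "a \<in> A" "0 < s" "real CARD('m) * s \<le> h a" "u \<in> cball (c a) (t * h a)"
  shows "cell s u \<subseteq> cball (c a) ((t + 1) * h a)"
proof
  fix w assume "w \<in> cell s u"
  then have "norm (u - w) \<le> h a" using norm_diff_cell[OF assms(2) cell_self, of w u] assms(3) by simp
  then show "w \<in> cball (c a) ((t + 1) * h a)" using assms(4) dist_triangle[of "c a" w u]
    by (auto simp: dist_norm distrib_right)
qed

lemma cells_D:
  assumes "(a, Q) \<in> cells t s" "0 < s" "\<forall>a\<in>A. real CARD('m) * s \<le> h a" "t \<le> 2"
  shows "a \<in> A" "Q \<in> sets borel" "Q \<subseteq> cball (c a) (3 * h a)" "emeasure lborel Q = ennreal (s ^ CARD('m))"
proof -
  obtain u where u: "a \<in> A" "u \<in> cball (c a) (t * h a)" "Q = cell s u" using assms(1) by (auto simp: cells_def)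
  have "Q \<subseteq> cball (c a) ((t + 1) * h a)" using cell_subset[OF u(1) assms(2) bspec[OF assms(3) u(1)] u(2)] u by simp
  also have "\<dots> \<subseteq> cball (c a) (3 * h a)" using h[OF u(1)] assms(4) by (intro subset_cball mult_right_mono) auto
  finally show "Q \<subseteq> cball (c a) (3 * h a)" .
  show "a \<in> A" "Q \<in> sets borel" "emeasure lborel Q = ennreal (s ^ CARD('m))" using u emeasure_cell[OF assms(2), of u] by auto
qed

lemma finite_cells:
  assumes "0 < s" "\<forall>a\<in>A. real CARD('m) * s \<le> h a" "t \<le> 2"
  shows "finite (cells t s)" "real (card (cells t s)) * s ^ CARD('m) \<le> total_volume"
proof -
  have f: "finite (cell s ` cball (c a) (t * h a))" if "a \<in> A" for a
    using card_cells(1)[of s "h a" "c a"] assms(1,2) that by simp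
  then show "finite (cells t s)" unfolding cells_def using A by (intro finite_SigmaI) auto
  have "real (card (cells t s)) * s ^ CARD('m) = (\<Sum>a\<in>A. real (card (cell s ` cball (c a) (t * h a))) * s ^ CARD('m))"
    unfolding cells_def using A f by (simp add: sum_distrib_right)
  also have "\<dots> \<le> total_volume" unfolding total_volume_def
  proof (rule sum_mono)
    fix a assume a: "a \<in> A"
    have "real (card (cell s ` cball (c a) (t * h a))) * s ^ CARD('m) \<le> measure lborel (cball (c a) (t * h a + h a))"
      using card_cells(2)[of s "h a" "c a"] assms(1,2) a by simp
    also have "\<dots> \<le> measure lborel (cball (c a) (3 * h a))"
    proof (rule measure_mono_fmeasurable)
      have "t * h a \<le> 2 * h a" using assms(3) h[OF a] by (intro mult_right_mono) auto
      then show "cball (c a) (t * h a + h a) \<subseteq> cball (c a) (3 * h a)" by (intro subset_cball) simp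
    qed (use emeasure_lborel_cball_finite in \<open>auto simp: fmeasurable_def\<close>)
    finally show "real (card (cell s ` cball (c a) (t * h a))) * s ^ CARD('m) \<le> measure lborel (cball (c a) (3 * h a))" .
  qed
  finally show "real (card (cells t s)) * s ^ CARD('m) \<le> total_volume" .
qed

text \<open>Within one chart the cells are disjoint and the chart is injective, so each chart
  contributes at most one cell containing the point.\<close>

lemma occupancy:
  assumes "0 < s" "\<forall>a\<in>A. real CARD('m) * s \<le> h a" "t \<le> 2"
  shows "(\<Sum>(a, Q)\<in>cells t s. indicator (\<phi> a ` Q) y :: real) \<le> real (card A)"
proof -
  let ?S = "{(a, Q)\<in>cells t s. y \<in> \<phi> a ` Q}"
  have fin: "finite ?S" using finite_cells(1)[OF assms] by (rule rev_finite_subset) auto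
  have "(\<Sum>(a, Q)\<in>cells t s. indicator (\<phi> a ` Q) y :: real) = (\<Sum>(a, Q)\<in>?S. 1)"
    using finite_cells(1)[OF assms] by (intro sum.mono_neutral_cong_right) (auto simp: indicator_def)
  also have "\<dots> = real (card ?S)" by (simp add: split_beta')
  also have "card ?S \<le> card A"
  proof (rule card_inj_on_le[where f = fst])
    show "inj_on fst ?S"
    proof (rule inj_onI)
      fix p q assume p: "p \<in> ?S" "q \<in> ?S" "fst p = fst q"
      obtain a Q Q' where pq: "p = (a, Q)" "q = (a, Q')" using p(3) by (cases p, cases q) auto
      have Q: "(a, Q) \<in> cells t s" "y \<in> \<phi> a ` Q" "(a, Q') \<in> cells t s" "y \<in> \<phi> a ` Q'" using p(1,2) by (auto simp: pq)
      note D = cells_D[OF Q(1) assms] cells_D[OF Q(3) assms]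
      obtain u u' where u: "u \<in> Q" "u' \<in> Q'" "\<phi> a u = \<phi> a u'" using Q by (auto simp: image_iff)
      have "u = u'" by (rule inj_onD[OF inj_\<phi>[OF D(1)] u(3)]) (use u D in auto)
      moreover have "Q = cell s u" "Q' = cell s u'" using Q(1,3) u(1,2) cell_eq by (auto simp: cells_def)
      ultimately show "p = q" by (simp add: pq)
    qed
    show "fst ` ?S \<subseteq> A" by (auto simp: cells_def)
  qed (rule A)
  finally show ?thesis by simp
qed

lemma prob_image_cell:
  assumes "(a, Q) \<in> cells t s" "0 < s" "\<forall>a\<in>A. real CARD('m) * s \<le> h a" "t \<le> 2"
  shows "\<phi> a ` Q \<in> sets P" "s ^ CARD('m) / k \<le> prob (\<phi> a ` Q)" "prob (\<phi> a ` Q) \<le> k * s ^ CARD('m)"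
proof -
  note D = cells_D[OF assms]
  show m: "\<phi> a ` Q \<in> sets P" by (rule image_sets[OF D(1-3)])
  have "ennreal (s ^ CARD('m)) \<le> ennreal (k * prob (\<phi> a ` Q))"
    using lower[OF D(1-3)] k by (simp add: D(4) emeasure_eq_measure ennreal_mult')
  then show "s ^ CARD('m) / k \<le> prob (\<phi> a ` Q)" using k by (simp add: pos_divide_le_eq mult.commute)
  have "(\<integral>\<^sup>+x. 1 * indicator (\<phi> a ` Q) x \<partial>P) \<le> ennreal k * (NI u. 1 * indicator Q u)"
    by (rule upper[OF D(1-3)]) (rule borel_measurable_const)
  then have "ennreal (prob (\<phi> a ` Q)) \<le> ennreal (k * s ^ CARD('m))"
    using m D k assms(2) by (simp add: emeasure_eq_measure ennreal_mult')
  then show "prob (\<phi> a ` Q) \<le> k * s ^ CARD('m)" using k assms(2) by simp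
qed

text \<open>A union bound over at most \<open>total_volume\<close> / \<eta> ^ m cells. The expected
  count is at least 4 \<open>lo\<close> and at most \<open>hi\<close> / 3. The factor 4 turns exp
  (-1) <= 1/2 into an exponent of at most -2 \<open>lo\<close> + \<open>lo\<close> for the lower
  tail, and exp 1 <= 3 makes the upper exponent at most minus the expected count.\<close>

lemma bad_probability:
  fixes n :: nat
  assumes \<eta>: "0 < \<eta>" "\<forall>a\<in>A. real CARD('m) * \<eta> \<le> h a"
  defines "lo \<equiv> real n * \<eta> ^ CARD('m) / (4 * k)" and "hi \<equiv> 3 * k * real n * \<eta> ^ CARD('m)"
  shows "{x \<in> space (PiM {..<n} (\<lambda>_. P)). \<not> good n \<eta> lo hi x} \<in> sets (PiM {..<n} (\<lambda>_. P))"
    and "emeasure (PiM {..<n} (\<lambda>_. P)) {x \<in> space (PiM {..<n} (\<lambda>_. P)). \<not> good n \<eta> lo hi x}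
      \<le> ennreal (2 * total_volume / \<eta> ^ CARD('m) * exp (- lo))"
proof -
  let ?M = "PiM {..<n} (\<lambda>_. P)"
  let ?N = "\<lambda>p x. \<Sum>i<n. indicator (\<phi> (fst p) ` snd p) (x i) :: real"
  let ?B = "\<lambda>p. {x \<in> space ?M. - lo \<le> (-1) * ?N p x} \<union> {x \<in> space ?M. hi \<le> 1 * ?N p x}"
  let ?bad = "{x \<in> space ?M. \<not> good n \<eta> lo hi x}"
  have nn: "0 \<le> lo" "0 \<le> hi" using k \<eta> by (simp_all add: lo_def hi_def)
  note fin = finite_cells[OF \<eta>, of 2, simplified]
  have Nm [measurable]: "?N p \<in> borel_measurable ?M" if p: "p \<in> cells 2 \<eta>" for p
  proof -
    have S: "\<phi> (fst p) ` snd p \<in> sets P" using prob_image_cell(1)[OF _ \<eta>, of "fst p" "snd p" 2] p by simp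
    have "i < n ==> (\<lambda>x. x i) \<in> ?M \<rightarrow>\<^sub>M P" for i by (rule measurable_component_singleton) simp
    then show ?thesis using S by (intro borel_measurable_sum measurable_compose[OF _ borel_measurable_indicator]) auto
  qed
  have bad: "?bad = (\<Union>p\<in>cells 2 \<eta>. {x \<in> space ?M. ?N p x < lo} \<union> {x \<in> space ?M. hi < ?N p x})"
    by (auto simp: good_def not_le split_beta')
  show "?bad \<in> sets ?M" unfolding bad using fin
    by (intro sets.finite_UN sets.Un) (auto intro!: borel_measurable_less Nm)
  have Bs: "?B p \<in> sets ?M" if "p \<in> cells 2 \<eta>" for p using Nm[OF that] by measurable
  have "emeasure ?M ?bad \<le> emeasure ?M (\<Union>p\<in>cells 2 \<eta>. ?B p)"
    unfolding bad by (intro emeasure_mono sets.finite_UN UN_mono Bs fin(1)) auto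
  also have "\<dots> \<le> (\<Sum>p\<in>cells 2 \<eta>. emeasure ?M (?B p))"
    by (intro emeasure_subadditive_finite image_subsetI Bs fin(1))
  also have "\<dots> \<le> (\<Sum>p\<in>cells 2 \<eta>. ennreal (2 * exp (- lo)))"
  proof (rule sum_mono)
    fix p assume p: "p \<in> cells 2 \<eta>"
    let ?S = "\<phi> (fst p) ` snd p"
    have S: "?S \<in> sets P" "\<eta> ^ CARD('m) / k \<le> prob ?S" "prob ?S \<le> k * \<eta> ^ CARD('m)"
      using prob_image_cell[OF _ \<eta>, of "fst p" "snd p" 2] p by auto
    have e1: "exp (-1) \<le> (1/2 :: real)" using exp_ge_add_one_self[of "1::real"] by (simp add: exp_minus field_simps)
    have e2: "exp 1 \<le> (3 :: real)" by (rule exp_le)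
    have lo4: "real n * (\<eta> ^ CARD('m) / k) = 4 * lo" using k by (simp add: lo_def)
    have "real n * (\<eta> ^ CARD('m) / k) \<le> real n * prob ?S" using S by (intro mult_left_mono) auto
    then have 1: "4 * lo \<le> real n * prob ?S" using lo4 by simp
    have "(real n * prob ?S) * (exp (-1) - 1) \<le> (real n * prob ?S) * (- 1/2)" using e1 by (intro mult_left_mono) auto
    then have a1: "real n * prob ?S * (exp (-1) - 1) - (- lo) \<le> - lo" using 1 by linarith
    have "real n * prob ?S \<le> real n * (k * \<eta> ^ CARD('m))" using S by (intro mult_left_mono) auto
    then have 2: "3 * (real n * prob ?S) \<le> hi" by (simp add: hi_def mult_ac)
    have "(real n * prob ?S) * (exp 1 - 1) \<le> (real n * prob ?S) * 2" using e2 by (intro mult_left_mono) auto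
    then have a2: "real n * prob ?S * (exp 1 - 1) - hi \<le> - lo" using 1 2 nn by linarith
    have "emeasure ?M (?B p) \<le> emeasure ?M {x \<in> space ?M. - lo \<le> (-1) * ?N p x} + emeasure ?M {x \<in> space ?M. hi \<le> 1 * ?N p x}"
      by (intro emeasure_subadditive borel_measurable_le borel_measurable_times borel_measurable_const Nm[OF p])
    also have "\<dots> \<le> ennreal (exp (real n * prob ?S * (exp (-1) - 1) - (- lo))) + ennreal (exp (real n * prob ?S * (exp 1 - 1) - hi))"
      using nn by (intro add_mono chernoff_count S(1)) auto
    also have "\<dots> \<le> ennreal (exp (- lo)) + ennreal (exp (- lo))"
      using a1 a2 by (intro add_mono ennreal_leI) auto
    also have "\<dots> = ennreal (2 * exp (- lo))" by (simp add: ennreal_plus[symmetric] del: ennreal_plus)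
    finally show "emeasure ?M (?B p) \<le> ennreal (2 * exp (- lo))" .
  qed
  also have "\<dots> = ennreal (real (card (cells 2 \<eta>)) * (2 * exp (- lo)))" by (simp add: ennreal_mult' ennreal_of_nat_eq_real_of_nat)
  also have "\<dots> \<le> ennreal (total_volume / \<eta> ^ CARD('m) * (2 * exp (- lo)))"
    using fin(2) \<eta> by (intro ennreal_leI mult_right_mono) (auto simp: pos_le_divide_eq)
  finally show "emeasure ?M ?bad \<le> ennreal (2 * total_volume / \<eta> ^ CARD('m) * exp (- lo))" by (simp add: mult_ac)
qed

end

section \<open>Small eigenvalues and the empirical norm on a good design\<close>

context atlas begin

text \<open>One linear constraint per coarse cell, a vanishing weighted mean, makes
  \<open>discrete_poincare\<close> available on that cell. Points within 3 m \<eta> in a chart are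
  within r in space and hence joined by an edge of weight at least \<kappa>, so the local
  inequalities add up to a spectral gap on the constrained vectors; overlaps cost a factor
  \<open>card A\<close>.\<close>

lemma card_small_eigenvalues:
  fixes x :: "nat => real^'d" and n :: nat
  assumes x: "\<And>i. i < n ==> x i \<in> space P" and good: "good n \<eta> lo hi x" and lo: "0 < lo" and hi: "0 < hi"
    and \<eta>: "0 < \<eta>" and l: "0 < (l::nat)" "\<forall>a\<in>A. real CARD('m) * (real l * \<eta>) \<le> h a"
    and K: "\<And>t. 0 \<le> t ==> 0 \<le> K t" "\<And>t. 0 \<le> t ==> t \<le> 1 ==> \<kappa> \<le> K t" and \<kappa>: "0 < \<kappa>"
    and r: "0 < r" "3 * real CARD('m) * \<eta> * L \<le> r"
    and sp: "spectral_data n (laplacian K n r x) Q d" and A0: "A \<noteq> {}"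
  shows "card {i. i < n \<and> d i < \<kappa> * lo^2 / (8 * real CARD('m) ^ (CARD('m) + 2) * hi * real (card A)) / (real l)^2}
     \<le> card (cells 1 (real l * \<eta>))"
proof -
  interpret spectral_data n "laplacian K n r x" Q d by fact
  define s where "s = real l * \<eta>"
  have s: "0 < s" "\<forall>a\<in>A. real CARD('m) * s \<le> h a" using l \<eta> by (simp_all add: s_def)
  note cD = cells_D[OF _ s, of _ _ 1, simplified]
  \<comment> \<open>Chart coordinates of the design points; they are used only for points in the
    image of the chart.\<close>
  define u where "u = (\<lambda>a i. inv_into (cball (c a) (3 * h a)) (\<phi> a) (x i))"
  define I where "I = (\<lambda>p. {i. i < n \<and> x i \<in> \<phi> (fst p) ` snd p})"
  have u: "u a i \<in> cball (c a) (3 * h a)" "\<phi> a (u a i) = x i" if "x i \<in> \<phi> a ` D" "D \<subseteq> cball (c a) (3 * h a)" for a i D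
  proof -
    have "x i \<in> \<phi> a ` cball (c a) (3 * h a)" using that by blast
    then show "u a i \<in> cball (c a) (3 * h a)" "\<phi> a (u a i) = x i" unfolding u_def
      by (rule inv_into_into, rule f_inv_into_f)
  qed
  have uQ: "u a i \<in> D" if a: "a \<in> A" and xD: "x i \<in> \<phi> a ` D" "D \<subseteq> cball (c a) (3 * h a)" for a i D
  proof -
    obtain v where v: "v \<in> D" "x i = \<phi> a v" using xD(1) by blast
    have "u a i = v" by (rule inj_onD[OF inj_\<phi>[OF a]]) (use u[OF xD] v xD(2) in auto)
    then show ?thesis using v by simp
  qed
  define C where "C = 4 * real CARD('m) ^ (CARD('m) + 2) * (hi / lo^2) * (real l)^2"
  have C: "0 < C" using hi lo l by (simp add: C_def)
  define e where "e = (\<lambda>f i j. of_bool (norm (x i - x j) \<le> r) * (f i - f j)^2 :: real)"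
  have e0: "0 \<le> e f i j" for f i j by (simp add: e_def)
  define w where "w = (\<lambda>p i. if i \<in> I p then 1 / cell_count \<eta> (u (fst p)) (I p) (u (fst p) i) else 0)"
  have local: "(\<Sum>i\<in>I p. (f i)^2) \<le> C * (\<Sum>i\<in>I p. \<Sum>j\<in>I p. e f i j)"
    if p: "p \<in> cells 1 s" and w0: "(\<Sum>i<n. w p i * f i) = 0" for p f
  proof -
    obtain a z where az: "a \<in> A" "z \<in> cball (c a) (h a)" "p = (a, cell s z)" using p by (auto simp: cells_def)
    have sub: "cell s z \<subseteq> cball (c a) (2 * h a)" using cell_subset[OF az(1) s(1) bspec[OF s(2) az(1)], of z 1] az(2) by simp
    have sub3: "cell s z \<subseteq> cball (c a) (3 * h a)"
      using sub h[OF az(1)] by (rule_tac order_trans[OF sub]) (intro subset_cball, simp)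
    \<comment> \<open>A fine cell of the coarse cell contains only points of \<open>I p\<close>, so
      its count is the count over the whole sample, the one that \<open>good\<close>
      controls.\<close>
    have cc: "cell_count \<eta> (u a) (I p) v = (\<Sum>i<n. indicator (\<phi> a ` cell \<eta> v) (x i))" if v: "v \<in> cell s z" for v
    proof -
      have vs: "cell \<eta> v \<subseteq> cell s z" using cell_nested[OF \<eta> l(1)] v unfolding s_def by blast
      have vs3: "cell \<eta> v \<subseteq> cball (c a) (3 * h a)" using vs sub3 by blast
      have "indicator (cell \<eta> (u a i)) v = (indicator (\<phi> a ` cell \<eta> v) (x i) :: real)" if i: "i \<in> I p" for i
      proof -
        have xi: "x i \<in> \<phi> a ` cell s z" using i az(3) by (simp add: I_def)
        have "v \<in> cell \<eta> (u a i) \<longleftrightarrow> x i \<in> \<phi> a ` cell \<eta> v"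
        proof
          assume "v \<in> cell \<eta> (u a i)"
          then have "u a i \<in> cell \<eta> v" by (simp add: cell_commute)
          then show "x i \<in> \<phi> a ` cell \<eta> v" using u(2)[OF xi sub3] by (metis imageI)
        next
          assume "x i \<in> \<phi> a ` cell \<eta> v"
          from uQ[OF az(1) this vs3] show "v \<in> cell \<eta> (u a i)" by (simp add: cell_commute)
        qed
        then show ?thesis by (simp add: indicator_def)
      qed
      then have "cell_count \<eta> (u a) (I p) v = (\<Sum>i\<in>I p. indicator (\<phi> a ` cell \<eta> v) (x i))" by (simp add: cell_count_def)
      also have "\<dots> = (\<Sum>i<n. indicator (\<phi> a ` cell \<eta> v) (x i))"
        using vs by (intro sum.mono_neutral_left) (auto simp: I_def az(3) indicator_def)
      finally show ?thesis .
    qed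
    have "(\<Sum>i\<in>I p. (f i)^2) \<le> 4 * real DIM(real^'m) ^ (DIM(real^'m) + 2) * (hi / lo^2) * (real l)^2 *
       (\<Sum>i\<in>I p. \<Sum>j\<in>I p. of_bool (norm (u a i - u a j) \<le> 3 * real DIM(real^'m) * \<eta>) * (f i - f j)^2)"
    proof (rule discrete_poincare[where z = z])
      show "finite (I p)" by (simp add: I_def)
      show "u a i \<in> cell (real l * \<eta>) z" if "i \<in> I p" for i
        using uQ[OF az(1) _ sub3, of i] that by (simp add: I_def az(3) s_def)
      fix v assume "v \<in> cell (real l * \<eta>) z"
      then have v: "v \<in> cell s z" by (simp add: s_def)
      have "(a, cell \<eta> v) \<in> cells 2 \<eta>" using v sub az(1) by (auto simp: cells_def)
      then show "lo \<le> cell_count \<eta> (u a) (I p) v" "cell_count \<eta> (u a) (I p) v \<le> hi"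
        using good unfolding cc[OF v] good_def by auto
    next
      have "(\<Sum>i\<in>I p. f i / cell_count \<eta> (u a) (I p) (u a i)) = (\<Sum>i<n. w p i * f i)"
        by (intro sum.mono_neutral_cong_left) (auto simp: I_def w_def az(3))
      then show "(\<Sum>i\<in>I p. f i / cell_count \<eta> (u a) (I p) (u a i)) = 0" using w0 by simp
    qed (use \<eta> l lo in auto)
    also have "\<dots> = C * (\<Sum>i\<in>I p. \<Sum>j\<in>I p. of_bool (norm (u a i - u a j) \<le> 3 * real CARD('m) * \<eta>) * (f i - f j)^2)"
      by (simp add: C_def)
    also have "\<dots> \<le> C * (\<Sum>i\<in>I p. \<Sum>j\<in>I p. e f i j)"
    proof (intro mult_left_mono sum_mono)
      fix i j assume ij: "i \<in> I p" "j \<in> I p"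
      then have xi: "x i \<in> \<phi> a ` cell s z" "x j \<in> \<phi> a ` cell s z" using az(3) by (auto simp: I_def)
      have "norm (x i - x j) \<le> L * norm (u a i - u a j)"
        using lip[OF az(1) u(1)[OF xi(1) sub3] u(1)[OF xi(2) sub3]] u(2)[OF xi(1) sub3] u(2)[OF xi(2) sub3] by simp
      moreover have "L * norm (u a i - u a j) \<le> L * (3 * real CARD('m) * \<eta>)" if "norm (u a i - u a j) \<le> 3 * real CARD('m) * \<eta>"
        using that L1 by (intro mult_left_mono) auto
      ultimately have "norm (x i - x j) \<le> r" if "norm (u a i - u a j) \<le> 3 * real CARD('m) * \<eta>"
        using that r by (simp add: mult_ac)
      then show "of_bool (norm (u a i - u a j) \<le> 3 * real CARD('m) * \<eta>) * (f i - f j)^2 \<le> e f i j"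
        unfolding e_def by (intro mult_right_mono) auto
    qed (use C in auto)
    finally show ?thesis .
  qed
  have fin: "finite (cells 1 s)" by (rule finite_cells(1)[OF s]) simp
  have occ: "(\<Sum>p\<in>cells 1 s. of_bool (i \<in> I p)) \<le> real (card A)" if "i < n" for i
    using occupancy[OF s, of 1 "x i"] that by (simp add: split_beta' I_def indicator_def of_bool_def)
  have cA: "0 < real (card A)" using A A0 by (simp add: card_gt_0_iff)
  \<comment> \<open>The 2 is the one in \<open>laplacian_quad_form\<close>, where the double sum
    counts each edge twice.\<close>
  have "card {i. i < n \<and> d i < \<kappa> / (2 * C * real (card A))} \<le> card (cells 1 s)"
  proof (rule card_eigenvalues_less[where w = w])
    fix f :: "nat => real" assume w0: "\<And>p. p \<in> cells 1 s ==> (\<Sum>i<n. w p i * f i) = 0"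
    let ?E = "\<Sum>i<n. \<Sum>j<n. e f i j"
    have "(\<Sum>i<n. (f i)^2) \<le> (\<Sum>i<n. \<Sum>p\<in>cells 1 s. of_bool (i \<in> I p) * (f i)^2)"
    proof (rule sum_mono)
      fix i assume "i \<in> {..<n}"
      then have i: "i < n" by simp
      obtain a z where az: "a \<in> A" "z \<in> cball (c a) (h a)" "x i = \<phi> a z" using cover[OF x[OF i]] by blast
      then have p: "(a, cell s z) \<in> cells 1 s" "i \<in> I (a, cell s z)" using i by (auto simp: cells_def I_def)
      have "(f i)^2 = of_bool (i \<in> I (a, cell s z)) * (f i)^2" using p by simp
      also have "\<dots> \<le> (\<Sum>p\<in>cells 1 s. of_bool (i \<in> I p) * (f i)^2)"
        by (rule member_le_sum[OF p(1) _ fin]) auto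
      finally show "(f i)^2 \<le> (\<Sum>p\<in>cells 1 s. of_bool (i \<in> I p) * (f i)^2)" .
    qed
    also have "\<dots> = (\<Sum>p\<in>cells 1 s. \<Sum>i\<in>I p. (f i)^2)"
      by (subst sum.swap) (intro sum.cong refl sum.mono_neutral_cong_right, auto simp: I_def)
    also have "\<dots> \<le> (\<Sum>p\<in>cells 1 s. C * (\<Sum>i\<in>I p. \<Sum>j\<in>I p. e f i j))"
      by (intro sum_mono local w0)
    also have "\<dots> \<le> C * (\<Sum>p\<in>cells 1 s. \<Sum>i<n. of_bool (i \<in> I p) * (\<Sum>j<n. e f i j))"
      unfolding sum_distrib_left[symmetric]
    proof (intro mult_left_mono sum_mono)
      fix p
      have "(\<Sum>i\<in>I p. \<Sum>j\<in>I p. e f i j) \<le> (\<Sum>i\<in>I p. \<Sum>j<n. e f i j)"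
        by (intro sum_mono sum_mono2) (auto simp: I_def e0)
      also have "\<dots> = (\<Sum>i<n. of_bool (i \<in> I p) * (\<Sum>j<n. e f i j))"
        by (intro sum.mono_neutral_cong_left) (auto simp: I_def)
      finally show "(\<Sum>i\<in>I p. \<Sum>j\<in>I p. e f i j) \<le> (\<Sum>i<n. of_bool (i \<in> I p) * (\<Sum>j<n. e f i j))" .
    qed (use C in auto)
    also have "\<dots> = C * (\<Sum>i<n. (\<Sum>p\<in>cells 1 s. of_bool (i \<in> I p)) * (\<Sum>j<n. e f i j))"
      by (subst sum.swap) (simp add: sum_distrib_right)
    also have "\<dots> \<le> C * (\<Sum>i<n. real (card A) * (\<Sum>j<n. e f i j))"
      using C by (intro mult_left_mono sum_mono mult_right_mono occ) (auto simp: sum_nonneg e0)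
    also have "\<dots> = C * real (card A) * ?E" by (simp add: sum_distrib_left mult.assoc)
    finally have 1: "(\<Sum>i<n. (f i)^2) \<le> C * real (card A) * ?E" .
    have "\<kappa> * ?E \<le> (\<Sum>i<n. \<Sum>j<n. K (norm (x i - x j) / r) * (f i - f j)^2)"
      unfolding sum_distrib_left
    proof (intro sum_mono)
      fix i j
      show "\<kappa> * e f i j \<le> K (norm (x i - x j) / r) * (f i - f j)^2"
        using K[of "norm (x i - x j) / r"] r(1) by (cases "norm (x i - x j) \<le> r") (auto simp: e_def intro!: mult_right_mono)
    qed
    then have 2: "\<kappa> / 2 * ?E \<le> (\<Sum>i<n. \<Sum>j<n. laplacian K n r x $$ (i, j) * f i * f j)"
      unfolding laplacian_quad_form by simp
    have "\<kappa> / (2 * C * real (card A)) * (\<Sum>i<n. (f i)^2) \<le> \<kappa> / (2 * C * real (card A)) * (C * real (card A) * ?E)"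
      using 1 \<kappa> C by (intro mult_left_mono) auto
    also have "\<dots> = \<kappa> / 2 * ?E" using C cA by simp
    finally show "\<kappa> / (2 * C * real (card A)) * (\<Sum>i<n. (f i)^2) \<le> (\<Sum>i<n. \<Sum>j<n. laplacian K n r x $$ (i, j) * f i * f j)"
      using 2 by linarith
  qed (rule fin)
  moreover have "\<kappa> / (2 * C * real (card A)) = \<kappa> * lo^2 / (8 * real CARD('m) ^ (CARD('m) + 2) * hi * real (card A)) / (real l)^2"
    using lo hi by (simp add: C_def mult_ac)
  ultimately show ?thesis by (simp add: s_def)
qed

definition pair_energy :: "(real^'d => real) => real => real^'d => ennreal" where
  "pair_energy f r x = (\<integral>\<^sup>+y. indicator (cball x r) y * ennreal ((f x - f y)^2) \<partial>P)"

text \<open>f(y)^2 <= 2 f(x)^2 + 2 (f(x) - f(y))^2 for y and a sample point x in the same cell,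
  summed over the at least \<open>lo\<close> sample points of that cell. This replaces a
  concentration bound for the empirical norm, which would ask for higher moments of f.\<close>

lemma empirical_norm_lower:
  assumes good: "good n \<eta> lo hi x" and lo: "0 < lo" and \<eta>: "0 < \<eta>" "\<forall>a\<in>A. real CARD('m) * \<eta> \<le> h a"
    and r: "real CARD('m) * \<eta> * L \<le> r" and f [measurable]: "f \<in> borel_measurable P"
  shows "ennreal lo * (\<integral>\<^sup>+y. ennreal ((f y)^2) \<partial>P) \<le> of_nat (card A) *
     (ennreal (2 * k * \<eta> ^ CARD('m)) * (\<Sum>i<n. ennreal ((f (x i))^2)) + 2 * (\<Sum>i<n. pair_energy f r (x i)))"
proof -
  let ?T = "\<lambda>i. ennreal (2 * k * \<eta> ^ CARD('m)) * ennreal ((f (x i))^2) + 2 * pair_energy f r (x i)"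
  let ?i = "\<lambda>p y. indicator (\<phi> (fst p) ` snd p) y :: ennreal"
  have fin: "finite (cells 1 \<eta>)" by (rule finite_cells(1)[OF \<eta>]) simp
  have S: "\<phi> (fst p) ` snd p \<in> sets P" if "p \<in> cells 1 \<eta>" for p
    using prob_image_cell(1)[OF _ \<eta>, of "fst p" "snd p" 1] that by simp
  have "(\<integral>\<^sup>+y. ennreal ((f y)^2) \<partial>P) \<le> (\<integral>\<^sup>+y. (\<Sum>p\<in>cells 1 \<eta>. ?i p y * ennreal ((f y)^2)) \<partial>P)"
  proof (rule nn_integral_mono)
    fix y assume "y \<in> space P"
    then obtain a z where az: "a \<in> A" "z \<in> cball (c a) (h a)" "y = \<phi> a z" using cover by blast
    then have p: "(a, cell \<eta> z) \<in> cells 1 \<eta>" by (auto simp: cells_def)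
    have "ennreal ((f y)^2) = ?i (a, cell \<eta> z) y * ennreal ((f y)^2)" using az by simp
    also have "\<dots> \<le> (\<Sum>p\<in>cells 1 \<eta>. ?i p y * ennreal ((f y)^2))" by (rule member_le_sum[OF p _ fin]) auto
    finally show "ennreal ((f y)^2) \<le> (\<Sum>p\<in>cells 1 \<eta>. ?i p y * ennreal ((f y)^2))" .
  qed
  also have "\<dots> = (\<Sum>p\<in>cells 1 \<eta>. \<integral>\<^sup>+y. ?i p y * ennreal ((f y)^2) \<partial>P)"
    using S by (intro nn_integral_sum) auto
  finally have "ennreal lo * (\<integral>\<^sup>+y. ennreal ((f y)^2) \<partial>P) \<le> ennreal lo * (\<Sum>p\<in>cells 1 \<eta>. \<integral>\<^sup>+y. ?i p y * ennreal ((f y)^2) \<partial>P)"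
    by (rule mult_left_mono) simp
  also have "\<dots> = (\<Sum>p\<in>cells 1 \<eta>. ennreal lo * (\<integral>\<^sup>+y. ?i p y * ennreal ((f y)^2) \<partial>P))" by (rule sum_distrib_left)
  also have "\<dots> \<le> (\<Sum>p\<in>cells 1 \<eta>. \<Sum>i<n. ?i p (x i) * ?T i)"
  proof (rule sum_mono)
    fix p assume p: "p \<in> cells 1 \<eta>"
    obtain a Q where aQ: "p = (a, Q)" by (cases p)
    note D = cells_D[OF p[unfolded aQ] \<eta>, simplified]
    obtain z where z: "z \<in> cball (c a) (h a)" "Q = cell \<eta> z" using p aQ by (auto simp: cells_def)
    have "z \<in> cball (c a) (2 * h a)" using z(1) h[OF D(1)] by auto
    then have "(a, Q) \<in> cells 2 \<eta>" using D(1) z(2) by (auto simp: cells_def)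
    then have "lo \<le> (\<Sum>i<n. indicator (\<phi> a ` Q) (x i))" using good by (auto simp: good_def)
    then have "ennreal lo \<le> (\<Sum>i<n. ?i p (x i))"
      by (simp add: aQ ennreal_indicator[symmetric] sum_ennreal ennreal_leI del: ennreal_indicator)
    then have "ennreal lo * (\<integral>\<^sup>+y. ?i p y * ennreal ((f y)^2) \<partial>P) \<le> (\<Sum>i<n. ?i p (x i)) * (\<integral>\<^sup>+y. ?i p y * ennreal ((f y)^2) \<partial>P)"
      by (rule mult_right_mono) simp
    also have "\<dots> = (\<Sum>i<n. ?i p (x i) * (\<integral>\<^sup>+y. ?i p y * ennreal ((f y)^2) \<partial>P))" by (rule sum_distrib_right)
    also have "\<dots> \<le> (\<Sum>i<n. ?i p (x i) * ?T i)"
    proof (rule sum_mono)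
      fix i
      show "?i p (x i) * (\<integral>\<^sup>+y. ?i p y * ennreal ((f y)^2) \<partial>P) \<le> ?i p (x i) * ?T i"
      proof (cases "x i \<in> \<phi> a ` Q")
        case True
        have [measurable]: "\<phi> a ` Q \<in> sets P" using S[OF p] by (simp add: aQ)
        have bm: "cball (x i) r \<in> sets borel" by simp
        have [measurable]: "(\<lambda>y. indicator (cball (x i) r) y :: ennreal) \<in> borel_measurable P"
          by (rule measurable_compose[OF borel_P borel_measurable_indicator[OF bm]])
        have "(\<integral>\<^sup>+y. ?i p y * ennreal ((f y)^2) \<partial>P)
          \<le> (\<integral>\<^sup>+y. ennreal (2 * (f (x i))^2) * indicator (\<phi> a ` Q) y + 2 * (indicator (cball (x i) r) y * ennreal ((f (x i) - f y)^2)) \<partial>P)"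
        proof (rule nn_integral_mono)
          fix y
          show "?i p y * ennreal ((f y)^2) \<le> ennreal (2 * (f (x i))^2) * indicator (\<phi> a ` Q) y + 2 * (indicator (cball (x i) r) y * ennreal ((f (x i) - f y)^2))"
          proof (cases "y \<in> \<phi> a ` Q")
            case y: True
            obtain u v where uv: "u \<in> Q" "v \<in> Q" "x i = \<phi> a u" "y = \<phi> a v" using True y by blast
            have "norm (x i - y) \<le> L * norm (u - v)" 
              using lip[OF D(1) subsetD[OF D(3) uv(1)] subsetD[OF D(3) uv(2)]] uv(3,4) by simp
            also have "\<dots> \<le> L * (real CARD('m) * \<eta>)"
              using norm_diff_cell[OF \<eta>(1), of u z v] uv z(2) L1 by (intro mult_left_mono) auto
            also have "\<dots> \<le> r" using r by (simp add: mult_ac)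
            finally have "y \<in> cball (x i) r" by (simp add: dist_norm)
            moreover have "(f y)^2 \<le> 2 * (f (x i))^2 + 2 * (f (x i) - f y)^2"
              using zero_le_power2[of "2 * f (x i) - f y"] by (simp add: power2_eq_square algebra_simps)
            then have "ennreal ((f y)^2) \<le> ennreal (2 * (f (x i))^2) + 2 * ennreal ((f (x i) - f y)^2)"
              by (simp add: ennreal_plus[symmetric] ennreal_numeral[symmetric] ennreal_mult'[symmetric] ennreal_leI del: ennreal_plus ennreal_numeral)
            ultimately show ?thesis using y by (simp add: aQ)
          qed (simp add: aQ)
        qed
        also have "\<dots> = ennreal (2 * (f (x i))^2) * emeasure P (\<phi> a ` Q) + 2 * pair_energy f r (x i)"
          unfolding pair_energy_def by (subst nn_integral_add) (auto simp: nn_integral_cmult)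
        also have "\<dots> \<le> ennreal (2 * (f (x i))^2) * ennreal (k * \<eta> ^ CARD('m)) + 2 * pair_energy f r (x i)"
          using prob_image_cell(3)[OF p[unfolded aQ] \<eta>]
          by (intro add_mono mult_left_mono) (auto simp: emeasure_eq_measure ennreal_leI)
        also have "\<dots> = ?T i" using k \<eta>(1) by (simp add: ennreal_mult'[symmetric] mult_ac)
        finally show ?thesis by (rule mult_left_mono) simp
      qed (simp add: aQ)
    qed
    finally show "ennreal lo * (\<integral>\<^sup>+y. ?i p y * ennreal ((f y)^2) \<partial>P) \<le> (\<Sum>i<n. ?i p (x i) * ?T i)" .
  qed
  also have "\<dots> = (\<Sum>i<n. (\<Sum>p\<in>cells 1 \<eta>. ?i p (x i)) * ?T i)" by (subst sum.swap) (simp add: sum_distrib_right)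
  also have "\<dots> \<le> (\<Sum>i<n. of_nat (card A) * ?T i)"
  proof (intro sum_mono mult_right_mono)
    fix i
    have "(\<Sum>p\<in>cells 1 \<eta>. ?i p (x i)) = ennreal (\<Sum>p\<in>cells 1 \<eta>. indicator (\<phi> (fst p) ` snd p) (x i))"
      by (simp add: ennreal_indicator[symmetric] sum_ennreal del: ennreal_indicator)
    also have "\<dots> \<le> ennreal (real (card A))"
      using occupancy[OF \<eta>, of 1 "x i"] by (intro ennreal_leI) (simp add: split_beta')
    finally show "(\<Sum>p\<in>cells 1 \<eta>. ?i p (x i)) \<le> of_nat (card A)" by (simp add: ennreal_of_nat_eq_real_of_nat)
  qed simp
  finally show ?thesis by (simp only: sum_distrib_left sum.distrib distrib_left)
qed

end

section \<open>Mean energies over the design\<close>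

context atlas begin

lemma pair_kernel_measurable:
  assumes [measurable]: "f \<in> borel_measurable P"
  shows "(\<lambda>(x, y). indicator (cball x r) y * ennreal ((f x - f y)^2)) \<in> borel_measurable (P \<Otimes>\<^sub>M P)"
proof -
  have [measurable]: "fst \<in> P \<Otimes>\<^sub>M P \<rightarrow>\<^sub>M borel" "snd \<in> P \<Otimes>\<^sub>M P \<rightarrow>\<^sub>M borel"
    using measurable_compose[OF measurable_fst borel_P] measurable_compose[OF measurable_snd borel_P] by simp_all
  have "(\<lambda>z. indicator {..r} (dist (fst z) (snd z)) * ennreal ((f (fst z) - f (snd z))^2)) \<in> borel_measurable (P \<Otimes>\<^sub>M P)"
    by measurable
  moreover have "indicator {..r} (dist x y) = (indicator (cball x r) y :: ennreal)" for x y :: "real^'d"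
    by (simp add: indicator_def)
  ultimately show ?thesis by (simp add: split_beta')
qed

lemma pair_energy_measurable [measurable]:
  assumes "f \<in> borel_measurable P"
  shows "pair_energy f r \<in> borel_measurable P"
  unfolding pair_energy_def[abs_def] using pair_kernel_measurable[OF assms] by (rule borel_measurable_nn_integral)

definition chart_fun :: "(real^'d => real) => 'a => real^'m => real" where
  "chart_fun f a u = indicator (cball (c a) (3 * h a)) u * f (\<phi> a u)"

text \<open>The trace that membership in the Sobolev ball leaves in the charts, with one bound S for
  the gradient energies. Functions and gradients vanish outside the closed 3h-ball, as the
  translation estimate requires, while the weak derivative is tested on the open ball only.\<close>

definition sobolev :: "(real^'d => real) => real => bool" where
  "sobolev f S \<longleftrightarrow> 0 \<le> S \<and> f \<in> borel_measurable P \<and>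
    (\<forall>a\<in>A. chart_fun f a \<in> borel_measurable borel \<and> (NI u. ennreal ((chart_fun f a u)^2)) < \<infinity> \<and>
      (\<exists>g. weak_grad (ball (c a) (3 * h a)) (chart_fun f a) g \<and> g \<in> borel_measurable borel \<and>
        (\<forall>u. u \<notin> cball (c a) (3 * h a) --> g u = 0) \<and> (NI u. ennreal ((norm (g u))^2)) \<le> ennreal S))"

text \<open>The inner factor is \<open>weak_grad_pairs\<close> at radius L r; k^2 comes from pulling
  both variables back to a chart, and \<open>card A\<close> from summing over the charts.\<close>

definition energy_const :: real where
  "energy_const = real (card A) * (k^2 * (6 * unit_ball_vol (real CARD('m)) * L ^ (CARD('m) + 2)))"

lemma energy_const_nonneg: "0 \<le> energy_const" using L1 by (simp add: energy_const_def)

text \<open>For r <= 1 / L a neighbour of a point in the image of an h-ball lies in the image of the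
  2h-ball of the same chart, so both variables can be pulled back together; their chart distance is
  then at most L r.\<close>

lemma pair_energy_integral:
  assumes f: "sobolev f S" and r: "0 \<le> r" "r \<le> inverse L"
  shows "(\<integral>\<^sup>+x. pair_energy f r x \<partial>P) \<le> ennreal (energy_const * r ^ (CARD('m) + 2) * S)"
proof -
  have fm [measurable]: "f \<in> borel_measurable P" and S: "0 \<le> S" using f by (auto simp: sobolev_def)
  let ?i = "\<lambda>a x. indicator (\<phi> a ` cball (c a) (h a)) x :: ennreal"
  define C where "C = k^2 * (6 * unit_ball_vol (real CARD('m)) * L ^ (CARD('m) + 2)) * r ^ (CARD('m) + 2) * S"
  have C0: "0 \<le> C" using L1 r S by (simp add: C_def)
  have sub: "cball (c a) (t * h a) \<subseteq> cball (c a) (3 * h a)" if "a \<in> A" "t \<le> 3" for a t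
    using h[OF that(1)] that(2) by (intro subset_cball mult_right_mono) auto
  have im: "\<phi> a ` cball (c a) (h a) \<in> sets P" if "a \<in> A" for a
    using sub[OF that, of 1] by (intro image_sets[OF that]) auto
  have local: "(\<integral>\<^sup>+x. pair_energy f r x * ?i a x \<partial>P) \<le> ennreal C" if a: "a \<in> A" for a
  proof -
    let ?D = "cball (c a) (2 * h a)" and ?F = "chart_fun f a"
  let ?N = "\<lambda>u. (NI v. indicator ?D v * indicator (cball u (L * r)) v * ennreal ((?F v - ?F u)^2))"
  let ?M = "\<lambda>u. (NI v. indicator ?D u * indicator ?D v * indicator (cball u (L * r)) v * ennreal ((?F v - ?F u)^2))"
    have F [measurable]: "?F \<in> borel_measurable borel" and fin: "(NI u. ennreal ((?F u)^2)) < \<infinity>"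
      using f a by (auto simp: sobolev_def)
    obtain g where g: "weak_grad (ball (c a) (3 * h a)) ?F g" "g \<in> borel_measurable borel"
        "\<And>u. u \<notin> cball (c a) (3 * h a) ==> g u = 0" "(NI u. ennreal ((norm (g u))^2)) \<le> ennreal S"
      using f a by (auto simp: sobolev_def)
    have D1 [measurable]: "?D \<in> sets borel" "cball (c a) (h a) \<in> sets borel" by simp_all
    have hD: "cball (c a) (h a) \<subseteq> ?D" using h[OF a] by (intro subset_cball) auto
    have D3: "?D \<subseteq> cball (c a) (3 * h a)" using sub[OF a, of 2] by simp
    have out: "u \<notin> cball (c a) (3 * h a)" if "norm (c a) + 3 * h a < norm u" for u
      using that norm_triangle_ineq[of "c a" "u - c a"] by (auto simp: dist_norm norm_minus_commute)
    have in_chart: "pair_energy f r (\<phi> a u) \<le> ennreal k * ?N u"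
      if u: "u \<in> cball (c a) (h a)" for u
    proof -
      let ?g = "\<lambda>y. indicator (cball (\<phi> a u) r) y * ennreal ((f (\<phi> a u) - f y)^2)"
      have uD: "u \<in> ?D" using u hD by blast
      have sp: "\<phi> a u \<in> space P" using im[OF a] sets.sets_into_space u by blast
      have gm: "?g \<in> borel_measurable P" using measurable_compose_Pair1[OF sp pair_kernel_measurable[OF fm]] by simp
      have "pair_energy f r (\<phi> a u) \<le> (\<integral>\<^sup>+y. ?g y * indicator (\<phi> a ` ?D) y \<partial>P)"
        unfolding pair_energy_def
      proof (rule nn_integral_mono)
        fix y assume "y \<in> space P"
        then have "y \<in> \<phi> a ` ?D" if "y \<in> cball (\<phi> a u) r"
          using near[OF a u, of y] that r by (simp add: dist_norm)
        then show "?g y \<le> ?g y * indicator (\<phi> a ` ?D) y" by (auto simp: indicator_def)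
      qed
      also have "\<dots> \<le> ennreal k * (NI v. ?g (\<phi> a v) * indicator ?D v)"
        by (rule upper[OF a D1(1) D3 gm])
      also have "\<dots> \<le> ennreal k * ?N u"
      proof (intro mult_left_mono nn_integral_mono)
        fix v
        show "?g (\<phi> a v) * indicator ?D v \<le> indicator ?D v * indicator (cball u (L * r)) v * ennreal ((?F v - ?F u)^2)"
        proof (cases "v \<in> ?D \<and> \<phi> a v \<in> cball (\<phi> a u) r")
          case True
          have uv: "u \<in> cball (c a) (3 * h a)" "v \<in> cball (c a) (3 * h a)" using D3 uD True by blast+
          have "norm (u - v) \<le> L * norm (\<phi> a u - \<phi> a v)" by (rule inverse_lip[OF a uv])
          also have "\<dots> \<le> L * r" using True L1 by (intro mult_left_mono) (auto simp: dist_norm)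
          finally have "v \<in> cball u (L * r)" by (simp add: dist_norm)
          moreover have "?F u = f (\<phi> a u)" "?F v = f (\<phi> a v)" using uv by (simp_all add: chart_fun_def)
          ultimately show ?thesis using True by (simp add: power2_commute)
        qed (auto simp: indicator_def)
      qed simp
      finally show ?thesis .
    qed
    have "(\<integral>\<^sup>+x. pair_energy f r x * ?i a x \<partial>P) \<le> ennreal k * (NI u. pair_energy f r (\<phi> a u) * indicator (cball (c a) (h a)) u)"
      using sub[OF a, of 1] by (intro upper[OF a]) auto
    also have "\<dots> \<le> ennreal k * (NI u. ennreal k * ?M u)"
    proof (intro mult_left_mono nn_integral_mono)
      fix u
      show "pair_energy f r (\<phi> a u) * indicator (cball (c a) (h a)) u
         \<le> ennreal k * ?M u"
      proof (cases "u \<in> cball (c a) (h a)")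
        case True
        then have "u \<in> ?D" using hD by blast
        then show ?thesis using in_chart[OF True] True by simp
      qed simp
    qed simp
    also have "\<dots> = ennreal k * (ennreal k * (NI u. ?M u))"
    proof (subst nn_integral_cmult)
      have "(\<lambda>(u, v). indicator ?D u * indicator ?D v * indicator {..L * r} (dist u v) * ennreal ((?F v - ?F u)^2)) \<in> borel_measurable (borel \<Otimes>\<^sub>M lborel)"
        by measurable
      moreover have "indicator {..L * r} (dist u v) = (indicator (cball u (L * r)) v :: ennreal)" for u v :: "real^'m"
        by (simp add: indicator_def)
      ultimately show "(\<lambda>u. (NI v. indicator ?D u * indicator ?D v * indicator (cball u (L * r)) v * ennreal ((?F v - ?F u)^2))) \<in> borel_measurable lborel"
        using lborel.borel_measurable_nn_integral by (simp add: split_beta')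
    qed simp
    also have "\<dots> \<le> ennreal k * (ennreal k * (ennreal (6 * (L * r)^2) * emeasure lborel (cball (0::real^'m) (L * r)) * (NI u. indicator ?D u * ennreal ((norm (g u))^2))))"
    proof (intro mult_left_mono)
      show "(NI u. ?M u)
        \<le> ennreal (6 * (L * r)^2) * emeasure lborel (cball (0::real^'m) (L * r)) * (NI u. indicator ?D u * ennreal ((norm (g u))^2))"
      proof (rule weak_grad_pairs[OF g(1) _ _ _ _ _ _ F g(2) fin, where B = ?D and R = "norm (c a) + 3 * h a"])
        show "?D \<subseteq> ball (c a) (3 * h a)" using h[OF a] by auto
        show "(NI u. ennreal ((norm (g u))^2)) < \<infinity>" using g(4) by (simp add: le_less_trans)
        show "?F u = 0" "g u = 0" if "norm (c a) + 3 * h a < norm u" for u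
          using out[OF that] g(3) by (auto simp: chart_fun_def)
      qed (use L1 r in auto)
    qed simp_all
    also have "\<dots> \<le> ennreal k * (ennreal k * (ennreal (6 * (L * r)^2) * ennreal (unit_ball_vol (real CARD('m)) * (L * r) ^ CARD('m)) * ennreal S))"
    proof (intro mult_left_mono mult_mono)
      show "emeasure lborel (cball (0::real^'m) (L * r)) \<le> ennreal (unit_ball_vol (real CARD('m)) * (L * r) ^ CARD('m))"
        using emeasure_cball[of "L * r" "0::real^'m"] L1 r by simp
      have "(NI u. indicator ?D u * ennreal ((norm (g u))^2)) \<le> (NI u. ennreal ((norm (g u))^2))"
        by (intro nn_integral_mono) (auto simp: indicator_def)
      then show "(NI u. indicator ?D u * ennreal ((norm (g u))^2)) \<le> ennreal S" using g(4) by simp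
    qed simp_all
    also have "\<dots> = ennreal (k * (k * (6 * (L * r)^2 * (unit_ball_vol (real CARD('m)) * (L * r) ^ CARD('m)) * S)))"
      using k L1 r S by (simp add: ennreal_mult')
    also have "k * (k * (6 * (L * r)^2 * (unit_ball_vol (real CARD('m)) * (L * r) ^ CARD('m)) * S)) = C"
      by (simp add: C_def power_mult_distrib power_add power2_eq_square mult_ac)
    finally show ?thesis .
  qed
  have "(\<integral>\<^sup>+x. pair_energy f r x \<partial>P) \<le> (\<integral>\<^sup>+x. (\<Sum>a\<in>A. pair_energy f r x * ?i a x) \<partial>P)"
  proof (rule nn_integral_mono)
    fix x assume "x \<in> space P"
    then obtain a where a: "a \<in> A" "x \<in> \<phi> a ` cball (c a) (h a)" using cover by blast
    then have "pair_energy f r x = pair_energy f r x * ?i a x" by simp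
    also have "\<dots> \<le> (\<Sum>a\<in>A. pair_energy f r x * ?i a x)" by (rule member_le_sum[OF a(1) _ A]) auto
    finally show "pair_energy f r x \<le> (\<Sum>a\<in>A. pair_energy f r x * ?i a x)" .
  qed
  also have "\<dots> = (\<Sum>a\<in>A. \<integral>\<^sup>+x. pair_energy f r x * ?i a x \<partial>P)"
    using im by (intro nn_integral_sum) auto
  also have "\<dots> \<le> (\<Sum>a\<in>A. ennreal C)" by (rule sum_mono[OF local])
  also have "\<dots> = ennreal (energy_const * r ^ (CARD('m) + 2) * S)"
    using C0 by (simp add: ennreal_of_nat_eq_real_of_nat ennreal_mult'[symmetric] C_def energy_const_def mult_ac)
  finally show ?thesis .
qed

lemma expected_pair_energy:
  assumes "sobolev f S" "0 \<le> r" "r \<le> inverse L"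
  shows "(\<integral>\<^sup>+x. (\<Sum>i<n. pair_energy f r (x i)) \<partial>PiM {..<n} (\<lambda>_. P)) \<le> ennreal (real n * (energy_const * r ^ (CARD('m) + 2) * S))"
proof -
  have fm: "pair_energy f r \<in> borel_measurable P" using assms(1) by (auto simp: sobolev_def)
  have cm: "i < n ==> (\<lambda>x. x i) \<in> PiM {..<n} (\<lambda>_. P) \<rightarrow>\<^sub>M P" for i by (rule measurable_component_singleton) simp
  have "(\<integral>\<^sup>+x. (\<Sum>i<n. pair_energy f r (x i)) \<partial>PiM {..<n} (\<lambda>_. P)) = (\<Sum>i<n. \<integral>\<^sup>+x. pair_energy f r (x i) \<partial>PiM {..<n} (\<lambda>_. P))"
    by (intro nn_integral_sum measurable_compose[OF cm fm]) auto
  also have "\<dots> = (\<Sum>i<n. \<integral>\<^sup>+x. pair_energy f r x \<partial>P)"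
    by (intro sum.cong refl nn_integral_product_component[OF prob_space_axioms _ _ fm]) auto
  also have "\<dots> \<le> (\<Sum>i<n. ennreal (energy_const * r ^ (CARD('m) + 2) * S))"
    by (intro sum_mono pair_energy_integral assms)
  finally show ?thesis by (simp add: ennreal_of_nat_eq_real_of_nat ennreal_mult')
qed

definition edge_energy :: "nat => (real^'d => real) => real => (nat => real^'d) => ennreal" where
  "edge_energy n f r x = (\<Sum>i<n. \<Sum>j<n. indicator (cball (x i) r) (x j) * ennreal ((f (x i) - f (x j))^2))"

lemma edge_energy_measurable:
  assumes "f \<in> borel_measurable P"
  shows "edge_energy n f r \<in> borel_measurable (PiM {..<n} (\<lambda>_. P))"
  unfolding edge_energy_def[abs_def]
proof (intro borel_measurable_sum)
  fix i j assume "i \<in> {..<n}" "j \<in> {..<n}"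
  then have "(\<lambda>x. (x i, x j)) \<in> PiM {..<n} (\<lambda>_. P) \<rightarrow>\<^sub>M P \<Otimes>\<^sub>M P"
    by (intro measurable_Pair measurable_component_singleton)
  from measurable_compose[OF this pair_kernel_measurable[OF assms, of r]]
  show "(\<lambda>x. indicator (cball (x i) r) (x j) * ennreal ((f (x i) - f (x j))^2)) \<in> borel_measurable (PiM {..<n} (\<lambda>_. P))"
    by simp
qed

text \<open>Distinct design points are independent, so each off-diagonal pair has the mean of
  \<open>pair_energy\<close>; the diagonal vanishes.\<close>

lemma expected_edge_energy:
  assumes f: "sobolev f S" and r: "0 \<le> r" "r \<le> inverse L"
  shows "(\<integral>\<^sup>+x. edge_energy n f r x \<partial>PiM {..<n} (\<lambda>_. P)) \<le> ennreal ((real n)^2 * (energy_const * r ^ (CARD('m) + 2) * S))"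
proof -
  let ?M = "PiM {..<n} (\<lambda>_. P)" and ?e = "\<lambda>x y. indicator (cball x r) y * ennreal ((f x - f y)^2)"
  let ?B = "ennreal (energy_const * r ^ (CARD('m) + 2) * S)"
  have fm: "f \<in> borel_measurable P" using f by (auto simp: sobolev_def)
  note km = pair_kernel_measurable[OF fm, of r]
  have m: "(\<lambda>x. ?e (x i) (x j)) \<in> borel_measurable ?M" if "i < n" "j < n" for i j
  proof -
    have "(\<lambda>x. (x i, x j)) \<in> ?M \<rightarrow>\<^sub>M P \<Otimes>\<^sub>M P" using that by (intro measurable_Pair measurable_component_singleton) auto
    from measurable_compose[OF this km] show ?thesis by simp
  qed
  have "(\<integral>\<^sup>+x. ?e (x i) (x j) \<partial>?M) \<le> ?B" if ij: "i < n" "j < n" for i j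
  proof (cases "i = j")
    case False
    have "(\<integral>\<^sup>+x. ?e (x i) (x j) \<partial>?M) = (\<integral>\<^sup>+x. ?e (x j) (x i) \<partial>?M)" by (simp add: dist_commute power2_commute indicator_def)
    also have "\<dots> = (\<integral>\<^sup>+x. \<integral>\<^sup>+y. ?e x y \<partial>P \<partial>P)"
    proof (rule nn_integral_product_pair[OF prob_space_axioms, where h = "\<lambda>y x. ?e x y"])
      have "(\<lambda>z. ?e (snd z) (fst z)) \<in> borel_measurable (P \<Otimes>\<^sub>M P)"
        using measurable_compose[OF measurable_Pair[OF measurable_snd measurable_fst] km] by simp
      then show "(\<lambda>(y, x). ?e x y) \<in> borel_measurable (P \<Otimes>\<^sub>M P)" by (simp add: split_beta')
    qed (use ij False in auto)
    also have "\<dots> = (\<integral>\<^sup>+x. pair_energy f r x \<partial>P)" by (simp add: pair_energy_def)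
    also have "\<dots> \<le> ?B" by (rule pair_energy_integral[OF f r])
    finally show ?thesis .
  qed simp
  then have "(\<Sum>i<n. \<Sum>j<n. \<integral>\<^sup>+x. ?e (x i) (x j) \<partial>?M) \<le> (\<Sum>i<n. \<Sum>j<n. ?B)" by (intro sum_mono) auto
  also have "(\<Sum>i<n. \<Sum>j<n. ?B) = ennreal ((real n)^2 * (energy_const * r ^ (CARD('m) + 2) * S))"
    by (simp add: ennreal_of_nat_eq_real_of_nat ennreal_mult' power2_eq_square mult.assoc)
  also have "(\<Sum>i<n. \<Sum>j<n. \<integral>\<^sup>+x. ?e (x i) (x j) \<partial>?M) = (\<integral>\<^sup>+x. edge_energy n f r x \<partial>?M)"
  proof -
    have "(\<integral>\<^sup>+x. edge_energy n f r x \<partial>?M) = (\<Sum>i<n. \<integral>\<^sup>+x. (\<Sum>j<n. ?e (x i) (x j)) \<partial>?M)"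
      unfolding edge_energy_def by (intro nn_integral_sum borel_measurable_sum m) auto
    also have "\<dots> = (\<Sum>i<n. \<Sum>j<n. \<integral>\<^sup>+x. ?e (x i) (x j) \<partial>?M)" by (intro sum.cong refl nn_integral_sum m) auto
    finally show ?thesis by simp
  qed
  finally show ?thesis .
qed

end

section \<open>Risk at given bounds on signal and noise\<close>

context atlas begin

lemma empirical_norm_real:
  assumes good: "good n \<eta> (real n * \<eta> ^ CARD('m) / (4 * k)) hi x" and n: "0 < n" and \<eta>: "0 < \<eta>" "\<forall>a\<in>A. real CARD('m) * \<eta> \<le> h a"
    and r: "real CARD('m) * \<eta> * L \<le> r" and f: "f \<in> borel_measurable P"
    and norm: "ennreal \<nu> \<le> (\<integral>\<^sup>+y. ennreal ((f y)^2) \<partial>P)" and A0: "A \<noteq> {}"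
    and e: "(\<Sum>i<n. pair_energy f r (x i)) \<le> ennreal e" "0 \<le> e"
  shows "real n * \<nu> / (8 * k^2 * real (card A)) - e / (k * \<eta> ^ CARD('m)) \<le> (\<Sum>i<n. (f (x i))^2)"
proof -
  let ?w = "\<eta> ^ CARD('m)" and ?q = "real (card A)" and ?F = "\<Sum>i<n. (f (x i))^2"
  define lo where "lo = real n * ?w / (4 * k)"
  have w: "0 < ?w" using \<eta> by simp
  have lo: "0 < lo" using n w k by (simp add: lo_def)
  have q: "0 < ?q" using A A0 by (simp add: card_gt_0_iff)
  have F: "0 \<le> ?F" by (simp add: sum_nonneg)
  have "ennreal (lo * \<nu>) = ennreal lo * ennreal \<nu>" using lo by (simp add: ennreal_mult')
  also have "\<dots> \<le> ennreal lo * (\<integral>\<^sup>+y. ennreal ((f y)^2) \<partial>P)" by (rule mult_left_mono[OF norm]) simp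
  also have "\<dots> \<le> of_nat (card A) * (ennreal (2 * k * ?w) * (\<Sum>i<n. ennreal ((f (x i))^2)) + 2 * (\<Sum>i<n. pair_energy f r (x i)))"
    by (rule empirical_norm_lower[OF good[folded lo_def] lo \<eta> r f])
  also have "\<dots> \<le> of_nat (card A) * (ennreal (2 * k * ?w) * (\<Sum>i<n. ennreal ((f (x i))^2)) + 2 * ennreal e)"
    using e(1) by (intro mult_left_mono add_left_mono) auto
  also have "\<dots> = ennreal (?q * (2 * k * ?w * ?F + 2 * e))"
    using e(2) w k F by (simp add: sum_ennreal ennreal_of_nat_eq_real_of_nat ennreal_mult' ennreal_plus)
  finally have "lo * \<nu> \<le> ?q * (2 * k * ?w * ?F + 2 * e)"
    using F k w q e(2) by (subst (asm) ennreal_le_iff) auto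
  then have "lo * \<nu> / (?q * (2 * k * ?w)) \<le> ?F + e / (k * ?w)"
  proof -
    have "?q * (2 * k * ?w * ?F + 2 * e) = (?F + e / (k * ?w)) * (?q * (2 * k * ?w))"
    proof -
      define v where "v = k * ?w"
      have "0 < v" using k w by (simp add: v_def)
      then have "?q * (2 * v * ?F + 2 * e) = (?F + e / v) * (?q * (2 * v))" by (simp add: distrib_right distrib_left)
      then show ?thesis by (simp add: v_def mult.assoc)
    qed
    then show ?thesis using \<open>lo * \<nu> \<le> _\<close> q k w by (simp add: pos_divide_le_eq mult_ac)
  qed
  moreover have "lo * \<nu> / (?q * (2 * k * ?w)) = real n * \<nu> / (8 * k^2 * ?q)"
    using \<eta>(1) k by (simp add: lo_def power2_eq_square)
  ultimately show ?thesis by linarith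
qed

lemma kernel_form_le:
  fixes n :: nat
  assumes K: "\<And>t. 0 \<le> t ==> K t \<le> K0" "\<And>t. 1 < t ==> K t = 0" and K0: "0 \<le> K0"
    and r: "0 < r" and e: "edge_energy n f r x \<le> ennreal e" "0 \<le> e"
  shows "(\<Sum>i<n. \<Sum>j<n. K (norm (x i - x j) / r) * (f (x i) - f (x j))^2) \<le> K0 * e"
proof -
  let ?e = "\<lambda>i j. indicator (cball (x i) r) (x j) * (f (x i) - f (x j))^2 :: real"
  have "edge_energy n f r x = (\<Sum>i<n. \<Sum>j<n. ennreal (?e i j))"
    unfolding edge_energy_def by (intro sum.cong refl) (auto simp: indicator_def)
  also have "\<dots> = ennreal (\<Sum>i<n. \<Sum>j<n. ?e i j)" by (simp add: sum_ennreal sum_nonneg)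
  finally have "(\<Sum>i<n. \<Sum>j<n. ?e i j) \<le> e" using e by simp
  then have "K0 * (\<Sum>i<n. \<Sum>j<n. ?e i j) \<le> K0 * e" using K0 by (rule mult_left_mono)
  moreover have "(\<Sum>i<n. \<Sum>j<n. K (norm (x i - x j) / r) * (f (x i) - f (x j))^2) \<le> K0 * (\<Sum>i<n. \<Sum>j<n. ?e i j)"
    unfolding sum_distrib_left
  proof (intro sum_mono)
    fix i j
    show "K (norm (x i - x j) / r) * (f (x i) - f (x j))^2 \<le> K0 * ?e i j"
      using K(1)[of "norm (x i - x j) / r"] K(2)[of "norm (x i - x j) / r"] r
      by (cases "norm (x i - x j) \<le> r") (auto simp: dist_norm intro!: mult_right_mono)
  qed
  ultimately show ?thesis by linarith
qed

text \<open>For every design the conditional type II error is dominated by the indicator of a bad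
  design, plus the two energies divided by b times their mean bounds, plus the Chebyshev bound.
  Integrating this single inequality is Markov's inequality without any measurability of the
  test.\<close>

lemma risk_bound:
  fixes n :: nat
  assumes n: "0 < n" and r: "0 < r" "r \<le> inverse L" and \<eta>: "0 < \<eta>" "\<forall>a\<in>A. real CARD('m) * \<eta> \<le> h a"
    and \<eta>r: "real CARD('m) * \<eta> * L \<le> r" and \<rho>: "0 < \<rho>" and \<alpha>: "0 < \<alpha>" and b: "1 \<le> b"
    and f: "sobolev f S" and S: "0 < S" and norm: "ennreal \<nu> \<le> (\<integral>\<^sup>+y. ennreal ((f y)^2) \<partial>P)" and A0: "A \<noteq> {}"
    and K: "\<And>t. 0 \<le> t ==> 0 \<le> K t" "\<And>t. 0 \<le> t ==> K t \<le> K0" "\<And>t. 1 < t ==> K t = 0"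
    and Ce: "energy_const \<le> Ce" "0 < Ce"
  defines "lo \<equiv> real n * \<eta> ^ CARD('m) / (4 * k)" and "hi \<equiv> 3 * k * real n * \<eta> ^ CARD('m)"
  assumes V: "\<And>x. (\<And>i. i < n ==> x i \<in> space P) ==> good n \<eta> lo hi x ==>
      (\<Sum>k = 1..n. 1 / (\<rho> * sorted_eigenvalue (laplacian K n r x) k + 1) ^ 4) \<le> V"
    and V0: "0 \<le> V"
    and Z: "Z \<le> (real n * \<nu> / (8 * k^2 * real (card A)) - b * (real n * (Ce * r ^ (CARD('m) + 2) * S)) / (k * \<eta> ^ CARD('m))) / 2
         - \<rho> * (K0 * (b * ((real n)^2 * (Ce * r ^ (CARD('m) + 2) * S))) / 2)"
    and pos: "0 < Z" and large: "2 * sqrt (2 / \<alpha> * V) \<le> Z"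
  shows "(\<integral>\<^sup>+\<omega>. ennreal (1 - laplacian_smoothing_test K n r \<rho> \<alpha> \<omega>) \<partial>sample_law P n f)
    \<le> ennreal (2 * total_volume / \<eta> ^ CARD('m) * exp (- lo) + 2 / b + (16 / Z + 8 * V / Z^2))"
proof -
  let ?M = "PiM {..<n} (\<lambda>_. P)"
  \<comment> \<open>\<open>Ce\<close> is positive, so that the energies can be divided by these
    bounds on their means.\<close>
  define E1 where "E1 = (real n)^2 * (Ce * r ^ (CARD('m) + 2) * S)"
  define E2 where "E2 = real n * (Ce * r ^ (CARD('m) + 2) * S)"
  have E: "0 < E1" "0 < E2" using n Ce r S by (simp_all add: E1_def E2_def)
  have fm: "f \<in> borel_measurable P" using f by (simp add: sobolev_def)
  have K0: "0 \<le> K0" using K(1,2)[of 0] by simp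
  interpret GI: prob_space "PiM {0..<n} (\<lambda>_. gauss)" by (rule prob_space_PiM) (rule prob_space_gauss)
  interpret PI: prob_space ?M by (rule prob_space_PiM) (rule prob_space_axioms)
  let ?bad = "{x \<in> space ?M. \<not> good n \<eta> lo hi x}"
  note bad = bad_probability[OF \<eta>, of n, folded lo_def hi_def]
  let ?t = "\<lambda>x. \<integral>\<^sup>+e. ennreal (1 - laplacian_smoothing_test K n r \<rho> \<alpha> (\<lambda>i\<in>{0..<n}. (x i, f (x i) + e i))) \<partial>PiM {0..<n} (\<lambda>_. gauss)"
  let ?P = "\<lambda>x. \<Sum>i<n. pair_energy f r (x i)"
  have Pm: "?P \<in> borel_measurable ?M"
  proof -
    have "i < n ==> (\<lambda>x. x i) \<in> ?M \<rightarrow>\<^sub>M P" for i by (rule measurable_component_singleton) simp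
    then show ?thesis by (intro borel_measurable_sum measurable_compose[OF _ pair_energy_measurable[OF fm]]) auto
  qed
  have "?t x \<le> indicator ?bad x + ennreal (1 / (b * E1)) * edge_energy n f r x + ennreal (1 / (b * E2)) * ?P x + ennreal (16 / Z + 8 * V / Z^2)"
    if x: "x \<in> space ?M" for x
  proof -
    have "?t x \<le> (\<integral>\<^sup>+e. 1 \<partial>PiM {0..<n} (\<lambda>_. gauss))"
      by (intro nn_integral_mono) (simp add: laplacian_smoothing_test_def)
    then have t1: "?t x \<le> 1" by (simp add: GI.emeasure_space_1)
    \<comment> \<open>Where an energy exceeds b times its bound, its scaled version is at least 1
      and thus dominates the error.\<close>
    have big: "1 \<le> ennreal (1 / (b * e)) * y" if "\<not> y \<le> ennreal (b * e)" "0 < e" for e y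
    proof -
      have "1 = ennreal (1 / (b * e)) * ennreal (b * e)" using b that(2) by (simp add: ennreal_mult'[symmetric])
      also have "\<dots> \<le> ennreal (1 / (b * e)) * y" using that(1) by (intro mult_left_mono) auto
      finally show ?thesis .
    qed
    have mono: "u \<le> u + v + w + z" "v \<le> u + v + w + z" "w \<le> u + v + w + z" "z \<le> u + v + w + z" for u v w z :: ennreal
      by (simp_all add: add_increasing add_increasing2 add.assoc)
    show ?thesis
    proof (cases "good n \<eta> lo hi x \<and> edge_energy n f r x \<le> ennreal (b * E1) \<and> ?P x \<le> ennreal (b * E2)")
      case True
      have xP: "x i \<in> space P" if "i < n" for i using x that by (auto simp: space_PiM)
      have 1: "real n * \<nu> / (8 * k^2 * real (card A)) - (b * E2) / (k * \<eta> ^ CARD('m)) \<le> (\<Sum>i<n. (f (x i))^2)"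
        using True b E by (intro empirical_norm_real[OF _ n \<eta> \<eta>r fm norm A0, where hi = hi]) (auto simp: lo_def)
      have "(\<Sum>i<n. \<Sum>j<n. K (norm (x i - x j) / r) * (f (x i) - f (x j))^2) \<le> K0 * (b * E1)"
        using True b E by (intro kernel_form_le K K0 r(1)) auto
      then have "\<rho> * ((\<Sum>i<n. \<Sum>j<n. K (norm (x i - x j) / r) * (f (x i) - f (x j))^2) / 2) \<le> \<rho> * (K0 * (b * E1) / 2)"
        using \<rho> by (intro mult_left_mono) auto
      then have "Z \<le> (\<Sum>i<n. (f (x i))^2) / 2 - \<rho> * ((\<Sum>i<n. \<Sum>j<n. K (norm (x i - x j) / r) * (f (x i) - f (x j))^2) / 2)"
        using divide_right_mono[OF 1, of 2] by (intro order_trans[OF Z[folded E1_def E2_def]] diff_mono) auto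
      from type_II_error[OF K(1) r(1) \<rho> n V[OF xP] this pos large \<alpha>] True
      have "?t x \<le> ennreal (16 / Z + 8 * V / Z^2)" by simp
      then show ?thesis by (rule order_trans[OF _ mono(4)])
    next
      case False
      then consider "\<not> good n \<eta> lo hi x" | "\<not> edge_energy n f r x \<le> ennreal (b * E1)" | "\<not> ?P x \<le> ennreal (b * E2)" by blast
      then show ?thesis
      proof cases
        case 1
        then have "1 \<le> (indicator ?bad x :: ennreal)" using x by simp
        then show ?thesis by (rule order_trans[OF order_trans[OF t1] mono(1)])
      next
        case 2
        show ?thesis by (rule order_trans[OF order_trans[OF t1 big[OF 2 E(1)]] mono(2)])
      next
        case 3
        show ?thesis by (rule order_trans[OF order_trans[OF t1 big[OF 3 E(2)]] mono(3)])
      qed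
    qed
  qed
  then have "(\<integral>\<^sup>+x. ?t x \<partial>?M) \<le> (\<integral>\<^sup>+x. indicator ?bad x + ennreal (1 / (b * E1)) * edge_energy n f r x + ennreal (1 / (b * E2)) * ?P x + ennreal (16 / Z + 8 * V / Z^2) \<partial>?M)"
    by (intro nn_integral_mono) auto
  also have "\<dots> = emeasure ?M ?bad + ennreal (1 / (b * E1)) * (\<integral>\<^sup>+x. edge_energy n f r x \<partial>?M) + ennreal (1 / (b * E2)) * (\<integral>\<^sup>+x. ?P x \<partial>?M) + ennreal (16 / Z + 8 * V / Z^2)"
    using edge_energy_measurable[OF fm, of n r] Pm bad(1)
    by (simp add: nn_integral_add nn_integral_cmult PI.emeasure_space_1)
  also have "\<dots> \<le> ennreal (2 * total_volume / \<eta> ^ CARD('m) * exp (- lo)) + ennreal (1 / (b * E1)) * ennreal E1 + ennreal (1 / (b * E2)) * ennreal E2 + ennreal (16 / Z + 8 * V / Z^2)"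
  proof (intro add_mono mult_left_mono order_refl)
    have "energy_const * r ^ (CARD('m) + 2) * S \<le> Ce * r ^ (CARD('m) + 2) * S" using Ce r S by (intro mult_right_mono) auto
    then have "(real n)^2 * (energy_const * r ^ (CARD('m) + 2) * S) \<le> E1" "real n * (energy_const * r ^ (CARD('m) + 2) * S) \<le> E2"
      unfolding E1_def E2_def by (intro mult_left_mono; simp)+
    then show "(\<integral>\<^sup>+x. edge_energy n f r x \<partial>?M) \<le> ennreal E1" "(\<integral>\<^sup>+x. ?P x \<partial>?M) \<le> ennreal E2"
      using order_trans[OF expected_edge_energy[OF f _ r(2), of n]] order_trans[OF expected_pair_energy[OF f _ r(2), of n]] r(1)
      by (auto intro: ennreal_leI)
  qed (use bad(2) in auto)
  also have "\<dots> = ennreal (2 * total_volume / \<eta> ^ CARD('m) * exp (- lo) + 2 / b + (16 / Z + 8 * V / Z^2))"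
  proof -
    have "ennreal (1 / (b * E1)) * ennreal E1 = ennreal (1 / b)" "ennreal (1 / (b * E2)) * ennreal E2 = ennreal (1 / b)"
      using b E by (simp_all add: ennreal_mult'[symmetric])
    moreover have "0 \<le> total_volume" by (simp add: total_volume_def sum_nonneg)
    ultimately show ?thesis using b pos V0 \<eta>(1)
      by (simp add: ennreal_plus[symmetric] add_divide_distrib[symmetric] del: ennreal_plus)
  qed
  finally show ?thesis
    unfolding lessThan_atLeast0 by (rule order_trans[OF sample_law_le[OF prob_space_axioms fm]])
qed

end

section \<open>Charts of the manifold\<close>

lemmas chart_okD =
  chart_ok_def[THEN iffD1, THEN conjunct1]
  chart_ok_def[THEN iffD1, THEN conjunct2, THEN conjunct1]
  chart_ok_def[THEN iffD1, THEN conjunct2, THEN conjunct2, THEN conjunct1]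
  chart_ok_def[THEN iffD1, THEN conjunct2, THEN conjunct2, THEN conjunct2, THEN conjunct1]
  chart_ok_def[THEN iffD1, THEN conjunct2, THEN conjunct2, THEN conjunct2, THEN conjunct2, THEN conjunct1]
  chart_ok_def[THEN iffD1, THEN conjunct2, THEN conjunct2, THEN conjunct2, THEN conjunct2, THEN conjunct2]

text \<open>Excludes an empty X: the volume then lives on the empty space, and no density of it is a
  probability measure.\<close>

lemma riemannian_volume_empty: "space (riemannian_volume TYPE('m::finite) ({} :: (real^'d::finite) set)) = {}"
proof -
  have "\<exists>!\<mu>. is_volume TYPE('m) ({} :: (real^'d) set) \<mu>"
  proof (rule ex1I)
    show "is_volume TYPE('m) {} (null_measure (restrict_space borel ({} :: (real^'d) set)))"
      unfolding is_volume_def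
    proof (intro conjI allI impI)
      fix U :: "(real^'m) set" and \<phi> :: "real^'m => real^'d" and B assume "local_param {} U \<phi>" "B \<subseteq> U"
      then have "B = {}" using local_paramD(8)[of "{}" U \<phi>] by auto
      then show "emeasure (null_measure (restrict_space borel {})) (\<phi> ` B) = (\<integral>\<^sup>+u\<in>B. ennreal (volume_density \<phi> u) \<partial>lborel)" by simp
    qed simp
  next
    fix \<mu> assume mu: "is_volume TYPE('m) ({} :: (real^'d) set) \<mu>"
    have "(\<lambda>x. {} :: (real^'d) set) ` sets (borel :: (real^'d) measure) = {{}}" by (rule image_constant[of "{}"]) simp
    then have s: "sets \<mu> = {{}}" using mu unfolding is_volume_def by (simp add: sets_restrict_space)
    show "\<mu> = null_measure (restrict_space borel {})"
      by (rule measure_eqI) (auto simp: s sets_restrict_space)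
  qed
  then have "is_volume TYPE('m) {} (THE \<mu>. is_volume TYPE('m) ({} :: (real^'d) set) \<mu>)" by (rule theI')
  then have "is_volume TYPE('m) {} (riemannian_volume TYPE('m) ({} :: (real^'d) set))"
    unfolding is_volume_def[abs_def] riemannian_volume_def .
  then have "sets (riemannian_volume TYPE('m) ({} :: (real^'d) set)) = sets (restrict_space borel {})" by (simp add: is_volume_def)
  then show ?thesis by (metis sets_eq_imp_space_eq space_restrict_space Int_empty_left)
qed

section \<open>Weak gradients in coordinates\<close>

lemma frechet_derivative_coord:
  fixes \<eta> :: "real^'m::finite => real"
  assumes "smooth_on UNIV \<eta>"
  shows "frechet_derivative \<eta> (at v) w = (\<Sum>j\<in>UNIV. vec_nth w j * coord_deriv \<eta> j v)"
proof -
  have l: "linear (frechet_derivative \<eta> (at v))" using Ck_on_1D[OF assms, of v] by (simp add: has_derivative_linear)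
  have "frechet_derivative \<eta> (at v) w = frechet_derivative \<eta> (at v) (\<Sum>j\<in>UNIV. vec_nth w j *\<^sub>R axis j 1)"
    by (simp add: basis_expansion scalar_mult_eq_scaleR[symmetric])
  also have "\<dots> = (\<Sum>j\<in>UNIV. vec_nth w j * coord_deriv \<eta> j v)"
    using l by (simp add: linear_sum linear_scale coord_deriv_def)
  finally show ?thesis .
qed

lemma coord_deriv_zero:
  fixes \<eta> :: "real^'m::finite => real"
  assumes "v \<notin> closure {u. \<eta> u \<noteq> 0}" shows "coord_deriv \<eta> j v = 0"
proof -
  have "(\<eta> has_derivative (\<lambda>_. 0)) (at v)"
  proof (rule has_derivative_transform_within_open[OF has_derivative_const[of 0]])
    show "open (- closure {u. \<eta> u \<noteq> 0})" "v \<in> - closure {u. \<eta> u \<noteq> 0}" using assms by auto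
    show "0 = \<eta> u" if "u \<in> - closure {u. \<eta> u \<noteq> 0}" for u
      using that closure_subset[of "{u. \<eta> u \<noteq> 0}"] by auto
  qed
  then show ?thesis unfolding coord_deriv_def by (metis frechet_derivative_at)
qed

lemma integrable_mult_square:
  fixes F d :: "'a => real"
  assumes "F \<in> borel_measurable M" "d \<in> borel_measurable M"
    "(\<integral>\<^sup>+u. ennreal ((F u)^2) \<partial>M) < \<infinity>" "(\<integral>\<^sup>+u. ennreal ((d u)^2) \<partial>M) < \<infinity>"
  shows "integrable M (\<lambda>u. F u * d u)"
proof (rule Bochner_Integration.integrable_bound)
  show "integrable M (\<lambda>u. (F u)^2 + (d u)^2)"
    using assms by (intro Bochner_Integration.integrable_add) (auto simp: integrable_iff_bounded)
  show "(\<lambda>u. F u * d u) \<in> borel_measurable M" using assms by auto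
  have "\<bar>a * b\<bar> \<le> a^2 + b^2" for a b :: real
    using sum_squares_bound[of "\<bar>a\<bar>" "\<bar>b\<bar>"] mult_nonneg_nonneg[of "\<bar>a\<bar>" "\<bar>b\<bar>"]
    unfolding abs_mult power2_abs mult.assoc by linarith
  then show "AE u in M. norm (F u * d u) \<le> norm ((F u)^2 + (d u)^2)" by simp
qed

lemma nn_integral_square_compact_support:
  fixes d :: "'a::euclidean_space => real"
  assumes "continuous_on UNIV d" "compact S" "\<And>u. u \<notin> S ==> d u = 0"
  shows "(NI u. ennreal ((d u)^2)) < \<infinity>"
proof -
  have "bounded (d ` S)" using assms by (intro compact_imp_bounded compact_continuous_image) (auto intro: continuous_on_subset)
  then obtain B where B: "\<And>u. u \<in> S ==> \<bar>d u\<bar> \<le> B" unfolding bounded_iff by auto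
  have "ennreal ((d u)^2) \<le> ennreal (B^2) * indicator S u" for u
    using power_mono[OF B, of u 2] assms(3)[of u] by (cases "u \<in> S") (auto intro: ennreal_leI)
  then have "(NI u. ennreal ((d u)^2)) \<le> (NI u. ennreal (B^2) * indicator S u)" by (rule nn_integral_mono)
  also have "\<dots> = ennreal (B^2) * emeasure lborel S" using assms(2) by (intro nn_integral_cmult_indicator) (simp add: borel_compact)
  also have "\<dots> < \<infinity>" using emeasure_compact_finite[OF assms(2)] by (simp add: ennreal_mult_less_top)
  finally show ?thesis .
qed

text \<open>Linearity in w. Sums and integrals may be exchanged because the products are integrable:
  F and g are square integrable, and test functions and their derivatives are bounded with compact
  support.\<close>

lemma weak_grad_coord:
  fixes F :: "real^'m::finite => real"
  assumes F: "F \<in> borel_measurable borel" "(NI u. ennreal ((F u)^2)) < \<infinity>"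
    and g: "g \<in> borel_measurable borel" "(NI u. ennreal ((norm (g u))^2)) < \<infinity>"
    and eq: "\<And>\<eta> j. test_fun V \<eta> ==> (\<integral>u. F u * coord_deriv \<eta> j u \<partial>lborel) = - (\<integral>u. vec_nth (g u) j * \<eta> u \<partial>lborel)"
  shows "weak_grad V F g"
  unfolding weak_grad_def
proof (intro allI impI)
  fix \<eta> :: "real^'m => real" and w :: "real^'m" assume t: "test_fun V \<eta>"
  then have s: "smooth_on UNIV \<eta>" and c: "compact (closure {u. \<eta> u \<noteq> 0})" by (auto simp: test_fun_def)
  have cd: "continuous_on UNIV (coord_deriv \<eta> j)" for j
    unfolding coord_deriv_def[abs_def] using s by (rule continuous_on_frechet)
  have ce: "continuous_on UNIV \<eta>" using s unfolding smooth_on_def by (metis Ck_on.simps(1))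
  have i1: "integrable lborel (\<lambda>u. F u * coord_deriv \<eta> j u)" for j
    using F cd[of j] nn_integral_square_compact_support[OF cd c coord_deriv_zero]
    by (intro integrable_mult_square) (auto intro: borel_measurable_continuous_onI)
  have i2: "integrable lborel (\<lambda>u. vec_nth (g u) j * \<eta> u)" for j
  proof (rule integrable_mult_square)
    show "(NI u. ennreal ((\<eta> u)^2)) < \<infinity>"
      using closure_subset[of "{u. \<eta> u \<noteq> 0}"] by (intro nn_integral_square_compact_support[OF ce c]) auto
    have "(NI u. ennreal ((vec_nth (g u) j)^2)) \<le> (NI u. ennreal ((norm (g u))^2))"
      by (intro nn_integral_mono ennreal_leI) (metis component_le_norm_cart power2_abs power_mono abs_ge_zero)
    then show "(NI u. ennreal ((vec_nth (g u) j)^2)) < \<infinity>" using g(2) by simp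
    have "(\<lambda>u. inner (g u) (axis j 1)) \<in> borel_measurable lborel" using g(1) by simp
    then show "(\<lambda>u. vec_nth (g u) j) \<in> borel_measurable lborel" by (simp add: inner_axis)
  qed (use ce in \<open>auto intro: borel_measurable_continuous_onI\<close>)
  have "(\<integral>v. F v * frechet_derivative \<eta> (at v) w \<partial>lborel) = (\<integral>v. (\<Sum>j\<in>UNIV. vec_nth w j * (F v * coord_deriv \<eta> j v)) \<partial>lborel)"
    by (simp add: frechet_derivative_coord[OF s] sum_distrib_left mult_ac)
  also have "\<dots> = (\<Sum>j\<in>UNIV. vec_nth w j * (\<integral>v. F v * coord_deriv \<eta> j v \<partial>lborel))"
    using i1 by (subst Bochner_Integration.integral_sum) auto
  also have "\<dots> = - (\<Sum>j\<in>UNIV. vec_nth w j * (\<integral>v. vec_nth (g v) j * \<eta> v \<partial>lborel))"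
    by (simp add: eq[OF t] sum_negf)
  also have "(\<Sum>j\<in>UNIV. vec_nth w j * (\<integral>v. vec_nth (g v) j * \<eta> v \<partial>lborel)) = (\<integral>v. (\<Sum>j\<in>UNIV. vec_nth w j * (vec_nth (g v) j * \<eta> v)) \<partial>lborel)"
    using i2 by (subst Bochner_Integration.integral_sum) auto
  also have "\<dots> = (\<integral>v. inner (g v) w * \<eta> v \<partial>lborel)"
    by (simp add: inner_vec_def sum_distrib_left sum_distrib_right mult_ac)
  finally show "(\<integral>v. F v * frechet_derivative \<eta> (at v) w \<partial>lborel) = - (\<integral>v. inner (g v) w * \<eta> v \<partial>lborel)" .
qed

lemma chart_compose_measurable:
  fixes F :: "real^'d::finite => 'b::real_normed_vector" and \<phi> :: "real^'m::finite => real^'d"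
  assumes P: "local_param X U \<phi>" and S: "sets V = sets (restrict_space borel X)" and D: "D \<in> sets borel" "D \<subseteq> U"
    and F: "F \<in> borel_measurable V"
  shows "(\<lambda>u. indicator D u *\<^sub>R F (\<phi> u)) \<in> borel_measurable borel"
proof -
  note d = local_paramD[OF P]
  have "\<phi> \<in> restrict_space borel D \<rightarrow>\<^sub>M restrict_space borel X"
    using d(8) D(2) borel_measurable_continuous_on_restrict[OF continuous_on_subset[OF d(6) D(2)]]
    by (intro measurable_restrict_space2) (auto simp: space_restrict_space)
  moreover have "F \<in> borel_measurable (restrict_space borel X)" using F by (simp cong: measurable_cong_sets add: measurable_cong_sets[OF S refl])
  ultimately have "(\<lambda>u. F (\<phi> u)) \<in> borel_measurable (restrict_space borel D)" by (rule measurable_compose)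
  then show ?thesis using D(1) by (subst (asm) borel_measurable_restrict_space_iff) auto
qed

text \<open>\<open>vol\<close> names the volume measure so that its definite description stays
  folded.\<close>

locale design =
  fixes X :: "(real^'d::finite) set" and P :: "(real^'d) measure" and p :: "real^'d => real"
    and p_min p_max L_p :: real and m :: "'m::finite itself" and vol :: "(real^'d) measure"
  assumes vol: "vol = riemannian_volume TYPE('m) X"
    and X: "compact X" "embedded_manifold TYPE('m) X"
    and P: "prob_space P" "P = density vol (\<lambda>x. ennreal (p x))"
    and p: "0 < p_min" "\<And>x. x \<in> X ==> p_min \<le> p x" "\<And>x. x \<in> X ==> p x \<le> p_max" "lipschitz_on L_p X p"
begin

lemma X_nonempty: "X \<noteq> {}"
  using prob_space.not_empty[OF P(1)] P(2) vol riemannian_volume_empty by auto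

lemma volume: "is_volume TYPE('m) X vol"
  unfolding vol by (rule is_volume_riemannian_volume[OF X(1) X_nonempty X(2)])

lemma sets_vol: "sets vol = sets (restrict_space borel X)" using volume by (simp add: is_volume_def)

lemma sets_P: "sets P = sets vol" by (simp add: P(2))

lemma space_vol: "space vol = X" "space P = X"
  using sets_eq_imp_space_eq[OF sets_vol] sets_eq_imp_space_eq[OF sets_P] by (simp_all add: space_restrict_space)

lemma measurable_P: "borel_measurable P = borel_measurable vol" by (rule measurable_cong_sets[OF sets_P refl])

lemma p_measurable: "p \<in> borel_measurable vol"
  using borel_measurable_continuous_on_restrict[OF lipschitz_on_continuous_on[OF p(4)]]
  by (simp add: measurable_cong_sets[OF sets_vol refl])

lemma nn_integral_P:
  assumes "g \<in> borel_measurable vol"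
  shows "(\<integral>\<^sup>+x. g x \<partial>P) \<le> ennreal p_max * (\<integral>\<^sup>+x. g x \<partial>vol)" "ennreal p_min * (\<integral>\<^sup>+x. g x \<partial>vol) \<le> (\<integral>\<^sup>+x. g x \<partial>P)"
proof -
  have eq: "(\<integral>\<^sup>+x. g x \<partial>P) = (\<integral>\<^sup>+x. ennreal (p x) * g x \<partial>vol)"
    unfolding P(2) using p_measurable assms by (intro nn_integral_density) auto
  show "(\<integral>\<^sup>+x. g x \<partial>P) \<le> ennreal p_max * (\<integral>\<^sup>+x. g x \<partial>vol)"
    unfolding eq using p(3) assms
    by (subst nn_integral_cmult[symmetric]) (auto intro!: nn_integral_mono mult_right_mono ennreal_leI simp: space_vol)
  show "ennreal p_min * (\<integral>\<^sup>+x. g x \<partial>vol) \<le> (\<integral>\<^sup>+x. g x \<partial>P)"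
    unfolding eq using p(2) assms
    by (subst nn_integral_cmult[symmetric]) (auto intro!: nn_integral_mono mult_right_mono ennreal_leI simp: space_vol)
qed

text \<open>The volume density lies between 1 / L and L on the 3h-ball.\<close>

lemma chart_integral:
  assumes lp: "local_param X U (\<phi> :: real^'m => real^'d)" and ok: "chart_ok X \<phi> c h L" and D: "D \<in> sets borel" "D \<subseteq> cball c (3 * h)"
    and U: "cball c (3 * h) \<subseteq> U" and g: "g \<in> borel_measurable vol" and L: "1 \<le> L"
  shows "(\<integral>\<^sup>+x. g x * indicator (\<phi> ` D) x \<partial>vol) \<le> ennreal L * (NI u. g (\<phi> u) * indicator D u)"
    and "(NI u. g (\<phi> u) * indicator D u) \<le> ennreal L * (\<integral>\<^sup>+x. g x * indicator (\<phi> ` D) x \<partial>vol)"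
    and "\<phi> ` D \<in> sets P"
proof -
  have DU: "D \<subseteq> U" using D(2) U by blast
  have Xb: "X \<in> sets borel" using X(1) by (simp add: compact_imp_closed)
  have eq: "(\<integral>\<^sup>+x. g x * indicator (\<phi> ` D) x \<partial>vol) = (NI u. ennreal (volume_density \<phi> u) * g (\<phi> u) * indicator D u)"
    by (rule nn_integral_volume_chart[OF volume Xb lp D(1) DU g])
  have S: "sets vol = sets (restrict_space borel X)" by (rule sets_vol)
  have "\<phi> ` D \<in> sets borel" "\<phi> ` D \<subseteq> X" using local_param_image_borel[OF lp Xb D(1) DU] local_paramD(8)[OF lp] DU by auto
  then show im: "\<phi> ` D \<in> sets P" using Xb by (simp add: sets_P S sets_restrict_space_iff)
  note d = local_paramD[OF lp]
  let ?G = "\<lambda>u. g (\<phi> u) * indicator D u"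
  have Gm: "?G \<in> borel_measurable lborel"
  proof -
    have "\<phi> \<in> restrict_space borel D \<rightarrow>\<^sub>M restrict_space borel X"
      using d(8) DU borel_measurable_continuous_on_restrict[OF continuous_on_subset[OF d(6) DU]]
      by (intro measurable_restrict_space2) (auto simp: space_restrict_space)
    moreover have "g \<in> borel_measurable (restrict_space borel X)" 
      by (rule subsetD[OF equalityD1[OF measurable_cong_sets[OF S refl]] g])
    ultimately have "(\<lambda>u. g (\<phi> u)) \<in> borel_measurable (restrict_space borel D)" by (rule measurable_compose)
    then show ?thesis using D(1) by (subst (asm) borel_measurable_restrict_space_iff_ennreal) auto
  qed
  have vd: "volume_density \<phi> u \<le> L" "1 \<le> L * volume_density \<phi> u" if "u \<in> D" for u
  proof -
    have "u \<in> cball c (3 * h)" using that D(2) by blast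
    note b = bspec[OF chart_okD(3)[OF ok] this] bspec[OF chart_okD(4)[OF ok] this]
    have "L * inverse L \<le> L * volume_density \<phi> u" using b(2) L by (intro mult_left_mono) auto
    then show "volume_density \<phi> u \<le> L" "1 \<le> L * volume_density \<phi> u" using b(1) L by simp_all
  qed
  show "(\<integral>\<^sup>+x. g x * indicator (\<phi> ` D) x \<partial>vol) \<le> ennreal L * (NI u. ?G u)"
    unfolding eq nn_integral_cmult[OF Gm, symmetric] using vd(1)
    by (intro nn_integral_mono) (auto simp: indicator_def intro!: mult_right_mono ennreal_leI)
  have "(NI u. ?G u) \<le> (NI u. ennreal L * (ennreal (volume_density \<phi> u) * g (\<phi> u) * indicator D u))"
  proof (rule nn_integral_mono)
    fix u
    show "?G u \<le> ennreal L * (ennreal (volume_density \<phi> u) * g (\<phi> u) * indicator D u)"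
    proof (cases "u \<in> D")
      case True
      have "1 * g (\<phi> u) \<le> ennreal (L * volume_density \<phi> u) * g (\<phi> u)"
        using ennreal_leI[OF vd(2)[OF True]] by (intro mult_right_mono) auto
      then show ?thesis using True L by (simp add: ennreal_mult' mult.assoc)
    qed simp
  qed
  also have "\<dots> = ennreal L * (NI u. ennreal (volume_density \<phi> u) * g (\<phi> u) * indicator D u)"
  proof (rule nn_integral_cmult)
    have "continuous_on U (volume_density \<phi>)" by (rule continuous_on_volume_density[OF lp])
    then have "volume_density \<phi> \<in> borel_measurable (restrict_space borel D)"
      using DU by (rule borel_measurable_continuous_on_restrict[OF continuous_on_subset])
    then have "(\<lambda>u. indicator D u *\<^sub>R volume_density \<phi> u) \<in> borel_measurable borel"
      using D(1) by (subst (asm) borel_measurable_restrict_space_iff) auto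
    then have "(\<lambda>u. ennreal (indicator D u *\<^sub>R volume_density \<phi> u) * ?G u) \<in> borel_measurable lborel" using Gm by measurable
    moreover have "ennreal (indicator D u *\<^sub>R volume_density \<phi> u) * ?G u = ennreal (volume_density \<phi> u) * g (\<phi> u) * indicator D u" for u
      by (auto simp: indicator_def)
    ultimately show "(\<lambda>u. ennreal (volume_density \<phi> u) * g (\<phi> u) * indicator D u) \<in> borel_measurable lborel" by simp
  qed
  finally show "(NI u. ?G u) \<le> ennreal L * (\<integral>\<^sup>+x. g x * indicator (\<phi> ` D) x \<partial>vol)" by (simp only: eq)
qed

text \<open>The gradient in the chart is the transposed derivative of \<phi> applied to the gradient
  field on X. Its norm brings one factor L, the change of measure another, hence L^2 M^2.\<close>

lemma sobolev_chart:
  fixes \<phi> :: "real^'m => real^'d"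
  assumes lp: "local_param X U \<phi>" and ok: "chart_ok X \<phi> c h L" and h: "0 < h"
    and U: "cball c (3 * h) \<subseteq> U" and L: "1 \<le> L" and f: "f \<in> H1_ball TYPE('m) X M"
  defines "F \<equiv> (\<lambda>u. indicator (cball c (3 * h)) u * f (\<phi> u))"
  shows "F \<in> borel_measurable borel" "(NI u. ennreal ((F u)^2)) < \<infinity>"
    "\<exists>g. weak_grad (ball c (3 * h)) F g \<and> g \<in> borel_measurable borel \<and>
        (\<forall>u. u \<notin> cball c (3 * h) --> g u = 0) \<and> (NI u. ennreal ((norm (g u))^2)) \<le> ennreal (L^2 * M^2)"
proof -
  let ?D = "cball c (3 * h)"
  have D: "?D \<in> sets borel" "?D \<subseteq> ?D" by auto
  note ci = chart_integral(2)[OF lp ok D U _ L]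
  have fH: "f \<in> borel_measurable vol" "integrable vol (\<lambda>x. (f x)^2)" "\<exists>G. is_weak_gradient TYPE('m) X f G" "(H1_norm TYPE('m) X f)^2 \<le> M^2"
    using f by (auto simp: H1_ball_def H1_def vol)
  \<comment> \<open>The seminorm is evaluated at the gradient selected by
    \<open>weak_gradient\<close>, so exactly this one is pulled back.\<close>
  define G where "G = weak_gradient TYPE('m) X f"
  have "is_weak_gradient TYPE('m) X f G" unfolding G_def weak_gradient_def by (rule someI_ex[OF fH(3)])
  then have Gm: "G \<in> borel_measurable vol" and Gi: "integrable vol (\<lambda>x. (norm (G x))^2)"
    and Gw: "\<And>\<eta> j. \<eta> \<in> test_functions U ==> set_lebesgue_integral lborel U (\<lambda>u. f (\<phi> u) * coord_deriv \<eta> j u) =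
           - set_lebesgue_integral lborel U (\<lambda>u. inner (G (\<phi> u)) (coord_deriv \<phi> j u) * \<eta> u)"
    using lp unfolding is_weak_gradient_def vol by blast+
  show Fm: "F \<in> borel_measurable borel"
    using chart_compose_measurable[OF lp sets_vol D(1) U fH(1)] by (simp add: F_def)
  have "(NI u. ennreal ((F u)^2)) = (NI u. ennreal ((f (\<phi> u))^2) * indicator ?D u)"
    by (intro nn_integral_cong) (auto simp: F_def indicator_def)
  also have "\<dots> \<le> ennreal L * (\<integral>\<^sup>+x. ennreal ((f x)^2) * indicator (\<phi> ` ?D) x \<partial>vol)" using fH(1) by (intro ci) auto
  also have "\<dots> \<le> ennreal L * (\<integral>\<^sup>+x. ennreal ((f x)^2) \<partial>vol)"
    by (intro mult_left_mono nn_integral_mono) (auto simp: indicator_def)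
  also have "\<dots> < \<infinity>" using fH(2) by (auto simp: integrable_iff_bounded ennreal_mult_less_top)
  finally show Ff: "(NI u. ennreal ((F u)^2)) < \<infinity>" .
  define g where "g = (\<lambda>u. \<chi> j. inner (indicator ?D u *\<^sub>R G (\<phi> u)) (indicator ?D u *\<^sub>R coord_deriv \<phi> j u))"
  have gm: "g \<in> borel_measurable borel"
  proof -
    have 1: "(\<lambda>u. indicator ?D u *\<^sub>R G (\<phi> u)) \<in> borel_measurable borel"
      by (rule chart_compose_measurable[OF lp sets_vol D(1) U Gm])
    have 2: "(\<lambda>u. indicator ?D u *\<^sub>R coord_deriv \<phi> j u) \<in> borel_measurable borel" for j
    proof -
      have "continuous_on ?D (coord_deriv \<phi> j)"
        unfolding coord_deriv_def[abs_def] using U by (rule continuous_on_subset[OF continuous_on_frechet[OF local_paramD(2)[OF lp]]])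
      then show ?thesis using borel_measurable_continuous_on_restrict by (subst borel_measurable_restrict_space_iff[symmetric]) auto
    qed
    show ?thesis
    proof (rule borel_measurable_euclidean_space[THEN iffD2], rule ballI)
      fix b :: "real^'m" assume "b \<in> Basis"
      then obtain j where b: "b = axis j 1" by (auto simp: Basis_vec_def)
      show "(\<lambda>u. inner (g u) b) \<in> borel_measurable borel"
        using borel_measurable_inner[OF 1 2[of j]] unfolding g_def b inner_axis vec_lambda_beta inner_real_def mult_1_right .
    qed
  qed
  have g0: "g u = 0" if "u \<notin> ?D" for u using that by (simp add: g_def Finite_Cartesian_Product.vec_eq_iff)
  have gle: "ennreal ((norm (g u))^2) \<le> ennreal L * (ennreal ((norm (G (\<phi> u)))^2) * indicator ?D u)" for u
  proof (cases "u \<in> ?D")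
    case True
    have "(norm (g u))^2 = (\<Sum>j\<in>UNIV. (inner (G (\<phi> u)) (coord_deriv \<phi> j u))^2)"
      using True unfolding power2_norm_eq_inner by (simp add: inner_vec_def g_def power2_eq_square)
    also have "\<dots> \<le> (\<Sum>j\<in>UNIV. (norm (G (\<phi> u)))^2 * (norm (coord_deriv \<phi> j u))^2)"
    proof (rule sum_mono)
      fix j
      have "\<bar>inner (G (\<phi> u)) (coord_deriv \<phi> j u)\<bar>\<^sup>2 \<le> (norm (G (\<phi> u)) * norm (coord_deriv \<phi> j u))^2"
        by (intro power_mono Cauchy_Schwarz_ineq2) auto
      then show "(inner (G (\<phi> u)) (coord_deriv \<phi> j u))^2 \<le> (norm (G (\<phi> u)))^2 * (norm (coord_deriv \<phi> j u))^2"
        by (simp add: power_mult_distrib)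
    qed
    also have "\<dots> = (norm (G (\<phi> u)))^2 * (\<Sum>j\<in>UNIV. (norm (coord_deriv \<phi> j u))^2)" by (rule sum_distrib_left[symmetric])
    also have "\<dots> \<le> (norm (G (\<phi> u)))^2 * L"
    proof (rule mult_left_mono)
      show "(\<Sum>j\<in>UNIV. (norm (coord_deriv \<phi> j u))^2) \<le> L"
        by (rule bspec[OF chart_okD(5)[OF ok] True])
    qed simp
    finally show ?thesis using True L by (simp add: ennreal_mult'[symmetric] ennreal_leI mult.commute)
  qed (simp add: g0)
  have "(NI u. ennreal ((norm (g u))^2)) \<le> (NI u. ennreal L * (ennreal ((norm (G (\<phi> u)))^2) * indicator ?D u))"
    by (intro nn_integral_mono gle)
  also have "\<dots> = ennreal L * (NI u. ennreal ((norm (G (\<phi> u)))^2) * indicator ?D u)"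
  proof (rule nn_integral_cmult)
    have "(\<lambda>u. ennreal ((norm (indicator ?D u *\<^sub>R G (\<phi> u)))^2)) \<in> borel_measurable lborel"
      using chart_compose_measurable[OF lp sets_vol D(1) U Gm] by measurable
    moreover have "ennreal ((norm (indicator ?D u *\<^sub>R G (\<phi> u)))^2) = ennreal ((norm (G (\<phi> u)))^2) * indicator ?D u" for u
      by (auto simp: indicator_def)
    ultimately show "(\<lambda>u. ennreal ((norm (G (\<phi> u)))^2) * indicator ?D u) \<in> borel_measurable lborel" by (simp only:)
  qed
  also have "\<dots> \<le> ennreal L * (ennreal L * (\<integral>\<^sup>+x. ennreal ((norm (G x))^2) * indicator (\<phi> ` ?D) x \<partial>vol))"
    using Gm by (intro mult_left_mono ci) auto
  also have "\<dots> \<le> ennreal L * (ennreal L * (\<integral>\<^sup>+x. ennreal ((norm (G x))^2) \<partial>vol))"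
    by (intro mult_left_mono nn_integral_mono) (auto simp: indicator_def)
  also have "(\<integral>\<^sup>+x. ennreal ((norm (G x))^2) \<partial>vol) = ennreal ((H1_seminorm TYPE('m) X f)^2)"
    using Gi by (simp add: nn_integral_eq_integral H1_seminorm_def G_def vol[symmetric])
  also have "ennreal L * (ennreal L * ennreal ((H1_seminorm TYPE('m) X f)^2)) = ennreal (L^2 * (H1_seminorm TYPE('m) X f)^2)"
    using L by (simp add: ennreal_mult'[symmetric] power2_eq_square mult.assoc)
  also have "\<dots> \<le> ennreal (L^2 * M^2)"
  proof (intro ennreal_leI mult_left_mono)
    have "0 \<le> L2_norm TYPE('m) X f" "0 \<le> H1_seminorm TYPE('m) X f" by (simp_all add: L2_norm_def H1_seminorm_def)
    then have "(H1_seminorm TYPE('m) X f)^2 \<le> (H1_norm TYPE('m) X f)^2" unfolding H1_norm_def by (intro power_mono) auto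
    then show "(H1_seminorm TYPE('m) X f)^2 \<le> M^2" using fH(4) by linarith
  qed simp
  finally have gS: "(NI u. ennreal ((norm (g u))^2)) \<le> ennreal (L^2 * M^2)" .
  have "weak_grad (ball c (3 * h)) F g"
  proof (rule weak_grad_coord[OF Fm Ff gm])
    show "(NI u. ennreal ((norm (g u))^2)) < \<infinity>" using gS by (simp add: le_less_trans)
    fix \<eta> :: "real^'m => real" and j assume t: "test_fun (ball c (3 * h)) \<eta>"
    then have sub: "closure {u. \<eta> u \<noteq> 0} \<subseteq> ?D"
      unfolding test_fun_def by (elim conjE) (rule order_trans[OF _ ball_subset_cball])
    have "\<eta> \<in> test_functions U"
      using t order_trans[OF sub U] unfolding test_fun_def test_functions_def mem_Collect_eq by (elim conjE) (intro conjI)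
    note w = Gw[OF this, of j]
    have DU: "indicator U u = (1::real)" if "u \<in> ?D" for u using that U by auto
    have "(\<integral>u. F u * coord_deriv \<eta> j u \<partial>lborel) = set_lebesgue_integral lborel U (\<lambda>u. f (\<phi> u) * coord_deriv \<eta> j u)"
      unfolding set_lebesgue_integral_def
    proof (rule Bochner_Integration.integral_cong[OF refl])
      fix u
      show "F u * coord_deriv \<eta> j u = indicator U u *\<^sub>R (f (\<phi> u) * coord_deriv \<eta> j u)"
      proof (cases "u \<in> ?D")
        case False
        then have "coord_deriv \<eta> j u = 0" using sub by (intro coord_deriv_zero) blast
        then show ?thesis by simp
      qed (simp add: F_def DU)
    qed
    also have "\<dots> = - set_lebesgue_integral lborel U (\<lambda>u. inner (G (\<phi> u)) (coord_deriv \<phi> j u) * \<eta> u)" by (rule w)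
    also have "set_lebesgue_integral lborel U (\<lambda>u. inner (G (\<phi> u)) (coord_deriv \<phi> j u) * \<eta> u) = (\<integral>u. vec_nth (g u) j * \<eta> u \<partial>lborel)"
      unfolding set_lebesgue_integral_def
    proof (rule Bochner_Integration.integral_cong[OF refl])
      fix u
      show "indicator U u *\<^sub>R (inner (G (\<phi> u)) (coord_deriv \<phi> j u) * \<eta> u) = vec_nth (g u) j * \<eta> u"
      proof (cases "u \<in> ?D")
        case False
        then have "\<eta> u = 0" using sub closure_subset[of "{u. \<eta> u \<noteq> 0}"] by blast
        then show ?thesis by simp
      qed (simp add: g_def DU)
    qed
    finally show "(\<integral>u. F u * coord_deriv \<eta> j u \<partial>lborel) = - (\<integral>u. vec_nth (g u) j * \<eta> u \<partial>lborel)" .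
  qed
  then show "\<exists>g. weak_grad (ball c (3 * h)) F g \<and> g \<in> borel_measurable borel \<and>
        (\<forall>u. u \<notin> ?D --> g u = 0) \<and> (NI u. ennreal ((norm (g u))^2)) \<le> ennreal (L^2 * M^2)"
    using gm gS by (intro exI[of _ g] conjI allI impI g0)
qed

end

section \<open>Rates\<close>

context atlas begin

lemma cell_size_exists:
  assumes "A \<noteq> {}"
  obtains \<sigma> where "0 < \<sigma>" "\<And>s a. s \<le> \<sigma> ==> a \<in> A ==> real CARD('m) * s \<le> h a"
proof
  show "0 < Min (h ` A) / real CARD('m)" using A assms h by (simp add: Min_gr_iff)
  fix s a assume s: "s \<le> Min (h ` A) / real CARD('m)" and a: "a \<in> A"
  have "real CARD('m) * s \<le> real CARD('m) * (Min (h ` A) / real CARD('m))" using s by (intro mult_left_mono) auto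
  also have "\<dots> \<le> h a" using A a by simp
  finally show "real CARD('m) * s \<le> h a" .
qed

text \<open>Applies \<open>power_sum_bound\<close> with \<eta> measured in units of \<sigma>, a side
  up to which cells fit into all charts, so that the admissible coarsenings are those with 2 ^ j
  (\<eta> / \<sigma>) <= 1.\<close>

lemma eigenvalue_sum:
  assumes K: "\<forall>t\<ge>0. 0 \<le> K t" "\<forall>t\<in>{0..1}. \<kappa> \<le> K t" and \<kappa>: "0 < \<kappa>" and A0: "A \<noteq> {}"
    and m4: "CARD('m) < 4"
  shows "\<exists>Cv>0. \<forall>n r \<eta> T x. 0 < n --> 0 < r --> 1 \<le> T --> real n * (T * r) ^ 8 \<le> T ^ CARD('m) -->
     \<eta> = r / (3 * real CARD('m) * L) --> (\<forall>i<n. x i \<in> space P) -->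
     good n \<eta> (real n * \<eta> ^ CARD('m) / (4 * k)) (3 * k * real n * \<eta> ^ CARD('m)) x -->
     (\<Sum>k = 1..n. 1 / (inverse (real n * r ^ (CARD('m) + 2)) * inverse (T^2) * sorted_eigenvalue (laplacian K n r x) k + 1) ^ 4) \<le> Cv * T ^ CARD('m)"
proof -
  obtain \<sigma> where \<sigma>: "0 < \<sigma>" "\<And>s a. s \<le> \<sigma> ==> a \<in> A ==> real CARD('m) * s \<le> h a" using cell_size_exists[OF A0] by blast
  define R where "R = 3 * real CARD('m) * L"
  have R: "0 < R" using L1 by (simp add: R_def)
  have cA: "0 < real (card A)" using A A0 by (simp add: card_gt_0_iff)
  \<comment> \<open>384 = 8 * 48: with lo = y / (4 k) and hi = 3 k y the ratio lo^2 / hi is y / (48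
    k^3), and the 8 is that of \<open>card_small_eigenvalues\<close>.\<close>
  define g0 where "g0 = \<kappa> / (384 * k ^ 3 * real CARD('m) ^ (CARD('m) + 2) * real (card A))"
  have g0: "0 < g0" using \<kappa> k cA by (simp add: g0_def)
  define q where "q = g0 / R ^ (CARD('m) + 2) / \<sigma>^2"
  have q: "0 < q" using g0 R \<sigma> by (simp add: q_def)
  define c1 where "c1 = total_volume / \<sigma> ^ CARD('m)"
  have c1: "0 \<le> c1" using \<sigma> by (simp add: c1_def total_volume_def sum_nonneg)
  define c2 where "c2 = (1 / (R * \<sigma>)) ^ 8"
  have c2: "0 < c2" using R \<sigma> by (simp add: c2_def)
  define Cv where "Cv = c2 + (8 * c1 + 128 * c1 / q ^ 4 + c2 / q ^ 4)"
  have Cv: "0 < Cv" using c1 c2 q by (simp add: Cv_def add_pos_nonneg)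
  have main: "(\<Sum>k = 1..n. 1 / (inverse (real n * r ^ (CARD('m) + 2)) * inverse (T^2) * sorted_eigenvalue (laplacian K n r x) k + 1) ^ 4) \<le> Cv * T ^ CARD('m)"
    if n: "0 < n" and r: "0 < r" and T: "1 \<le> T" and Tr: "real n * (T * r) ^ 8 \<le> T ^ CARD('m)"
      and \<eta>: "\<eta> = r / (3 * real CARD('m) * L)" and x: "\<forall>i<n. x i \<in> space P"
      and good: "good n \<eta> (real n * \<eta> ^ CARD('m) / (4 * k)) (3 * k * real n * \<eta> ^ CARD('m)) x" for n r \<eta> T x
  proof -
    define \<rho> where "\<rho> = inverse (real n * r ^ (CARD('m) + 2)) * inverse (T^2)"
    have \<rho>: "0 < \<rho>" using n r T by (simp add: \<rho>_def)
    have rR: "r = R * \<eta>" using L1 by (simp add: \<eta> R_def)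
    have \<eta>0: "0 < \<eta>" using r R by (simp add: \<eta> R_def[symmetric])
    obtain Q d where sp: "spectral_data n (laplacian K n r x) Q d" and d: "\<forall>k<n. 0 \<le> d k"
      using laplacian_spectrum[of K r n x] K(1) r by auto
    let ?h = "\<lambda>t. 1 / (\<rho> * t + 1) ^ 4"
    have eq: "(\<Sum>k = 1..n. ?h (sorted_eigenvalue (laplacian K n r x) k)) = (\<Sum>k<n. ?h (d k))"
      by (rule sum_sorted_eigenvalue[OF spectral_data.Q[OF sp] spectral_data.L[OF sp]])
    have c2b: "real n * (T * (\<eta> / \<sigma>)) ^ 8 \<le> c2 * T ^ CARD('m)"
    proof -
      have "T * (\<eta> / \<sigma>) = 1 / (R * \<sigma>) * (T * r)" using R by (simp add: rR)
      then have "real n * (T * (\<eta> / \<sigma>)) ^ 8 = c2 * (real n * (T * r) ^ 8)" by (simp only: c2_def power_mult_distrib mult_ac)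
      also have "\<dots> \<le> c2 * T ^ CARD('m)" using c2 by (intro mult_left_mono Tr) auto
      finally show ?thesis .
    qed
    have "(\<Sum>k<n. ?h (d k)) \<le> Cv * T ^ CARD('m)"
    proof (cases "T * (\<eta> / \<sigma>) \<le> 1")
      \<comment> \<open>The finest cells are already coarser than \<sigma> / T; then n is at most c2
        T ^ m, and bounding every summand by 1 suffices.\<close>
      case False
      have "(\<Sum>k<n. ?h (d k)) \<le> (\<Sum>k<n. 1)"
        using d \<rho> by (intro sum_mono) (auto simp: divide_le_eq_1 intro!: one_le_power)
      also have "\<dots> = real n * 1" by simp
      also have "\<dots> \<le> real n * (T * (\<eta> / \<sigma>)) ^ 8" using False by (intro mult_left_mono one_le_power) auto
      also have "\<dots> \<le> c2 * T ^ CARD('m)" by (rule c2b)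
      also have "\<dots> \<le> Cv * T ^ CARD('m)" using c1 c2 q T by (intro mult_right_mono) (auto simp: Cv_def)
      finally show ?thesis .
    next
      case True
      \<comment> \<open>The spectral gap at the finest scale; coarsening by 2 ^ j divides it by 4 ^
        j.\<close>
      define G where "G = g0 * (real n * \<eta> ^ CARD('m))"
      have cnt: "real (card {i. i < n \<and> d i < G / 4 ^ j}) \<le> c1 / (2 ^ j * (\<eta> / \<sigma>)) ^ CARD('m)" if j: "2 ^ j * (\<eta> / \<sigma>) \<le> 1" for j
      proof -
        have s: "real (2 ^ j) * \<eta> \<le> \<sigma>" using j \<sigma>(1) by (simp add: pos_divide_le_eq)
        then have sm: "\<forall>a\<in>A. real CARD('m) * (real (2 ^ j) * \<eta>) \<le> h a" using \<sigma>(2) by blast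
        let ?lo = "real n * \<eta> ^ CARD('m) / (4 * k)" and ?hi = "3 * k * real n * \<eta> ^ CARD('m)"
        have pos: "0 < ?lo" "0 < ?hi" using n \<eta>0 k by auto
        have "G / 4 ^ j = \<kappa> * ?lo^2 / (8 * real CARD('m) ^ (CARD('m) + 2) * ?hi * real (card A)) / (real (2 ^ j))^2"
        proof -
          define y where "y = real n * \<eta> ^ CARD('m)"
          have y: "0 < y" using n \<eta>0 by (simp add: y_def)
          have "?lo^2 / ?hi = y / (48 * k ^ 3)"
            unfolding mult.assoc y_def[symmetric] using y k by (simp add: power2_eq_square power3_eq_cube)
          moreover have "(real (2 ^ j))^2 = 4 ^ j" by (simp add: power_mult[symmetric] mult.commute[of j]) (simp add: power_mult)
          moreover have "\<kappa> * ?lo^2 / (8 * real CARD('m) ^ (CARD('m) + 2) * ?hi * real (card A)) = \<kappa> / (8 * real CARD('m) ^ (CARD('m) + 2) * real (card A)) * (?lo^2 / ?hi)"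
            by simp
          ultimately show ?thesis by (simp add: G_def g0_def y_def)
        qed
        then have "card {i. i < n \<and> d i < G / 4 ^ j} \<le> card (cells 1 (real (2 ^ j) * \<eta>))"
          using card_small_eigenvalues[where K = K, OF _ good pos \<eta>0 _ sm _ _ \<kappa> r _ sp A0] x R K by (simp add: rR R_def)
        then have "real (card {i. i < n \<and> d i < G / 4 ^ j}) \<le> real (card (cells 1 (real (2 ^ j) * \<eta>)))" by (rule of_nat_mono)
        also have "\<dots> \<le> total_volume / (real (2 ^ j) * \<eta>) ^ CARD('m)"
          using finite_cells(2)[of "real (2 ^ j) * \<eta>" 1] sm \<eta>0 by (subst pos_le_divide_eq) auto
        also have "\<dots> = c1 / (2 ^ j * (\<eta> / \<sigma>)) ^ CARD('m)" using \<sigma>(1) by (simp add: c1_def power_mult_distrib power_divide)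
        finally show ?thesis .
      qed
      have qb: "q / (T * (\<eta> / \<sigma>))^2 \<le> \<rho> * G"
      proof -
        have "\<rho> * G = g0 / R ^ (CARD('m) + 2) / (T * \<eta>)^2"
          unfolding \<rho>_def G_def rR using n \<eta>0 R T by (simp add: power_mult_distrib power_add power2_eq_square divide_simps)
        also have "\<dots> = q / (T * (\<eta> / \<sigma>))^2" using \<sigma> by (simp add: q_def power_mult_distrib power_divide)
        finally show ?thesis by simp
      qed
      have "0 < G" using g0 n \<eta>0 by (simp add: G_def)
      have "(\<Sum>k<n. ?h (d k)) \<le> (8 * c1 + 128 * c1 / q ^ 4 + c2 / q ^ 4) * T ^ CARD('m)"
        using d \<eta>0 \<sigma>(1) by (intro power_sum_bound[OF _ m4 T _ \<rho> \<open>0 < G\<close> q qb c1 cnt c2b True]) auto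
      also have "\<dots> \<le> Cv * T ^ CARD('m)" using c2 T by (intro mult_right_mono) (auto simp: Cv_def)
      finally show ?thesis .
    qed
    then show ?thesis unfolding \<rho>_def[symmetric] eq .
  qed
  show ?thesis by (intro exI[of _ Cv] conjI allI impI Cv) (rule main; assumption)
qed

text \<open>T, \<tau> and r enter only through a few algebraic relations, so that no real exponents
  occur in the estimate. All quantities are compared with y = n \<tau>, the common order of noise
  and bias.\<close>

lemma risk_rate:
  assumes K: "\<forall>t\<ge>0. 0 \<le> K t" "\<forall>t\<in>{0..1}. \<kappa> \<le> K t" "\<forall>t\<ge>0. K t \<le> K0" "\<forall>t>1. K t = 0"
    and \<kappa>: "0 < \<kappa>" and A0: "A \<noteq> {}" and m4: "CARD('m) < 4"
  shows "\<exists>C c c0. 0 < C \<and> 0 < c \<and> 0 < c0 \<and> (\<forall>n r T \<tau> M b \<alpha> f \<nu>. 0 < n --> 0 < r --> r \<le> c0 --> 1 \<le> T -->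
     real n * (T * r) ^ 8 \<le> T ^ CARD('m) --> 0 < \<tau> --> (real n * \<tau>)^2 = T ^ CARD('m) --> \<tau> * T^2 = M^2 --> (T * r)^2 \<le> 1 -->
     1 \<le> real n * r ^ CARD('m) --> 0 < M --> sobolev f (L^2 * M^2) --> 1 \<le> b --> 0 < \<alpha> -->
     C * \<tau> * (b^2 + b * sqrt (1 / \<alpha>)) \<le> \<nu> --> ennreal \<nu> \<le> (\<integral>\<^sup>+y. ennreal ((f y)^2) \<partial>P) -->
     (\<integral>\<^sup>+\<omega>. ennreal (1 - laplacian_smoothing_test K n r (inverse (real n * r ^ (CARD('m) + 2)) * inverse (T^2)) \<alpha> \<omega>) \<partial>sample_law P n f)
       \<le> ennreal (C / b + C * real n * exp (- c * real n * r ^ CARD('m))))"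
proof -
  obtain Cv where Cv: "0 < Cv" and V: "\<forall>n r \<eta> T x. 0 < n --> 0 < r --> 1 \<le> T --> real n * (T * r) ^ 8 \<le> T ^ CARD('m) -->
     \<eta> = r / (3 * real CARD('m) * L) --> (\<forall>i<n. x i \<in> space P) -->
     good n \<eta> (real n * \<eta> ^ CARD('m) / (4 * k)) (3 * k * real n * \<eta> ^ CARD('m)) x -->
     (\<Sum>k = 1..n. 1 / (inverse (real n * r ^ (CARD('m) + 2)) * inverse (T^2) * sorted_eigenvalue (laplacian K n r x) k + 1) ^ 4) \<le> Cv * T ^ CARD('m)"
    using eigenvalue_sum[where K = K, OF K(1,2) \<kappa> A0 m4] by (elim exE conjE) (rule that)
  obtain \<sigma> where \<sigma>: "0 < \<sigma>" "\<And>s a. s \<le> \<sigma> ==> a \<in> A ==> real CARD('m) * s \<le> h a" using cell_size_exists[OF A0] by blast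
  define R where "R = 3 * real CARD('m) * L"
  have R: "0 < R" using L1 by (simp add: R_def)
  have cA: "0 < real (card A)" using A A0 by (simp add: card_gt_0_iff)
  have K0: "0 \<le> K0" using K(1,3) by (metis order.refl order_trans)
  define Ce where "Ce = energy_const + 1"
  have Ce: "energy_const \<le> Ce" "0 < Ce" using energy_const_nonneg by (auto simp: Ce_def)
  \<comment> \<open>With Z = n \<nu> / w the main term n \<nu> / (8 k^2 \<open>card A\<close>)
    equals 4 Z; half of it is 2 Z, one Z may be spent on the two losses, and Z is left.\<close>
  define w where "w = 32 * k^2 * real (card A)"
  have w: "0 < w" using k cA by (simp add: w_def)
  \<comment> \<open>In units of y b, \<open>B1\<close> bounds the loss in the empirical norm and
    \<open>B2\<close> is the smoothing bias.\<close>
  define B1 where "B1 = Ce * R ^ CARD('m) * L^2 / k"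
  define B2 where "B2 = K0 * Ce * L^2 / 2"
  have B: "0 \<le> B1" "0 \<le> B2" using Ce R k K0 by (simp_all add: B1_def B2_def)
  have tv: "0 \<le> total_volume" by (simp add: total_volume_def sum_nonneg)
  \<comment> \<open>One summand for each demand: the signal beats the losses, the signal beats the
    random part of the threshold, the terms of order 1 / b, and the union bound over cells.\<close>
  define C where "C = w * (1 + B1 / 2 + B2) + w * (2 * sqrt (2 * Cv)) + (18 + 8 * Cv) + 2 * total_volume * R ^ CARD('m)"
  have nnC: "0 \<le> w * (1 + B1 / 2 + B2)" "0 \<le> w * (2 * sqrt (2 * Cv))" "0 \<le> 2 * total_volume * R ^ CARD('m)" using w B Cv tv R by auto
  have C: "w * (1 + B1 / 2 + B2) \<le> C" "w * (2 * sqrt (2 * Cv)) \<le> C" "18 + 8 * Cv \<le> C" "2 * total_volume * R ^ CARD('m) \<le> C" "0 < C"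
    using nnC Cv unfolding C_def by linarith+
  define c where "c = 1 / (4 * k * R ^ CARD('m))"
  have c: "0 < c" using k R by (simp add: c_def)
  define c0 where "c0 = min (inverse L) (R * \<sigma>)"
  have c0: "0 < c0" using L1 R \<sigma> by (simp add: c0_def)
  have main: "(\<integral>\<^sup>+\<omega>. ennreal (1 - laplacian_smoothing_test K n r (inverse (real n * r ^ (CARD('m) + 2)) * inverse (T^2)) \<alpha> \<omega>) \<partial>sample_law P n f)
       \<le> ennreal (C / b + C * real n * exp (- c * real n * r ^ CARD('m)))"
    if n: "0 < n" and r: "0 < r" "r \<le> c0" and T: "1 \<le> T" "real n * (T * r) ^ 8 \<le> T ^ CARD('m)" and \<tau>: "0 < \<tau>" "(real n * \<tau>)^2 = T ^ CARD('m)" "\<tau> * T^2 = M^2"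
      and Tr: "(T * r)^2 \<le> 1" and nr: "1 \<le> real n * r ^ CARD('m)" and M: "0 < M" and f: "sobolev f (L^2 * M^2)" and b: "1 \<le> b" and \<alpha>: "0 < \<alpha>"
      and \<nu>: "C * \<tau> * (b^2 + b * sqrt (1 / \<alpha>)) \<le> \<nu>" "ennreal \<nu> \<le> (\<integral>\<^sup>+y. ennreal ((f y)^2) \<partial>P)" for n r T \<tau> M b \<alpha> f \<nu>
  proof -
    define \<eta> where "\<eta> = r / (3 * real CARD('m) * L)"
    have rR: "r = R * \<eta>" using L1 by (simp add: \<eta>_def R_def)
    have \<eta>0: "0 < \<eta>" using r R by (simp add: \<eta>_def R_def[symmetric])
    have "\<eta> \<le> \<sigma>" using r(2) R by (simp add: c0_def rR)
    then have \<eta>: "0 < \<eta>" "\<forall>a\<in>A. real CARD('m) * \<eta> \<le> h a" using \<eta>0 \<sigma>(2) by auto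
    have \<eta>r: "real CARD('m) * \<eta> * L \<le> r" using \<eta>0 L1 by (simp add: rR R_def)
    define \<rho> where "\<rho> = inverse (real n * r ^ (CARD('m) + 2)) * inverse (T^2)"
    have \<rho>: "0 < \<rho>" using n r T by (simp add: \<rho>_def)
    define Z where "Z = real n * \<nu> / w"
    define y where "y = real n * \<tau>"
    have y0: "0 < y" using n \<tau> by (simp add: y_def)
    have "1^2 \<le> y^2" unfolding y_def \<tau>(2) using T(1) by (simp add: one_le_power)
    then have y: "1 \<le> y" by (rule power2_le_imp_le) (use y0 in simp)
    have sa: "0 \<le> sqrt (1 / \<alpha>)" using \<alpha> by simp
    have b2: "1 \<le> b^2" "b \<le> b^2" using b by (simp_all add: one_le_power self_le_power)
    have Zy: "C * y * (b^2 + b * sqrt (1 / \<alpha>)) / w \<le> Z"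
    proof -
      have "real n * (C * \<tau> * (b^2 + b * sqrt (1 / \<alpha>))) \<le> real n * \<nu>" using \<nu>(1) by (intro mult_left_mono) auto
      then show ?thesis unfolding Z_def using w by (intro divide_right_mono) (auto simp: y_def mult_ac)
    qed
    have Z1: "y * b * (1 + B1 / 2 + B2) \<le> Z"
    proof -
      have "y * b * (1 + B1 / 2 + B2) = (w * (1 + B1 / 2 + B2)) * y * b / w" using w by simp
      also have "\<dots> \<le> C * y * (b^2 + b * sqrt (1 / \<alpha>)) / w"
        using w B y0 b b2 sa C by (intro divide_right_mono mult_mono) (auto simp: add_increasing2)
      finally show ?thesis using Zy by linarith
    qed
    have Z2: "y * b^2 \<le> Z"
    proof -
      have "w * 1 \<le> w * (1 + B1 / 2 + B2)" using w B by (intro mult_left_mono) auto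
      then have wC: "w \<le> C" using C(1) by linarith
      have "y * b^2 = w * y * b^2 / w" using w by simp
      also have "\<dots> \<le> C * y * (b^2 + b * sqrt (1 / \<alpha>)) / w"
        using w y0 b sa wC by (intro divide_right_mono mult_mono) auto
      finally show ?thesis using Zy by linarith
    qed
    have Z3: "2 * sqrt (2 / \<alpha> * (Cv * T ^ CARD('m))) \<le> Z"
    proof -
      have "sqrt (2 / \<alpha> * (Cv * T ^ CARD('m))) = sqrt (2 * Cv * (1 / \<alpha>) * y^2)" by (simp add: y_def \<tau>(2))
      also have "\<dots> = sqrt (2 * Cv) * sqrt (1 / \<alpha>) * y" using y0 by (simp only: real_sqrt_mult real_sqrt_abs abs_of_pos)
      finally have "2 * sqrt (2 / \<alpha> * (Cv * T ^ CARD('m))) = (w * (2 * sqrt (2 * Cv))) * y * sqrt (1 / \<alpha>) / w" using w by simp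
      also have "\<dots> \<le> C * y * (b^2 + b * sqrt (1 / \<alpha>)) / w"
      proof (intro divide_right_mono mult_mono)
        have "1 * sqrt (1 / \<alpha>) \<le> b * sqrt (1 / \<alpha>)" using b sa by (intro mult_right_mono) auto
        then show "sqrt (1 / \<alpha>) \<le> b^2 + b * sqrt (1 / \<alpha>)" using b2 by linarith
      qed (use w y0 sa C in auto)
      finally show ?thesis using Zy by linarith
    qed
    have yb: "b \<le> y * b^2"
      using mult_mono[of 1 y b "b^2"] y b2 b by simp
    have Zb: "b \<le> Z" using yb Z2 by linarith
    have Zpos: "0 < Z" using Zb b by linarith
    have eta_pow: "r ^ (CARD('m) + 2) / \<eta> ^ CARD('m) = R ^ CARD('m) * r^2"
      unfolding power_add using \<eta>0 by (simp add: rR power_mult_distrib)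
    have e1: "b * (real n * (Ce * r ^ (CARD('m) + 2) * (L^2 * M^2))) / (k * \<eta> ^ CARD('m)) \<le> y * b * B1"
    proof -
      have "b * (real n * (Ce * r ^ (CARD('m) + 2) * (L^2 * M^2))) / (k * \<eta> ^ CARD('m))
         = b * real n * (Ce * L^2 / k) * M^2 * (r ^ (CARD('m) + 2) / \<eta> ^ CARD('m))" by simp
      also have "\<dots> = b * B1 * real n * (\<tau> * (T * r)^2)"
        unfolding eta_pow \<tau>(3)[symmetric] by (simp add: B1_def power_mult_distrib)
      also have "\<dots> \<le> b * B1 * real n * (\<tau> * 1)" using Tr \<tau>(1) b B by (intro mult_left_mono) auto
      finally show ?thesis by (simp add: y_def mult_ac)
    qed
    have e2: "\<rho> * (K0 * (b * ((real n)^2 * (Ce * r ^ (CARD('m) + 2) * (L^2 * M^2)))) / 2) = y * b * B2"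
    proof -
      have "\<rho> * ((real n)^2 * r ^ (CARD('m) + 2) * M^2) = y"
      proof -
        have "inverse u * inverse v * (real n * u * (\<tau> * v)) = y" if "0 < u" "0 < v" for u v using that by (simp add: y_def field_simps)
        from this[of "real n * r ^ (CARD('m) + 2)" "T^2"] show ?thesis
          using n r T unfolding \<rho>_def \<tau>(3)[symmetric] by (simp only: power2_eq_square[of "real n"] mult.assoc) simp
      qed
      then have "K0 * Ce * L^2 / 2 * b * (\<rho> * ((real n)^2 * r ^ (CARD('m) + 2) * M^2)) = y * b * B2" by (simp add: B2_def mult_ac)
      then show ?thesis by (simp add: mult_ac)
    qed
    have Z: "Z \<le> (real n * \<nu> / (8 * k^2 * real (card A)) - b * (real n * (Ce * r ^ (CARD('m) + 2) * (L^2 * M^2))) / (k * \<eta> ^ CARD('m))) / 2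
         - \<rho> * (K0 * (b * ((real n)^2 * (Ce * r ^ (CARD('m) + 2) * (L^2 * M^2)))) / 2)"
    proof -
      have "real n * \<nu> / (8 * k^2 * real (card A)) = 4 * Z" by (simp add: Z_def w_def mult_ac)
      moreover have "y * b * B1 / 2 + y * b * B2 \<le> Z"
      proof -
        have "y * b * (1 + B1 / 2 + B2) = y * b + (y * b * B1 / 2 + y * b * B2)" by (simp add: distrib_left)
        moreover have "0 \<le> y * b" using y0 b by simp
        ultimately show ?thesis using Z1 by linarith
      qed
      moreover have "Z \<le> (N - e) / 2 - b2" if "N = 4 * Z" "b1 / 2 + b2 \<le> Z" "e \<le> b1" for N e b1 b2
        using that by (simp add: field_simps)
      ultimately show ?thesis unfolding e2 using e1 by blast
    qed
    have "(\<integral>\<^sup>+\<omega>. ennreal (1 - laplacian_smoothing_test K n r \<rho> \<alpha> \<omega>) \<partial>sample_law P n f)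
      \<le> ennreal (2 * total_volume / \<eta> ^ CARD('m) * exp (- (real n * \<eta> ^ CARD('m) / (4 * k))) + 2 / b + (16 / Z + 8 * (Cv * T ^ CARD('m)) / Z^2))"
    proof (rule risk_bound[where K = K, OF n r(1) _ \<eta> \<eta>r \<rho> \<alpha> b f _ \<nu>(2) A0 K(1,3,4)[rule_format] Ce _ _ Z Zpos Z3])
      show "r \<le> inverse L" using r(2) by (simp add: c0_def)
      show "0 < L^2 * M^2" using L1 M by simp
      show "0 \<le> Cv * T ^ CARD('m)" using Cv T by simp
      show "(\<Sum>k = 1..n. 1 / (\<rho> * sorted_eigenvalue (laplacian K n r x) k + 1) ^ 4) \<le> Cv * T ^ CARD('m)"
        if "\<And>i. i < n ==> x i \<in> space P" "good n \<eta> (real n * \<eta> ^ CARD('m) / (4 * k)) (3 * k * real n * \<eta> ^ CARD('m)) x" for x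
        unfolding \<rho>_def using that by (intro V[rule_format, OF n r(1) T \<eta>_def]) auto
    qed assumption+
    also have "\<dots> \<le> ennreal (C / b + C * real n * exp (- c * real n * r ^ CARD('m)))"
    proof (rule ennreal_leI)
      have "16 / Z \<le> 16 / b" using Zb b by (intro divide_left_mono) auto
      moreover have "8 * (Cv * T ^ CARD('m)) / Z^2 \<le> 8 * Cv / b"
      proof -
        have "b * y^2 \<le> (y * b^2)^2"
        proof -
          have "b \<le> b ^ 4" using b by (intro self_le_power) auto
          then have "b * y^2 \<le> b ^ 4 * y^2" by (intro mult_right_mono) auto
          then show ?thesis by (simp add: power_mult_distrib power_mult[symmetric] mult.commute)
        qed
        also have "\<dots> \<le> Z^2" using Z2 y0 by (intro power_mono) auto
        \<comment> \<open>V / Z^2 is of order y^2 / Z^2 because T ^ m = y^2, and Z >= y b^2 makes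
          this at most 1 / b.\<close>
        finally have "8 * Cv * (y^2 * b) \<le> 8 * Cv * Z^2" using Cv by (intro mult_left_mono) (auto simp: mult.commute)
        then show ?thesis unfolding \<tau>(2)[symmetric] y_def[symmetric] using Zpos b by (simp add: divide_simps mult_ac)
      qed
      moreover have "16 / b + 8 * Cv / b + 2 / b \<le> C / b"
        using C(3) b by (simp add: add_divide_distrib[symmetric] divide_right_mono)
      moreover have "2 * total_volume / \<eta> ^ CARD('m) * exp (- (real n * \<eta> ^ CARD('m) / (4 * k))) \<le> C * real n * exp (- c * real n * r ^ CARD('m))"
      proof -
        have ex: "real n * \<eta> ^ CARD('m) / (4 * k) = c * real n * r ^ CARD('m)"
          using R k by (simp add: c_def rR power_mult_distrib)
        have "2 * total_volume / \<eta> ^ CARD('m) = 2 * total_volume * R ^ CARD('m) * (1 / r ^ CARD('m))"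
          using R by (simp add: rR power_mult_distrib)
        \<comment> \<open>n r ^ m >= 1 exchanges the number of cells, of order r ^ -m, for
          n.\<close>
        also have "\<dots> \<le> C * real n"
          using nr r(1) tv R C by (intro mult_mono) (auto simp: pos_divide_le_eq)
        finally show ?thesis unfolding ex mult_minus_left by (rule mult_right_mono) simp
      qed
      ultimately show "2 * total_volume / \<eta> ^ CARD('m) * exp (- (real n * \<eta> ^ CARD('m) / (4 * k))) + 2 / b + (16 / Z + 8 * (Cv * T ^ CARD('m)) / Z^2)
         \<le> C / b + C * real n * exp (- c * real n * r ^ CARD('m))" by linarith
    qed
    finally show ?thesis unfolding \<rho>_def .
  qed
  show ?thesis
    by (rule exI[of _ C], rule exI[of _ c], rule exI[of _ c0], intro conjI allI impI C(5) c c0) (rule main; assumption)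
qed

end

context design
begin

lemma atlas_exists:
  obtains A :: "(real^'d) set" and \<phi> :: "real^'d => real^'m => real^'d" and c h L k where "atlas P A \<phi> c h L k" "A \<noteq> {}"
    "\<And>f M. f \<in> H1_ball TYPE('m) X M ==> atlas.sobolev P A \<phi> c h f (L^2 * M^2)"
proof -
  obtain A :: "(real^'d) set" and U :: "real^'d => (real^'m) set" and \<phi> c h L where
    A: "finite A" and lp: "\<And>a. a \<in> A ==> local_param X (U a) (\<phi> a)" and h: "\<And>a. a \<in> A ==> 0 < h a"
    and sub: "\<And>a. a \<in> A ==> cball (c a) (3 * h a) \<subseteq> U a" and ok: "\<And>a. a \<in> A ==> chart_ok X (\<phi> a) (c a) (h a) L"
    and cov: "X \<subseteq> (\<Union>a\<in>A. \<phi> a ` cball (c a) (h a))" and L: "1 \<le> L"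
    by (rule finite_charts_ok[OF X]) (rule that; assumption)
  \<comment> \<open>In a chart P has a density between p_min / L and p_max L with respect to
    Lebesgue measure, and k majorises both comparison factors.\<close>
  define k where "k = max 1 (max (p_max * L) (L / p_min))"
  have k: "1 \<le> k" "p_max * L \<le> k" "L / p_min \<le> k" by (auto simp: k_def)
  obtain x0 where "x0 \<in> X" using X_nonempty by blast
  then have pm: "0 < p_max" using p(1) p(2,3)[of x0] by linarith
  note ci = chart_integral[OF lp ok _ _ sub _ L]
  have A0: "A \<noteq> {}" using X_nonempty cov by auto
  have atl: "atlas P A \<phi> c h L k"
  proof (intro atlas.intro atlas_axioms.intro P(1) A h L k(1))
    fix a assume a: "a \<in> A"
    show "norm (\<phi> a u - \<phi> a v) \<le> L * norm (u - v)" "norm (u - v) \<le> L * norm (\<phi> a u - \<phi> a v)"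
      if "u \<in> cball (c a) (3 * h a)" "v \<in> cball (c a) (3 * h a)" for u v
      by (rule bspec[OF bspec[OF chart_okD(1)[OF ok[OF a]] that(1)] that(2)], rule bspec[OF bspec[OF chart_okD(2)[OF ok[OF a]] that(1)] that(2)])
    show "y \<in> \<phi> a ` cball (c a) (2 * h a)" if "u \<in> cball (c a) (h a)" "y \<in> space P" "norm (\<phi> a u - y) \<le> inverse L" for u y
      using bspec[OF bspec[OF chart_okD(6)[OF ok[OF a]] that(1)], of y] that(2,3) by (simp add: space_vol)
    fix D :: "(real^'m) set" assume D: "D \<in> sets borel" "D \<subseteq> cball (c a) (3 * h a)"
    show imD: "\<phi> a ` D \<in> sets P" by (rule ci(3)[OF a a D a borel_measurable_const])
    have im: "\<phi> a ` D \<in> sets vol" using imD by (simp add: sets_P)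
    show "(\<integral>\<^sup>+x. g x * indicator (\<phi> a ` D) x \<partial>P) \<le> ennreal k * (NI u. g (\<phi> a u) * indicator D u)" if g: "g \<in> borel_measurable P" for g
    proof -
      have gv: "g \<in> borel_measurable vol" using g by (simp only: measurable_cong_sets[OF sets_P refl])
      have "(\<lambda>x. g x * indicator (\<phi> a ` D) x) \<in> borel_measurable vol"
        by (intro borel_measurable_times_ennreal gv borel_measurable_indicator im)
      then have "(\<integral>\<^sup>+x. g x * indicator (\<phi> a ` D) x \<partial>P) \<le> ennreal p_max * (\<integral>\<^sup>+x. g x * indicator (\<phi> a ` D) x \<partial>vol)"
        by (rule nn_integral_P)
      also have "\<dots> \<le> ennreal p_max * (ennreal L * (NI u. g (\<phi> a u) * indicator D u))"
        by (intro mult_left_mono ci(1)[OF a a D a gv]) simp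
      also have "\<dots> = ennreal (p_max * L) * (NI u. g (\<phi> a u) * indicator D u)"
        using pm by (simp add: ennreal_mult' mult.assoc)
      also have "\<dots> \<le> ennreal k * (NI u. g (\<phi> a u) * indicator D u)"
        by (intro mult_right_mono ennreal_leI k(2)) simp
      finally show ?thesis .
    qed
    have "(NI u. 1 * indicator D u) \<le> ennreal L * (\<integral>\<^sup>+x. 1 * indicator (\<phi> a ` D) x \<partial>vol)"
      by (rule ci(2)[OF a a D a borel_measurable_const])
    then have 1: "emeasure lborel D \<le> ennreal L * emeasure vol (\<phi> a ` D)" using D im by simp
    have "ennreal p_min * (\<integral>\<^sup>+x. indicator (\<phi> a ` D) x \<partial>vol) \<le> (\<integral>\<^sup>+x. indicator (\<phi> a ` D) x \<partial>P)"
      by (rule nn_integral_P(2)) (rule borel_measurable_indicator[OF im])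
    then have 2: "ennreal p_min * emeasure vol (\<phi> a ` D) \<le> emeasure P (\<phi> a ` D)" using im imD by simp
    have "ennreal L * emeasure vol (\<phi> a ` D) = ennreal (L / p_min) * (ennreal p_min * emeasure vol (\<phi> a ` D))"
      using p(1) L by (simp add: mult.assoc[symmetric] ennreal_mult'[symmetric])
    also have "\<dots> \<le> ennreal k * emeasure P (\<phi> a ` D)" using 2 by (intro mult_mono ennreal_leI k(3)) auto
    finally show "emeasure lborel D \<le> ennreal k * emeasure P (\<phi> a ` D)" using 1 by (rule order_trans[rotated])
  next
    have "(\<lambda>x. x) \<in> borel_measurable (restrict_space borel X)" by (rule measurable_restrict_space1) simp
    then show "(\<lambda>x. x) \<in> P \<rightarrow>\<^sub>M borel"
      by (simp only: measurable_cong_sets[OF sets_P refl] measurable_cong_sets[OF sets_vol refl])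
    show "\<exists>a\<in>A. x \<in> \<phi> a ` cball (c a) (h a)" if "x \<in> space P" for x
      using that cov unfolding space_vol by blast
  qed
  interpret atlas P A \<phi> c h L k by (rule atl)
  have "sobolev f (L^2 * M^2)" if f: "f \<in> H1_ball TYPE('m) X M" for f M
    unfolding sobolev_def
  proof (intro conjI ballI)
    show "f \<in> borel_measurable P" using f by (simp add: measurable_P H1_ball_def H1_def vol)
    fix a assume a: "a \<in> A"
    have cf: "chart_fun f a = (\<lambda>u. indicator (cball (c a) (3 * h a)) u * f (\<phi> a u))" by (simp add: chart_fun_def[abs_def])
    note sc = sobolev_chart[OF lp[OF a] ok[OF a] h[OF a] sub[OF a] L f]
    show "chart_fun f a \<in> borel_measurable borel" unfolding cf by (rule sc(1))
    show "(NI u. ennreal ((chart_fun f a u)^2)) < \<infinity>" unfolding cf by (rule sc(2))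
    show "\<exists>g. weak_grad (ball (c a) (3 * h a)) (chart_fun f a) g \<and> g \<in> borel_measurable borel \<and>
        (\<forall>u. u \<notin> cball (c a) (3 * h a) --> g u = 0) \<and> (NI u. ennreal ((norm (g u))^2)) \<le> ennreal (L^2 * M^2)"
      unfolding cf by (rule sc(3))
  qed simp
  then show thesis by (rule that[OF atl A0])
qed

lemma L2_norm_P:
  assumes f: "f \<in> H1_ball TYPE('m) X M" and \<epsilon>: "0 < \<epsilon>" "\<epsilon> < L2_norm TYPE('m) X f"
  shows "ennreal (p_min * \<epsilon>^2) \<le> (\<integral>\<^sup>+x. ennreal ((f x)^2) \<partial>P)"
proof -
  have fm: "f \<in> borel_measurable vol" "integrable vol (\<lambda>x. (f x)^2)" using f by (auto simp: H1_ball_def H1_def vol)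
  have "\<epsilon>^2 \<le> (L2_norm TYPE('m) X f)^2" using \<epsilon> by (intro power_mono) auto
  also have "\<dots> = (\<integral>x. (f x)^2 \<partial>vol)" by (simp add: L2_norm_def vol)
  finally have "ennreal (\<epsilon>^2) \<le> (\<integral>\<^sup>+x. ennreal ((f x)^2) \<partial>vol)"
    using fm(2) by (simp add: nn_integral_eq_integral ennreal_leI)
  then have "ennreal p_min * ennreal (\<epsilon>^2) \<le> ennreal p_min * (\<integral>\<^sup>+x. ennreal ((f x)^2) \<partial>vol)" by (rule mult_left_mono) simp
  also have "\<dots> \<le> (\<integral>\<^sup>+x. ennreal ((f x)^2) \<partial>P)" using fm(1) by (intro nn_integral_P) auto
  finally show ?thesis using p(1) by (simp add: ennreal_mult')
qed

end

text \<open>Monomials n^a M^b are kept in a normal form, so that identities between rates reduce to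
  identities between exponents.\<close>

lemma powr_product_nonneg_exponents:
  fixes n M :: real
  assumes "0 < n" "0 < M"
  shows "n powr a * M powr b * (n powr a' * M powr b') = n powr (a + a') * M powr (b + b')"
    and "(n powr a * M powr b) ^ j = n powr (real j * a) * M powr (real j * b)"
  using assms by (simp_all add: powr_add power_mult_distrib powr_power mult.commute)

text \<open>Here \<open>\<tau>\<close> is the squared minimax rate and \<open>T\<close> the frequency at which the smoother cuts off.\<close>

lemma rate_identities:
  fixes n M r :: real and m :: nat
  assumes m: "1 \<le> m" "m < 4" and n: "1 \<le> n" and M: "n powr (-1/2) \<le> M" "M \<le> n powr ((4 - real m) / (4 * real m))"
    and r: "0 < r" "r \<le> M powr ((real m - 8) / (8 + 2 * real m)) * n powr ((real m - 20) / (32 + 8 * real m))"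
  defines "T \<equiv> n powr (2 / (4 + real m)) * M powr (4 / (4 + real m))"
    and "\<tau> \<equiv> M powr (2 * real m / (4 + real m)) * n powr (- 4 / (4 + real m))"
  shows "1 \<le> T" "n * (T * r) ^ 8 \<le> T ^ m" "0 < \<tau>" "(n * \<tau>)^2 = T ^ m" "\<tau> * T^2 = M^2" "(T * r)^2 \<le> 1"
    "n powr (- 4 / (4 + real m)) * M powr (- 8 / (4 + real m)) = inverse (T^2)"
proof -
  have n0: "0 < n" using n by simp
  have M0: "0 < M" using M(1) n0 by (rule_tac less_le_trans[OF _ M(1)]) simp
  define q where "q = 4 + real m"
  have q: "0 < q" by (simp add: q_def)
  note pp = powr_product_nonneg_exponents[OF n0 M0]
  have T0: "0 < T" using n0 M0 by (simp add: T_def)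
  show \<tau>0: "0 < \<tau>" using n0 M0 by (simp add: \<tau>_def)
  \<comment> \<open>M >= n^(-1/2) is exactly what makes T >= 1.\<close>
  have "1 = n powr (2 / q) * (n powr (-1/2)) powr (4 / q)" using n0 by (simp add: powr_powr powr_add[symmetric])
  also have "\<dots> \<le> n powr (2 / q) * M powr (4 / q)"
    using M(1) n0 q by (intro mult_left_mono powr_mono2) auto
  finally show T1: "1 \<le> T" by (simp add: T_def q_def)
  have Tp: "T ^ j = n powr (real j * (2 / q)) * M powr (real j * (4 / q))" for j unfolding T_def q_def by (rule pp(2))
  have n1: "n = n powr 1 * M powr 0" and M2: "M^2 = n powr 0 * M powr 2" using n0 M0 by (simp_all add: powr_numeral)
  have \<tau>': "\<tau> = n powr (- 4 / q) * M powr (2 * real m / q)" by (simp add: \<tau>_def q_def mult.commute)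
  have "n * \<tau> = n powr (1 + - 4 / q) * M powr (0 + 2 * real m / q)" unfolding \<tau>' by (subst (1) n1, rule pp(1))
  then have "(n * \<tau>)^2 = n powr (2 * (1 + - 4 / q)) * M powr (2 * (0 + 2 * real m / q))" by (simp only: pp(2) of_nat_numeral)
  also have "2 * (1 + - 4 / q) = real m * (2 / q)" using q by (simp add: field_simps) (simp add: q_def)
  also have "2 * (0 + 2 * real m / q) = real m * (4 / q)" by simp
  finally show "(n * \<tau>)^2 = T ^ m" unfolding Tp .
  have "\<tau> * T^2 = n powr (- 4 / q + real 2 * (2 / q)) * M powr (2 * real m / q + real 2 * (4 / q))"
    unfolding \<tau>' Tp by (rule pp(1))
  also have "- 4 / q + real 2 * (2 / q) = 0" by simp
  also have "2 * real m / q + real 2 * (4 / q) = 2" using q by (simp add: field_simps) (simp add: q_def)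
  finally show \<tau>T: "\<tau> * T^2 = M^2" unfolding M2 .
  show "n powr (- 4 / (4 + real m)) * M powr (- 8 / (4 + real m)) = inverse (T^2)"
  proof -
    have "n powr (- 4 / q) * M powr (- 8 / q) * T^2 = n powr (- 4 / q + real 2 * (2 / q)) * M powr (- 8 / q + real 2 * (4 / q))"
      unfolding Tp by (rule pp(1))
    also have "\<dots> = 1" using n0 M0 by simp
    finally show ?thesis using T0 unfolding q_def by (simp add: field_simps)
  qed
  \<comment> \<open>The exponents in the bound on r are an eighth of those that turn n T^8 r^8 into
    T^m.\<close>
  have "r ^ 8 \<le> (n powr ((real m - 20) / (32 + 8 * real m)) * M powr ((real m - 8) / (8 + 2 * real m))) ^ 8"
    using r by (intro power_mono) (auto simp: mult.commute)
  also have "\<dots> = n powr (real 8 * ((real m - 20) / (32 + 8 * real m))) * M powr (real 8 * ((real m - 8) / (8 + 2 * real m)))" by (rule pp(2))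
  also have "real 8 * ((real m - 20) / (32 + 8 * real m)) = (real m - 20) / q"
    unfolding q_def by (simp add: divide_simps) (simp add: algebra_simps)
  also have "real 8 * ((real m - 8) / (8 + 2 * real m)) = 4 * (real m - 8) / q"
    unfolding q_def by (simp add: divide_simps) (simp add: algebra_simps)
  finally have r8: "r ^ 8 \<le> n powr ((real m - 20) / q) * M powr (4 * (real m - 8) / q)" .
  have "n * (T * r) ^ 8 = n * (T ^ 8 * r ^ 8)" by (simp add: power_mult_distrib)
  also have "\<dots> \<le> n * (T ^ 8 * (n powr ((real m - 20) / q) * M powr (4 * (real m - 8) / q)))"
    using n0 T0 r8 by (intro mult_left_mono) auto
  also have "\<dots> = n powr (1 + (real 8 * (2 / q) + (real m - 20) / q)) * M powr (0 + (real 8 * (4 / q) + 4 * (real m - 8) / q))"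
    unfolding Tp pp(1) by (subst (1) n1, rule pp(1))
  also have "1 + (real 8 * (2 / q) + (real m - 20) / q) = real m * (2 / q)" using q by (simp add: field_simps) (simp add: q_def)
  also have "0 + (real 8 * (4 / q) + 4 * (real m - 8) / q) = real m * (4 / q)" using q by (simp add: field_simps)
  finally show Tr8: "n * (T * r) ^ 8 \<le> T ^ m" unfolding Tp .
  \<comment> \<open>M <= n^((4-m)/(4m)) is exactly the condition under which T^m does not exceed
    n.\<close>
  have "T ^ m \<le> n"
  proof -
    have "M powr (real m * (4 / q)) \<le> (n powr ((4 - real m) / (4 * real m))) powr (real m * (4 / q))"
      using M(2) M0 q by (intro powr_mono2) auto
    also have "\<dots> = n powr ((4 - real m) / (4 * real m) * (real m * (4 / q)))" by (rule powr_powr)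
    also have "(4 - real m) / (4 * real m) * (real m * (4 / q)) = (4 - real m) / q" using m q by (simp add: field_simps)
    finally have "T ^ m \<le> n powr (real m * (2 / q)) * n powr ((4 - real m) / q)" unfolding Tp using n0 by (intro mult_left_mono) auto
    also have "\<dots> = n powr (real m * (2 / q) + (4 - real m) / q)" by (simp add: powr_add)
    also have "real m * (2 / q) + (4 - real m) / q = 1" using q by (simp add: field_simps) (simp add: q_def)
    finally show ?thesis using n0 by simp
  qed
  with Tr8 have "n * (T * r) ^ 8 \<le> n * 1" by simp
  then have "(T * r) ^ 8 \<le> 1 ^ 8" using n0 by simp
  then have "T * r \<le> 1" by (rule power_le_imp_le_base[of _ 7, simplified]) simp
  then show "(T * r)^2 \<le> 1" using T0 r(1) by (intro power_le_one) auto
qed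

theorem theorem5:
  fixes X :: "(real^'d::finite) set"
    and P :: "(real^'d) measure"
    and p :: "real^'d \<Rightarrow> real"
    and K :: "real \<Rightarrow> real"
    and p_min p_max L_p :: real
    and m :: nat
  assumes m: "m = CARD('m::finite)" "m \<le> CARD('d)" "m < 4"
    and X: "compact X" "connected X" "embedded_manifold TYPE('m) X" "0 < reach X"
    and P: "prob_space P" "P = density (riemannian_volume TYPE('m) X) (\<lambda>x. ennreal (p x))"
    and p: "0 < p_min" "\<And>x. x \<in> X \<Longrightarrow> p_min \<le> p x" "\<And>x. x \<in> X \<Longrightarrow> p x \<le> p_max"
           "lipschitz_on L_p X p"
    and K: "admissible_kernel TYPE('d) K"
  shows "\<exists>C0 c0 C c :: real. \<exists>N :: nat. 0 < C0 \<and> 0 < c0 \<and> 0 < C \<and> 0 < c \<and> 0 < N \<and>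
    (\<forall>(n::nat) (\<alpha>::real) (M::real) (r::real) (b::real) (\<epsilon>::real).
       N \<le> n \<longrightarrow> 0 < \<alpha> \<longrightarrow> \<alpha> < 1 \<longrightarrow>
       real n powr (-1/2) \<le> M \<longrightarrow> M \<le> M_max m n \<longrightarrow>
       C0 * (ln (real n) / real n) powr (1 / real m) \<le> r \<longrightarrow>
       r \<le> min c0 (M powr ((real m - 8) / (8 + 2 * real m))
                   * real n powr ((real m - 20) / (32 + 8 * real m))) \<longrightarrow>
       1 \<le> b \<longrightarrow> 0 < \<epsilon> \<longrightarrow>
       \<epsilon>\<^sup>2 \<ge> C * M powr (2 * real m / (4 + real m)) * real n powr (- 4 / (4 + real m))
               * (b\<^sup>2 + b * sqrt (1 / \<alpha>)) \<longrightarrow>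
       (let \<rho> = inverse (real n * r ^ (m + 2)) * real n powr (- 4 / (4 + real m))
                  * M powr (- 8 / (4 + real m))
        in worst_case_risk TYPE('m) X P n (laplacian_smoothing_test K n r \<rho> \<alpha>)
             (H1_ball TYPE('m) X M) \<epsilon>
           \<le> ennreal (C / b + C * real n * exp (- c * real n * r ^ m))))"
proof -
  interpret design X P p p_min p_max L_p "TYPE('m)" "riemannian_volume TYPE('m) X"
    by (rule design.intro) (rule refl, rule X(1), rule X(3), rule P(1), rule P(2), rule p(1), rule p(2), assumption, rule p(3), assumption, rule p(4))
  obtain A :: "(real^'d) set" and \<phi> :: "real^'d \<Rightarrow> real^'m \<Rightarrow> real^'d" and ce h L k where atl: "atlas P A \<phi> ce h L k" and A0: "A \<noteq> {}"
    and sob: "\<And>f M. f \<in> H1_ball TYPE('m) X M \<Longrightarrow> atlas.sobolev P A \<phi> ce h f (L\<^sup>2 * M\<^sup>2)"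
    by (rule atlas_exists) (rule that; assumption)
  have K1: "\<forall>t\<ge>0. 0 \<le> K t" and K2: "antimono_on {0..} K" and K3: "\<forall>t>1. K t = 0" and K4: "0 < K 1"
    using K by (auto simp: admissible_kernel_def)
  have K5: "\<forall>t\<in>{0..1}. K 1 \<le> K t" "\<forall>t\<ge>0. K t \<le> K 0" using K2 by (auto simp: monotone_on_def)
  obtain C c c0 where C: "0 < C" and c: "0 < c" and c0: "0 < c0"
    and risk: "\<forall>n r T \<tau> M b \<alpha> f \<nu>. 0 < n \<longrightarrow> 0 < r \<longrightarrow> r \<le> c0 \<longrightarrow> 1 \<le> T \<longrightarrow>
     real n * (T * r) ^ 8 \<le> T ^ CARD('m) \<longrightarrow> 0 < \<tau> \<longrightarrow> (real n * \<tau>)\<^sup>2 = T ^ CARD('m) \<longrightarrow> \<tau> * T\<^sup>2 = M\<^sup>2 \<longrightarrow> (T * r)\<^sup>2 \<le> 1 \<longrightarrow>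
     1 \<le> real n * r ^ CARD('m) \<longrightarrow> 0 < M \<longrightarrow> atlas.sobolev P A \<phi> ce h f (L\<^sup>2 * M\<^sup>2) \<longrightarrow> 1 \<le> b \<longrightarrow> 0 < \<alpha> \<longrightarrow>
     C * \<tau> * (b\<^sup>2 + b * sqrt (1 / \<alpha>)) \<le> \<nu> \<longrightarrow> ennreal \<nu> \<le> (\<integral>\<^sup>+y. ennreal ((f y)\<^sup>2) \<partial>P) \<longrightarrow>
     (\<integral>\<^sup>+\<omega>. ennreal (1 - laplacian_smoothing_test K n r (inverse (real n * r ^ (CARD('m) + 2)) * inverse (T\<^sup>2)) \<alpha> \<omega>) \<partial>sample_law P n f)
       \<le> ennreal (C / b + C * real n * exp (- c * real n * r ^ CARD('m)))"
    using atlas.risk_rate[OF atl K1 K5(1) K5(2) K3 K4 A0 m(3)[unfolded m(1)]] by (elim exE conjE) (rule that)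
  \<comment> \<open>The signal is measured in the norm of the volume, while the estimate uses that
    of L2(P); the factor \<open>p_min\<close> between their squares is absorbed here.\<close>
  define C' where "C' = max C (C / p_min)"
  have C': "0 < C'" "C \<le> C'" "C \<le> p_min * C'"
    using C p(1) by (auto simp: C'_def max_def field_simps)
  have m1: "1 \<le> m" using m(1) by (simp add: Suc_leI)
  have bound: "worst_case_risk TYPE('m) X P n (laplacian_smoothing_test K n r (inverse (real n * r ^ (m + 2)) * real n powr (- 4 / (4 + real m))
                  * M powr (- 8 / (4 + real m))) \<alpha>) (H1_ball TYPE('m) X M) \<epsilon> \<le> ennreal (C' / b + C' * real n * exp (- c * real n * r ^ m))"
    if n: "3 \<le> n" and \<alpha>: "0 < \<alpha>" "\<alpha> < 1" and M: "real n powr (-1/2) \<le> M" "M \<le> M_max m n"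
      and r: "1 * (ln (real n) / real n) powr (1 / real m) \<le> r"
        "r \<le> min c0 (M powr ((real m - 8) / (8 + 2 * real m)) * real n powr ((real m - 20) / (32 + 8 * real m)))"
      and b: "1 \<le> b" and \<epsilon>: "0 < \<epsilon>"
        "\<epsilon>\<^sup>2 \<ge> C' * M powr (2 * real m / (4 + real m)) * real n powr (- 4 / (4 + real m)) * (b\<^sup>2 + b * sqrt (1 / \<alpha>))"
    for n :: nat and \<alpha> M r b \<epsilon> :: real
  proof -
    have n1: "1 \<le> real n" and n0: "0 < n" using n by auto
    have M0: "0 < M" using M(1) n0 by (rule_tac less_le_trans[OF _ M(1)]) simp
    \<comment> \<open>n >= 3 > e gives ln n >= 1; with C0 = 1 the lower bound on r then yields n r^m
      >= ln n >= 1.\<close>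
    have ln1: "1 \<le> ln (real n)"
    proof -
      have "exp 1 \<le> real n" using exp_le n by (rule_tac order_trans[OF exp_le]) simp
      then show ?thesis using n0 by (simp add: ln_ge_iff)
    qed
    have lnn: "0 < ln (real n) / real n" using ln1 n0 by (intro divide_pos_pos) linarith+
    have r0: "0 < r" by (rule less_le_trans[OF _ r(1)]) (use lnn in \<open>subst mult_1, subst powr_gt_zero, rule less_imp_neq[symmetric]\<close>)
    have nr: "1 \<le> real n * r ^ m"
    proof -
      have "x = (x powr (1 / real m)) ^ m" if "0 < x" for x :: real
        using that m1 by (simp add: powr_realpow[symmetric] powr_powr)
      from this[OF lnn] have "ln (real n) / real n = ((ln (real n) / real n) powr (1 / real m)) ^ m" .
      also have "\<dots> \<le> r ^ m" using r(1) by (intro power_mono) auto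
      finally have "real n * (ln (real n) / real n) \<le> real n * r ^ m" by (rule mult_left_mono) simp
      then show ?thesis using ln1 n0 by simp
    qed
    \<comment> \<open>For m = 1 the assumed bound n^(1/8) is stronger than the n^(3/4) of the
      general formula.\<close>
    have Mm: "M \<le> real n powr ((4 - real m) / (4 * real m))"
    proof (cases "m = 1")
      case True
      have "real n powr (1 / 8) \<le> real n powr (3 / 4)" using n1 by (intro powr_mono) auto
      then show ?thesis using M(2) True by (simp add: M_max_def)
    qed (use M(2) in \<open>simp add: M_max_def\<close>)
    define T where "T = real n powr (2 / (4 + real m)) * M powr (4 / (4 + real m))"
    define \<tau> where "\<tau> = M powr (2 * real m / (4 + real m)) * real n powr (- 4 / (4 + real m))"
    note id = rate_identities[OF m1 m(3) n1 M(1) Mm r0 order_trans[OF r(2) min.cobounded2], folded T_def \<tau>_def]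
    have \<rho>: "inverse (real n * r ^ (m + 2)) * real n powr (- 4 / (4 + real m)) * M powr (- 8 / (4 + real m)) = inverse (real n * r ^ (m + 2)) * inverse (T\<^sup>2)"
      using id(7) by (simp only: mult.assoc)
    show ?thesis
      unfolding worst_case_risk_def \<rho>
    proof (rule SUP_least)
      fix f assume "f \<in> {f0 \<in> H1_ball TYPE('m) X M. \<epsilon> < L2_norm TYPE('m) X f0}"
      then have f: "f \<in> H1_ball TYPE('m) X M" "\<epsilon> < L2_norm TYPE('m) X f" by auto
      define B where "B = b\<^sup>2 + b * sqrt (1 / \<alpha>)"
      have "0 \<le> \<tau> * B" using id(3) b \<alpha> by (simp add: B_def)
      then have "C * (\<tau> * B) \<le> (p_min * C') * (\<tau> * B)" using C'(3) by (rule mult_right_mono[rotated])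
      also have "\<dots> \<le> p_min * \<epsilon>\<^sup>2" using \<epsilon>(2) p(1) by (simp add: \<tau>_def B_def mult.assoc)
      finally have \<nu>: "C * \<tau> * (b\<^sup>2 + b * sqrt (1 / \<alpha>)) \<le> p_min * \<epsilon>\<^sup>2" by (simp add: B_def mult.assoc)
      have "(\<integral>\<^sup>+\<omega>. ennreal (1 - laplacian_smoothing_test K n r (inverse (real n * r ^ (m + 2)) * inverse (T\<^sup>2)) \<alpha> \<omega>) \<partial>sample_law P n f)
        \<le> ennreal (C / b + C * real n * exp (- c * real n * r ^ m))"
        using risk[rule_format, folded m(1), OF n0 r0 _ id(1-6) nr M0 sob[OF f(1)] b \<alpha>(1) \<nu> L2_norm_P[OF f(1) \<epsilon>(1) f(2)]] r(2) by simp
      also have "\<dots> \<le> ennreal (C' / b + C' * real n * exp (- c * real n * r ^ m))"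
        using C' b by (intro ennreal_leI add_mono divide_right_mono mult_right_mono) auto
      finally show "(\<integral>\<^sup>+\<omega>. ennreal (1 - laplacian_smoothing_test K n r (inverse (real n * r ^ (m + 2)) * inverse (T\<^sup>2)) \<alpha> \<omega>) \<partial>sample_law P n f)
        \<le> ennreal (C' / b + C' * real n * exp (- c * real n * r ^ m))" .
    qed
  qed
  show ?thesis
    unfolding Let_def
  proof (rule exI[of _ 1], rule exI[of _ c0], rule exI[of _ C'], rule exI[of _ c], rule exI[of _ 3], intro conjI allI impI c0 C'(1) c)
    show "(0::real) < 1" "(0::nat) < 3" by simp_all
  qed (rule bound; assumption)
qed

end
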